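(* Let $f\in W_2^{1/2}(\mathbb{T})\cap H^\infty$, and let $F$ be the holomorphic extension of $f$ to $\mathbb{D}$. Then for every $\varphi\in\mathcal{W}_1[0,\|f\|_\infty^2]$, the operator $\varphi(T_f^*T_f)-\varphi(T_fT_f^* )$ belongs to the trace class $S_1(H^2)$ and $$\operatorname{Tr}\big(\varphi(T_f^*T_f)-\varphi(T_fT_f^* )\big)=\frac1\pi\int_{\mathbb{D}}\varphi'(|F(z)|^2)\,|F'(z)|^2\,dA(z).$$
   Context: $\mathbb{T}=\mathbb{R}/2\pi\mathbb{Z}$, identified with the unit circle via $t\mapsto e^{it}$; $\mathbb{D}$ is the open unit disk and $dA$ is area (Lebesgue) measure on $\mathbb{C}$. For $f\in L^1(\mathbb{T})$, $\hat f(n)=\frac1{2\pi}\int_{\mathbb{T}}f(t)e^{-int}dt$. $L^2(\mathbb{T})$ is taken with respect to $dt/2\pi$, and $\|f\|_\infty$ is the $L^\infty$ norm. $W_2^{1/2}(\mathbb{T})=\{f\in L^2(\mathbb{T}):\sum_{n\in\mathbb{Z}}(1+|n|)|\hat f(n)|^2<\infty\}$. The Hardy space is $H^2=\{f\in L^2(\mathbb{T}):\hat f(n)=0\ \forall n<0\}$ and $H^\infty=H^2\cap L^\infty(\mathbb{T})$. $P_+$ is the orthogonal projection of $L^2(\mathbb{T})$ onto $H^2$, and for $f\in L^\infty(\mathbb{T})$ the Toeplitz operator $T_f\in B(H^2)$ is $T_fh=P_+(fh)$. The holomorphic extension of $f\in H^\infty$ is $F(z)=\sum_{n\ge0}\hat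 f(n)z^n$ (its Poisson extension). $\mathcal{W}_1(\mathbb{R})$ is the set of $\varphi\in C^1(\mathbb{R})$ such that $\varphi'$ is the Fourier transform of a finite complex Borel measure on $\mathbb{R}$, i.e. $\varphi'(x)=\int_{\mathbb{R}}e^{ixy}d\mu(y)$. For a finite closed interval $[a,b]$, $\mathcal{W}_1[a,b]$ is the set of $\varphi\in C^1[a,b]$ that extend to a function in $\mathcal{W}_1(\mathbb{R})$. Operators $\varphi(\cdot)$ are defined by continuous functional calculus. *)

theory Defs
  imports "HOL-Probability.Probability"
begin

section \<open>Complex Hilbert spaces and their bounded operators\<close>

class complex_hilbert = real_inner + banach +
  fixes scaleC :: "complex \<Rightarrow> 'a \<Rightarrow> 'a" (infixr "*\<^sub>C" 75)
    and cinner :: "'a \<Rightarrow> 'a \<Rightarrow> complex"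
  assumes scaleC_add_right: "c *\<^sub>C (x + y) = c *\<^sub>C x + c *\<^sub>C y"
    and scaleC_add_left: "(c + d) *\<^sub>C x = c *\<^sub>C x + d *\<^sub>C x"
    and scaleC_scaleC: "c *\<^sub>C d *\<^sub>C x = (c * d) *\<^sub>C x"
    and scaleR_scaleC: "r *\<^sub>R x = complex_of_real r *\<^sub>C x"
    and cinner_commute: "cinner x y = cnj (cinner y x)"
    and cinner_add_left: "cinner (x + y) z = cinner x z + cinner y z"
    and cinner_scaleC_left: "cinner (c *\<^sub>C x) y = c * cinner x y"
    and inner_eq_Re_cinner: "inner x y = Re (cinner x y)"

text \<open>The type \<open>'a \<Rightarrow>\<^sub>L 'a\<close> consists of the bounded real-linear operators; those in
  \<open>B(H)\<close> are singled out by the following predicate.\<close>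

definition complex_linear :: "('a::complex_hilbert \<Rightarrow>\<^sub>L 'a) \<Rightarrow> bool" where
  "complex_linear A \<longleftrightarrow> (\<forall>c x. A (c *\<^sub>C x) = c *\<^sub>C A x)"

definition adjoint_op :: "('a::complex_hilbert \<Rightarrow>\<^sub>L 'a) \<Rightarrow> ('a \<Rightarrow>\<^sub>L 'a)" where
  "adjoint_op A = (THE B. \<forall>x y. cinner (blinfun_apply A x) y = cinner x (blinfun_apply B y))"

definition poly_op :: "complex poly \<Rightarrow> ('a::complex_hilbert \<Rightarrow>\<^sub>L 'a) \<Rightarrow> ('a \<Rightarrow>\<^sub>L 'a)" where
  "poly_op p A = Blinfun (\<lambda>x. \<Sum>i\<le>degree p. coeff p i *\<^sub>C (blinfun_apply A ^^ i) x)"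

definition op_spectrum :: "('a::complex_hilbert \<Rightarrow>\<^sub>L 'a) \<Rightarrow> complex set" where
  "op_spectrum A =
    {z. \<not> (\<exists>B. poly_op [:- z, 1:] A o\<^sub>L B = id_blinfun \<and> B o\<^sub>L poly_op [:- z, 1:] A = id_blinfun)}"

text \<open>Continuous functional calculus \<open>\<phi>(A)\<close> of a self-adjoint operator \<open>A\<close>, whose spectrum is
  real: the limit in operator norm of \<open>p\<^sub>n(A)\<close>, for any polynomials \<open>p\<^sub>n\<close> converging to \<open>\<phi>\<close>
  uniformly on the spectrum.\<close>

definition cfc :: "(real \<Rightarrow> complex) \<Rightarrow> ('a::complex_hilbert \<Rightarrow>\<^sub>L 'a) \<Rightarrow> ('a \<Rightarrow>\<^sub>L 'a)" where
  "cfc \<phi> A = (THE B. \<forall>p :: nat \<Rightarrow> complex poly.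
     uniform_limit {x. complex_of_real x \<in> op_spectrum A}
       (\<lambda>n x. poly (p n) (complex_of_real x)) \<phi> sequentially
     \<longrightarrow> (\<lambda>n. poly_op (p n) A) \<longlonglongrightarrow> B)"

definition abs_op :: "('a::complex_hilbert \<Rightarrow>\<^sub>L 'a) \<Rightarrow> ('a \<Rightarrow>\<^sub>L 'a)" where
  "abs_op A = cfc (\<lambda>x. complex_of_real (sqrt x)) (adjoint_op A o\<^sub>L A)"

definition orthonormal_basis :: "'a::complex_hilbert set \<Rightarrow> bool" where
  "orthonormal_basis E \<longleftrightarrow>
     (\<forall>e\<in>E. \<forall>e'\<in>E. cinner e e' = (if e = e' then 1 else 0)) \<and>
     (\<forall>x. (\<forall>e\<in>E. cinner x e = 0) \<longrightarrow> x = 0)"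

definition trace_class :: "('a::complex_hilbert \<Rightarrow>\<^sub>L 'a) \<Rightarrow> bool" where
  "trace_class A \<longleftrightarrow> complex_linear A \<and>
     (\<exists>E. orthonormal_basis E \<and> (\<lambda>e. cinner (abs_op A e) e) summable_on E)"

definition op_trace :: "('a::complex_hilbert \<Rightarrow>\<^sub>L 'a) \<Rightarrow> complex" where
  "op_trace A = (THE t. \<forall>E. orthonormal_basis E \<longrightarrow> ((\<lambda>e. cinner (A e) e) has_sum t) E)"


section \<open>The Hilbert space \<open>L\<^sup>2\<close> of the circle\<close>

text \<open>The circle is parametrised by \<open>[0, 2\<pi>)\<close>; this is the measure \<open>dt/2\<pi>\<close>, regarded
  as a probability measure on the line.\<close>

definition circle_measure :: "real measure" where
  "circle_measure = uniform_measure lborel {0..<2*pi}"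

definition square_integrable :: "(real \<Rightarrow> complex) \<Rightarrow> bool" where
  "square_integrable f \<longleftrightarrow>
     f \<in> borel_measurable borel \<and> integrable circle_measure (\<lambda>t. (cmod (f t))\<^sup>2)"

definition fourier_coeff :: "(real \<Rightarrow> complex) \<Rightarrow> int \<Rightarrow> complex" where
  "fourier_coeff f n = (LINT t|circle_measure. f t * cis (- (of_int n * t)))"

lemma sets_circle_measure [simp, measurable_cong]: "sets circle_measure = sets borel"
  by (simp add: circle_measure_def)

lemma space_circle_measure [simp]: "space circle_measure = UNIV"
  by (simp add: circle_measure_def)

interpretation circle: prob_space circle_measure
  unfolding circle_measure_def by (rule prob_space_uniform_measure) auto

lemma borel_measurable_cnj [measurable]: "cnj \<in> borel_measurable borel"
  by (intro borel_measurable_continuous_onI continuous_intros)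

lemma square_integrable_measurable [dest]:
  "square_integrable f \<Longrightarrow> f \<in> borel_measurable borel"
  by (simp add: square_integrable_def)

lemma square_integrable_integrable_mult:
  assumes "square_integrable f" "square_integrable g"
  shows "integrable circle_measure (\<lambda>t. f t * cnj (g t))"
proof (rule Bochner_Integration.integrable_bound)
  show "integrable circle_measure (\<lambda>t. (cmod (f t))\<^sup>2 + (cmod (g t))\<^sup>2)"
    using assms by (auto simp: square_integrable_def)
  have [measurable]: "f \<in> borel_measurable borel" "g \<in> borel_measurable borel"
    using assms by auto
  show "(\<lambda>t. f t * cnj (g t)) \<in> borel_measurable circle_measure"
    by measurable
  show "AE t in circle_measure.
      norm (f t * cnj (g t)) \<le> norm ((cmod (f t))\<^sup>2 + (cmod (g t))\<^sup>2)"
  proof (intro AE_I2)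
    fix t
    have "2 * (cmod (f t) * cmod (g t)) \<le> (cmod (f t))\<^sup>2 + (cmod (g t))\<^sup>2"
      using sum_squares_bound[of "cmod (f t)" "cmod (g t)"] by simp
    moreover have "0 \<le> cmod (f t) * cmod (g t)" by simp
    ultimately show "norm (f t * cnj (g t)) \<le> norm ((cmod (f t))\<^sup>2 + (cmod (g t))\<^sup>2)"
      unfolding norm_mult complex_mod_cnj real_norm_def by linarith
  qed
qed

lemma square_integrable_scale:
  "square_integrable f \<Longrightarrow> square_integrable (\<lambda>t. c * f t)"
  by (auto simp: square_integrable_def norm_mult power_mult_distrib)

lemma square_integrable_add:
  assumes "square_integrable f" "square_integrable g"
  shows "square_integrable (\<lambda>t. f t + g t)"
proof -
  have [measurable]: "f \<in> borel_measurable borel" "g \<in> borel_measurable borel"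
    using assms by auto
  have "integrable circle_measure (\<lambda>t. (cmod (f t + g t))\<^sup>2)"
  proof (rule Bochner_Integration.integrable_bound)
    show "integrable circle_measure (\<lambda>t. 2 * (cmod (f t))\<^sup>2 + 2 * (cmod (g t))\<^sup>2)"
      using assms by (auto simp: square_integrable_def)
    show "AE t in circle_measure.
        norm ((cmod (f t + g t))\<^sup>2) \<le> norm (2 * (cmod (f t))\<^sup>2 + 2 * (cmod (g t))\<^sup>2)"
    proof (intro AE_I2)
      fix t
      have "(cmod (f t + g t))\<^sup>2 \<le> (cmod (f t) + cmod (g t))\<^sup>2"
        by (intro power_mono norm_triangle_ineq) auto
      also have "\<dots> \<le> 2 * (cmod (f t))\<^sup>2 + 2 * (cmod (g t))\<^sup>2"
        using sum_squares_bound[of "cmod (f t)" "cmod (g t)"] by (simp add: power2_sum)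
      finally show "norm ((cmod (f t + g t))\<^sup>2) \<le> norm (2 * (cmod (f t))\<^sup>2 + 2 * (cmod (g t))\<^sup>2)"
        by simp
    qed
  qed measurable
  then show ?thesis by (simp add: square_integrable_def)
qed

lemma square_integrable_bounded:
  assumes "f \<in> borel_measurable borel" "\<And>t. cmod (f t) \<le> C"
  shows "square_integrable f"
  unfolding square_integrable_def
proof (intro conjI circle.integrable_const_bound[where B = "C\<^sup>2"] AE_I2)
  have [measurable]: "f \<in> borel_measurable borel" by fact
  show "(\<lambda>t. (cmod (f t))\<^sup>2) \<in> borel_measurable circle_measure" by measurable
  show "norm ((cmod (f t))\<^sup>2) \<le> C\<^sup>2" for t
    using assms(2)[of t] by (simp add: power_mono)
qed (rule assms)

definition l2_rel :: "(real \<Rightarrow> complex) \<Rightarrow> (real \<Rightarrow> complex) \<Rightarrow> bool" where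
  "l2_rel f g \<longleftrightarrow> square_integrable f \<and> square_integrable g \<and> (AE t in circle_measure. f t = g t)"

quotient_type l2 = "real \<Rightarrow> complex" / partial: l2_rel
proof (rule part_equivpI)
  show "\<exists>f. l2_rel f f"
    by (rule exI[of _ "\<lambda>_. 0"]) (simp add: l2_rel_def square_integrable_bounded[where C = 0])
  show "symp l2_rel" by (auto intro!: sympI simp: l2_rel_def)
  show "transp l2_rel" by (auto intro!: transpI simp: l2_rel_def)
qed

instantiation l2 :: real_vector
begin

lift_definition zero_l2 :: l2 is "\<lambda>_. 0"
  by (simp add: l2_rel_def square_integrable_bounded[where C = 0])

lift_definition plus_l2 :: "l2 \<Rightarrow> l2 \<Rightarrow> l2" is "\<lambda>f g t. f t + g t"
  by (auto simp: l2_rel_def intro: square_integrable_add)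

lift_definition uminus_l2 :: "l2 \<Rightarrow> l2" is "\<lambda>f t. - f t"
  using square_integrable_scale[of _ "-1"] by (auto simp: l2_rel_def)

lift_definition scaleR_l2 :: "real \<Rightarrow> l2 \<Rightarrow> l2" is "\<lambda>r f t. complex_of_real r * f t"
  by (auto simp: l2_rel_def intro: square_integrable_scale)

definition minus_l2 :: "l2 \<Rightarrow> l2 \<Rightarrow> l2" where "minus_l2 f g = f + - g"

instance
proof
  fix x y z :: l2 and r s :: real
  show "x + y + z = x + (y + z)"
    by transfer (auto simp: l2_rel_def add.assoc intro!: square_integrable_add)
  show "x + y = y + x"
    by transfer (auto simp: l2_rel_def add.commute intro!: square_integrable_add)
  show "0 + x = x" by transfer (auto simp: l2_rel_def)
  show "- x + x = 0"
    by transfer (auto simp: l2_rel_def square_integrable_bounded[where C = 0])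
  show "x - y = x + - y" by (rule minus_l2_def)
  show "r *\<^sub>R (x + y) = r *\<^sub>R x + r *\<^sub>R y"
    by transfer (auto simp: l2_rel_def distrib_left
        intro!: square_integrable_add square_integrable_scale)
  show "(r + s) *\<^sub>R x = r *\<^sub>R x + s *\<^sub>R x"
    by transfer (auto simp: l2_rel_def distrib_right
        intro!: square_integrable_add square_integrable_scale)
  show "r *\<^sub>R s *\<^sub>R x = (r * s) *\<^sub>R x"
    by transfer (auto simp: l2_rel_def mult.assoc intro!: square_integrable_scale)
  show "1 *\<^sub>R x = x" by transfer (auto simp: l2_rel_def)
qed

end

instantiation l2 :: real_inner
begin

lift_definition inner_l2 :: "l2 \<Rightarrow> l2 \<Rightarrow> real"
  is "\<lambda>f g. Re (LINT t|circle_measure. f t * cnj (g t))"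
proof -
  fix f f' g g' assume *: "l2_rel f f'" "l2_rel g g'"
  then have [measurable]: "f \<in> borel_measurable borel" "g \<in> borel_measurable borel"
      "f' \<in> borel_measurable borel" "g' \<in> borel_measurable borel"
    by (auto simp: l2_rel_def)
  have "(LINT t|circle_measure. f t * cnj (g t)) = (LINT t|circle_measure. f' t * cnj (g' t))"
    using * by (intro integral_cong_AE) (measurable, auto simp: l2_rel_def)
  then show "Re (LINT t|circle_measure. f t * cnj (g t)) =
      Re (LINT t|circle_measure. f' t * cnj (g' t))" by simp
qed

definition norm_l2 :: "l2 \<Rightarrow> real" where "norm_l2 f = sqrt (inner f f)"
definition sgn_l2 :: "l2 \<Rightarrow> l2" where "sgn_l2 f = f /\<^sub>R norm f"
definition dist_l2 :: "l2 \<Rightarrow> l2 \<Rightarrow> real" where "dist_l2 f g = norm (f - g)"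
definition uniformity_l2 :: "(l2 \<times> l2) filter" where
  "uniformity_l2 = (INF e\<in>{0 <..}. principal {(x, y). dist x y < e})"
definition open_l2 :: "l2 set \<Rightarrow> bool" where
  "open_l2 U = (\<forall>x\<in>U. eventually (\<lambda>(x', y). x' = x \<longrightarrow> y \<in> U) uniformity)"

instance
proof
  fix x y z :: l2 and r :: real
  show "sgn x = x /\<^sub>R norm x" by (rule sgn_l2_def)
  show "dist x y = norm (x - y)" by (rule dist_l2_def)
  show "uniformity = (INF e\<in>{0 <..}. principal {(x :: l2, y). dist x y < e})"
    by (rule uniformity_l2_def)
  show "open U = (\<forall>x\<in>U. eventually (\<lambda>(x', y). x' = x \<longrightarrow> y \<in> U) uniformity)" for U :: "l2 set"
    by (rule open_l2_def)
  show "inner x y = inner y x"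
  proof transfer
    fix f g
    have "(LINT t|circle_measure. f t * cnj (g t)) = cnj (LINT t|circle_measure. g t * cnj (f t))"
      by (subst Bochner_Integration.integral_cnj [symmetric]) (simp add: mult.commute)
    then show "Re (LINT t|circle_measure. f t * cnj (g t)) =
        Re (LINT t|circle_measure. g t * cnj (f t))" by simp
  qed
  show "inner (x + y) z = inner x z + inner y z"
    by transfer (simp add: l2_rel_def distrib_right square_integrable_integrable_mult)
  show "inner (r *\<^sub>R x) y = r * inner x y"
    by transfer (simp add: mult.assoc)
  have *: "Re (LINT t|circle_measure. f t * cnj (f t)) = (LINT t|circle_measure. (cmod (f t))\<^sup>2)" for f
    by (simp add: complex_norm_square [symmetric] del: of_real_power)
  show "0 \<le> inner x x"
    by transfer (simp add: * del: Re_complex_of_real)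
  show "inner x x = 0 \<longleftrightarrow> x = 0"
  proof transfer
    fix f assume "l2_rel f f"
    then have f: "square_integrable f" by (simp add: l2_rel_def)
    then have "(LINT t|circle_measure. (cmod (f t))\<^sup>2) = 0 \<longleftrightarrow> (AE t in circle_measure. f t = 0)"
      by (subst integral_nonneg_eq_0_iff_AE) (auto simp: square_integrable_def)
    then show "Re (LINT t|circle_measure. f t * cnj (f t)) = 0 \<longleftrightarrow> l2_rel f (\<lambda>_. 0)"
      using f by (simp add: * l2_rel_def square_integrable_bounded[where C = 0])
  qed
  show "norm x = sqrt (inner x x)" by (rule norm_l2_def)
qed

end


lift_definition l2_cinner :: "l2 \<Rightarrow> l2 \<Rightarrow> complex"
  is "\<lambda>f g. LINT t|circle_measure. f t * cnj (g t)"
proof -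
  fix f f' g g' assume *: "l2_rel f f'" "l2_rel g g'"
  then have [measurable]: "f \<in> borel_measurable borel" "g \<in> borel_measurable borel"
      "f' \<in> borel_measurable borel" "g' \<in> borel_measurable borel"
    by (auto simp: l2_rel_def)
  show "(LINT t|circle_measure. f t * cnj (g t)) = (LINT t|circle_measure. f' t * cnj (g' t))"
    using * by (intro integral_cong_AE) (measurable, auto simp: l2_rel_def)
qed

lemma norm_abs_l2:
  assumes "square_integrable f"
  shows "(norm (abs_l2 f))\<^sup>2 = (LINT t|circle_measure. (cmod (f t))\<^sup>2)"
proof -
  have "l2_rel f f" using assms by (simp add: l2_rel_def)
  then have "inner (abs_l2 f) (abs_l2 f) = Re (LINT t|circle_measure. f t * cnj (f t))"
    by (simp add: inner_l2.abs_eq)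
  also have "\<dots> = (LINT t|circle_measure. (cmod (f t))\<^sup>2)"
    by (simp add: complex_norm_square [symmetric] del: of_real_power)
  finally show ?thesis by (simp add: power2_norm_eq_inner)
qed

lemma diff_abs_l2:
  assumes "square_integrable f" "square_integrable g"
  shows "abs_l2 f - abs_l2 g = abs_l2 (\<lambda>t. f t - g t)"
proof -
  have "l2_rel f f" "l2_rel g g" "l2_rel (\<lambda>t. - g t) (\<lambda>t. - g t)"
    using assms square_integrable_scale[of g "-1"] by (auto simp: l2_rel_def)
  then show ?thesis
    unfolding minus_l2_def by (simp add: uminus_l2.abs_eq plus_l2.abs_eq)
qed

lemma obtain_l2_rep:
  obtains f where "square_integrable f" "x = abs_l2 f"
  by (metis Quotient3_l2 Quotient3_def l2_rel_def)

lemma nn_integral_norm_abs_l2: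
  assumes "square_integrable f"
  shows "(\<integral>\<^sup>+t. ennreal ((cmod (f t))\<^sup>2) \<partial>circle_measure) = ennreal ((norm (abs_l2 f))\<^sup>2)"
  using assms by (subst nn_integral_eq_integral) (auto simp: norm_abs_l2 square_integrable_def)

text \<open>The Riesz-Fischer theorem.\<close>

instance l2 :: banach
proof
  fix X :: "nat \<Rightarrow> l2" assume X: "Cauchy X"
  have "\<exists>f. square_integrable f \<and> X n = abs_l2 f" for n
    by (metis obtain_l2_rep)
  then obtain x where x: "\<And>n. square_integrable (x n)" "\<And>n. X n = abs_l2 (x n)"
    by metis
  have [measurable]: "x n \<in> borel_measurable borel" for n
    using x(1) by auto
  have x_diff: "square_integrable (\<lambda>t. x n t - x m t)" for n m
    using square_integrable_add[OF x(1)[of n] square_integrable_scale[OF x(1)[of m], of "-1"]]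
    by simp
  have "\<exists>N. \<forall>m\<ge>N. \<forall>n\<ge>N. dist (X m) (X n) < (1/2)^k" for k
    using X by (auto simp: Cauchy_def)
  then obtain N where N: "\<And>k m n. m \<ge> N k \<Longrightarrow> n \<ge> N k \<Longrightarrow> dist (X m) (X n) < (1/2)^k"
    by metis
  define r where "r = (\<lambda>k. Max (N ` {..k}))"
  have rN: "N k \<le> r k" and r_Suc: "N k \<le> r (Suc k)" for k
    unfolding r_def by (auto intro!: Max_ge)
  have r_le: "N k \<le> r j" if "k \<le> j" for k j
    unfolding r_def using that by (auto intro!: Max_ge)
  define d where "d = (\<lambda>k t. x (r (Suc k)) t - x (r k) t)"
  have [measurable]: "d k \<in> borel_measurable borel" for k
    unfolding d_def by measurable
  have d_L1: "(\<integral>\<^sup>+t. ennreal (cmod (d k t)) \<partial>circle_measure) \<le> ennreal ((1/2)^k)" for k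
  proof -
    have sq: "square_integrable (d k)"
      unfolding d_def by (rule x_diff)
    have "norm (abs_l2 (d k)) \<le> (1/2)^k"
      using N[of k "r (Suc k)" "r k", OF r_Suc rN]
      by (simp add: dist_norm x(2) diff_abs_l2[OF x(1) x(1)] d_def)
    then have "(norm (abs_l2 (d k)))\<^sup>2 \<le> ((1/2)^k)\<^sup>2"
      by (intro power_mono) auto
    then have le: "(LINT t|circle_measure. (cmod (d k t))\<^sup>2) \<le> ((1/2)^k)\<^sup>2"
      by (simp add: norm_abs_l2[OF sq])
    have int: "integrable circle_measure (\<lambda>t. (cmod (d k t))\<^sup>2)"
      using sq by (simp add: square_integrable_def)
    have "(\<integral>\<^sup>+t. ennreal (cmod (d k t)) \<partial>circle_measure)
        \<le> (\<integral>\<^sup>+t. ennreal (2^k / 2 * (cmod (d k t))\<^sup>2 + (1/2)^k / 2) \<partial>circle_measure)"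
    proof (intro nn_integral_mono ennreal_leI)
      fix t
      have "0 \<le> 2^k / 2 * (cmod (d k t) - (1/2)^k)\<^sup>2"
        by simp
      also have "\<dots> = 2^k / 2 * (cmod (d k t))\<^sup>2 + (2^k * (1/2)^k) * (1/2)^k / 2
          - (2^k * (1/2)^k) * cmod (d k t)"
        by (simp only: power2_eq_square) algebra
      also have "(2::real)^k * (1/2)^k = 1"
        by (simp add: power_mult_distrib [symmetric])
      finally show "cmod (d k t) \<le> 2^k / 2 * (cmod (d k t))\<^sup>2 + (1/2)^k / 2"
        by simp
    qed
    also have "\<dots> = ennreal (LINT t|circle_measure. 2^k / 2 * (cmod (d k t))\<^sup>2 + (1/2)^k / 2)"
      using int by (intro nn_integral_eq_integral) auto
    also have "(LINT t|circle_measure. 2^k / 2 * (cmod (d k t))\<^sup>2 + (1/2)^k / 2)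
        = 2^k / 2 * (LINT t|circle_measure. (cmod (d k t))\<^sup>2) + (1/2)^k / 2"
      using int circle.prob_space by simp
    also have "\<dots> \<le> 2^k / 2 * ((1/2)^k)\<^sup>2 + (1/2)^k / 2"
      using le by (intro add_right_mono mult_left_mono) auto
    also have "\<dots> = (1/2)^k"
      by (simp add: field_simps power2_eq_square)
    finally show ?thesis by (simp add: ennreal_leI)
  qed
  have "(\<integral>\<^sup>+t. (\<Sum>k. ennreal (cmod (d k t))) \<partial>circle_measure)
      = (\<Sum>k. \<integral>\<^sup>+t. ennreal (cmod (d k t)) \<partial>circle_measure)"
    by (intro nn_integral_suminf) measurable
  also have "\<dots> \<le> (\<Sum>k. ennreal ((1/2)^k))"
    by (intro suminf_le d_L1 summableI)
  also have "\<dots> = ennreal (\<Sum>k. (1/2)^k)"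
    by (intro suminf_ennreal2) (auto intro!: summable_geometric)
  finally have "(\<integral>\<^sup>+t. (\<Sum>k. ennreal (cmod (d k t))) \<partial>circle_measure) \<noteq> \<infinity>"
    by (auto simp: top_unique)
  then have "AE t in circle_measure. (\<Sum>k. ennreal (cmod (d k t))) \<noteq> \<infinity>"
    by (intro nn_integral_PInf_AE) measurable
  then have conv: "AE t in circle_measure. convergent (\<lambda>k. x (r k) t)"
  proof eventually_elim
    case (elim t)
    then have "summable (\<lambda>k. cmod (d k t))"
      by (intro summable_suminf_not_top) auto
    then have "summable (\<lambda>k. d k t)"
      by (rule summable_norm_cancel)
    then have "convergent (\<lambda>n. x (r 0) t + (\<Sum>k<n. d k t))"
      by (intro convergent_add convergent_const) (simp add: summable_iff_convergent)
    moreover have "x (r 0) t + (\<Sum>k<n. d k t) = x (r n) t" for n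
      using sum_lessThan_telescope[of "\<lambda>k. x (r k) t" n] by (simp add: d_def)
    ultimately show ?case by simp
  qed
  define F where "F = (\<lambda>t. lim (\<lambda>k. x (r k) t))"
  have [measurable]: "F \<in> borel_measurable borel"
    unfolding F_def by measurable
  have F_bound: "(\<integral>\<^sup>+t. ennreal ((cmod (F t - x m t))\<^sup>2) \<partial>circle_measure) \<le> ennreal (((1/2)^j)\<^sup>2)"
    if "m \<ge> N j" for m j
  proof -
    have "(\<integral>\<^sup>+t. ennreal ((cmod (F t - x m t))\<^sup>2) \<partial>circle_measure)
        = (\<integral>\<^sup>+t. liminf (\<lambda>k. ennreal ((cmod (x (r k) t - x m t))\<^sup>2)) \<partial>circle_measure)"
    proof (intro nn_integral_cong_AE, use conv in eventually_elim)
      case (elim t)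
      then have "(\<lambda>k. x (r k) t) \<longlonglongrightarrow> F t"
        by (simp add: F_def convergent_LIMSEQ_iff)
      then have "(\<lambda>k. ennreal ((cmod (x (r k) t - x m t))\<^sup>2)) \<longlonglongrightarrow> ennreal ((cmod (F t - x m t))\<^sup>2)"
        by (intro tendsto_ennrealI tendsto_intros)
      then show ?case
        by (intro lim_imp_Liminf [symmetric] trivial_limit_sequentially)
    qed
    also have "\<dots> \<le> liminf (\<lambda>k. \<integral>\<^sup>+t. ennreal ((cmod (x (r k) t - x m t))\<^sup>2) \<partial>circle_measure)"
      by (intro nn_integral_liminf) measurable
    also have "\<dots> \<le> limsup (\<lambda>k. \<integral>\<^sup>+t. ennreal ((cmod (x (r k) t - x m t))\<^sup>2) \<partial>circle_measure)"
      by (intro Liminf_le_Limsup) auto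
    also have "\<dots> \<le> ennreal (((1/2)^j)\<^sup>2)"
    proof (intro Limsup_bounded eventually_mono[OF eventually_ge_at_top[of j]])
      fix k assume "j \<le> k"
      then have "dist (X (r k)) (X m) < (1/2)^j"
        using that by (intro N r_le)
      then have "norm (abs_l2 (\<lambda>t. x (r k) t - x m t)) \<le> (1/2)^j"
        by (simp add: dist_norm x(2) diff_abs_l2[OF x(1) x(1)])
      then show "(\<integral>\<^sup>+t. ennreal ((cmod (x (r k) t - x m t))\<^sup>2) \<partial>circle_measure)
          \<le> ennreal (((1/2)^j)\<^sup>2)"
        by (subst nn_integral_norm_abs_l2[OF x_diff]) (intro ennreal_leI power_mono norm_ge_zero)
    qed
    finally show ?thesis .
  qed
  have F_diff: "square_integrable (\<lambda>t. F t - x m t)" if "m \<ge> N 0" for m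
  proof -
    have "integrable circle_measure (\<lambda>t. (cmod (F t - x m t))\<^sup>2)"
    proof (rule integrableI_bounded)
      show "(\<lambda>t. (cmod (F t - x m t))\<^sup>2) \<in> borel_measurable circle_measure" by measurable
      show "(\<integral>\<^sup>+t. ennreal (norm ((cmod (F t - x m t))\<^sup>2)) \<partial>circle_measure) < \<infinity>"
        using F_bound[OF that] by (simp add: le_less_trans)
    qed
    then show ?thesis by (simp add: square_integrable_def)
  qed
  have F: "square_integrable F"
    using square_integrable_add[OF F_diff[OF order_refl] x(1)[of "N 0"]] by simp
  have "X \<longlonglongrightarrow> abs_l2 F"
  proof (rule metric_LIMSEQ_I)
    fix e :: real assume "e > 0"
    then obtain j where j: "(1/2)^j < e"
      using real_arch_pow_inv[of e "1/2"] by auto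
    have "dist (X m) (abs_l2 F) < e" if m: "m \<ge> max (N 0) (N j)" for m
    proof -
      have "ennreal ((norm (abs_l2 (\<lambda>t. F t - x m t)))\<^sup>2) \<le> ennreal (((1/2)^j)\<^sup>2)"
        using F_bound[of j m] m nn_integral_norm_abs_l2[OF F_diff[of m]] by simp
      then have "(norm (abs_l2 (\<lambda>t. F t - x m t)))\<^sup>2 \<le> ((1/2)^j)\<^sup>2"
        by (subst (asm) ennreal_le_iff) auto
      then have "norm (abs_l2 (\<lambda>t. F t - x m t)) \<le> (1/2)^j"
        by (rule power2_le_imp_le) simp
      then have "dist (abs_l2 F) (X m) \<le> (1/2)^j"
        by (simp add: dist_norm x(2) diff_abs_l2[OF F x(1)])
      then show ?thesis using j by (simp add: dist_commute)
    qed
    then show "\<exists>no. \<forall>n\<ge>no. dist (X n) (abs_l2 F) < e" by blast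
  qed
  then show "convergent X" by (rule convergentI)
qed

instantiation l2 :: complex_hilbert
begin

lift_definition scaleC_l2 :: "complex \<Rightarrow> l2 \<Rightarrow> l2" is "\<lambda>c f t. c * f t"
  by (auto simp: l2_rel_def intro: square_integrable_scale)

definition cinner_l2 :: "l2 \<Rightarrow> l2 \<Rightarrow> complex" where "cinner_l2 = l2_cinner"

instance
proof
  fix x y z :: l2 and c d :: complex and r :: real
  show "c *\<^sub>C (x + y) = c *\<^sub>C x + c *\<^sub>C y"
    by transfer (auto simp: l2_rel_def distrib_left
        intro!: square_integrable_add square_integrable_scale)
  show "(c + d) *\<^sub>C x = c *\<^sub>C x + d *\<^sub>C x"
    by transfer (auto simp: l2_rel_def distrib_right
        intro!: square_integrable_add square_integrable_scale)
  show "c *\<^sub>C d *\<^sub>C x = (c * d) *\<^sub>C x"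
    by transfer (auto simp: l2_rel_def mult.assoc intro!: square_integrable_scale)
  show "r *\<^sub>R x = complex_of_real r *\<^sub>C x"
    by transfer (auto simp: l2_rel_def intro!: square_integrable_scale)
  show "cinner x y = cnj (cinner y x)"
    unfolding cinner_l2_def
    by transfer (subst Bochner_Integration.integral_cnj [symmetric], simp add: mult.commute)
  show "cinner (x + y) z = cinner x z + cinner y z"
    unfolding cinner_l2_def
    by transfer (simp add: l2_rel_def distrib_right square_integrable_integrable_mult)
  show "cinner (c *\<^sub>C x) y = c * cinner x y"
    unfolding cinner_l2_def by transfer (simp add: mult.assoc)
  show "inner x y = Re (cinner x y)"
    unfolding cinner_l2_def by transfer simp
qed

end


lift_definition fourier :: "l2 \<Rightarrow> int \<Rightarrow> complex" is fourier_coeff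
proof
  fix f f' :: "real \<Rightarrow> complex" and n :: int assume *: "l2_rel f f'"
  then have [measurable]: "f \<in> borel_measurable borel" "f' \<in> borel_measurable borel"
    by (auto simp: l2_rel_def)
  have [measurable]: "cis \<in> borel_measurable borel"
    by (intro borel_measurable_continuous_onI continuous_intros)
  show "fourier_coeff f n = fourier_coeff f' n"
    unfolding fourier_coeff_def
    using * by (intro integral_cong_AE) (measurable, auto simp: l2_rel_def)
qed

text \<open>The essential supremum of \<open>|f|\<close>, which is \<open>\<infinity>\<close> outside \<open>L\<^sup>\<infinity>\<close>.\<close>

lift_definition ess_bound :: "l2 \<Rightarrow> ereal" is "\<lambda>f. esssup circle_measure (\<lambda>t. ereal (cmod (f t)))"
proof -
  fix f f' :: "real \<Rightarrow> complex" assume *: "l2_rel f f'"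
  then have [measurable]: "f \<in> borel_measurable borel" "f' \<in> borel_measurable borel"
    by (auto simp: l2_rel_def)
  show "esssup circle_measure (\<lambda>t. ereal (cmod (f t))) =
      esssup circle_measure (\<lambda>t. ereal (cmod (f' t)))"
    using * by (intro esssup_AE_cong) (measurable, auto simp: l2_rel_def)
qed

definition L_infinity :: "l2 set" where
  "L_infinity = {f. ess_bound f < \<infinity>}"

definition linf_norm :: "l2 \<Rightarrow> real" where
  "linf_norm f = real_of_ereal (ess_bound f)"

definition sobolev_half :: "l2 set" where
  "sobolev_half = {f. (\<lambda>n. (1 + real_of_int \<bar>n\<bar>) * (cmod (fourier f n))\<^sup>2) summable_on UNIV}"

text \<open>The pointwise product, with dummy value \<open>0\<close> if it is not in \<open>L\<^sup>2\<close>; it is in \<open>L\<^sup>2\<close> whenever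
  one of the factors is in \<open>L\<^sup>\<infinity>\<close>.\<close>

lift_definition l2_mult :: "l2 \<Rightarrow> l2 \<Rightarrow> l2"
  is "\<lambda>f g. if square_integrable (\<lambda>t. f t * g t) then (\<lambda>t. f t * g t) else (\<lambda>_. 0)"
proof -
  fix f f' g g' :: "real \<Rightarrow> complex" assume *: "l2_rel f f'" "l2_rel g g'"
  then have [measurable]: "f \<in> borel_measurable borel" "g \<in> borel_measurable borel"
      "f' \<in> borel_measurable borel" "g' \<in> borel_measurable borel"
    by (auto simp: l2_rel_def)
  have eq: "AE t in circle_measure. f t * g t = f' t * g' t"
    using * by (auto simp: l2_rel_def)
  have "integrable circle_measure (\<lambda>t. (cmod (f t * g t))\<^sup>2) \<longleftrightarrow>
      integrable circle_measure (\<lambda>t. (cmod (f' t * g' t))\<^sup>2)"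
    using eq by (intro integrable_cong_AE) (measurable, auto)
  then have "square_integrable (\<lambda>t. f t * g t) \<longleftrightarrow> square_integrable (\<lambda>t. f' t * g' t)"
    by (simp add: square_integrable_def)
  then show "l2_rel (if square_integrable (\<lambda>t. f t * g t) then (\<lambda>t. f t * g t) else (\<lambda>_. 0))
      (if square_integrable (\<lambda>t. f' t * g' t) then (\<lambda>t. f' t * g' t) else (\<lambda>_. 0))"
    using eq by (auto simp: l2_rel_def square_integrable_bounded[where C = 0])
qed


section \<open>The Hardy space \<open>H\<^sup>2\<close> and Toeplitz operators\<close>

definition H2 :: "l2 set" where
  "H2 = {f. \<forall>n<0. fourier f n = 0}"

definition H_infinity :: "l2 set" where
  "H_infinity = H2 \<inter> L_infinity"

text \<open>The type \<open>h2\<close> is the subspace \<open>H2\<close>, regarded as a Hilbert space in its own right.\<close>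

lemma cinner_add_right: "cinner x (y + z) = cinner x y + cinner x (z :: 'a::complex_hilbert)"
  by (metis cinner_add_left cinner_commute complex_cnj_add)

lemma cinner_scaleC_right: "cinner x (c *\<^sub>C y) = cnj c * cinner x (y :: 'a::complex_hilbert)"
  by (metis cinner_scaleC_left cinner_commute complex_cnj_mult complex_cnj_cnj)

lemma fourier_eq_cinner: "fourier f n = cinner f (abs_l2 (\<lambda>t. cis (of_int n * t)))"
proof -
  have [measurable]: "cis \<in> borel_measurable borel"
    by (intro borel_measurable_continuous_onI continuous_intros)
  have e: "square_integrable (\<lambda>t. cis (of_int n * t))"
  proof (rule square_integrable_bounded[where C = 1])
    show "(\<lambda>t. cis (of_int n * t)) \<in> borel_measurable borel" by measurable
  qed simp
  obtain g where g: "square_integrable g" "f = abs_l2 g" by (rule obtain_l2_rep)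
  have "l2_rel g g" "l2_rel (\<lambda>t. cis (of_int n * t)) (\<lambda>t. cis (of_int n * t))"
    using g e by (auto simp: l2_rel_def)
  then show ?thesis
    by (simp add: g(2) cinner_l2_def fourier.abs_eq l2_cinner.abs_eq fourier_coeff_def cis_cnj)
qed

lemma H2_subspace:
  "0 \<in> H2" "f \<in> H2 \<Longrightarrow> g \<in> H2 \<Longrightarrow> f + g \<in> H2" "f \<in> H2 \<Longrightarrow> c *\<^sub>C f \<in> H2"
proof -
  have "cinner 0 x = 0" for x :: l2
    using cinner_add_left[of 0 0 x] by simp
  then show "0 \<in> H2" by (simp add: H2_def fourier_eq_cinner)
qed (auto simp: H2_def fourier_eq_cinner cinner_add_left cinner_scaleC_left)

lemma closed_H2: "closed H2"
proof -
  define e where "e = (\<lambda>n::int. abs_l2 (\<lambda>t. cis (of_int n * t)))"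
  have "H2 = (\<Inter>n\<in>{..<0}. {f. inner f (e n) = 0} \<inter> {f. inner f (\<i> *\<^sub>C e n) = 0})"
    by (auto simp: H2_def fourier_eq_cinner inner_eq_Re_cinner cinner_scaleC_right complex_eq_iff e_def)
  also have "closed \<dots>"
    by (intro closed_INT ballI closed_Int closed_Collect_eq continuous_intros)
  finally show ?thesis .
qed

typedef h2 = H2 morphisms h2_l2 Abs_h2
  using H2_subspace(1) by blast

setup_lifting type_definition_h2

instantiation h2 :: real_vector
begin

lift_definition zero_h2 :: h2 is 0 by (rule H2_subspace)
lift_definition plus_h2 :: "h2 \<Rightarrow> h2 \<Rightarrow> h2" is "(+)" by (rule H2_subspace)
lift_definition uminus_h2 :: "h2 \<Rightarrow> h2" is uminus
  using H2_subspace(3)[of _ "-1"] by (metis scaleR_minus1_left scaleR_scaleC of_real_minus of_real_1)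
lift_definition minus_h2 :: "h2 \<Rightarrow> h2 \<Rightarrow> h2" is "(-)"
  using H2_subspace(2) H2_subspace(3)[of _ "-1"]
  by (metis scaleR_minus1_left scaleR_scaleC of_real_minus of_real_1 diff_conv_add_uminus)
lift_definition scaleR_h2 :: "real \<Rightarrow> h2 \<Rightarrow> h2" is scaleR
  by (simp add: scaleR_scaleC H2_subspace)

instance
  by standard (transfer, simp add: algebra_simps)+

end

instantiation h2 :: real_inner
begin

lift_definition inner_h2 :: "h2 \<Rightarrow> h2 \<Rightarrow> real" is inner .
lift_definition norm_h2 :: "h2 \<Rightarrow> real" is norm .
definition sgn_h2 :: "h2 \<Rightarrow> h2" where "sgn_h2 f = f /\<^sub>R norm f"
definition dist_h2 :: "h2 \<Rightarrow> h2 \<Rightarrow> real" where "dist_h2 f g = norm (f - g)"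
definition uniformity_h2 :: "(h2 \<times> h2) filter" where
  "uniformity_h2 = (INF e\<in>{0 <..}. principal {(x, y). dist x y < e})"
definition open_h2 :: "h2 set \<Rightarrow> bool" where
  "open_h2 U = (\<forall>x\<in>U. eventually (\<lambda>(x', y). x' = x \<longrightarrow> y \<in> U) uniformity)"

instance
proof
  fix x y z :: h2 and r :: real
  show "sgn x = x /\<^sub>R norm x" by (rule sgn_h2_def)
  show "dist x y = norm (x - y)" by (rule dist_h2_def)
  show "uniformity = (INF e\<in>{0 <..}. principal {(x :: h2, y). dist x y < e})"
    by (rule uniformity_h2_def)
  show "open U = (\<forall>x\<in>U. eventually (\<lambda>(x', y). x' = x \<longrightarrow> y \<in> U) uniformity)" for U :: "h2 set"
    by (rule open_h2_def)
  show "inner x y = inner y x" by transfer (rule inner_commute)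
  show "inner (x + y) z = inner x z + inner y z" by transfer (rule inner_add_left)
  show "inner (r *\<^sub>R x) y = r * inner x y" by transfer simp
  show "0 \<le> inner x x" by transfer simp
  show "inner x x = 0 \<longleftrightarrow> x = 0" by transfer simp
  show "norm x = sqrt (inner x x)" by transfer (rule norm_eq_sqrt_inner)
qed

end

instance h2 :: banach
proof
  fix X :: "nat \<Rightarrow> h2" assume "Cauchy X"
  have dist: "dist (h2_l2 x) (h2_l2 y) = dist x y" for x y
    by (simp add: dist_norm norm_h2.rep_eq minus_h2.rep_eq)
  from \<open>Cauchy X\<close> have "Cauchy (\<lambda>n. h2_l2 (X n))"
    by (simp add: Cauchy_def dist)
  then obtain l where l: "(\<lambda>n. h2_l2 (X n)) \<longlonglongrightarrow> l"
    by (auto simp: Cauchy_convergent_iff convergent_def)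
  have "l \<in> H2"
    by (rule closed_sequentially[OF closed_H2 _ l]) (use h2_l2 in blast)
  then obtain l' where "l = h2_l2 l'"
    by (metis Abs_h2_inverse)
  with l have "X \<longlonglongrightarrow> l'"
    by (simp add: lim_sequentially dist)
  then show "convergent X" by (rule convergentI)
qed

instantiation h2 :: complex_hilbert
begin

lift_definition scaleC_h2 :: "complex \<Rightarrow> h2 \<Rightarrow> h2" is scaleC by (rule H2_subspace)
lift_definition cinner_h2 :: "h2 \<Rightarrow> h2 \<Rightarrow> complex" is cinner .

instance
proof
  fix x y z :: h2 and c d :: complex and r :: real
  show "c *\<^sub>C (x + y) = c *\<^sub>C x + c *\<^sub>C y" by transfer (rule scaleC_add_right)
  show "(c + d) *\<^sub>C x = c *\<^sub>C x + d *\<^sub>C x" by transfer (rule scaleC_add_left)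
  show "c *\<^sub>C d *\<^sub>C x = (c * d) *\<^sub>C x" by transfer (rule scaleC_scaleC)
  show "r *\<^sub>R x = complex_of_real r *\<^sub>C x" by transfer (rule scaleR_scaleC)
  show "cinner x y = cnj (cinner y x)" by transfer (rule cinner_commute)
  show "cinner (x + y) z = cinner x z + cinner y z" by transfer (rule cinner_add_left)
  show "cinner (c *\<^sub>C x) y = c * cinner x y" by transfer (rule cinner_scaleC_left)
  show "inner x y = Re (cinner x y)" by transfer (rule inner_eq_Re_cinner)
qed

end

text \<open>The orthogonal projection \<open>P\<^sub>+\<close> of \<open>L\<^sup>2\<close> onto \<open>H\<^sup>2\<close>.\<close>

definition riesz_projection :: "l2 \<Rightarrow> h2" where
  "riesz_projection f = (THE g. \<forall>h. cinner (f - h2_l2 g) (h2_l2 h) = 0)"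

definition toeplitz :: "l2 \<Rightarrow> (h2 \<Rightarrow>\<^sub>L h2)" where
  "toeplitz f = Blinfun (\<lambda>h. riesz_projection (l2_mult f (h2_l2 h)))"

definition holomorphic_extension :: "l2 \<Rightarrow> complex \<Rightarrow> complex" where
  "holomorphic_extension f z = (\<Sum>n. fourier f (int n) * z ^ n)"


section \<open>The function classes \<open>\<W>\<^sub>1\<close>\<close>

definition complex_borel_measure :: "(real set \<Rightarrow> complex) \<Rightarrow> bool" where
  "complex_borel_measure \<mu> \<longleftrightarrow>
     (\<forall>A :: nat \<Rightarrow> real set. range A \<subseteq> sets borel \<longrightarrow> disjoint_family A \<longrightarrow>
        (\<lambda>n. \<mu> (A n)) sums \<mu> (\<Union>n. A n))"

text \<open>The integral against \<open>\<mu>\<close> is obtained by writing \<open>\<mu> = \<nu>\<^sub>0 - \<nu>\<^sub>2 + \<i> (\<nu>\<^sub>1 - \<nu>\<^sub>3)\<close> with finite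
  positive measures, as is possible by the Jordan decomposition; for bounded Borel functions
  the value does not depend on the choice of the \<open>\<nu>\<^sub>k\<close>.\<close>

definition has_complex_measure_integral ::
    "(real set \<Rightarrow> complex) \<Rightarrow> (real \<Rightarrow> complex) \<Rightarrow> complex \<Rightarrow> bool" where
  "has_complex_measure_integral \<mu> g I \<longleftrightarrow>
     (\<exists>\<nu> :: nat \<Rightarrow> real measure.
        (\<forall>k<4. sets (\<nu> k) = sets borel \<and> finite_measure (\<nu> k) \<and> integrable (\<nu> k) g) \<and>
        (\<forall>A\<in>sets borel. \<mu> A = (\<Sum>k<4. \<i> ^ k * complex_of_real (measure (\<nu> k) A))) \<and>
        I = (\<Sum>k<4. \<i> ^ k * (LINT y|\<nu> k. g y)))"

definition W1 :: "(real \<Rightarrow> complex) set" where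
  "W1 = {\<phi>. \<phi> C1_differentiable_on UNIV \<and>
     (\<exists>\<mu>. complex_borel_measure \<mu> \<and>
        (\<forall>x. has_complex_measure_integral \<mu> (\<lambda>y. cis (x * y)) (vector_derivative \<phi> (at x))))}"

text \<open>Only the values on \<open>[a, b]\<close> matter. An extension in \<open>W1\<close> is \<open>C\<^sup>1\<close>, and so therefore is \<open>\<phi>\<close>
  on \<open>[a, b]\<close>.\<close>

definition W1_on :: "real \<Rightarrow> real \<Rightarrow> (real \<Rightarrow> complex) set" where
  "W1_on a b = {\<phi>. \<exists>\<psi>\<in>W1. \<forall>x\<in>{a..b}. \<psi> x = \<phi> x}"

end

theory Submission
  imports Defs "HOL-Computational_Algebra.Fundamental_Theorem_Algebra"
begin

text \<open>For \<open>\<phi>(x) = x\<^sup>n\<close> the formula is a computation with power series. Write \<open>T = T\<^sub>f\<close>, let \<open>T*\<close> be its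
  adjoint, \<open>F\<close> the power series of \<open>f\<close>, and \<open>S*\<close> the backward shift of coefficient sequences. The commutator of \<open>T*\<close> with
  the multiplication by a power series \<open>G\<close> is a sum of rank one operators,
  \<open>\<Sum>\<^sub>k \<langle>\<cdot>, S*\<^sup>k F\<rangle> S*\<^sup>k G\<close> over \<open>k \<ge> 1\<close> (\<open>nuclear_sum_commutator\<close>). Since
  \<open>\<Sum>\<^sub>k \<parallel>S*\<^sup>k F\<parallel>\<^sup>2 = \<Sum>\<^sub>l l |F\<^sub>l|\<^sup>2\<close>, which is finite because \<open>f\<close> lies in the Sobolev space of order
  \<open>1/2\<close>, this sum converges in trace norm. Now \<open>(T*T)\<^sup>n - (TT*)\<^sup>n\<close> equals
  \<open>T*\<^sup>n\<^sup>-\<^sup>1 [T*, T\<^sup>n]\<close> plus a commutator of \<open>T*\<close> with a trace class operator, and such a commutator has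
  trace \<open>0\<close> (\<open>trace_power_difference\<close>). The trace of the first term is
  \<open>\<Sum>\<^sub>k \<langle>S*\<^sup>k F\<^sup>n, T\<^sup>n\<^sup>-\<^sup>1 S*\<^sup>k F\<rangle>\<close>; collecting equal powers of \<open>z\<close> and using \<open>(F\<^sup>n)' = n F' F\<^sup>n\<^sup>-\<^sup>1\<close>
  turns it into \<open>\<Sum>\<^sub>l l |(F\<^sup>n)\<^sub>l|\<^sup>2 / n\<close> (\<open>trace_commutator_sum\<close>). Integration over circles shows that
  \<open>\<pi> \<Sum>\<^sub>l l |G\<^sub>l|\<^sup>2\<close> is the area integral of \<open>|G'|\<^sup>2\<close>, and \<open>|(F\<^sup>n)'|\<^sup>2 / n = n |F|\<^sup>2\<^sup>n\<^sup>-\<^sup>2 |F'|\<^sup>2\<close> is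
  \<open>\<phi>'(|F|\<^sup>2) |F'|\<^sup>2\<close> (\<open>energy_power\<close>).

  From powers to \<open>\<phi> \<in> \<W>\<^sub>1\<close>: with \<open>A = T*T\<close> and \<open>B = TT*\<close>, telescoping \<open>U\<^sup>m - V\<^sup>m\<close> for
  \<open>U = exp(i y A/m)\<close> and \<open>V = exp(i y B/m)\<close> and letting \<open>m\<close> tend to infinity bounds the trace norm of
  \<open>exp(i y A) - exp(i y B)\<close> by \<open>|y|\<close> times that of \<open>A - B\<close> (\<open>trace_bound_cis\<close>). So the
  primitives \<open>\<psi>\<^sub>y(x) = (exp(i x y) - 1)/(i y)\<close> of \<open>x \<mapsto> exp(i x y)\<close> give trace norms of
  \<open>\<psi>\<^sub>y(A) - \<psi>\<^sub>y(B)\<close> that are bounded uniformly in \<open>y\<close>. Both sides of the formula are continuous along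
  sequences \<open>\<phi>\<^sub>n\<close> for which \<open>\<phi>\<^sub>n\<close> and \<open>\<phi>\<^sub>n'\<close> converge uniformly and \<open>\<phi>\<^sub>n(A) - \<phi>\<^sub>n(B)\<close> is a Cauchy sequence
  in trace norm (\<open>formula_holds_limit\<close>). This gives the formula for \<open>\<psi>\<^sub>y\<close> from its Taylor series, and
  then for \<open>\<integral> \<psi>\<^sub>y d\<mu>(y)\<close> by approximating \<open>y\<close> with functions of finite range
  (\<open>formula_holds_integral\<close>). A function \<open>\<phi>\<close> with \<open>\<phi>'(x) = \<integral> exp(i x y) d\<mu>(y)\<close> differs from that
  integral by a constant, which contributes nothing to either side.

  Throughout, the trace norm of \<open>X\<close> is measured by the sums \<open>\<Sum>\<^sub>i |\<langle>X a\<^sub>i, b\<^sub>i\<rangle>|\<close> over finite families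
  that satisfy Bessel's inequality. That a bound on these sums makes \<open>X\<close> a trace class operator in the
  sense of a summable diagonal of \<open>|X|\<close> follows from an approximate polar decomposition
  (\<open>trace_classI\<close>). The continuous functional calculus rests on
  \<open>\<parallel>p(A)\<parallel> \<le> sup |p|\<close> over the spectrum of a self-adjoint \<open>A\<close> (\<open>norm_poly_op_le\<close>).\<close>


section \<open>Complex inner products\<close>

lemma norm_scaleC: "norm (c *\<^sub>C x) = cmod c * norm (x :: 'a::complex_hilbert)"
proof -
  have "(norm (c *\<^sub>C x))\<^sup>2 = Re (c * cnj c * cinner x x)"
    by (simp add: power2_norm_eq_inner inner_eq_Re_cinner cinner_scaleC_left cinner_scaleC_right algebra_simps)
  also have "c * cnj c = complex_of_real ((cmod c)\<^sup>2)" by (rule complex_norm_square[symmetric])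
  also have "Re (complex_of_real ((cmod c)\<^sup>2) * cinner x x) = (cmod c * norm x)\<^sup>2"
    by (simp add: power2_norm_eq_inner inner_eq_Re_cinner power_mult_distrib)
  finally show ?thesis by (simp add: power2_eq_iff_nonneg)
qed

lemma cinner_scaleR_left: "cinner (r *\<^sub>R x) y = r *\<^sub>R cinner x (y :: 'a::complex_hilbert)"
  by (simp add: scaleR_scaleC cinner_scaleC_left scaleR_conv_of_real)

lemma cinner_scaleR_right: "cinner x (r *\<^sub>R y) = r *\<^sub>R cinner x (y :: 'a::complex_hilbert)"
  by (simp add: scaleR_scaleC cinner_scaleC_right scaleR_conv_of_real)

lemma scaleC_of_real: "complex_of_real r *\<^sub>C x = r *\<^sub>R (x :: 'a::complex_hilbert)"
  by (simp add: scaleR_scaleC)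

lemma scaleC_one [simp]: "1 *\<^sub>C x = (x :: 'a::complex_hilbert)"
  using scaleC_of_real[of 1 x] by simp

lemma cinner_self: "cinner x x = complex_of_real ((norm (x :: 'a::complex_hilbert))\<^sup>2)"
proof -
  have "cinner x x = cnj (cinner x x)" by (rule cinner_commute)
  then have "Im (cinner x x) = 0" by (metis Reals_cnj_iff complex_is_Real_iff)
  then show ?thesis
    by (simp add: complex_eq_iff power2_norm_eq_inner inner_eq_Re_cinner)
qed

lemma cinner_norm_le: "cmod (cinner x y) \<le> norm x * norm (y :: 'a::complex_hilbert)"
proof (cases "cinner x y = 0")
  case False
  \<comment> \<open>This phase makes the inner product real and nonnegative, which reduces the claim to the
    Cauchy-Schwarz inequality for the underlying real inner product.\<close>
  define u where "u = cnj (sgn (cinner x y))"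
  have u: "cmod u = 1" using False by (simp add: u_def norm_sgn)
  have "cinner (u *\<^sub>C x) y = complex_of_real (cmod (cinner x y))"
    using False by (simp add: cinner_scaleC_left u_def sgn_eq complex_norm_square[symmetric]
        mult.commute[of "cnj _"] power2_eq_square)
  then have "cmod (cinner x y) = inner (u *\<^sub>C x) y" by (simp add: inner_eq_Re_cinner)
  also have "\<dots> \<le> norm (u *\<^sub>C x) * norm y" by (rule norm_cauchy_schwarz)
  finally show ?thesis by (simp add: norm_scaleC u)
qed auto

interpretation cinner: bounded_bilinear "cinner :: 'a::complex_hilbert \<Rightarrow> 'a \<Rightarrow> complex"
proof
  show "\<exists>K. \<forall>a b :: 'a. cmod (cinner a b) \<le> norm a * norm b * K"
    by (rule exI[of _ 1]) (simp add: cinner_norm_le)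
qed (auto simp: cinner_add_left cinner_add_right cinner_scaleR_left cinner_scaleR_right)

interpretation scaleC: bounded_bilinear "scaleC :: complex \<Rightarrow> 'a \<Rightarrow> 'a::complex_hilbert"
proof
  show "\<exists>K. \<forall>(a::complex) b :: 'a. norm (a *\<^sub>C b) \<le> norm a * norm b * K"
    by (rule exI[of _ 1]) (simp add: norm_scaleC)
next
  fix r :: real and a :: complex and b :: 'a
  show "(r *\<^sub>R a) *\<^sub>C b = r *\<^sub>R a *\<^sub>C b"
    by (simp add: scaleR_scaleC scaleC_scaleC scaleR_conv_of_real)
  show "a *\<^sub>C r *\<^sub>R b = r *\<^sub>R a *\<^sub>C b"
    by (simp add: scaleR_scaleC scaleC_scaleC mult.commute)
qed (auto simp: scaleC_add_left scaleC_add_right)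

lemma cinner_ext_left: "(\<And>z. cinner x z = cinner y z) \<Longrightarrow> x = (y :: 'a::complex_hilbert)"
proof -
  assume "\<And>z. cinner x z = cinner y z"
  then have "cinner (x - y) (x - y) = 0" by (simp add: cinner.diff_left)
  then show ?thesis by (simp add: cinner_self)
qed

lemma cinner_ext_right: "(\<And>z. cinner z x = cinner z y) \<Longrightarrow> x = (y :: 'a::complex_hilbert)"
  using cinner_commute by (metis cinner_ext_left)

lemma cmod_cinner_commute: "cmod (cinner x y) = cmod (cinner y x)"
  by (metis cinner_commute complex_mod_cnj)


section \<open>Orthonormal sets and Parseval's identity\<close>

definition orthonormal :: "'a::complex_hilbert set \<Rightarrow> bool" where
  "orthonormal E \<longleftrightarrow> (\<forall>e\<in>E. \<forall>e'\<in>E. cinner e e' = (if e = e' then 1 else 0))"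

lemma orthonormal_basis_orthonormal: "orthonormal_basis E \<Longrightarrow> orthonormal E"
  by (simp add: orthonormal_basis_def orthonormal_def)

lemma orthonormal_subset: "orthonormal E \<Longrightarrow> F \<subseteq> E \<Longrightarrow> orthonormal F"
  by (simp add: orthonormal_def subset_iff)

lemma cinner_projection:
  assumes "finite F" "orthonormal F" "e \<in> F"
  shows "cinner (\<Sum>e\<in>F. c e *\<^sub>C e) e = c e"
proof -
  have "cinner (\<Sum>e\<in>F. c e *\<^sub>C e) e = (\<Sum>e'\<in>F. c e' * cinner e' e)"
    by (simp add: cinner.sum_left cinner_scaleC_left)
  also have "\<dots> = (\<Sum>e'\<in>F. if e' = e then c e' else 0)"
    using assms by (intro sum.cong) (auto simp: orthonormal_def)
  finally show ?thesis using assms by simp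
qed

lemma norm_combination:
  assumes "finite F" "orthonormal F"
  shows "(norm (\<Sum>e\<in>F. c e *\<^sub>C e))\<^sup>2 = (\<Sum>e\<in>F. (cmod (c e))\<^sup>2)"
proof -
  let ?s = "\<Sum>e\<in>F. c e *\<^sub>C e"
  have "complex_of_real ((norm ?s)\<^sup>2) = cinner ?s ?s" by (simp add: cinner_self)
  also have "\<dots> = (\<Sum>e\<in>F. cnj (c e) * cinner ?s e)"
    using cinner.sum_right[of ?s "\<lambda>e. c e *\<^sub>C e" F] by (simp add: cinner_scaleC_right)
  also have "\<dots> = (\<Sum>e\<in>F. complex_of_real ((cmod (c e))\<^sup>2))"
    unfolding complex_norm_square
    by (intro sum.cong) (auto simp: cinner_projection[OF assms] mult.commute)
  also have "\<dots> = complex_of_real (\<Sum>e\<in>F. (cmod (c e))\<^sup>2)" by simp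
  finally show ?thesis by (simp only: of_real_eq_iff)
qed

lemma norm_residual:
  assumes "finite F" "orthonormal F"
  shows "(norm (x - (\<Sum>e\<in>F. cinner x e *\<^sub>C e)))\<^sup>2 = (norm x)\<^sup>2 - (\<Sum>e\<in>F. (cmod (cinner x e))\<^sup>2)"
proof -
  let ?s = "\<Sum>e\<in>F. cinner x e *\<^sub>C e"
  have 1: "cinner (x - ?s) ?s = 0"
  proof -
    have "cinner (x - ?s) e = 0" if "e \<in> F" for e
      using that by (simp add: cinner.diff_left cinner_projection[OF assms])
    then show ?thesis by (subst cinner.sum_right) (simp add: cinner_scaleC_right)
  qed
  have "inner (x - ?s) ?s = 0" by (simp add: inner_eq_Re_cinner 1)
  then have "(norm x)\<^sup>2 = (norm (x - ?s))\<^sup>2 + (norm ?s)\<^sup>2"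
    using norm_add_Pythagorean[of "x - ?s" ?s] by (simp add: orthogonal_def)
  then show ?thesis by (simp add: norm_combination[OF assms])
qed

lemma bessel_finite:
  assumes "finite F" "orthonormal F"
  shows "(\<Sum>e\<in>F. (cmod (cinner x e))\<^sup>2) \<le> (norm x)\<^sup>2"
  using norm_residual[OF assms, of x] zero_le_power2[of "norm (x - (\<Sum>e\<in>F. cinner x e *\<^sub>C e))"] by linarith

lemma bessel_summable:
  assumes "orthonormal E"
  shows "(\<lambda>e. (cmod (cinner x e))\<^sup>2) summable_on E"
proof (rule nonneg_bdd_above_summable_on)
  show "bdd_above (sum (\<lambda>e. (cmod (cinner x e))\<^sup>2) ` {F. F \<subseteq> E \<and> finite F})"
    using bessel_finite orthonormal_subset[OF assms]
    by (intro bdd_aboveI[of _ "(norm x)\<^sup>2"]) auto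
qed simp

text \<open>The partial sums form a Cauchy net because the norm of a difference is a tail of the convergent sum in
  Bessel's inequality; the limit has the same coefficients as \<open>x\<close>, so it is \<open>x\<close> by completeness of
  the basis. Nets are needed as the basis of a general space may be uncountable.\<close>

theorem orthonormal_expansion:
  assumes "orthonormal_basis E"
  shows "((\<lambda>e. cinner x e *\<^sub>C e) has_sum x) E"
proof -
  have on: "orthonormal E" using assms by (rule orthonormal_basis_orthonormal)
  define a where "a = (\<lambda>e. (cmod (cinner x e))\<^sup>2)"
  define P where "P = (\<lambda>F. \<Sum>e\<in>F. cinner x e *\<^sub>C e)"
  have "(a has_sum infsum a E) E" using bessel_summable[OF on] by (simp add: a_def)
  then have lim: "(sum a \<longlongrightarrow> infsum a E) (finite_subsets_at_top E)" by (simp add: has_sum_def)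
  have "\<exists>Q. eventually Q (finite_subsets_at_top E) \<and> (\<forall>F G. Q F \<and> Q G \<longrightarrow> dist (P F) (P G) < e)"
    if e: "e > 0" for e
  proof -
    obtain F where F: "finite F" "F \<subseteq> E" "\<And>G. finite G \<Longrightarrow> F \<subseteq> G \<Longrightarrow> G \<subseteq> E \<Longrightarrow>
      \<bar>sum a G - infsum a E\<bar> < (e/2)\<^sup>2 / 2"
      using tendstoD[OF lim, of "(e/2)\<^sup>2 / 2"] e
      unfolding eventually_finite_subsets_at_top dist_real_def by auto
    have near: "norm (P G - P F) < e/2" if G: "finite G" "F \<subseteq> G" "G \<subseteq> E" for G
    proof -
      have "P G - P F = (\<Sum>e\<in>G - F. cinner x e *\<^sub>C e)"
        unfolding P_def using G by (simp add: sum_diff)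
      then have "(norm (P G - P F))\<^sup>2 = sum a (G - F)"
        unfolding a_def using G by (simp only:) (intro norm_combination orthonormal_subset[OF on], auto)
      also have "\<dots> = sum a G - sum a F" using G F by (intro sum_diff) auto
      finally have "(norm (P G - P F))\<^sup>2 < (e/2)\<^sup>2" using F(3)[OF G] F(3)[OF F(1) order_refl F(2)] by linarith
      then show ?thesis by (rule power2_less_imp_less) (use e in simp)
    qed
    define Q where "Q = (\<lambda>G. finite G \<and> F \<subseteq> G \<and> G \<subseteq> E)"
    have "dist (P G) (P G') < e" if "Q G" "Q G'" for G G'
      using dist_triangle_half_l[of "P G" "P F" e "P G'"] near[of G] near[of G'] that
      by (simp add: dist_norm Q_def norm_minus_commute)
    moreover have "eventually Q (finite_subsets_at_top E)"
      unfolding eventually_finite_subsets_at_top Q_def using F(1,2) by (intro exI[of _ F]) simp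
    ultimately show ?thesis by (intro exI[of _ Q]) simp
  qed
  then have "cauchy_filter (filtermap P (finite_subsets_at_top E))"
    unfolding cauchy_filter_metric_filtermap by simp
  from cauchy_filter_complete_converges[OF this complete_UNIV]
  obtain p where "filtermap P (finite_subsets_at_top E) \<le> nhds p" by (auto simp: filtermap_bot_iff)
  then have sum: "((\<lambda>e. cinner x e *\<^sub>C e) has_sum p) E" by (simp add: has_sum_def filterlim_def P_def)
  have "cinner (x - p) e = 0" if e: "e \<in> E" for e
  proof -
    have "bounded_linear (\<lambda>y. cinner y e)" by (rule cinner.bounded_linear_left)
    then have "((\<lambda>e'. cinner (cinner x e' *\<^sub>C e') e) has_sum cinner p e) E"
      using has_sum_bounded_linear sum by blast
    moreover have "((\<lambda>e'. cinner (cinner x e' *\<^sub>C e') e) has_sum cinner x e) E"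
    proof (rule has_sum_finite_neutralI[of "{e}"])
      show "cinner (cinner x e' *\<^sub>C e') e = 0" if "e' \<in> E - {e}" for e'
        using on that e by (auto simp: cinner_scaleC_left orthonormal_def)
    qed (use e on in \<open>auto simp: cinner_scaleC_left orthonormal_def\<close>)
    ultimately have "cinner p e = cinner x e" by (rule has_sum_unique)
    then show ?thesis by (simp add: cinner.diff_left)
  qed
  then have "x - p = 0" using assms unfolding orthonormal_basis_def by blast
  then show ?thesis using sum by simp
qed

corollary parseval:
  assumes "orthonormal_basis E"
  shows "((\<lambda>e. cinner x e * cinner e y) has_sum cinner x y) E"
proof -
  have "((\<lambda>e. cinner (cinner x e *\<^sub>C e) y) has_sum cinner x y) E"
    using has_sum_bounded_linear[OF cinner.bounded_linear_left orthonormal_expansion[OF assms]] by blast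
  then show ?thesis by (simp add: cinner_scaleC_left)
qed

corollary parseval_norm:
  assumes "orthonormal_basis E"
  shows "((\<lambda>e. (cmod (cinner x e))\<^sup>2) has_sum (norm x)\<^sup>2) E"
proof -
  have "((\<lambda>e. Re (cinner x e * cinner e x)) has_sum Re (cinner x x)) E"
    using has_sum_bounded_linear[OF bounded_linear_Re parseval[OF assms]] by blast
  moreover have "cinner x e * cinner e x = complex_of_real ((cmod (cinner x e))\<^sup>2)" for e
    by (metis cinner_commute complex_norm_square)
  ultimately show ?thesis by (simp add: cinner_self)
qed


section \<open>Operators with an adjoint\<close>

abbreviation (input) compose_op (infixl "\<odot>" 70) where
  "A \<odot> B \<equiv> A o\<^sub>L B"

lemmas [simp] = scaleC.zero_left scaleC.zero_right cinner.zero_left cinner.zero_right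

text \<open>A relation rather than a function, because on an arbitrary \<open>complex_hilbert\<close> space the operators at
  hand come with explicit adjoints.\<close>

definition adjoint_pair :: "('a::complex_hilbert \<Rightarrow>\<^sub>L 'a) \<Rightarrow> ('a \<Rightarrow>\<^sub>L 'a) \<Rightarrow> bool" where
  "adjoint_pair A B \<longleftrightarrow> (\<forall>x y. cinner (A x) y = cinner x (B y))"

lemma adjoint_pairD: "adjoint_pair A B \<Longrightarrow> cinner (blinfun_apply A x) y = cinner x (blinfun_apply B y)"
  by (simp add: adjoint_pair_def)

lemma adjoint_pair_sym:
  assumes "adjoint_pair A B" shows "adjoint_pair B A"
  unfolding adjoint_pair_def
proof (intro allI)
  fix x y
  have "cinner (B x) y = cnj (cinner y (B x))" by (rule cinner_commute)
  also have "\<dots> = cnj (cinner (A y) x)" by (simp add: adjoint_pairD[OF assms])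
  also have "\<dots> = cinner x (A y)" by (rule cinner_commute[symmetric])
  finally show "cinner (B x) y = cinner x (A y)" .
qed

lemma adjoint_op_eq:
  assumes "adjoint_pair A B" shows "adjoint_op A = B"
  unfolding adjoint_op_def
proof (rule the_equality)
  fix B' assume "\<forall>x y. cinner (blinfun_apply A x) y = cinner x (blinfun_apply B' y)"
  then have "cinner z (B' y) = cinner z (B y)" for z y by (simp flip: adjoint_pairD[OF assms])
  then show "B' = B" by (intro blinfun_eqI cinner_ext_right)
qed (simp add: adjoint_pairD[OF assms])

lemma adjoint_pair_scaleC: "adjoint_pair A B \<Longrightarrow> blinfun_apply A (c *\<^sub>C x) = c *\<^sub>C blinfun_apply A x"
  by (rule cinner_ext_left) (simp add: adjoint_pairD cinner_scaleC_left)

lemma adjoint_pair_complex_linear: "adjoint_pair A B \<Longrightarrow> complex_linear A"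
  by (simp add: complex_linear_def adjoint_pair_scaleC)

lift_definition scalar_op :: "complex \<Rightarrow> ('a::complex_hilbert \<Rightarrow>\<^sub>L 'a)" is "\<lambda>c x. c *\<^sub>C x"
  by (rule scaleC.bounded_linear_right)

lemma scalar_op_apply [simp]: "blinfun_apply (scalar_op c) x = c *\<^sub>C x" by (simp add: scalar_op.rep_eq)

lemma scalar_op_of_real: "scalar_op (complex_of_real r) = r *\<^sub>R id_blinfun"
  by (rule blinfun_eqI) (simp add: scaleC_of_real scaleR_blinfun.rep_eq)

lemma scalar_op_1: "scalar_op 1 = id_blinfun" using scalar_op_of_real[of 1] by simp

lemma adjoint_pair_compose:
  "adjoint_pair A A' \<Longrightarrow> adjoint_pair B B' \<Longrightarrow> adjoint_pair (A \<odot> B) (B' \<odot> A')"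
  by (simp add: adjoint_pair_def)

lemma adjoint_pair_add:
  "adjoint_pair A A' \<Longrightarrow> adjoint_pair B B' \<Longrightarrow> adjoint_pair (A + B) (A' + B')"
  by (simp add: adjoint_pair_def blinfun.add_left cinner_add_left cinner_add_right)

lemma adjoint_pair_diff:
  "adjoint_pair A A' \<Longrightarrow> adjoint_pair B B' \<Longrightarrow> adjoint_pair (A - B) (A' - B')"
  by (simp add: adjoint_pair_def blinfun.diff_left cinner.diff_left cinner.diff_right)

lemma adjoint_pair_scalar_op: "adjoint_pair (scalar_op c) (scalar_op (cnj c))"
  by (simp add: adjoint_pair_def cinner_scaleC_left cinner_scaleC_right)

lemma adjoint_pair_0: "adjoint_pair 0 0"
  by (simp add: adjoint_pair_def)

lemma adjoint_pair_id: "adjoint_pair id_blinfun id_blinfun"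
  by (simp add: adjoint_pair_def)

lemma adjoint_pair_norm_le:
  assumes "adjoint_pair A B"
  shows "norm B \<le> norm A"
proof (rule norm_blinfun_bound)
  fix x
  have "(norm (B x))\<^sup>2 = cmod (cinner (A (B x)) x)"
    using adjoint_pairD[OF assms, of "B x" x] cinner_self[of "B x"] by (simp add: norm_power)
  also have "\<dots> \<le> norm (A (B x)) * norm x" by (rule cinner_norm_le)
  also have "\<dots> \<le> (norm A * norm (B x)) * norm x"
    by (intro mult_right_mono norm_blinfun) auto
  finally have "norm (B x) * norm (B x) \<le> (norm A * norm x) * norm (B x)"
    by (simp add: power2_eq_square mult_ac)
  then show "norm (B x) \<le> norm A * norm x"
    by (cases "B x = 0") (auto intro: mult_right_le_imp_le)
qed simp

lemma adjoint_pair_LIMSEQ: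
  assumes "A \<longlonglongrightarrow> A'" "B \<longlonglongrightarrow> B'" "\<And>n. adjoint_pair (A n) (B n)"
  shows "adjoint_pair A' B'"
  unfolding adjoint_pair_def
proof (intro allI)
  fix x y
  have 1: "(\<lambda>n. cinner (A n x) y) \<longlonglongrightarrow> cinner (A' x) y"
    by (intro cinner.tendsto tendsto_const blinfun.tendsto assms)
  have "(\<lambda>n. cinner x (B n y)) \<longlonglongrightarrow> cinner x (B' y)"
    by (intro cinner.tendsto tendsto_const blinfun.tendsto assms)
  then have "(\<lambda>n. cinner (A n x) y) \<longlonglongrightarrow> cinner x (B' y)"
    by (simp add: adjoint_pairD[OF assms(3)])
  with 1 show "cinner (A' x) y = cinner x (B' y)" by (rule LIMSEQ_unique)
qed

lemma compose_assoc: "(A \<odot> B) \<odot> C = A \<odot> (B \<odot> C)"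
  by (rule blinfun_eqI) simp

lemma compose_id [simp]: "A \<odot> id_blinfun = A" "id_blinfun \<odot> A = A"
  by (rule blinfun_eqI, simp)+

lemma compose_add: "(A + B) \<odot> C = A \<odot> C + B \<odot> C" "C \<odot> (A + B) = C \<odot> A + C \<odot> B"
  by (rule blinfun_eqI, simp add: blinfun.bilinear_simps)+

lemma compose_diff: "(A - B) \<odot> C = A \<odot> C - B \<odot> C" "C \<odot> (A - B) = C \<odot> A - C \<odot> B"
  by (rule blinfun_eqI, simp add: blinfun.bilinear_simps)+

lemma compose_scaleR: "(r *\<^sub>R A) \<odot> C = r *\<^sub>R (A \<odot> C)" "C \<odot> (r *\<^sub>R A) = r *\<^sub>R (C \<odot> A)"
  by (rule blinfun_eqI, simp add: blinfun.bilinear_simps)+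

primrec opow :: "('a::real_normed_vector \<Rightarrow>\<^sub>L 'a) \<Rightarrow> nat \<Rightarrow> ('a \<Rightarrow>\<^sub>L 'a)" where
  "opow A 0 = id_blinfun"
| "opow A (Suc n) = A \<odot> opow A n"

lemma opow_apply: "blinfun_apply (opow A n) x = (blinfun_apply A ^^ n) x"
  by (induction n) auto

lemma opow_commute: "opow A n \<odot> A = A \<odot> opow A n"
  by (induction n) (auto simp: compose_assoc)

lemma norm_compose_le:
  assumes "norm A \<le> a" "norm B \<le> b" shows "norm (A \<odot> B) \<le> a * b"
proof -
  have "norm (A \<odot> B) \<le> norm A * norm B" by (rule norm_blinfun_compose)
  also have "\<dots> \<le> a * b" by (intro mult_mono assms order_trans[OF norm_ge_zero assms(1)]) auto
  finally show ?thesis .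
qed

lemma norm_opow: "norm A \<le> c \<Longrightarrow> norm (opow A n) \<le> c ^ n"
  by (induction n) (auto simp: norm_blinfun_id_le intro: norm_compose_le)

lemma adjoint_pair_opow: "adjoint_pair A B \<Longrightarrow> adjoint_pair (opow A n) (opow B n)"
proof (induction n)
  case (Suc n)
  then have "adjoint_pair (A \<odot> opow A n) (opow B n \<odot> B)" by (intro adjoint_pair_compose) auto
  then show ?case by (simp add: opow_commute)
qed (simp add: adjoint_pair_id)

text \<open>The inductive step of the telescoping sum for \<open>A\<^sup>n - B\<^sup>n\<close>.\<close>

lemma opow_diff:
  "opow A (Suc n) - opow B (Suc n) = A \<odot> (opow A n - opow B n) + (A - B) \<odot> opow B n"
  by (simp add: compose_diff)


section \<open>Polynomials of an operator\<close>

lemma poly_op_sum: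
  assumes "degree p \<le> N"
  shows "poly_op p A = (\<Sum>i\<le>N. scalar_op (coeff p i) \<odot> opow A i)"
proof -
  have *: "(\<lambda>x. \<Sum>i\<le>degree p. coeff p i *\<^sub>C (blinfun_apply A ^^ i) x) =
      blinfun_apply (\<Sum>i\<le>degree p. scalar_op (coeff p i) \<odot> opow A i)"
    by (simp add: fun_eq_iff blinfun.sum_left opow_apply)
  have "poly_op p A = (\<Sum>i\<le>degree p. scalar_op (coeff p i) \<odot> opow A i)"
    unfolding poly_op_def * by (rule blinfun_apply_inverse)
  also have "\<dots> = (\<Sum>i\<le>N. scalar_op (coeff p i) \<odot> opow A i)"
    using assms by (intro sum.mono_neutral_left)
      (auto simp: coeff_eq_0 intro!: blinfun_eqI)
  finally show ?thesis .
qed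

lemma poly_op_0 [simp]: "poly_op 0 A = 0"
  using poly_op_sum[of 0 0 A] by (auto intro!: blinfun_eqI)

lemma poly_op_add: "poly_op (p + q) A = poly_op p A + poly_op q A"
proof -
  let ?N = "max (degree p) (degree q)"
  have "poly_op (p + q) A = (\<Sum>i\<le>?N. scalar_op (coeff (p + q) i) \<odot> opow A i)"
    by (intro poly_op_sum degree_add_le_max)
  also have "\<dots> = (\<Sum>i\<le>?N. scalar_op (coeff p i) \<odot> opow A i) + (\<Sum>i\<le>?N. scalar_op (coeff q i) \<odot> opow A i)"
    unfolding sum.distrib[symmetric]
    by (intro sum.cong) (auto intro!: blinfun_eqI simp: scaleC_add_left blinfun.add_left)
  finally show ?thesis by (simp add: poly_op_sum[of p ?N] poly_op_sum[of q ?N])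
qed

lemma poly_op_smult: "poly_op (smult c p) A = scalar_op c \<odot> poly_op p A"
proof -
  have "poly_op (smult c p) A = (\<Sum>i\<le>degree p. scalar_op (coeff (smult c p) i) \<odot> opow A i)"
    by (intro poly_op_sum degree_smult_le)
  also have "\<dots> = scalar_op c \<odot> poly_op p A"
    by (rule blinfun_eqI)
      (simp add: poly_op_sum[OF order_refl] blinfun.sum_left scaleC.sum_right scaleC_scaleC)
  finally show ?thesis .
qed

lemma poly_op_diff: "poly_op (p - q) A = poly_op p A - poly_op q A"
proof -
  have "poly_op ((p - q) + q) A = poly_op (p - q) A + poly_op q A" by (rule poly_op_add)
  then show ?thesis by simp
qed

lemma poly_op_pCons:
  assumes "complex_linear A"
  shows "poly_op (pCons a p) A = scalar_op a + A \<odot> poly_op p A"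
proof -
  have "poly_op (pCons a p) A = (\<Sum>i\<le>Suc (degree p). scalar_op (coeff (pCons a p) i) \<odot> opow A i)"
    by (intro poly_op_sum degree_pCons_le)
  also have "\<dots> = scalar_op a + (\<Sum>i\<le>degree p. scalar_op (coeff p i) \<odot> opow A (Suc i))"
    by (subst sum.atMost_Suc_shift) simp
  also have "(\<Sum>i\<le>degree p. scalar_op (coeff p i) \<odot> opow A (Suc i)) = A \<odot> poly_op p A"
    using assms
    by (intro blinfun_eqI)
      (simp add: poly_op_sum[OF order_refl] blinfun.sum_left blinfun.sum_right complex_linear_def)
  finally show ?thesis .
qed

lemma poly_op_const: "poly_op [:c:] A = scalar_op c"
  using poly_op_sum[of "[:c:]" 0 A] by simp

lemma poly_op_X: "complex_linear A \<Longrightarrow> poly_op [:0, 1:] A = A"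
  by (simp add: poly_op_pCons poly_op_const[of 1] scalar_op_1) (auto intro!: blinfun_eqI)

lemma poly_op_linear: "complex_linear A \<Longrightarrow> poly_op [:c, 1:] A = A + scalar_op c"
  by (simp add: poly_op_pCons poly_op_const[of 1] scalar_op_1)

lemma poly_op_mult:
  assumes "complex_linear A"
  shows "poly_op (p * q) A = poly_op p A \<odot> poly_op q A"
proof (induction p)
  case (pCons a p)
  have "poly_op (pCons a p * q) A = poly_op (smult a q) A + poly_op (pCons 0 (p * q)) A"
    by (simp add: poly_op_add)
  also have "\<dots> = scalar_op a \<odot> poly_op q A + A \<odot> (poly_op p A \<odot> poly_op q A)"
    by (simp add: poly_op_smult poly_op_pCons[OF assms] pCons.IH) (auto intro!: blinfun_eqI)
  also have "\<dots> = poly_op (pCons a p) A \<odot> poly_op q A"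
    by (simp add: poly_op_pCons[OF assms] compose_add compose_assoc)
  finally show ?case .
qed (auto intro!: blinfun_eqI)

lemma poly_op_commute:
  "complex_linear A \<Longrightarrow> poly_op p A \<odot> poly_op q A = poly_op q A \<odot> poly_op p A"
  by (metis poly_op_mult mult.commute)

lemma adjoint_pair_poly_op:
  assumes "adjoint_pair A A"
  shows "adjoint_pair (poly_op p A) (poly_op (map_poly cnj p) A)"
proof (induction p)
  case (pCons a p)
  note cl = adjoint_pair_complex_linear[OF assms]
  have "A \<odot> poly_op (map_poly cnj p) A = poly_op (map_poly cnj p) A \<odot> A"
    using poly_op_commute[OF cl, of "[:0,1:]"] by (simp add: poly_op_X[OF cl])
  then have "adjoint_pair (scalar_op a + A \<odot> poly_op p A) (scalar_op (cnj a) + A \<odot> poly_op (map_poly cnj p) A)"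
    using adjoint_pair_add[OF adjoint_pair_scalar_op adjoint_pair_compose[OF assms pCons.IH], of a] by simp
  then show ?case by (simp add: poly_op_pCons[OF cl] map_poly_pCons)
qed (simp add: adjoint_pair_0)


section \<open>Invertibility and the spectrum of a self-adjoint operator\<close>

definition inv_op :: "('a::real_normed_vector \<Rightarrow>\<^sub>L 'a) \<Rightarrow> bool" where
  "inv_op X \<longleftrightarrow> (\<exists>B. X \<odot> B = id_blinfun \<and> B \<odot> X = id_blinfun)"

lemma op_spectrum_iff: "z \<in> op_spectrum A \<longleftrightarrow> \<not> inv_op (poly_op [:- z, 1:] A)"
  by (simp add: op_spectrum_def inv_op_def)

lemma inv_op_compose:
  assumes "inv_op X" "inv_op Y" shows "inv_op (X \<odot> Y)"
proof -
  obtain B C where "X \<odot> B = id_blinfun" "B \<odot> X = id_blinfun" "Y \<odot> C = id_blinfun" "C \<odot> Y = id_blinfun"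
    using assms by (auto simp: inv_op_def)
  then have "(X \<odot> Y) \<odot> (C \<odot> B) = id_blinfun" "(C \<odot> B) \<odot> (X \<odot> Y) = id_blinfun"
    by (metis compose_assoc compose_id)+
  then show ?thesis by (auto simp: inv_op_def)
qed

lemma inv_op_factor:
  assumes "inv_op (X \<odot> Y)" "X \<odot> Y = Y \<odot> X" shows "inv_op X"
proof -
  obtain B where B: "(X \<odot> Y) \<odot> B = id_blinfun" "B \<odot> (X \<odot> Y) = id_blinfun"
    using assms by (auto simp: inv_op_def)
  have r: "X \<odot> (Y \<odot> B) = id_blinfun" and l: "(B \<odot> Y) \<odot> X = id_blinfun"
    using B assms(2) by (metis compose_assoc)+
  have "B \<odot> Y = (B \<odot> Y) \<odot> (X \<odot> (Y \<odot> B))" by (simp add: r)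
  also have "\<dots> = Y \<odot> B" using l by (metis compose_assoc compose_id(2))
  finally show ?thesis using l r by (auto simp: inv_op_def)
qed

lemma inv_op_scaleR:
  assumes "inv_op X" "r \<noteq> 0" shows "inv_op (r *\<^sub>R X)"
proof -
  obtain B where "X \<odot> B = id_blinfun" "B \<odot> X = id_blinfun" using assms by (auto simp: inv_op_def)
  then show ?thesis unfolding inv_op_def
    by (intro exI[of _ "(1/r) *\<^sub>R B"]) (simp add: compose_scaleR assms)
qed

text \<open>The inverse is the Neumann series \<open>\<Sum>\<^sub>n (1 - X)\<^sup>n\<close>.\<close>

lemma inv_op_near_id:
  fixes X :: "'a::banach \<Rightarrow>\<^sub>L 'a"
  assumes "norm (id_blinfun - X) < 1"
  shows "inv_op X"
proof -
  define R where "R = id_blinfun - X"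
  have "summable (opow R)"
  proof (rule summable_comparison_test')
    show "summable (\<lambda>n. norm R ^ n)" using assms by (intro summable_geometric) (simp add: R_def)
    show "norm (opow R n) \<le> norm R ^ n" if "n \<ge> 0" for n by (rule norm_opow) simp
  qed
  define S where "S = suminf (opow R)"
  have S: "opow R sums S" using \<open>summable (opow R)\<close> by (simp add: S_def summable_sums)
  have "(\<lambda>n. opow R (Suc n)) sums (S - id_blinfun)"
    using sums_Suc_iff[of "opow R" "S - id_blinfun"] S by simp
  moreover have "(\<lambda>n. opow R (Suc n)) sums (R \<odot> S)"
    using bounded_linear.sums[OF bounded_bilinear.bounded_linear_right[OF bounded_bilinear_blinfun_compose] S, of R]
    by simp
  moreover have "(\<lambda>n. opow R (Suc n)) sums (S \<odot> R)"
    using bounded_linear.sums[OF bounded_bilinear.bounded_linear_left[OF bounded_bilinear_blinfun_compose] S, of R]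
    by (simp add: opow_commute)
  ultimately have "R \<odot> S = S - id_blinfun" "S \<odot> R = S - id_blinfun"
    by (auto dest: sums_unique2)
  moreover have "X = id_blinfun - R" by (simp add: R_def)
  ultimately have "X \<odot> S = id_blinfun" "S \<odot> X = id_blinfun"
    by (auto simp: compose_diff)
  then show ?thesis by (auto simp: inv_op_def)
qed

lemma norm_diff_scaleR_sq:
  "(norm (a - r *\<^sub>R x))\<^sup>2 = (norm a)\<^sup>2 - 2 * r * inner a x + r\<^sup>2 * (norm x)\<^sup>2"
  unfolding power2_norm_eq_inner
  by (simp add: inner_diff inner_commute power2_eq_square algebra_simps)

text \<open>With \<open>p = \<parallel>D\<parallel>\<^sup>2\<close>, the operator \<open>P = D*D\<close> satisfies \<open>\<parallel>P x\<parallel>\<^sup>2 \<le> p \<langle>P x, x\<rangle>\<close>, so its distance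
  from the midpoint \<open>p/2\<close> of \<open>[0, p]\<close> is at most \<open>p/2\<close>. Hence \<open>P + b\<close> is within \<open>p/2\<close> of
  \<open>p/2 + b\<close>, and the Neumann series inverts it.\<close>

lemma inv_op_positive_shift:
  fixes D :: "'a::complex_hilbert \<Rightarrow>\<^sub>L 'a"
  assumes "adjoint_pair D E" "b > 0"
  shows "inv_op (E \<odot> D + b *\<^sub>R id_blinfun)"
proof -
  define p where "p = (norm D)\<^sup>2"
  define P where "P = E \<odot> D"
  have p: "p \<ge> 0" by (simp add: p_def)
  have "norm (P - (p/2) *\<^sub>R id_blinfun) \<le> p/2"
  proof (rule norm_blinfun_bound)
    fix x
    have PP: "norm (P x) \<le> norm D * norm (D x)"
      using norm_blinfun[of E "D x"] mult_right_mono[OF adjoint_pair_norm_le[OF assms(1)], of "norm (D x)"]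
      by (simp add: P_def)
    have "(norm (P x - (p/2) *\<^sub>R x))\<^sup>2 = (norm (P x))\<^sup>2 - p * inner (P x) x + (p/2)\<^sup>2 * (norm x)\<^sup>2"
      by (simp add: norm_diff_scaleR_sq)
    moreover have "inner (P x) x = (norm (D x))\<^sup>2"
      using adjoint_pairD[OF adjoint_pair_sym[OF assms(1)], of "D x" x]
      by (simp add: P_def inner_eq_Re_cinner cinner_self)
    moreover have "(norm (P x))\<^sup>2 \<le> p * (norm (D x))\<^sup>2"
      using power_mono[OF PP, of 2] by (simp add: p_def power_mult_distrib)
    ultimately have "(norm (P x - (p/2) *\<^sub>R x))\<^sup>2 \<le> (p/2)\<^sup>2 * (norm x)\<^sup>2"
      by simp
    then have "(norm (P x - (p/2) *\<^sub>R x))\<^sup>2 \<le> (p/2 * norm x)\<^sup>2"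
      unfolding power_mult_distrib .
    then show "norm (blinfun_apply (P - (p/2) *\<^sub>R id_blinfun) x) \<le> p/2 * norm x"
      using p power2_le_imp_le[of "norm (P x - (p/2) *\<^sub>R x)" "p/2 * norm x"]
      by (simp add: blinfun.bilinear_simps)
  qed (use p in simp)
  define c where "c = p/2 + b"
  have c: "c > 0" using p assms by (simp add: c_def)
  have "id_blinfun - (1/c) *\<^sub>R (P + b *\<^sub>R id_blinfun) = (- (1/c)) *\<^sub>R (P - (p/2) *\<^sub>R id_blinfun)"
  proof (rule blinfun_eqI)
    fix x :: 'a
    have "p / (c * 2) + b / c = (p/2 + b) / c" by (simp add: add_divide_distrib mult.commute)
    also have "\<dots> = 1" using c by (simp flip: c_def)
    finally have "(p / (c * 2) + b / c) *\<^sub>R x = x" by simp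
    then have "x - (b / c) *\<^sub>R x = (p / (c * 2)) *\<^sub>R x"
      unfolding scaleR_add_left by (metis add_diff_cancel_right')
    then show "blinfun_apply (id_blinfun - (1/c) *\<^sub>R (P + b *\<^sub>R id_blinfun)) x =
        blinfun_apply ((- (1/c)) *\<^sub>R (P - (p/2) *\<^sub>R id_blinfun)) x"
      by (simp add: blinfun.bilinear_simps scaleR_diff_right scaleR_add_right)
  qed
  then have "norm (id_blinfun - (1/c) *\<^sub>R (P + b *\<^sub>R id_blinfun)) =
      (1/c) * norm (P - (p/2) *\<^sub>R id_blinfun)"
    using c by (simp only: norm_scaleR) simp
  also have "\<dots> \<le> (1/c) * (p/2)"
    using \<open>norm (P - (p/2) *\<^sub>R id_blinfun) \<le> p/2\<close> c by (intro mult_left_mono) auto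
  also have "\<dots> < 1" using c assms by (simp add: c_def)
  finally have "inv_op ((1/c) *\<^sub>R (P + b *\<^sub>R id_blinfun))" by (rule inv_op_near_id)
  from inv_op_scaleR[OF this, of c] have "inv_op (c *\<^sub>R ((1/c) *\<^sub>R (P + b *\<^sub>R id_blinfun)))"
    using c by simp
  moreover have "c *\<^sub>R ((1/c) *\<^sub>R Y) = Y" for Y :: "'a \<Rightarrow>\<^sub>L 'a" using c by simp
  ultimately show ?thesis by (simp only: P_def)
qed

text \<open>For \<open>z = x + i y\<close> the product \<open>(A - z)(A - cnj z) = (A - x)\<^sup>2 + y\<^sup>2\<close> is invertible if \<open>y \<noteq> 0\<close>, and
  then so is its factor \<open>A - z\<close>.\<close>

lemma spectrum_selfadjoint_real:
  assumes "adjoint_pair A A" "z \<in> op_spectrum A"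
  shows "z = complex_of_real (Re z)"
proof (rule ccontr)
  assume "z \<noteq> complex_of_real (Re z)"
  then have b: "(Im z)\<^sup>2 > 0" by (auto simp: complex_eq_iff)
  note cl = adjoint_pair_complex_linear[OF assms(1)]
  define S where "S = poly_op [:- complex_of_real (Re z), 1:] A"
  have S: "adjoint_pair S S"
    using adjoint_pair_poly_op[OF assms(1), of "[:- complex_of_real (Re z), 1:]"]
    by (simp add: S_def map_poly_pCons)
  have "[:- z, 1:] * [:- cnj z, 1:] = [:- complex_of_real (Re z), 1:] * [:- complex_of_real (Re z), 1:] +
      [:complex_of_real ((Im z)\<^sup>2):]"
    by (simp add: complex_eq_iff power2_eq_square)
  then have "poly_op [:- z, 1:] A \<odot> poly_op [:- cnj z, 1:] A = S \<odot> S + (Im z)\<^sup>2 *\<^sub>R id_blinfun"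
    unfolding S_def by (simp only: poly_op_mult[OF cl, symmetric] poly_op_add poly_op_const scalar_op_of_real)
  moreover have "inv_op (S \<odot> S + (Im z)\<^sup>2 *\<^sub>R id_blinfun)"
    by (rule inv_op_positive_shift[OF S b])
  ultimately have "inv_op (poly_op [:- z, 1:] A)"
    using poly_op_commute[OF cl] by (metis inv_op_factor)
  then show False using assms by (simp add: op_spectrum_iff)
qed

definition real_spectrum :: "('a::complex_hilbert \<Rightarrow>\<^sub>L 'a) \<Rightarrow> real set" where
  "real_spectrum A = {x. complex_of_real x \<in> op_spectrum A}"

lemma real_spectrum_positive:
  assumes "adjoint_pair D E"
  shows "real_spectrum (E \<odot> D) \<subseteq> {0..(norm D)\<^sup>2}"
proof
  fix x assume x: "x \<in> real_spectrum (E \<odot> D)"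
  let ?A = "E \<odot> D"
  have "adjoint_pair ?A ?A" using adjoint_pair_compose[OF adjoint_pair_sym[OF assms] assms] .
  then have lin: "poly_op [:- complex_of_real x, 1:] ?A = ?A + (- x) *\<^sub>R id_blinfun"
    using poly_op_linear[OF adjoint_pair_complex_linear, of ?A ?A "- complex_of_real x"]
    by (simp flip: of_real_minus add: scalar_op_of_real)
  have ninv: "\<not> inv_op (?A + (- x) *\<^sub>R id_blinfun)"
    using x by (simp add: real_spectrum_def op_spectrum_iff lin)
  have "norm ?A \<le> norm D * norm D"
    by (intro norm_compose_le adjoint_pair_norm_le[OF assms]) simp
  then have nA: "norm ?A \<le> (norm D)\<^sup>2" by (simp add: power2_eq_square)
  have "x \<ge> 0" using inv_op_positive_shift[OF assms, of "- x"] ninv by force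
  moreover have "x \<le> (norm D)\<^sup>2"
  proof (rule ccontr)
    assume "\<not> x \<le> (norm D)\<^sup>2"
    then have x1: "norm ?A < x" "x > 0" using nA norm_ge_zero[of ?A] by linarith+
    have "inv_op (id_blinfun - (1/x) *\<^sub>R ?A)"
      by (rule inv_op_near_id) (use x1 in simp)
    then have "inv_op ((- x) *\<^sub>R (id_blinfun - (1/x) *\<^sub>R ?A))"
      using x1 inv_op_scaleR[of _ "- x"] by simp
    moreover have "(- x) *\<^sub>R (id_blinfun - (1/x) *\<^sub>R ?A) = ?A + (- x) *\<^sub>R id_blinfun"
      using x1 by (simp add: scaleR_diff_right)
    ultimately show False using ninv by simp
  qed
  ultimately show "x \<in> {0..(norm D)\<^sup>2}" by simp
qed

text \<open>By the fundamental theorem of algebra \<open>q(A)\<close> is a product of factors \<open>A - z\<close> over the roots \<open>z\<close> of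
  \<open>q\<close> and of a scalar; if all of them are invertible then so is \<open>q(A)\<close>.\<close>

lemma not_inv_op_imp_root:
  assumes cl: "complex_linear A"
  shows "q \<noteq> 0 \<Longrightarrow> \<not> inv_op (poly_op q A) \<Longrightarrow> \<exists>z\<in>op_spectrum A. poly q z = 0"
proof (induction "degree q" arbitrary: q)
  case 0
  then obtain c where c: "q = [:c:]" by (metis degree_eq_zeroE)
  then have "c \<noteq> 0" using 0 by auto
  then have "inv_op (scalar_op c :: 'a \<Rightarrow>\<^sub>L 'a)" unfolding inv_op_def
    by (intro exI[of _ "scalar_op (1/c)"]) (auto intro!: blinfun_eqI simp: scaleC_scaleC)
  then show ?case using 0 c by (simp add: poly_op_const)
next
  case (Suc n)
  have "\<not> constant (poly q)" using Suc(2) by (simp add: constant_degree)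
  then obtain z where z: "poly q z = 0" using fundamental_theorem_of_algebra by blast
  then obtain r where r: "q = [:- z, 1:] * r" by (auto simp: poly_eq_0_iff_dvd)
  show ?case
  proof (cases "z \<in> op_spectrum A")
    case False
    have "poly_op q A = poly_op [:- z, 1:] A \<odot> poly_op r A" unfolding r by (rule poly_op_mult[OF cl])
    then have "\<not> inv_op (poly_op r A)"
      using Suc(4) False inv_op_compose[of "poly_op [:- z, 1:] A"] by (auto simp: op_spectrum_iff)
    moreover have "r \<noteq> 0" using Suc(3) r by auto
    moreover have "n = degree r" using Suc(2) \<open>r \<noteq> 0\<close>
      by (simp add: r degree_mult_eq del: mult_pCons_left)
    ultimately obtain w where "w \<in> op_spectrum A" "poly r w = 0" using Suc(1) by blast
    then show ?thesis by (auto simp: r)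
  qed (use z in auto)
qed

text \<open>This is where points of the spectrum come from. With \<open>l = \<parallel>P\<parallel>\<^sup>2\<close> one has
  \<open>\<parallel>P*P x - l x\<parallel>\<^sup>2 \<le> l (l \<parallel>x\<parallel>\<^sup>2 - \<parallel>P x\<parallel>\<^sup>2)\<close>, which is small for unit vectors at which \<open>P\<close> almost
  attains its norm. An inverse of norm below \<open>b\<close> would bound the left side from below by
  \<open>\<parallel>x\<parallel>\<^sup>2 / b\<^sup>2\<close> and so force \<open>\<parallel>P\<parallel>\<^sup>2 \<le> l - 1/(b\<^sup>2 l)\<close>.\<close>

lemma not_inv_op_norm:
  assumes "adjoint_pair P Q" "P \<noteq> 0"
  shows "\<not> inv_op (Q \<odot> P - (norm P)\<^sup>2 *\<^sub>R id_blinfun)"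
proof
  define l where "l = (norm P)\<^sup>2"
  have l: "l > 0" using assms by (simp add: l_def)
  assume "inv_op (Q \<odot> P - (norm P)\<^sup>2 *\<^sub>R id_blinfun)"
  then obtain B where B: "B \<odot> (Q \<odot> P - l *\<^sub>R id_blinfun) = id_blinfun" by (auto simp: inv_op_def l_def)
  \<comment> \<open>One more than the norm of the inverse, so that dividing by \<open>b\<close> is harmless.\<close>
  define b where "b = norm B + 1"
  have b: "b > 0" using norm_ge_zero[of B] unfolding b_def by linarith
  have "(norm (P x))\<^sup>2 \<le> (l - 1 / (b\<^sup>2 * l)) * (norm x)\<^sup>2" for x
  proof -
    have 1: "norm (Q (P x)) \<le> norm P * norm (P x)"
      using norm_blinfun[of Q "P x"] mult_right_mono[OF adjoint_pair_norm_le[OF assms(1)], of "norm (P x)"]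
      by simp
    have "(norm (Q (P x) - l *\<^sub>R x))\<^sup>2 = (norm (Q (P x)))\<^sup>2 - 2 * l * inner (Q (P x)) x + l\<^sup>2 * (norm x)\<^sup>2"
      by (simp add: norm_diff_scaleR_sq)
    moreover have "inner (Q (P x)) x = (norm (P x))\<^sup>2"
      using adjoint_pairD[OF adjoint_pair_sym[OF assms(1)], of "P x" x]
      by (simp add: inner_eq_Re_cinner cinner_self)
    moreover have "(norm (Q (P x)))\<^sup>2 \<le> l * (norm (P x))\<^sup>2"
      using power_mono[OF 1, of 2] by (simp add: l_def power_mult_distrib)
    ultimately have 2: "(norm (Q (P x) - l *\<^sub>R x))\<^sup>2 \<le> l\<^sup>2 * (norm x)\<^sup>2 - l * (norm (P x))\<^sup>2"
      by simp
    have "x = B (Q (P x) - l *\<^sub>R x)"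
      using arg_cong[OF B, of "\<lambda>Z. blinfun_apply Z x"] by (simp add: blinfun.bilinear_simps)
    then have "norm x \<le> norm B * norm (Q (P x) - l *\<^sub>R x)" by (metis norm_blinfun)
    also have "\<dots> \<le> b * norm (Q (P x) - l *\<^sub>R x)" by (intro mult_right_mono) (auto simp: b_def)
    finally have "norm x \<le> b * norm (Q (P x) - l *\<^sub>R x)" .
    from power_mono[OF this norm_ge_zero, of 2]
    have "(norm x)\<^sup>2 \<le> b\<^sup>2 * (norm (Q (P x) - l *\<^sub>R x))\<^sup>2" by (simp add: power_mult_distrib)
    also have "\<dots> \<le> b\<^sup>2 * (l\<^sup>2 * (norm x)\<^sup>2 - l * (norm (P x))\<^sup>2)" using 2 by (intro mult_left_mono) auto
    finally show ?thesis using b l by (simp add: field_simps power2_eq_square)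
  qed
  note * = this
  \<comment> \<open>The maximum with \<open>0\<close> keeps the square root meaningful.\<close>
  have "norm P \<le> sqrt (max 0 (l - 1 / (b\<^sup>2 * l)))"
  proof (rule norm_blinfun_bound)
    fix x
    have "(norm (P x))\<^sup>2 \<le> max 0 (l - 1 / (b\<^sup>2 * l)) * (norm x)\<^sup>2"
      by (rule order_trans[OF *]) (intro mult_right_mono, auto)
    then have "(norm (P x))\<^sup>2 \<le> (sqrt (max 0 (l - 1 / (b\<^sup>2 * l))) * norm x)\<^sup>2"
      by (simp add: power_mult_distrib)
    then show "norm (P x) \<le> sqrt (max 0 (l - 1 / (b\<^sup>2 * l))) * norm x"
      by (rule power2_le_imp_le) simp
  qed simp
  then have "(norm P)\<^sup>2 \<le> (sqrt (max 0 (l - 1 / (b\<^sup>2 * l))))\<^sup>2" by (intro power_mono) auto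
  then have "l \<le> max 0 (l - 1 / (b\<^sup>2 * l))" by (simp add: l_def)
  moreover have "1 / (b\<^sup>2 * l) > 0" using b l by simp
  ultimately show False using l by linarith
qed

lemma real_spectrum_nonempty:
  assumes sa: "adjoint_pair A A" and x0: "(x0::'a::complex_hilbert) \<noteq> 0"
  shows "real_spectrum (A :: 'a \<Rightarrow>\<^sub>L 'a) \<noteq> {}"
proof -
  note cl = adjoint_pair_complex_linear[OF sa]
  have "\<exists>z. z \<in> op_spectrum A"
  proof (cases "A = 0")
    case True
    have "\<not> inv_op (0 :: 'a \<Rightarrow>\<^sub>L 'a)"
    proof
      assume "inv_op (0 :: 'a \<Rightarrow>\<^sub>L 'a)"
      then have "id_blinfun = (0 :: 'a \<Rightarrow>\<^sub>L 'a)" by (auto simp: inv_op_def)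
      then show False using x0 by (metis blinfun_apply_id_blinfun id_apply zero_blinfun.rep_eq)
    qed
    then have "0 \<in> op_spectrum A" using True poly_op_X[OF cl] by (simp add: op_spectrum_iff)
    then show ?thesis by blast
  next
    case False
    \<comment> \<open>The roots of \<open>x\<^sup>2 - \<parallel>A\<parallel>\<^sup>2\<close> are \<open>\<plusminus>\<parallel>A\<parallel>\<close>, and one of them is in the spectrum.\<close>
    let ?q = "[:0,1:] * [:0,1:] - [:complex_of_real ((norm A)\<^sup>2):]"
    have "poly_op ?q A = A \<odot> A - (norm A)\<^sup>2 *\<^sub>R id_blinfun"
      by (simp only: poly_op_diff poly_op_mult[OF cl] poly_op_X[OF cl] poly_op_const scalar_op_of_real)
    moreover have "\<not> inv_op (A \<odot> A - (norm A)\<^sup>2 *\<^sub>R id_blinfun)" by (rule not_inv_op_norm[OF sa False])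
    moreover have "?q \<noteq> 0" by simp
    ultimately show ?thesis using not_inv_op_imp_root[OF cl, of ?q] by metis
  qed
  then obtain z where "z \<in> op_spectrum A" ..
  then have "Re z \<in> real_spectrum A" using spectrum_selfadjoint_real[OF sa] by (simp add: real_spectrum_def)
  then show ?thesis by blast
qed

text \<open>Let \<open>P = p(A)\<close>. The operator \<open>P*P - \<parallel>P\<parallel>\<^sup>2\<close> is not invertible, and it is \<open>q(A)\<close> for
  \<open>q = cnj p \<sqdot> p - \<parallel>P\<parallel>\<^sup>2\<close>. So \<open>q\<close> has a root in the spectrum, and at that root \<open>|p|\<close> takes the value
  \<open>\<parallel>P\<parallel>\<close>.\<close>

theorem norm_poly_op_le:
  assumes sa: "adjoint_pair A A" and C: "C \<ge> 0"
    and bound: "\<And>x. x \<in> real_spectrum A \<Longrightarrow> cmod (poly p (complex_of_real x)) \<le> C"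
  shows "norm (poly_op p A) \<le> C"
proof (rule ccontr)
  assume n: "\<not> norm (poly_op p A) \<le> C"
  note cl = adjoint_pair_complex_linear[OF sa]
  define P where "P = poly_op p A"
  have P0: "P \<noteq> 0" using n C by (auto simp: P_def)
  define l where "l = complex_of_real ((norm P)\<^sup>2)"
  define q where "q = map_poly cnj p * p - [:l:]"
  have "poly_op q A = poly_op (map_poly cnj p) A \<odot> P - (norm P)\<^sup>2 *\<^sub>R id_blinfun"
    by (simp only: q_def l_def poly_op_diff poly_op_mult[OF cl] poly_op_const scalar_op_of_real P_def)
  moreover have "\<not> inv_op (poly_op (map_poly cnj p) A \<odot> P - (norm P)\<^sup>2 *\<^sub>R id_blinfun)"
    unfolding P_def by (rule not_inv_op_norm[OF adjoint_pair_poly_op[OF sa]]) (use P0 in \<open>simp add: P_def\<close>)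
  ultimately have ni: "\<not> inv_op (poly_op q A)" by simp
  have "\<exists>z\<in>op_spectrum A. poly q z = 0"
  \<comment> \<open>If \<open>q\<close> vanishes identically then any point of the spectrum will do.\<close>
  proof (cases "q = 0")
    case True
    obtain x0 where "P x0 \<noteq> 0" using P0 by (metis blinfun_eqI zero_blinfun.rep_eq)
    then have "x0 \<noteq> 0" by auto
    then show ?thesis using real_spectrum_nonempty[OF sa] True by (auto simp: real_spectrum_def)
  qed (use not_inv_op_imp_root[OF cl _ ni] in auto)
  then obtain z where z: "z \<in> op_spectrum A" "poly q z = 0" by blast
  define x where "x = Re z"
  have zx: "z = complex_of_real x" unfolding x_def by (rule spectrum_selfadjoint_real[OF sa z(1)])
  have x: "x \<in> real_spectrum A" using z zx by (simp add: real_spectrum_def)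
  have "poly (map_poly cnj p) (complex_of_real x) = cnj (poly p (complex_of_real x))"
    using poly_map_poly_cnj by (metis complex_cnj_complex_of_real)
  then have "complex_of_real ((cmod (poly p (complex_of_real x)))\<^sup>2) = complex_of_real ((norm P)\<^sup>2)"
    using z(2) unfolding q_def l_def zx complex_norm_square by (simp add: mult.commute)
  then have "(cmod (poly p (complex_of_real x)))\<^sup>2 = (norm P)\<^sup>2" by (simp only: of_real_eq_iff)
  then have "cmod (poly p (complex_of_real x)) = norm P" by (simp add: power2_eq_iff_nonneg)
  then show False using bound[OF x] n by (simp add: P_def)
qed


section \<open>Continuous functional calculus\<close>

lemma complex_poly_approx:
  fixes \<phi> :: "real \<Rightarrow> complex"
  assumes "continuous_on {0..c} \<phi>" "e > 0"
  shows "\<exists>p. \<forall>x\<in>{0..c}. cmod (poly p (complex_of_real x) - \<phi> x) < e"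
proof -
  obtain g where g: "polynomial_function g" "\<And>x. x \<in> {0..c} \<Longrightarrow> norm (\<phi> x - g x) < e"
    using Stone_Weierstrass_polynomial_function[OF compact_Icc assms] by blast
  have "real_polynomial_function (Re \<circ> g)" "real_polynomial_function (Im \<circ> g)"
    using g(1) bounded_linear_Re bounded_linear_Im unfolding polynomial_function_def by blast+
  then obtain a n b m where ab: "Re \<circ> g = (\<lambda>x. \<Sum>i\<le>n. a i * x ^ i)" "Im \<circ> g = (\<lambda>x. \<Sum>i\<le>m. b i * x ^ i)"
    unfolding real_polynomial_function_iff_sum by blast
  define p where "p = (\<Sum>i\<le>(n::nat). monom (complex_of_real (a i)) i) + smult \<i> (\<Sum>i\<le>(m::nat). monom (complex_of_real (b i)) i)"
  have "poly p (complex_of_real x) = g x" for x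
  proof -
    have "poly p (complex_of_real x) = complex_of_real (\<Sum>i\<le>n. a i * x ^ i) + \<i> * complex_of_real (\<Sum>i\<le>m. b i * x ^ i)"
      by (simp add: p_def poly_sum poly_monom)
    also have "\<dots> = complex_of_real (Re (g x)) + \<i> * complex_of_real (Im (g x))"
      using fun_cong[OF ab(1), of x] fun_cong[OF ab(2), of x] by simp
    finally show ?thesis by (simp add: complex_eq[symmetric])
  qed
  then show ?thesis using g(2) by (intro exI[of _ p]) (auto simp: norm_minus_commute)
qed

text \<open>A fixed interval is used in place of the spectrum so that one continuity assumption serves for both
  \<open>T*T\<close> and \<open>TT*\<close>.\<close>

definition selfadjoint_in :: "real \<Rightarrow> ('a::complex_hilbert \<Rightarrow>\<^sub>L 'a) \<Rightarrow> bool" where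
  "selfadjoint_in c A \<longleftrightarrow> adjoint_pair A A \<and> real_spectrum A \<subseteq> {0..c}"

lemma selfadjoint_in_compose:
  assumes "adjoint_pair D E" "(norm D)\<^sup>2 \<le> c"
  shows "selfadjoint_in c (E \<odot> D)"
  using real_spectrum_positive[OF assms(1)] assms(2)
    adjoint_pair_compose[OF adjoint_pair_sym[OF assms(1)] assms(1)]
  by (force simp: selfadjoint_in_def)

lemma poly_op_tendsto_0:
  assumes sa: "adjoint_pair A A"
    and "uniform_limit (real_spectrum A) (\<lambda>n x. poly (p n) (complex_of_real x)) (\<lambda>_. 0) sequentially"
  shows "(\<lambda>n. poly_op (p n) A) \<longlonglongrightarrow> 0"
proof (rule metric_LIMSEQ_I)
  fix e :: real assume "e > 0"
  then obtain N where N: "\<And>n x. n \<ge> N \<Longrightarrow> x \<in> real_spectrum A \<Longrightarrow> cmod (poly (p n) (complex_of_real x)) < e/2"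
    using assms(2) unfolding uniform_limit_sequentially_iff dist_norm by (metis diff_zero half_gt_zero)
  have "norm (poly_op (p n) A) \<le> e/2" if "n \<ge> N" for n
    by (rule norm_poly_op_le[OF sa]) (use N[OF that] \<open>e > 0\<close> in \<open>auto intro: less_imp_le\<close>)
  then have "dist (poly_op (p n) A) 0 < e" if "n \<ge> N" for n
    using that \<open>e > 0\<close> by (force simp: dist_norm)
  then show "\<exists>N. \<forall>n\<ge>N. dist (poly_op (p n) A) 0 < e" by blast
qed

lemma uniform_limit_diff_0:
  assumes "uniform_limit S f (h :: 'x \<Rightarrow> 'y::real_normed_vector) F" "uniform_limit S g h F"
  shows "uniform_limit S (\<lambda>n x. f n x - g n x) (\<lambda>_. 0) F"
  using uniform_limit_minus[OF assms] by simp

lemma poly_op_same_limit: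
  assumes sa: "adjoint_pair A A"
    and p: "uniform_limit (real_spectrum A) (\<lambda>n x. poly (p n) (complex_of_real x)) \<phi> sequentially"
    and q: "uniform_limit (real_spectrum A) (\<lambda>n x. poly (q n) (complex_of_real x)) \<phi> sequentially"
    and B: "(\<lambda>n. poly_op (q n) A) \<longlonglongrightarrow> B"
  shows "(\<lambda>n. poly_op (p n) A) \<longlonglongrightarrow> B"
proof -
  have "(\<lambda>n. poly_op (p n - q n) A) \<longlonglongrightarrow> 0"
    by (rule poly_op_tendsto_0[OF sa]) (use uniform_limit_diff_0[OF p q] in simp)
  from tendsto_add[OF this B] show ?thesis by (simp add: poly_op_diff)
qed

lemma cfc_eqI_spectrum:
  assumes sa: "adjoint_pair A A"
    and q: "uniform_limit (real_spectrum A) (\<lambda>n x. poly (q n) (complex_of_real x)) \<phi> sequentially"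
    and B: "(\<lambda>n. poly_op (q n) A) \<longlonglongrightarrow> B"
  shows "cfc \<phi> A = B"
  unfolding cfc_def
proof (rule the_equality)
  show "\<forall>p. uniform_limit {x. complex_of_real x \<in> op_spectrum A}
      (\<lambda>n x. poly (p n) (complex_of_real x)) \<phi> sequentially \<longrightarrow> (\<lambda>n. poly_op (p n) A) \<longlonglongrightarrow> B"
    using poly_op_same_limit[OF sa _ q B] unfolding real_spectrum_def by blast
  fix B' assume "\<forall>p. uniform_limit {x. complex_of_real x \<in> op_spectrum A}
      (\<lambda>n x. poly (p n) (complex_of_real x)) \<phi> sequentially \<longrightarrow> (\<lambda>n. poly_op (p n) A) \<longlonglongrightarrow> B'"
  then have "(\<lambda>n. poly_op (q n) A) \<longlonglongrightarrow> B'" using q unfolding real_spectrum_def by blast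
  then show "B' = B" using B LIMSEQ_unique by blast
qed

lemma cfc_eqI:
  assumes "selfadjoint_in c A"
    and "uniform_limit {0..c} (\<lambda>n x. poly (q n) (complex_of_real x)) \<phi> sequentially"
    and "(\<lambda>n. poly_op (q n) A) \<longlonglongrightarrow> B"
  shows "cfc \<phi> A = B"
  using assms uniform_limit_on_subset unfolding selfadjoint_in_def by (blast intro: cfc_eqI_spectrum)

text \<open>Weierstrass approximation gives the polynomials, and \<open>norm_poly_op_le\<close> makes the operators \<open>p\<^sub>n(A)\<close> a
  Cauchy sequence.\<close>

lemma cfc_approx:
  assumes A: "selfadjoint_in c A" and \<phi>: "continuous_on {0..c} \<phi>"
  obtains p where "uniform_limit {0..c} (\<lambda>n x. poly (p n) (complex_of_real x)) \<phi> sequentially"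
    "(\<lambda>n. poly_op (p n) A) \<longlonglongrightarrow> cfc \<phi> A"
proof -
  have sa: "adjoint_pair A A" using A by (simp add: selfadjoint_in_def)
  have "\<forall>n. \<exists>p. \<forall>x\<in>{0..c}. cmod (poly p (complex_of_real x) - \<phi> x) < 1 / real (Suc n)"
    using complex_poly_approx[OF \<phi>] by simp
  from choice[OF this] obtain p
    where p: "\<And>n x. x \<in> {0..c} \<Longrightarrow> cmod (poly (p n) (complex_of_real x) - \<phi> x) < 1 / real (Suc n)"
    by blast
  have lim: "uniform_limit {0..c} (\<lambda>n x. poly (p n) (complex_of_real x)) \<phi> sequentially"
    unfolding uniform_limit_sequentially_iff dist_norm
  proof (intro allI impI)
    fix e :: real assume "e > 0"
    then obtain N where N: "1 / real (Suc N) < e" using reals_Archimedean[of e] by (auto simp: inverse_eq_divide)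
    have "cmod (poly (p n) (complex_of_real x) - \<phi> x) < e" if "n \<ge> N" "x \<in> {0..c}" for n x
    proof -
      have "1 / real (Suc n) \<le> 1 / real (Suc N)" using that by (intro divide_left_mono) auto
      then show ?thesis using p[OF that(2), of n] N by linarith
    qed
    then show "\<exists>N. \<forall>n\<ge>N. \<forall>x\<in>{0..c}. cmod (poly (p n) (complex_of_real x) - \<phi> x) < e" by blast
  qed
  have "Cauchy (\<lambda>n. poly_op (p n) A)"
  proof (rule CauchyI)
    fix e :: real assume e: "e > 0"
    then obtain N where N: "1 / real (Suc N) < e/4"
      using reals_Archimedean[of "e/4"] by (auto simp: inverse_eq_divide)
    have "norm (poly_op (p m) A - poly_op (p n) A) < e" if "m \<ge> N" "n \<ge> N" for m n
    proof -
      have "norm (poly_op (p m - p n) A) \<le> e/2"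
      proof (rule norm_poly_op_le[OF sa])
        fix x assume "x \<in> real_spectrum A"
        then have x: "x \<in> {0..c}" using A by (auto simp: selfadjoint_in_def)
        have "1 / real (Suc n) \<le> 1 / real (Suc N)" "1 / real (Suc m) \<le> 1 / real (Suc N)"
          using that by (intro divide_left_mono; simp)+
        then have "cmod (poly (p m) (complex_of_real x) - \<phi> x) < e/4"
          "cmod (poly (p n) (complex_of_real x) - \<phi> x) < e/4"
          using p[OF x, of m] p[OF x, of n] N by linarith+
        moreover have "cmod (poly (p m) (complex_of_real x) - poly (p n) (complex_of_real x)) \<le>
            cmod (poly (p m) (complex_of_real x) - \<phi> x) + cmod (poly (p n) (complex_of_real x) - \<phi> x)"
          by (rule norm_diff_triangle_le[OF order_refl]) (simp add: norm_minus_commute)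
        ultimately show "cmod (poly (p m - p n) (complex_of_real x)) \<le> e/2" by simp
      qed (use e in simp)
      then show ?thesis using e by (simp add: poly_op_diff)
    qed
    then show "\<exists>M. \<forall>m\<ge>M. \<forall>n\<ge>M. norm (poly_op (p m) A - poly_op (p n) A) < e" by blast
  qed
  then obtain B where B: "(\<lambda>n. poly_op (p n) A) \<longlonglongrightarrow> B" by (auto simp: Cauchy_convergent_iff convergent_def)
  then show ?thesis using that[OF lim] cfc_eqI[OF A lim B] by simp
qed

lemma cfc_cong:
  assumes A: "selfadjoint_in c A" and \<phi>: "continuous_on {0..c} \<phi>"
    and eq: "\<And>x. x \<in> {0..c} \<Longrightarrow> \<phi> x = \<psi> x"
  shows "cfc \<psi> A = cfc \<phi> A"
proof -
  obtain p where p: "uniform_limit {0..c} (\<lambda>n x. poly (p n) (complex_of_real x)) \<phi> sequentially"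
    "(\<lambda>n. poly_op (p n) A) \<longlonglongrightarrow> cfc \<phi> A" using cfc_approx[OF A \<phi>] .
  have "uniform_limit {0..c} (\<lambda>n x. poly (p n) (complex_of_real x)) \<psi> sequentially"
    using p(1) eq by (simp add: uniform_limit_sequentially_iff)
  then show ?thesis using p(2) by (rule cfc_eqI[OF A])
qed

lemma cfc_poly:
  assumes A: "selfadjoint_in c A"
  shows "cfc (\<lambda>x. poly p (complex_of_real x)) A = poly_op p A"
  by (rule cfc_eqI[OF A, of "\<lambda>_. p"]) (auto simp: uniform_limit_sequentially_iff)

lemma cfc_const: "selfadjoint_in c A \<Longrightarrow> cfc (\<lambda>x. k) A = scalar_op k"
  using cfc_poly[of c A "[:k:]"] by (simp add: poly_op_const)

lemma cfc_add:
  assumes A: "selfadjoint_in c A" and \<phi>: "continuous_on {0..c} \<phi>" and \<psi>: "continuous_on {0..c} \<psi>"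
  shows "cfc (\<lambda>x. \<phi> x + \<psi> x) A = cfc \<phi> A + cfc \<psi> A"
proof -
  obtain p where p: "uniform_limit {0..c} (\<lambda>n x. poly (p n) (complex_of_real x)) \<phi> sequentially"
    "(\<lambda>n. poly_op (p n) A) \<longlonglongrightarrow> cfc \<phi> A" using cfc_approx[OF A \<phi>] .
  obtain q where q: "uniform_limit {0..c} (\<lambda>n x. poly (q n) (complex_of_real x)) \<psi> sequentially"
    "(\<lambda>n. poly_op (q n) A) \<longlonglongrightarrow> cfc \<psi> A" using cfc_approx[OF A \<psi>] .
  show ?thesis
    by (rule cfc_eqI[OF A, of "\<lambda>n. p n + q n"])
      (use uniform_limit_add[OF p(1) q(1)] tendsto_add[OF p(2) q(2)] in \<open>auto simp: poly_op_add\<close>)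
qed

lemma cfc_mult:
  assumes A: "selfadjoint_in c A" and \<phi>: "continuous_on {0..c} \<phi>" and \<psi>: "continuous_on {0..c} \<psi>"
  shows "cfc (\<lambda>x. \<phi> x * \<psi> x) A = cfc \<phi> A \<odot> cfc \<psi> A"
proof -
  have cl: "complex_linear A" using A adjoint_pair_complex_linear by (auto simp: selfadjoint_in_def)
  obtain p where p: "uniform_limit {0..c} (\<lambda>n x. poly (p n) (complex_of_real x)) \<phi> sequentially"
    "(\<lambda>n. poly_op (p n) A) \<longlonglongrightarrow> cfc \<phi> A" using cfc_approx[OF A \<phi>] .
  obtain q where q: "uniform_limit {0..c} (\<lambda>n x. poly (q n) (complex_of_real x)) \<psi> sequentially"
    "(\<lambda>n. poly_op (q n) A) \<longlonglongrightarrow> cfc \<psi> A" using cfc_approx[OF A \<psi>] .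
  have "bounded (\<phi> ` {0..c})" "bounded (\<psi> ` {0..c})"
    by (intro compact_imp_bounded compact_continuous_image \<phi> \<psi> compact_Icc)+
  then have "uniform_limit {0..c} (\<lambda>n x. poly (p n) (complex_of_real x) * poly (q n) (complex_of_real x))
      (\<lambda>x. \<phi> x * \<psi> x) sequentially"
    by (intro uniform_lim_mult p q)
  then show ?thesis
    by (intro cfc_eqI[OF A, of "\<lambda>n. p n * q n"])
      (auto simp: poly_op_mult[OF cl] intro!: bounded_bilinear.tendsto[OF bounded_bilinear_blinfun_compose] p q)
qed

lemma cfc_cmult:
  assumes A: "selfadjoint_in c A" and \<phi>: "continuous_on {0..c} \<phi>"
  shows "cfc (\<lambda>x. k * \<phi> x) A = scalar_op k \<odot> cfc \<phi> A"
  by (subst cfc_mult[OF A _ \<phi>]) (auto simp: cfc_const[OF A])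

lemma cfc_diff:
  assumes A: "selfadjoint_in c A" and \<phi>: "continuous_on {0..c} \<phi>" and \<psi>: "continuous_on {0..c} \<psi>"
  shows "cfc (\<lambda>x. \<phi> x - \<psi> x) A = cfc \<phi> A - cfc \<psi> A"
proof -
  have "cfc (\<lambda>x. (\<phi> x - \<psi> x) + \<psi> x) A = cfc (\<lambda>x. \<phi> x - \<psi> x) A + cfc \<psi> A"
    by (intro cfc_add[OF A] continuous_intros \<phi> \<psi>)
  then show ?thesis by simp
qed

lemma cfc_sum:
  assumes A: "selfadjoint_in c A" and "finite I" and "\<And>i. i \<in> I \<Longrightarrow> continuous_on {0..c} (\<phi> i)"
  shows "cfc (\<lambda>x. \<Sum>i\<in>I. \<phi> i x) A = (\<Sum>i\<in>I. cfc (\<phi> i) A)"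
  using assms(2,3)
proof (induction I)
  case empty
  then show ?case using cfc_const[OF A, of 0] by (auto intro!: blinfun_eqI)
next
  case (insert i I)
  then show ?case by (auto intro!: cfc_add[OF A, THEN trans] continuous_intros)
qed

lemma cfc_power:
  assumes A: "selfadjoint_in c A" and \<phi>: "continuous_on {0..c} \<phi>"
  shows "cfc (\<lambda>x. \<phi> x ^ n) A = opow (cfc \<phi> A) n"
proof (induction n)
  case 0
  then show ?case using cfc_const[OF A, of 1] by (simp add: scalar_op_1)
next
  case (Suc n)
  have "cfc (\<lambda>x. \<phi> x * \<phi> x ^ n) A = cfc \<phi> A \<odot> cfc (\<lambda>x. \<phi> x ^ n) A"
    by (intro cfc_mult[OF A] continuous_intros \<phi>)
  then show ?case by (simp add: Suc)
qed

lemma adjoint_pair_cfc: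
  assumes A: "selfadjoint_in c A" and \<phi>: "continuous_on {0..c} \<phi>"
  shows "adjoint_pair (cfc \<phi> A) (cfc (\<lambda>x. cnj (\<phi> x)) A)"
proof -
  have sa: "adjoint_pair A A" using A by (simp add: selfadjoint_in_def)
  obtain p where p: "uniform_limit {0..c} (\<lambda>n x. poly (p n) (complex_of_real x)) \<phi> sequentially"
    "(\<lambda>n. poly_op (p n) A) \<longlonglongrightarrow> cfc \<phi> A" using cfc_approx[OF A \<phi>] .
  have q: "uniform_limit {0..c} (\<lambda>n x. poly (map_poly cnj (p n)) (complex_of_real x)) (\<lambda>x. cnj (\<phi> x)) sequentially"
    using p(1) by (simp add: uniform_limit_sequentially_iff dist_norm flip: complex_cnj_diff)
  have c: "continuous_on {0..c} (\<lambda>x. cnj (\<phi> x))" by (intro continuous_intros \<phi>)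
  obtain r where r: "uniform_limit {0..c} (\<lambda>n x. poly (r n) (complex_of_real x)) (\<lambda>x. cnj (\<phi> x)) sequentially"
    "(\<lambda>n. poly_op (r n) A) \<longlonglongrightarrow> cfc (\<lambda>x. cnj (\<phi> x)) A" using cfc_approx[OF A c] .
  have "(\<lambda>n. poly_op (map_poly cnj (p n)) A) \<longlonglongrightarrow> cfc (\<lambda>x. cnj (\<phi> x)) A"
    using A by (intro poly_op_same_limit[OF sa uniform_limit_on_subset[OF q] uniform_limit_on_subset[OF r(1)] r(2)])
      (auto simp: selfadjoint_in_def)
  then show ?thesis using p(2) adjoint_pair_poly_op[OF sa] by (blast intro: adjoint_pair_LIMSEQ)
qed

lemma norm_cfc_le:
  assumes A: "selfadjoint_in c A" and \<phi>: "continuous_on {0..c} \<phi>" and C: "C \<ge> 0"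
    and bound: "\<And>x. x \<in> {0..c} \<Longrightarrow> cmod (\<phi> x) \<le> C"
  shows "norm (cfc \<phi> A) \<le> C"
proof (rule field_le_epsilon)
  fix e :: real assume e: "e > 0"
  have sa: "adjoint_pair A A" using A by (simp add: selfadjoint_in_def)
  obtain p where p: "uniform_limit {0..c} (\<lambda>n x. poly (p n) (complex_of_real x)) \<phi> sequentially"
    "(\<lambda>n. poly_op (p n) A) \<longlonglongrightarrow> cfc \<phi> A" using cfc_approx[OF A \<phi>] .
  obtain N where N: "\<And>n x. n \<ge> N \<Longrightarrow> x \<in> {0..c} \<Longrightarrow> cmod (poly (p n) (complex_of_real x) - \<phi> x) < e"
    using p(1) e unfolding uniform_limit_sequentially_iff dist_norm by blast
  have "norm (poly_op (p n) A) \<le> C + e" if "n \<ge> N" for n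
  proof (rule norm_poly_op_le[OF sa])
    fix x assume "x \<in> real_spectrum A"
    then have x: "x \<in> {0..c}" using A by (auto simp: selfadjoint_in_def)
    show "cmod (poly (p n) (complex_of_real x)) \<le> C + e"
      using N[OF that x] bound[OF x] norm_triangle_ineq[of "poly (p n) (complex_of_real x) - \<phi> x" "\<phi> x"] by simp
  qed (use C e in simp)
  then show "norm (cfc \<phi> A) \<le> C + e"
    by (intro Lim_bounded[OF tendsto_norm[OF p(2)]]) auto
qed

lemma cfc_uniform_limit:
  assumes A: "selfadjoint_in c A" and \<phi>: "\<And>n. continuous_on {0..c} (\<phi> n)"
    and lim: "uniform_limit {0..c} \<phi> \<psi> sequentially"
  shows "(\<lambda>n. cfc (\<phi> n) A) \<longlonglongrightarrow> cfc \<psi> A"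
proof (rule LIMSEQ_I)
  fix e :: real assume e: "e > 0"
  have \<psi>: "continuous_on {0..c} \<psi>"
    by (rule uniform_limit_theorem[OF _ lim]) (auto simp: \<phi>)
  obtain N where N: "\<And>n x. n \<ge> N \<Longrightarrow> x \<in> {0..c} \<Longrightarrow> cmod (\<phi> n x - \<psi> x) < e/2"
    using lim half_gt_zero[OF e] unfolding uniform_limit_sequentially_iff dist_norm by blast
  have "norm (cfc (\<phi> n) A - cfc \<psi> A) < e" if "n \<ge> N" for n
  proof -
    have "norm (cfc (\<lambda>x. \<phi> n x - \<psi> x) A) \<le> e/2"
      by (rule norm_cfc_le[OF A]) (use N[OF that] e in \<open>auto intro!: continuous_intros \<phi> \<psi> less_imp_le\<close>)
    then show ?thesis using e by (simp add: cfc_diff[OF A \<phi> \<psi>])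
  qed
  then show "\<exists>no. \<forall>n\<ge>no. norm (cfc (\<phi> n) A - cfc \<psi> A) < e" by blast
qed


section \<open>Trace norm bounds\<close>

text \<open>Finite orthonormal families are the main example. The wider class is used because it is stable under
  every contraction that has an adjoint, which makes the ideal property of the trace norm immediate.\<close>

definition bessel_family :: "nat \<Rightarrow> (nat \<Rightarrow> 'a::complex_hilbert) \<Rightarrow> bool" where
  "bessel_family d a \<longleftrightarrow> (\<forall>x. (\<Sum>i<d. (cmod (cinner x (a i)))\<^sup>2) \<le> (norm x)\<^sup>2)"

text \<open>The trace norm of \<open>X\<close> is at most \<open>C\<close> if this holds for every \<open>d\<close>. The length \<open>d\<close> of the families is a
  parameter because error terms that are small in operator norm only have trace bounds proportional to
  \<open>d\<close>; they are made to vanish before \<open>d\<close> is varied.\<close>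

definition trace_bound :: "nat \<Rightarrow> ('a::complex_hilbert \<Rightarrow>\<^sub>L 'a) \<Rightarrow> real \<Rightarrow> bool" where
  "trace_bound d X C \<longleftrightarrow> (\<forall>a b. bessel_family d a \<longrightarrow> bessel_family d b \<longrightarrow>
     (\<Sum>i<d. cmod (cinner (X (a i)) (b i))) \<le> C)"

lemma trace_boundI:
  "(\<And>a b. bessel_family d a \<Longrightarrow> bessel_family d b \<Longrightarrow> (\<Sum>i<d. cmod (cinner (blinfun_apply X (a i)) (b i))) \<le> C) \<Longrightarrow>
   trace_bound d X C"
  by (simp add: trace_bound_def)

lemma trace_boundD:
  "trace_bound d X C \<Longrightarrow> bessel_family d a \<Longrightarrow> bessel_family d b \<Longrightarrow> (\<Sum>i<d. cmod (cinner (blinfun_apply X (a i)) (b i))) \<le> C"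
  by (simp add: trace_bound_def)

lemma bessel_family_norm_le:
  assumes "bessel_family d a" "i < d"
  shows "norm (a i) \<le> 1"
proof -
  have "(cmod (cinner (a i) (a i)))\<^sup>2 \<le> (\<Sum>j<d. (cmod (cinner (a i) (a j)))\<^sup>2)"
    using assms by (intro member_le_sum) auto
  also have "\<dots> \<le> (norm (a i))\<^sup>2" using assms(1) by (simp add: bessel_family_def)
  finally have "((norm (a i))\<^sup>2)\<^sup>2 \<le> (norm (a i))\<^sup>2" by (simp add: cinner_self norm_power)
  then have le: "(norm (a i))\<^sup>2 * (norm (a i))\<^sup>2 \<le> (norm (a i))\<^sup>2 * 1"
    by (simp only: power2_eq_square[of "(norm (a i))\<^sup>2"] mult_1_right)
  show ?thesis
  proof (rule ccontr)
    assume "\<not> norm (a i) \<le> 1"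
    then have "1 < (norm (a i))\<^sup>2" by (simp add: one_less_power)
    then show False using le by (simp only: mult_le_cancel_left) auto
  qed
qed

lemma bessel_family_apply:
  assumes "bessel_family d a" "adjoint_pair A B" "norm A \<le> r" "r > 0"
  shows "bessel_family d (\<lambda>i. (1/r) *\<^sub>R A (a i))"
  unfolding bessel_family_def
proof
  fix x
  have "(\<Sum>i<d. (cmod (cinner x ((1/r) *\<^sub>R A (a i))))\<^sup>2) = (\<Sum>i<d. (cmod (cinner ((1/r) *\<^sub>R B x) (a i)))\<^sup>2)"
    by (simp add: cinner_scaleR_left cinner_scaleR_right adjoint_pairD[OF adjoint_pair_sym[OF assms(2)]])
  also have "\<dots> \<le> (norm ((1/r) *\<^sub>R B x))\<^sup>2"
    using assms(1) unfolding bessel_family_def by blast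
  also have "norm ((1/r) *\<^sub>R B x) \<le> norm x"
  proof -
    have "norm (B x) \<le> norm B * norm x" by (rule norm_blinfun)
    also have "\<dots> \<le> r * norm x"
      using adjoint_pair_norm_le[OF assms(2)] assms(3) by (intro mult_right_mono) auto
    finally show ?thesis using assms(4) by (simp add: field_simps)
  qed
  then have "(norm ((1/r) *\<^sub>R B x))\<^sup>2 \<le> (norm x)\<^sup>2" by (intro power_mono) auto
  finally show "(\<Sum>i<d. (cmod (cinner x ((1/r) *\<^sub>R A (a i))))\<^sup>2) \<le> (norm x)\<^sup>2" .
qed

lemma bessel_family_orthonormal:
  assumes "bij_betw a {..<d} F" "orthonormal F"
  shows "bessel_family d a"
  unfolding bessel_family_def
proof
  fix x
  have F: "finite F" using assms(1) bij_betw_finite by blast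
  have "(\<Sum>i<d. (cmod (cinner x (a i)))\<^sup>2) = (\<Sum>e\<in>F. (cmod (cinner x e))\<^sup>2)"
    by (rule sum.reindex_bij_betw[OF assms(1)])
  then show "(\<Sum>i<d. (cmod (cinner x (a i)))\<^sup>2) \<le> (norm x)\<^sup>2"
    using bessel_finite[OF F assms(2)] by simp
qed

lemma bessel_family_mult:
  assumes "bessel_family d a" "bessel_family d b"
  shows "(\<Sum>i<d. cmod (cinner x (a i)) * cmod (cinner y (b i))) \<le> norm x * norm y"
proof -
  have "(\<Sum>i<d. cmod (cinner x (a i)) * cmod (cinner y (b i))) \<le>
      L2_set (\<lambda>i. cmod (cinner x (a i))) {..<d} * L2_set (\<lambda>i. cmod (cinner y (b i))) {..<d}"
    using L2_set_mult_ineq[of "\<lambda>i. cmod (cinner x (a i))" "\<lambda>i. cmod (cinner y (b i))" "{..<d}"] by simp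
  also have "\<dots> \<le> norm x * norm y"
  proof (intro mult_mono)
    show "L2_set (\<lambda>i. cmod (cinner x (a i))) {..<d} \<le> norm x"
      "L2_set (\<lambda>i. cmod (cinner y (b i))) {..<d} \<le> norm y"
      using assms by (auto simp: L2_set_def bessel_family_def intro!: real_le_lsqrt sum_nonneg)
  qed auto
  finally show ?thesis .
qed

lemma trace_bound_mono: "trace_bound d X C \<Longrightarrow> C \<le> C' \<Longrightarrow> trace_bound d X C'"
  unfolding trace_bound_def by (meson order_trans)

lemma trace_bound_zero: "trace_bound d 0 0"
  by (simp add: trace_bound_def)

lemma trace_bound_add:
  assumes "trace_bound d X C" "trace_bound d Y C'"
  shows "trace_bound d (X + Y) (C + C')"
proof (rule trace_boundI)
  fix a b :: "nat \<Rightarrow> 'a" assume ab: "bessel_family d a" "bessel_family d b"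
  have "(\<Sum>i<d. cmod (cinner ((X + Y) (a i)) (b i))) \<le>
      (\<Sum>i<d. cmod (cinner (X (a i)) (b i)) + cmod (cinner (Y (a i)) (b i)))"
    by (intro sum_mono) (simp add: blinfun.add_left cinner.add_left norm_triangle_ineq)
  also have "\<dots> \<le> C + C'"
    unfolding sum.distrib by (intro add_mono trace_boundD[OF assms(1)] trace_boundD[OF assms(2)] ab)
  finally show "(\<Sum>i<d. cmod (cinner ((X + Y) (a i)) (b i))) \<le> C + C'" .
qed

lemma trace_bound_scalar_op:
  assumes "trace_bound d X C"
  shows "trace_bound d (scalar_op k \<odot> X) (cmod k * C)"
  using assms by (auto simp: trace_bound_def cinner_scaleC_left norm_mult sum_distrib_left[symmetric]
      intro!: mult_left_mono)

lemma trace_bound_minus: "trace_bound d X C \<Longrightarrow> trace_bound d (- X) C"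
  by (simp add: trace_bound_def blinfun.minus_left cinner.minus_left)

lemma trace_bound_diff:
  "trace_bound d X C \<Longrightarrow> trace_bound d Y C' \<Longrightarrow> trace_bound d (X - Y) (C + C')"
  using trace_bound_add[OF _ trace_bound_minus, of d X C Y C'] by simp

lemma trace_bound_sum:
  assumes "finite I" "\<And>i. i \<in> I \<Longrightarrow> trace_bound d (X i) (C i)"
  shows "trace_bound d (\<Sum>i\<in>I. X i) (\<Sum>i\<in>I. C i)"
  using assms by (induction I) (auto intro: trace_bound_zero trace_bound_add)

lemma trace_bound_norm:
  assumes "norm X \<le> r"
  shows "trace_bound d X (real d * r)"
proof (rule trace_boundI)
  fix a b :: "nat \<Rightarrow> 'a" assume ab: "bessel_family d a" "bessel_family d b"
  have r: "r \<ge> 0" using assms norm_ge_zero order_trans by blast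
  have "cmod (cinner (X (a i)) (b i)) \<le> r" if "i < d" for i
  proof -
    have "cmod (cinner (X (a i)) (b i)) \<le> norm (X (a i)) * norm (b i)" by (rule cinner_norm_le)
    also have "\<dots> \<le> (norm X * norm (a i)) * norm (b i)" by (intro mult_right_mono norm_blinfun) auto
    also have "\<dots> \<le> (r * 1) * 1"
      using bessel_family_norm_le[OF ab(1) that] bessel_family_norm_le[OF ab(2) that] assms r
      by (intro mult_mono) auto
    finally show ?thesis by simp
  qed
  then show "(\<Sum>i<d. cmod (cinner (X (a i)) (b i))) \<le> real d * r"
    using sum_bounded_above[of "{..<d}" "\<lambda>i. cmod (cinner (X (a i)) (b i))" r] by simp
qed

lemma trace_bound_nonneg: "trace_bound d X C \<Longrightarrow> C \<ge> 0"
  using trace_boundD[of d X C "\<lambda>_. 0" "\<lambda>_. 0"] by (simp add: bessel_family_def)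

text \<open>The factor \<open>A\<close> moves to the second family as \<open>A*/r\<close>, which keeps it a Bessel family.\<close>

lemma trace_bound_compose_left:
  assumes X: "trace_bound d X C" and A: "adjoint_pair A A'" "norm A \<le> r"
  shows "trace_bound d (A \<odot> X) (r * C)"
proof (cases "r > 0")
  case True
  have nA': "norm A' \<le> r" using adjoint_pair_norm_le[OF A(1)] A(2) by simp
  show ?thesis
  proof (rule trace_boundI)
    fix a b :: "nat \<Rightarrow> 'a" assume ab: "bessel_family d a" "bessel_family d b"
    have "(\<Sum>i<d. cmod (cinner ((A \<odot> X) (a i)) (b i))) =
        r * (\<Sum>i<d. cmod (cinner (X (a i)) ((1/r) *\<^sub>R A' (b i))))"
      using True by (simp add: sum_distrib_left adjoint_pairD[OF A(1)] cinner_scaleR_right)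
    also have "\<dots> \<le> r * C"
      using True by (intro mult_left_mono trace_boundD[OF X] ab(1)
          bessel_family_apply[OF ab(2) adjoint_pair_sym[OF A(1)] nA']) auto
    finally show "(\<Sum>i<d. cmod (cinner ((A \<odot> X) (a i)) (b i))) \<le> r * C" .
  qed
next
  case False
  then have "norm A = 0" "r = 0" using A(2) norm_ge_zero[of A] by linarith+
  then show ?thesis by (simp add: trace_bound_zero trace_bound_def)
qed

lemma trace_bound_compose_right:
  assumes X: "trace_bound d X C" and A: "adjoint_pair A A'" "norm A \<le> r"
  shows "trace_bound d (X \<odot> A) (r * C)"
proof (cases "r > 0")
  case True
  show ?thesis
  proof (rule trace_boundI)
    fix a b :: "nat \<Rightarrow> 'a" assume ab: "bessel_family d a" "bessel_family d b"
    have "(\<Sum>i<d. cmod (cinner ((X \<odot> A) (a i)) (b i))) =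
        r * (\<Sum>i<d. cmod (cinner (X ((1/r) *\<^sub>R A (a i))) (b i)))"
      using True by (simp add: sum_distrib_left blinfun.scaleR_right cinner_scaleR_left)
    also have "\<dots> \<le> r * C"
      using True by (intro mult_left_mono trace_boundD[OF X] ab(2) bessel_family_apply[OF ab(1) A]) auto
    finally show "(\<Sum>i<d. cmod (cinner ((X \<odot> A) (a i)) (b i))) \<le> r * C" .
  qed
next
  case False
  then have "norm A = 0" "r = 0" using A(2) norm_ge_zero[of A] by linarith+
  then show ?thesis by (simp add: trace_bound_zero trace_bound_def)
qed

lemma trace_bound_LIMSEQ:
  assumes "X \<longlonglongrightarrow> Y" "C \<longlonglongrightarrow> D" "\<forall>\<^sub>F n in sequentially. trace_bound d (X n) (C n)"
  shows "trace_bound d Y D"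
proof (rule trace_boundI)
  fix a b :: "nat \<Rightarrow> 'a" assume ab: "bessel_family d a" "bessel_family d b"
  have "(\<lambda>n. \<Sum>i<d. cmod (cinner (X n (a i)) (b i))) \<longlonglongrightarrow> (\<Sum>i<d. cmod (cinner (Y (a i)) (b i)))"
    by (intro tendsto_sum tendsto_norm cinner.tendsto blinfun.tendsto tendsto_const assms)
  moreover have "\<forall>\<^sub>F n in sequentially. (\<Sum>i<d. cmod (cinner (X n (a i)) (b i))) \<le> C n"
    using assms(3) by eventually_elim (intro trace_boundD ab)
  ultimately show "(\<Sum>i<d. cmod (cinner (Y (a i)) (b i))) \<le> D"
    using assms(2) by (intro tendsto_le[OF sequentially_bot])
qed

text \<open>The telescoping sum \<open>A\<^sup>n - B\<^sup>n = \<Sum>\<^sub>j A\<^sup>j (A - B) B\<^sup>n\<^sup>-\<^sup>1\<^sup>-\<^sup>j\<close>, estimated term by term.\<close>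

lemma trace_bound_opow_diff:
  assumes K: "trace_bound d (A - B) \<kappa>" and A: "adjoint_pair A A'" "norm A \<le> c"
    and B: "adjoint_pair B B'" "norm B \<le> c"
  shows "trace_bound d (opow A n - opow B n) (real n * c ^ (n - 1) * \<kappa>)"
proof (induction n)
  case 0
  then show ?case by (simp add: trace_bound_zero)
next
  case (Suc n)
  have "trace_bound d (A \<odot> (opow A n - opow B n) + (A - B) \<odot> opow B n)
      (c * (real n * c ^ (n - 1) * \<kappa>) + c ^ n * \<kappa>)"
    by (intro trace_bound_add trace_bound_compose_left[OF Suc A]
        trace_bound_compose_right[OF K adjoint_pair_opow[OF B(1)] norm_opow[OF B(2)]])
  moreover have "c * (real n * c ^ (n - 1) * \<kappa>) + c ^ n * \<kappa> = real (Suc n) * c ^ (Suc n - 1) * \<kappa>"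
    by (cases n) (auto simp: algebra_simps)
  ultimately show ?case by (simp only: opow_diff)
qed


section \<open>Exponentials\<close>

lemma cis_minus_one_le: "cmod (cis t - 1 - \<i> * complex_of_real t) \<le> t\<^sup>2"
proof -
  have "cmod (cis t - (\<Sum>k\<le>1. (\<i> * t)^k / fact k)) \<le> \<bar>t\<bar>^(Suc 1) / fact (Suc 1)"
    using iexp_approx1[of t 1] by (simp add: cis_conv_exp)
  then have "cmod (cis t - 1 - \<i> * complex_of_real t) \<le> t\<^sup>2 / 2"
    by (simp add: power2_eq_square diff_diff_eq)
  then show ?thesis using zero_le_power2[of t] by linarith
qed

lemma continuous_on_cis_mult: "continuous_on S (\<lambda>x. cis (x * y))"
  by (intro continuous_intros)

lemma cfc_id:
  assumes A: "selfadjoint_in c A" shows "cfc complex_of_real A = A"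
proof -
  have "complex_linear A" using A adjoint_pair_complex_linear by (auto simp: selfadjoint_in_def)
  then show ?thesis using cfc_poly[OF A, of "[:0,1:]"] by (simp add: poly_op_X)
qed

lemma norm_cfc_cis_remainder:
  assumes A: "selfadjoint_in c A"
  shows "norm (cfc (\<lambda>x. cis (x * s)) A - scalar_op 1 - scalar_op (\<i> * complex_of_real s) \<odot> A) \<le> (c * s)\<^sup>2"
proof -
  have 1: "cfc (\<lambda>x. \<i> * complex_of_real s * complex_of_real x) A = scalar_op (\<i> * complex_of_real s) \<odot> A"
    using cfc_cmult[OF A, of complex_of_real "\<i> * complex_of_real s"]
    by (simp add: cfc_id[OF A] continuous_on_of_real_id)
  have 2: "cfc (\<lambda>x. cis (x * s) - 1) A = cfc (\<lambda>x. cis (x * s)) A - scalar_op 1"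
    using cfc_diff[OF A continuous_on_cis_mult, of "\<lambda>_. 1" s] by (simp add: cfc_const[OF A])
  have "cfc (\<lambda>x. cis (x * s) - 1 - \<i> * complex_of_real s * complex_of_real x) A =
      cfc (\<lambda>x. cis (x * s) - 1) A - cfc (\<lambda>x. \<i> * complex_of_real s * complex_of_real x) A"
    by (rule cfc_diff[OF A]) (intro continuous_intros)+
  then have "cfc (\<lambda>x. cis (x * s) - 1 - \<i> * complex_of_real s * complex_of_real x) A =
      cfc (\<lambda>x. cis (x * s)) A - scalar_op 1 - scalar_op (\<i> * complex_of_real s) \<odot> A"
    by (simp only: 1 2)
  moreover have "norm (cfc (\<lambda>x. cis (x * s) - 1 - \<i> * complex_of_real s * complex_of_real x) A) \<le> (c * s)\<^sup>2"
  proof (rule norm_cfc_le[OF A])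
    fix x assume "x \<in> {0..c}"
    then have "(x * s)\<^sup>2 \<le> (c * s)\<^sup>2" by (simp add: power_mult_distrib mult_right_mono power_mono)
    then show "cmod (cis (x * s) - 1 - \<i> * complex_of_real s * complex_of_real x) \<le> (c * s)\<^sup>2"
      using cis_minus_one_le[of "x * s"] by (simp add: mult_ac)
  qed (auto intro!: continuous_intros)
  ultimately show ?thesis by simp
qed

text \<open>With \<open>s = y/m\<close> the unitary operators \<open>U = exp(i s A)\<close> and \<open>V = exp(i s B)\<close> differ by \<open>i s (A - B)\<close> up to an
  operator of norm \<open>O(1/m\<^sup>2)\<close>. The telescoping sum for \<open>U\<^sup>m - V\<^sup>m\<close> multiplies this by \<open>m\<close>, so the main
  term becomes \<open>|y| \<kappa>\<close> and the error \<open>O(d/m)\<close>, which vanishes as \<open>m \<rightarrow> \<infinity>\<close> for fixed \<open>d\<close>.\<close>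

lemma trace_bound_cis:
  assumes A: "selfadjoint_in c A" and B: "selfadjoint_in c B" and K: "trace_bound d (A - B) \<kappa>"
  shows "trace_bound d (cfc (\<lambda>x. cis (x * y)) A - cfc (\<lambda>x. cis (x * y)) B) (\<bar>y\<bar> * \<kappa>)"
    (is "trace_bound d ?X _")
proof -
  have bound: "trace_bound d ?X (\<bar>y\<bar> * \<kappa> + real d * (2 * (c * y)\<^sup>2) / real (Suc n))" for n
  proof -
    define m where "m = real (Suc n)"
    have m: "m > 0" by (simp add: m_def)
    define s where "s = y / m"
    define U where "U = cfc (\<lambda>x. cis (x * s)) A"
    define V where "V = cfc (\<lambda>x. cis (x * s)) B"
    have nU: "norm U \<le> 1" "norm V \<le> 1"
      unfolding U_def V_def by (rule norm_cfc_le[OF A] norm_cfc_le[OF B], auto intro: continuous_on_cis_mult)+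
    have adj: "\<exists>U'. adjoint_pair U U'" "\<exists>V'. adjoint_pair V V'"
      unfolding U_def V_def using adjoint_pair_cfc[OF A continuous_on_cis_mult]
        adjoint_pair_cfc[OF B continuous_on_cis_mult] by blast+
    define R where "R = (U - scalar_op 1 - scalar_op (\<i> * complex_of_real s) \<odot> A) - (V - scalar_op 1 - scalar_op (\<i> * complex_of_real s) \<odot> B)"
    have "norm R \<le> norm (U - scalar_op 1 - scalar_op (\<i> * complex_of_real s) \<odot> A) +
        norm (V - scalar_op 1 - scalar_op (\<i> * complex_of_real s) \<odot> B)"
      unfolding R_def by (rule norm_triangle_ineq4)
    also have "\<dots> \<le> (c * s)\<^sup>2 + (c * s)\<^sup>2"
      unfolding U_def V_def by (intro add_mono norm_cfc_cis_remainder A B)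
    finally have "norm R \<le> 2 * (c * s)\<^sup>2" by simp
    then have R: "trace_bound d R (real d * (2 * (c * s)\<^sup>2))" by (rule trace_bound_norm)
    have "U - V = scalar_op (\<i> * complex_of_real s) \<odot> (A - B) + R"
      by (simp add: R_def compose_diff)
    then have UV: "trace_bound d (U - V) (\<bar>s\<bar> * \<kappa> + real d * (2 * (c * s)\<^sup>2))"
      using trace_bound_add[OF trace_bound_scalar_op[OF K, of "\<i> * complex_of_real s"] R] by (simp add: norm_mult)
    have "trace_bound d (opow U (Suc n) - opow V (Suc n))
        (real (Suc n) * 1 ^ (Suc n - 1) * (\<bar>s\<bar> * \<kappa> + real d * (2 * (c * s)\<^sup>2)))"
      using adj nU trace_bound_opow_diff[OF UV] by blast
    moreover have "cis (x * s) ^ Suc n = cis (x * y)" for x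
    proof -
      have "real (Suc n) * (x * (y / real (Suc n))) = x * y" by (simp del: of_nat_Suc)
      then show ?thesis by (simp only: Complex.DeMoivre s_def m_def)
    qed
    then have "opow U (Suc n) = cfc (\<lambda>x. cis (x * y)) A" "opow V (Suc n) = cfc (\<lambda>x. cis (x * y)) B"
      unfolding U_def V_def by (simp_all only: cfc_power[OF A continuous_on_cis_mult, symmetric]
          cfc_power[OF B continuous_on_cis_mult, symmetric])
    moreover have "real (Suc n) * 1 ^ (Suc n - 1) * (\<bar>s\<bar> * \<kappa> + real d * (2 * (c * s)\<^sup>2)) =
        \<bar>y\<bar> * \<kappa> + real d * (2 * (c * y)\<^sup>2) / real (Suc n)"
      using m unfolding s_def m_def[symmetric] by (simp add: field_simps power2_eq_square)
    ultimately show ?thesis by metis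
  qed
  have "(\<lambda>n. \<bar>y\<bar> * \<kappa> + real d * (2 * (c * y)\<^sup>2) / real (Suc n)) \<longlonglongrightarrow> \<bar>y\<bar> * \<kappa> + 0"
    by (intro tendsto_add tendsto_const LIMSEQ_Suc[OF lim_const_over_n])
  then show ?thesis using bound by (intro trace_bound_LIMSEQ[OF tendsto_const]) auto
qed


section \<open>From trace norm bounds to the trace class\<close>

text \<open>Let \<open>P = D*D\<close> and \<open>H = (P\<^sup>1\<^sup>/\<^sup>2 + \<epsilon>)\<^sup>-\<^sup>1\<close>. Then \<open>V = D H\<close> is a contraction that plays the role of the
  partial isometry in the polar decomposition: \<open>V*D = H P\<close> is within \<open>\<epsilon>\<close> of \<open>|D| = P\<^sup>1\<^sup>/\<^sup>2\<close>. So the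
  diagonal of \<open>|D|\<close> is, up to \<open>\<epsilon>\<close> for each entry, that of \<open>\<langle>D e, V e\<rangle>\<close>, where both families satisfy
  Bessel's inequality.\<close>

lemma abs_op_trace_le:
  assumes D: "adjoint_pair D D'" and X: "\<And>d. trace_bound d D C" and F: "finite F" "orthonormal F"
  shows "(\<Sum>e\<in>F. cmod (cinner (abs_op D e) e)) \<le> C"
proof (rule field_le_epsilon)
  fix \<delta> :: real assume \<delta>: "\<delta> > 0"
  define p where "p = (norm D)\<^sup>2"
  define P where "P = D' \<odot> D"
  have P: "selfadjoint_in p P" unfolding P_def p_def by (rule selfadjoint_in_compose[OF D order_refl])
  \<comment> \<open>Each of the \<open>card F\<close> diagonal entries is allowed an error of \<open>\<epsilon>\<close>; the \<open>1\<close> guards against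
    empty \<open>F\<close>.\<close>
  define \<epsilon> where "\<epsilon> = \<delta> / (card F + 1)"
  have \<epsilon>: "\<epsilon> > 0" using \<delta> by (simp add: \<epsilon>_def)
  define h where "h = (\<lambda>x. complex_of_real (1 / (sqrt x + \<epsilon>)))"
  have pos: "sqrt x + \<epsilon> > 0" if "x \<in> {0..p}" for x using that \<epsilon> by (simp add: add_nonneg_pos)
  have h: "continuous_on {0..p} h" unfolding h_def
    by (intro continuous_intros) (use pos in force)
  define H where "H = cfc h P"
  have HH: "adjoint_pair H H"
    using adjoint_pair_cfc[OF P h] unfolding H_def by (simp add: h_def)
  define V where "V = D \<odot> H"
  have V: "adjoint_pair V (H \<odot> D')" unfolding V_def by (rule adjoint_pair_compose[OF D HH])
  have abs: "abs_op D = cfc (\<lambda>x. complex_of_real (sqrt x)) P"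
    by (simp add: abs_op_def adjoint_op_eq[OF D] P_def)
  have hid: "cfc (\<lambda>x. h x * complex_of_real x) P = H \<odot> P"
    using cfc_mult[OF P h, of complex_of_real] by (simp add: cfc_id[OF P] H_def continuous_on_of_real_id)
  \<comment> \<open>This operator is \<open>V*V\<close>; bounding it by \<open>1\<close> makes \<open>V\<close> a contraction.\<close>
  have HPH: "(H \<odot> D') \<odot> V = cfc (\<lambda>x. h x * complex_of_real x * h x) P"
    using cfc_mult[OF P _ h, of "\<lambda>x. h x * complex_of_real x"] h hid
    by (simp add: continuous_on_mult continuous_on_of_real_id V_def P_def compose_assoc H_def)
  have "norm ((H \<odot> D') \<odot> V) \<le> 1"
    unfolding HPH
  proof (rule norm_cfc_le[OF P])
    fix x assume x: "x \<in> {0..p}"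
    have "x = sqrt x * sqrt x" using x by simp
    also have "\<dots> \<le> (sqrt x + \<epsilon>) * (sqrt x + \<epsilon>)" using \<epsilon> x by (intro mult_mono) auto
    finally have le: "x \<le> (sqrt x + \<epsilon>) * (sqrt x + \<epsilon>)" .
    define S where "S = sqrt x + \<epsilon>"
    have "S > 0" "x \<le> S * S" using pos[OF x] le by (simp_all only: S_def)
    then have "x / (S * S) \<le> 1" by (subst divide_le_eq_1_pos) auto
    then have "(1 / S) * x * (1 / S) \<le> 1" by simp
    then have "(1 / (sqrt x + \<epsilon>)) * x * (1 / (sqrt x + \<epsilon>)) \<le> 1" by (simp only: S_def)
    then show "cmod (h x * complex_of_real x * h x) \<le> 1"
      using x pos[OF x] unfolding h_def norm_mult norm_of_real by simp
  qed (auto intro!: continuous_intros h)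
  have nV: "norm V \<le> 1"
  proof (rule norm_blinfun_bound)
    fix x
    have "(norm (V x))\<^sup>2 = cmod (cinner (((H \<odot> D') \<odot> V) x) x)"
      using adjoint_pairD[OF adjoint_pair_sym[OF V], of "V x" x] cinner_self[of "V x"] by (simp add: norm_power)
    also have "\<dots> \<le> norm (((H \<odot> D') \<odot> V) x) * norm x" by (rule cinner_norm_le)
    also have "\<dots> \<le> (norm ((H \<odot> D') \<odot> V) * norm x) * norm x" by (intro mult_right_mono norm_blinfun) auto
    also have "\<dots> \<le> (1 * norm x) * norm x" using \<open>norm ((H \<odot> D') \<odot> V) \<le> 1\<close> by (intro mult_right_mono) auto
    finally have "(norm (V x))\<^sup>2 \<le> (norm x)\<^sup>2" by (simp add: power2_eq_square)
    then show "norm (V x) \<le> 1 * norm x" by (simp add: power2_le_iff_abs_le)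
  qed simp
  have near: "norm (abs_op D - H \<odot> P) \<le> \<epsilon>"
  proof -
    have "cfc (\<lambda>x. complex_of_real (sqrt x) - h x * complex_of_real x) P = abs_op D - H \<odot> P"
      unfolding abs hid[symmetric] by (intro cfc_diff[OF P] continuous_intros h)
    moreover have "norm (cfc (\<lambda>x. complex_of_real (sqrt x) - h x * complex_of_real x) P) \<le> \<epsilon>"
    proof (rule norm_cfc_le[OF P])
      fix x assume x: "x \<in> {0..p}"
      have sx: "x = sqrt x * sqrt x" using x by simp
      have "complex_of_real (sqrt x) - h x * complex_of_real x = complex_of_real (sqrt x - x / (sqrt x + \<epsilon>))"
        by (simp add: h_def)
      also have "sqrt x - x / (sqrt x + \<epsilon>) = \<epsilon> * (sqrt x / (sqrt x + \<epsilon>))"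
        using pos[OF x] sx by (simp add: field_simps)
      finally have "cmod (complex_of_real (sqrt x) - h x * complex_of_real x) = \<bar>\<epsilon> * (sqrt x / (sqrt x + \<epsilon>))\<bar>"
        by (simp only: norm_of_real)
      also have "\<dots> = \<epsilon> * (sqrt x / (sqrt x + \<epsilon>))" using \<epsilon> pos[OF x] x by simp
      also have "\<dots> \<le> \<epsilon> * 1" using \<epsilon> pos[OF x] by (intro mult_left_mono) (auto simp: field_simps)
      finally show "cmod (complex_of_real (sqrt x) - h x * complex_of_real x) \<le> \<epsilon>" by simp
    qed (use \<epsilon> in \<open>auto intro!: continuous_intros h\<close>)
    ultimately show ?thesis by simp
  qed
  obtain a where a: "bij_betw a {..<card F} F"
    using ex_bij_betw_nat_finite[OF F(1)] by (auto simp: atLeast0LessThan)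
  have bf: "bessel_family (card F) a" by (rule bessel_family_orthonormal[OF a F(2)])
  have "(\<Sum>e\<in>F. cmod (cinner (abs_op D e) e)) = (\<Sum>i<card F. cmod (cinner (abs_op D (a i)) (a i)))"
    by (rule sum.reindex_bij_betw[OF a, symmetric])
  also have "\<dots> \<le> C + real (card F) * \<epsilon>"
  proof -
    have "(\<Sum>i<card F. cmod (cinner ((H \<odot> P) (a i)) (a i))) = (\<Sum>i<card F. cmod (cinner (D (a i)) (V (a i))))"
      by (intro sum.cong refl)
        (simp add: adjoint_pairD[OF adjoint_pair_sym[OF V], symmetric] P_def)
    also have "\<dots> \<le> C"
      using trace_boundD[OF X bf bessel_family_apply[OF bf V nV]] by simp
    finally have 1: "(\<Sum>i<card F. cmod (cinner ((H \<odot> P) (a i)) (a i))) \<le> C" .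
    have 2: "(\<Sum>i<card F. cmod (cinner ((abs_op D - H \<odot> P) (a i)) (a i))) \<le> real (card F) * \<epsilon>"
      by (rule trace_boundD[OF trace_bound_norm[OF near] bf bf])
    have "(\<Sum>i<card F. cmod (cinner (abs_op D (a i)) (a i))) \<le>
        (\<Sum>i<card F. cmod (cinner ((H \<odot> P) (a i)) (a i)) + cmod (cinner ((abs_op D - H \<odot> P) (a i)) (a i)))"
    proof (rule sum_mono)
      fix i
      have "cinner (abs_op D (a i)) (a i) = cinner ((H \<odot> P) (a i)) (a i) + cinner ((abs_op D - H \<odot> P) (a i)) (a i)"
        by (simp add: blinfun.diff_left cinner.diff_left)
      then show "cmod (cinner (abs_op D (a i)) (a i)) \<le>
          cmod (cinner ((H \<odot> P) (a i)) (a i)) + cmod (cinner ((abs_op D - H \<odot> P) (a i)) (a i))"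
        by (simp only: norm_triangle_ineq)
    qed
    also have "\<dots> \<le> C + real (card F) * \<epsilon>" unfolding sum.distrib by (intro add_mono 1 2)
    finally show ?thesis .
  qed
  also have "real (card F) * \<epsilon> \<le> \<delta>" using \<delta> by (simp add: \<epsilon>_def field_simps)
  finally show "(\<Sum>e\<in>F. cmod (cinner (abs_op D e) e)) \<le> C + \<delta>" by simp
qed

theorem trace_classI:
  fixes D :: "'a::complex_hilbert \<Rightarrow>\<^sub>L 'a" and E :: "'a set"
  assumes D: "adjoint_pair D D'" and X: "\<And>d. trace_bound d D C" and E: "orthonormal_basis E"
  shows "trace_class D"
proof -
  have abs: "(\<lambda>e. cmod (cinner (abs_op D e) e)) summable_on E"
    unfolding abs_summable_iff_bdd_above
    using abs_op_trace_le[OF D X] orthonormal_subset[OF orthonormal_basis_orthonormal[OF E]]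
    by (intro bdd_aboveI[of _ C]) auto
  have "(\<lambda>e. cinner (abs_op D e) e) summable_on E"
    by (rule Infinite_Sum.abs_summable_summable[OF abs])
  then show ?thesis unfolding trace_class_def
    using E adjoint_pair_complex_linear[OF D] by blast
qed


section \<open>Traces\<close>

text \<open>A form of the statement that \<open>X\<close> is of trace class which is stable under products from both sides and contains the
  cyclicity of the trace: both \<open>A X\<close> and \<open>X A\<close> have the trace \<open>\<tau> A\<close>, because a factor on the left and a factor on the
  right enter only through their product \<open>C B\<close>.\<close>

definition traceable :: "('a::complex_hilbert \<Rightarrow>\<^sub>L 'a) \<Rightarrow> (('a \<Rightarrow>\<^sub>L 'a) \<Rightarrow> complex) \<Rightarrow> bool" where
  "traceable X \<tau> \<longleftrightarrow> (\<forall>B B' C C' E. adjoint_pair B B' \<longrightarrow> adjoint_pair C C' \<longrightarrow> orthonormal_basis E \<longrightarrow>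
     ((\<lambda>e. cinner ((B \<odot> X \<odot> C) e) e) has_sum \<tau> (C \<odot> B)) E)"

lemma traceableD:
  "traceable X \<tau> \<Longrightarrow> adjoint_pair B B' \<Longrightarrow> adjoint_pair C C' \<Longrightarrow> orthonormal_basis E \<Longrightarrow>
     ((\<lambda>e. cinner ((B \<odot> X \<odot> C) e) e) has_sum \<tau> (C \<odot> B)) E"
  unfolding traceable_def by blast

lemma traceable_add:
  assumes "traceable X \<tau>" "traceable Y \<sigma>"
  shows "traceable (X + Y) (\<lambda>Z. \<tau> Z + \<sigma> Z)"
  unfolding traceable_def
proof (intro allI impI)
  fix B B' C C' :: "'a \<Rightarrow>\<^sub>L 'a" and E :: "'a set"
  assume *: "adjoint_pair B B'" "adjoint_pair C C'" "orthonormal_basis E"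
  show "((\<lambda>e. cinner ((B \<odot> (X + Y) \<odot> C) e) e) has_sum \<tau> (C \<odot> B) + \<sigma> (C \<odot> B)) E"
    using has_sum_add[OF traceableD[OF assms(1) *] traceableD[OF assms(2) *]]
    by (simp add: blinfun.bilinear_simps cinner.add_left)
qed

lemma traceable_left:
  assumes X: "traceable X \<tau>" and A: "adjoint_pair A A'"
  shows "traceable (A \<odot> X) (\<lambda>Z. \<tau> (Z \<odot> A))"
  unfolding traceable_def
proof (intro allI impI)
  fix B B' C C' :: "'a \<Rightarrow>\<^sub>L 'a" and E :: "'a set"
  assume *: "adjoint_pair B B'" "adjoint_pair C C'" "orthonormal_basis E"
  show "((\<lambda>e. cinner ((B \<odot> (A \<odot> X) \<odot> C) e) e) has_sum \<tau> ((C \<odot> B) \<odot> A)) E"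
    using traceableD[OF X adjoint_pair_compose[OF *(1) A] *(2,3)] by (simp add: compose_assoc)
qed

lemma traceable_right:
  assumes X: "traceable X \<tau>" and A: "adjoint_pair A A'"
  shows "traceable (X \<odot> A) (\<lambda>Z. \<tau> (A \<odot> Z))"
  unfolding traceable_def
proof (intro allI impI)
  fix B B' C C' :: "'a \<Rightarrow>\<^sub>L 'a" and E :: "'a set"
  assume *: "adjoint_pair B B'" "adjoint_pair C C'" "orthonormal_basis E"
  show "((\<lambda>e. cinner ((B \<odot> (X \<odot> A) \<odot> C) e) e) has_sum \<tau> (A \<odot> (C \<odot> B))) E"
    using traceableD[OF X *(1) adjoint_pair_compose[OF A *(2)] *(3)] by (simp add: compose_assoc)
qed

lemma traceable_commutator:
  fixes X :: "'a::complex_hilbert \<Rightarrow>\<^sub>L 'a" and E :: "'a set"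
  assumes X: "traceable X \<tau>" and A: "adjoint_pair A A'" and E: "orthonormal_basis E"
  shows "((\<lambda>e. cinner ((A \<odot> X - X \<odot> A) e) e) has_sum 0) E"
proof -
  have "((\<lambda>e. cinner ((A \<odot> X) e) e) has_sum \<tau> A) E" "((\<lambda>e. cinner ((X \<odot> A) e) e) has_sum \<tau> A) E"
    using traceableD[OF X A adjoint_pair_id E] traceableD[OF X adjoint_pair_id A E] by simp_all
  from has_sum_add[OF this(1) has_sum_uminusI[OF this(2)]]
  show ?thesis by (simp add: blinfun.diff_left cinner.diff_left)
qed

text \<open>\<open>X\<close> is the sum of the rank one operators \<open>x \<mapsto> \<langle>x, v\<^sub>k\<rangle> w\<^sub>k\<close>, absolutely convergent in trace norm.\<close>

definition nuclear_sum :: "('a::complex_hilbert \<Rightarrow>\<^sub>L 'a) \<Rightarrow> (nat \<Rightarrow> 'a) \<Rightarrow> (nat \<Rightarrow> 'a) \<Rightarrow> bool" where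
  "nuclear_sum X v w \<longleftrightarrow> summable (\<lambda>k. norm (v k) * norm (w k)) \<and>
     (\<forall>x y. (\<lambda>k. cinner x (v k) * cinner (w k) y) sums cinner (X x) y)"

lemma trace_bound_nuclear_sum:
  assumes "nuclear_sum X v w"
  shows "trace_bound d X (\<Sum>k. norm (v k) * norm (w k))"
proof (rule trace_boundI)
  fix a b :: "nat \<Rightarrow> 'a" assume ab: "bessel_family d a" "bessel_family d b"
  have sm: "summable (\<lambda>k. norm (v k) * norm (w k))" using assms by (simp add: nuclear_sum_def)
  have abs: "summable (\<lambda>k. cmod (cinner x (v k) * cinner (w k) y))" for x y
  proof (rule summable_comparison_test')
    show "summable (\<lambda>k. norm x * norm y * (norm (v k) * norm (w k)))" by (intro summable_mult sm)
    show "norm (cmod (cinner x (v k) * cinner (w k) y)) \<le> norm x * norm y * (norm (v k) * norm (w k))" if "k \<ge> 0" for k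
      using mult_mono[OF cinner_norm_le[of x "v k"] cinner_norm_le[of "w k" y]] by (simp add: norm_mult mult_ac)
  qed
  have "(\<Sum>i<d. cmod (cinner (X (a i)) (b i))) \<le> (\<Sum>i<d. \<Sum>k. cmod (cinner (a i) (v k) * cinner (w k) (b i)))"
  proof (rule sum_mono)
    fix i
    have "cinner (X (a i)) (b i) = (\<Sum>k. cinner (a i) (v k) * cinner (w k) (b i))"
      using assms by (simp add: nuclear_sum_def sums_iff)
    then show "cmod (cinner (X (a i)) (b i)) \<le> (\<Sum>k. cmod (cinner (a i) (v k) * cinner (w k) (b i)))"
      using summable_norm[OF abs] by simp
  qed
  also have "\<dots> = (\<Sum>k. \<Sum>i<d. cmod (cinner (a i) (v k) * cinner (w k) (b i)))"
    by (rule suminf_sum[symmetric]) (rule abs)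
  also have "\<dots> \<le> (\<Sum>k. norm (v k) * norm (w k))"
  proof (rule suminf_le)
    fix k
    have "cmod (cinner (a i) (v k) * cinner (w k) (b i)) = cmod (cinner (v k) (a i)) * cmod (cinner (w k) (b i))" for i
      by (simp add: norm_mult cmod_cinner_commute[of "a i"])
    then show "(\<Sum>i<d. cmod (cinner (a i) (v k) * cinner (w k) (b i))) \<le> norm (v k) * norm (w k)"
      using bessel_family_mult[OF ab] by simp
  qed (auto intro!: summable_sum abs sm)
  finally show "(\<Sum>i<d. cmod (cinner (X (a i)) (b i))) \<le> (\<Sum>k. norm (v k) * norm (w k))" .
qed

lemma parseval_abs_le:
  assumes E: "orthonormal E"
  shows "infsum (\<lambda>e. cmod (cinner x e * cinner e y)) E \<le> norm x * norm y"
    and "(\<lambda>e. cmod (cinner x e * cinner e y)) summable_on E"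
proof -
  have *: "(\<Sum>e\<in>F. cmod (cinner x e * cinner e y)) \<le> norm x * norm y" if F: "finite F" "F \<subseteq> E" for F
  proof -
    obtain a where a: "bij_betw a {..<card F} F"
      using ex_bij_betw_nat_finite[OF F(1)] by (auto simp: atLeast0LessThan)
    have bf: "bessel_family (card F) a"
      by (rule bessel_family_orthonormal[OF a orthonormal_subset[OF E F(2)]])
    have "(\<Sum>e\<in>F. cmod (cinner x e * cinner e y)) = (\<Sum>i<card F. cmod (cinner x (a i)) * cmod (cinner y (a i)))"
      by (subst sum.reindex_bij_betw[OF a, symmetric]) (simp add: norm_mult cmod_cinner_commute[of _ y])
    then show ?thesis using bessel_family_mult[OF bf bf] by simp
  qed
  show s: "(\<lambda>e. cmod (cinner x e * cinner e y)) summable_on E"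
    unfolding abs_summable_iff_bdd_above using * by (intro bdd_aboveI[of _ "norm x * norm y"]) auto
  show "infsum (\<lambda>e. cmod (cinner x e * cinner e y)) E \<le> norm x * norm y"
    by (rule infsum_le_finite_sums[OF s]) (use * in auto)
qed

text \<open>Summing over the basis first gives \<open>\<langle>p\<^sub>k, q\<^sub>k\<rangle>\<close> by Parseval's identity. The interchange with the sum over
  \<open>k\<close> is legitimate since the double sum converges absolutely, again by Bessel's inequality.\<close>

lemma has_sum_rank_ones:
  assumes E: "orthonormal_basis E" and sm: "summable (\<lambda>k. norm (p k) * norm (q k))"
    and g: "\<And>e. e \<in> E \<Longrightarrow> (\<lambda>k. cinner (p k) e * cinner e (q k)) sums g e"
  shows "(g has_sum (\<Sum>k. cinner (p k) (q k))) E"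
proof -
  note on = orthonormal_basis_orthonormal[OF E]
  define f where "f = (\<lambda>(k::nat, e). cinner (p k) e * cinner e (q k))"
  have sm': "(\<lambda>k. norm (p k) * norm (q k)) summable_on UNIV"
    using sm by (subst summable_on_UNIV_nonneg_real_iff) auto
  have "(\<lambda>x. norm (f x)) summable_on (UNIV \<times> E)"
    unfolding Infinite_Sum.abs_summable_on_Sigma_iff
  proof (intro conjI ballI)
    show "(\<lambda>e. norm (f (k, e))) summable_on E" for k
      using parseval_abs_le(2)[OF on] by (simp add: f_def)
    show "(\<lambda>k. norm (infsum (\<lambda>e. cmod (f (k, e))) E)) summable_on UNIV"
    proof (rule Infinite_Sum.abs_summable_on_comparison_test')
      show "(\<lambda>k. norm (p k) * norm (q k)) summable_on UNIV" by (rule sm')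
      show "norm (infsum (\<lambda>e. cmod (f (k, e))) E) \<le> norm (p k) * norm (q k)" for k
        using parseval_abs_le(1)[OF on] by (simp add: f_def infsum_nonneg)
    qed
  qed
  then obtain S where S: "(f has_sum S) (UNIV \<times> E)"
    using Infinite_Sum.abs_summable_summable summable_on_def by blast
  have 1: "((\<lambda>k. cinner (p k) (q k)) has_sum S) UNIV"
    by (rule has_sum_SigmaD[OF S]) (use parseval[OF E] in \<open>simp add: f_def\<close>)
  have "(\<lambda>k. cinner (p k) (q k)) sums S" by (rule has_sum_imp_sums[OF 1])
  then have S': "S = (\<Sum>k. cinner (p k) (q k))" by (simp add: sums_iff)
  have "((\<lambda>(e, k). f (k, e)) has_sum S) (E \<times> UNIV)" using S by (subst (asm) has_sum_swap) simp
  then have "(g has_sum S) E"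
  proof (rule has_sum_SigmaD)
    fix e assume e: "e \<in> E"
    have "summable (\<lambda>k. cmod (cinner (p k) e * cinner e (q k)))"
    proof (rule summable_comparison_test')
      show "summable (\<lambda>k. norm e * norm e * (norm (p k) * norm (q k)))" by (intro summable_mult sm)
      show "norm (cmod (cinner (p k) e * cinner e (q k))) \<le> norm e * norm e * (norm (p k) * norm (q k))" if "k \<ge> 0" for k
        using mult_mono[OF cinner_norm_le[of "p k" e] cinner_norm_le[of e "q k"]] by (simp add: norm_mult mult_ac)
    qed
    then show "((\<lambda>k. case (e, k) of (e, k) \<Rightarrow> f (k, e)) has_sum g e) UNIV"
      using norm_summable_imp_has_sum[OF _ g[OF e]] by (simp add: f_def)
  qed
  then show ?thesis by (simp add: S')
qed

lemma traceable_nuclear_sum: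
  assumes X: "nuclear_sum X v w"
  shows "traceable X (\<lambda>Z. \<Sum>k. cinner (Z (w k)) (v k))"
  unfolding traceable_def
proof (intro allI impI)
  fix B B' C C' :: "'a \<Rightarrow>\<^sub>L 'a" and E :: "'a set"
  assume *: "adjoint_pair B B'" "adjoint_pair C C'" "orthonormal_basis E"
  have sm: "summable (\<lambda>k. norm (v k) * norm (w k))" using X by (simp add: nuclear_sum_def)
  have "((\<lambda>e. cinner ((B \<odot> X \<odot> C) e) e) has_sum (\<Sum>k. cinner (B (w k)) (C' (v k)))) E"
  proof (rule has_sum_rank_ones[OF *(3)])
    show "summable (\<lambda>k. norm (B (w k)) * norm (C' (v k)))"
    proof (rule summable_comparison_test')
      show "summable (\<lambda>k. norm B * norm C' * (norm (v k) * norm (w k)))" by (intro summable_mult sm)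
      show "norm (norm (B (w k)) * norm (C' (v k))) \<le> norm B * norm C' * (norm (v k) * norm (w k))" if "k \<ge> 0" for k
        using mult_mono[OF norm_blinfun[of B "w k"] norm_blinfun[of C' "v k"]] by (simp add: mult_ac)
    qed
    fix e
    have "(\<lambda>k. cinner (C e) (v k) * cinner (w k) (B' e)) sums cinner (X (C e)) (B' e)"
      using X by (simp add: nuclear_sum_def)
    then show "(\<lambda>k. cinner (B (w k)) e * cinner e (C' (v k))) sums cinner ((B \<odot> X \<odot> C) e) e"
      by (simp add: adjoint_pairD[OF *(1)] adjoint_pairD[OF *(2)] mult.commute)
  qed
  then show "((\<lambda>e. cinner ((B \<odot> X \<odot> C) e) e) has_sum (\<Sum>k. cinner ((C \<odot> B) (w k)) (v k))) E"
    by (simp add: adjoint_pairD[OF *(2)])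
qed


section \<open>Completeness of the trigonometric system\<close>

lemma cis_measurable [measurable]: "cis \<in> borel_measurable borel"
  by (intro borel_measurable_continuous_onI continuous_intros)

lemma AE_circle_range: "AE t in circle_measure. t \<in> {0..<2*pi}"
  unfolding circle_measure_def by (rule AE_uniform_measureI) auto

lemma square_integrable_integrable:
  assumes "square_integrable f"
  shows "integrable circle_measure f"
  using square_integrable_integrable_mult[OF assms square_integrable_bounded[of "\<lambda>_. 1" 1]] by simp

lemma integrable_mult_bounded:
  fixes f g :: "real \<Rightarrow> complex"
  assumes f: "integrable circle_measure f" and g [measurable]: "g \<in> borel_measurable borel"
    and bound: "\<And>t. cmod (g t) \<le> C"
  shows "integrable circle_measure (\<lambda>t. f t * g t)"
proof (rule Bochner_Integration.integrable_bound)
  show "integrable circle_measure (\<lambda>t. C * cmod (f t))" using f by auto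
  show "(\<lambda>t. f t * g t) \<in> borel_measurable circle_measure" using f by measurable
  show "AE t in circle_measure. norm (f t * g t) \<le> norm (C * cmod (f t))"
  proof (rule AE_I2)
    fix t
    have "cmod (f t) * cmod (g t) \<le> cmod (f t) * C" by (intro mult_left_mono bound) auto
    then show "norm (f t * g t) \<le> norm (C * cmod (f t))" by (simp add: norm_mult mult.commute)
  qed
qed

text \<open>This class of functions is closed under multiplication and contains the polynomials in \<open>cos t\<close> and
  \<open>sin t\<close>, so that the Stone-Weierstrass theorem on the unit circle applies to it.\<close>

inductive trig_poly :: "(real \<Rightarrow> complex) \<Rightarrow> bool" where
  exp: "trig_poly (\<lambda>t. c * cis (of_int n * t))"
| add: "trig_poly g \<Longrightarrow> trig_poly h \<Longrightarrow> trig_poly (\<lambda>t. g t + h t)"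

lemma trig_poly_mult:
  assumes "trig_poly g" "trig_poly h"
  shows "trig_poly (\<lambda>t. g t * h t)"
  using assms(1)
proof induction
  case (exp c n)
  show ?case using assms(2)
  proof induction
    case (exp d m)
    have "(\<lambda>t. c * cis (of_int n * t) * (d * cis (of_int m * t))) = (\<lambda>t. (c * d) * cis (of_int (n + m) * t))"
    proof (rule ext)
      fix t
      have "cis (of_int n * t) * cis (of_int m * t) = cis (of_int (n + m) * t)"
        by (simp add: cis_mult distrib_right)
      then show "c * cis (of_int n * t) * (d * cis (of_int m * t)) = (c * d) * cis (of_int (n + m) * t)"
        by (metis mult.assoc mult.left_commute)
    qed
    then show ?case by (simp only: trig_poly.exp)
  next
    case (add g h)
    then show ?case using trig_poly.add by (simp add: distrib_left)
  qed
next
  case (add g' h')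
  then show ?case using trig_poly.add by (simp add: distrib_right)
qed

lemma trig_poly_const: "trig_poly (\<lambda>t. c)"
  using trig_poly.exp[of c 0] by simp

lemma trig_poly_of_polynomial:
  assumes "real_polynomial_function (q :: complex \<Rightarrow> real)"
  shows "trig_poly (\<lambda>t. complex_of_real (q (cis t)))"
  using assms
proof induction
  case (linear f)
  interpret bounded_linear f by fact
  have "complex_of_real (f (cis t)) = (complex_of_real (f 1 / 2) + complex_of_real (f \<i> / 2) / \<i>) * cis (of_int 1 * t) +
      (complex_of_real (f 1 / 2) - complex_of_real (f \<i> / 2) / \<i>) * cis (of_int (-1) * t)" for t
  proof -
    have "cis t = cos t *\<^sub>R 1 + sin t *\<^sub>R \<i>" by (simp add: complex_eq_iff)
    then have "f (cis t) = cos t * f 1 + sin t * f \<i>" by (simp add: add scaleR)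
    then show ?thesis by (simp add: complex_eq_iff)
  qed
  then show ?case using trig_poly.intros by presburger
next
  case (const c)
  show ?case by (rule trig_poly_const)
next
  case (add f g)
  then show ?case using trig_poly.add by simp
next
  case (mult f g)
  then show ?case using trig_poly_mult by simp
qed

lemma integral_trig_poly_eq_0:
  assumes f: "integrable circle_measure f" and z: "\<And>n. fourier_coeff f n = 0" and g: "trig_poly g"
  shows "integrable circle_measure (\<lambda>t. f t * g t) \<and> (LINT t|circle_measure. f t * g t) = 0"
  using g
proof induction
  case (exp c n)
  have m: "(\<lambda>t. c * cis (of_int n * t)) \<in> borel_measurable borel" by measurable
  have "(LINT t|circle_measure. f t * (c * cis (of_int n * t))) =
      (LINT t|circle_measure. c * (f t * cis (- (of_int (- n) * t))))"
    by (intro Bochner_Integration.integral_cong) (auto simp: mult_ac)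
  also have "\<dots> = c * fourier_coeff f (- n)" unfolding fourier_coeff_def by simp
  finally show ?case using z integrable_mult_bounded[OF f m, of "cmod c"] by (simp add: norm_mult)
next
  case (add g h)
  then show ?case by (simp add: distrib_left)
qed

lemma integral_continuous_circle_eq_0:
  assumes f: "integrable circle_measure f" and z: "\<And>n. fourier_coeff f n = 0"
    and \<phi>: "continuous_on UNIV (\<phi> :: complex \<Rightarrow> real)"
  shows "(LINT t|circle_measure. f t * complex_of_real (\<phi> (cis t))) = 0"
proof -
  define I where "I = cmod (LINT t|circle_measure. f t * complex_of_real (\<phi> (cis t)))"
  define J where "J = (LINT t|circle_measure. cmod (f t))"
  have J: "J \<ge> 0" unfolding J_def by (intro Bochner_Integration.integral_nonneg) auto
  have [measurable]: "\<phi> \<in> borel_measurable borel" by (rule borel_measurable_continuous_onI[OF \<phi>])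
  have "I \<le> 0 + e" if "e > 0" for e
  proof -
    define d where "d = e / (J + 1)"
    have d: "d > 0" using that J by (simp add: d_def)
    have "continuous_on (sphere 0 1) \<phi>" using \<phi> continuous_on_subset by blast
    then obtain q where q: "real_polynomial_function q" "\<And>x. x \<in> sphere 0 1 \<Longrightarrow> \<bar>\<phi> x - q x\<bar> < d"
      using Stone_Weierstrass_real_polynomial_function[of "sphere (0::complex) 1" \<phi> d] d by auto
    have qc: "continuous_on UNIV q"
      by (rule continuous_on_eq_continuous_at[THEN iffD2]) (use continuous_real_polymonial_function[OF q(1)] in auto)
    have [measurable]: "q \<in> borel_measurable borel" by (rule borel_measurable_continuous_onI[OF qc])
    have b: "cmod (complex_of_real (\<phi> (cis t) - q (cis t))) \<le> d" for t
      using q(2)[of "cis t"] by (simp only: norm_of_real) (simp add: less_imp_le)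
    have i1: "integrable circle_measure (\<lambda>t. f t * complex_of_real (\<phi> (cis t) - q (cis t)))"
      by (rule integrable_mult_bounded[OF f _ b]) measurable
    note i2 = integral_trig_poly_eq_0[OF f z trig_poly_of_polynomial[OF q(1)]]
    have "(LINT t|circle_measure. f t * complex_of_real (\<phi> (cis t))) =
        (LINT t|circle_measure. f t * complex_of_real (\<phi> (cis t) - q (cis t)) + f t * complex_of_real (q (cis t)))"
      by (intro Bochner_Integration.integral_cong) (auto simp: algebra_simps)
    also have "\<dots> = (LINT t|circle_measure. f t * complex_of_real (\<phi> (cis t) - q (cis t)))"
      using i2 by (subst Bochner_Integration.integral_add[OF i1]) auto
    finally have "I \<le> (LINT t|circle_measure. cmod (f t * complex_of_real (\<phi> (cis t) - q (cis t))))"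
      unfolding I_def by simp
    also have "\<dots> \<le> (LINT t|circle_measure. d * cmod (f t))"
    proof (rule integral_mono)
      fix t show "cmod (f t * complex_of_real (\<phi> (cis t) - q (cis t))) \<le> d * cmod (f t)"
        using mult_left_mono[OF b norm_ge_zero[of "f t"], of t] by (simp add: norm_mult mult.commute)
    qed (use i1 f in auto)
    also have "\<dots> = d * J" unfolding J_def by simp
    also have "\<dots> \<le> e" using J that by (simp add: d_def field_simps)
    finally show ?thesis by simp
  qed
  then have "I \<le> 0" by (rule field_le_epsilon)
  then show ?thesis by (simp add: I_def)
qed

text \<open>The indicator function of the arc \<open>C = {exp(i t) | 0 \<le> t \<le> a}\<close> is the limit of the continuous functions
  \<open>max 0 (1 - k dist(z, C))\<close>.\<close>

lemma integral_arc_eq_0: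
  assumes f: "integrable circle_measure f" and z: "\<And>n. fourier_coeff f n = 0"
  shows "(LINT t|circle_measure. f t * indicator {..a} t) = 0"
proof -
  consider "a < 0" | "a \<ge> 2 * pi" | "0 \<le> a" "a < 2 * pi" by linarith
  then show ?thesis
  proof cases
    case 1
    have "(LINT t|circle_measure. f t * indicator {..a} t) = (LINT t|circle_measure. 0)"
      using f AE_circle_range 1
      by (intro integral_cong_AE) (auto elim!: eventually_mono simp: indicator_def)
    then show ?thesis by simp
  next
    case 2
    have "(LINT t|circle_measure. f t * indicator {..a} t) = (LINT t|circle_measure. f t * cis (- (of_int 0 * t)))"
    proof (intro integral_cong_AE)
      show "AE t in circle_measure. f t * indicator {..a} t = f t * cis (- (of_int 0 * t))"
        using AE_circle_range by eventually_elim (use 2 in \<open>auto simp: indicator_def\<close>)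
    qed (use f in auto)
    then show ?thesis using z[of 0] by (simp add: fourier_coeff_def)
  next
    case 3
    define C where "C = cis ` {0..a}"
    have cC: "compact C" unfolding C_def by (intro compact_continuous_image continuous_intros) auto
    then have C: "closed C" "C \<noteq> {}" using 3 compact_imp_closed by (auto simp: C_def)
    define \<phi> where "\<phi> = (\<lambda>k::nat. \<lambda>z. max 0 (1 - real k * infdist z C))"
    have \<phi>c: "continuous_on UNIV (\<phi> k)" for k unfolding \<phi>_def by (intro continuous_intros)
    have [measurable]: "\<phi> k \<in> borel_measurable borel" for k by (rule borel_measurable_continuous_onI[OF \<phi>c])
    have arc: "cis t \<in> C \<longleftrightarrow> t \<le> a" if t: "t \<in> {0..<2*pi}" for t
    proof
      assume "cis t \<in> C"
      then obtain s where s: "s \<in> {0..a}" "cis t = cis s" by (auto simp: C_def)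
      then have "sin t = sin s \<and> cos t = cos s" by (simp add: complex_eq_iff)
      then obtain n :: int where n: "t = s + 2 * pi * n" using sin_cos_eq_iff by blast
      have "\<bar>2 * pi * real_of_int n\<bar> < 2 * pi" using n s t 3 by auto
      then have "\<bar>real_of_int n\<bar> < 1" by (simp add: abs_mult)
      then have "n = 0" by linarith
      then show "t \<le> a" using n s by simp
    next
      assume "t \<le> a" then show "cis t \<in> C" using t by (auto simp: C_def)
    qed
    have "(\<lambda>k. LINT t|circle_measure. f t * complex_of_real (\<phi> k (cis t))) \<longlonglongrightarrow>
        (LINT t|circle_measure. f t * indicator {..a} t)"
    proof (rule integral_dominated_convergence[where w = "\<lambda>t. cmod (f t)"])
      show "AE t in circle_measure. (\<lambda>k. f t * complex_of_real (\<phi> k (cis t))) \<longlonglongrightarrow> f t * indicator {..a} t"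
        using AE_circle_range
      proof eventually_elim
        case (elim t)
        have "(\<lambda>k. \<phi> k (cis t)) \<longlonglongrightarrow> indicator {..a} t"
        proof (cases "t \<le> a")
          case True
          then have "infdist (cis t) C = 0" using arc[OF elim] by simp
          then show ?thesis using True by (simp add: \<phi>_def)
        next
          case False
          then have "infdist (cis t) C \<noteq> 0" using arc[OF elim] C in_closed_iff_infdist_zero by blast
          then have pos: "infdist (cis t) C > 0" using infdist_nonneg[of "cis t" C] by linarith
          obtain N :: nat where N: "1 / infdist (cis t) C \<le> real N" using real_arch_simple by blast
          have "\<phi> k (cis t) = 0" if "k \<ge> N" for k
          proof -
            have "1 / infdist (cis t) C \<le> real k" using N that by linarith
            then show ?thesis using pos by (simp add: \<phi>_def field_simps)
          qed
          then have "\<forall>\<^sub>F k in sequentially. \<phi> k (cis t) = 0" by (auto simp: eventually_sequentially)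
          then show ?thesis using False by (simp add: tendsto_eventually)
        qed
        then have "(\<lambda>k. f t * complex_of_real (\<phi> k (cis t))) \<longlonglongrightarrow> f t * complex_of_real (indicator {..a} t)"
          by (intro tendsto_intros)
        then show ?case by (cases "t \<le> a") (auto simp: indicator_def)
      qed
      show "AE t in circle_measure. norm (f t * complex_of_real (\<phi> k (cis t))) \<le> cmod (f t)" for k
      proof (rule AE_I2)
        fix t
        have "\<bar>\<phi> k (cis t)\<bar> \<le> 1" using infdist_nonneg[of "cis t" C] by (simp add: \<phi>_def)
        then show "norm (f t * complex_of_real (\<phi> k (cis t))) \<le> cmod (f t)"
          using mult_left_mono[of _ 1 "cmod (f t)"] by (simp add: norm_mult)
      qed
    qed (use f in auto)
    then have "(\<lambda>k. 0) \<longlonglongrightarrow> (LINT t|circle_measure. f t * indicator {..a} t)"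
      by (simp add: integral_continuous_circle_eq_0[OF f z \<phi>c])
    then show ?thesis using LIMSEQ_unique tendsto_const by blast
  qed
qed

lemma integral_set_eq_0:
  assumes f: "integrable circle_measure f" and z: "\<And>n. fourier_coeff f n = 0" and A: "A \<in> sets borel"
  shows "(LINT t|circle_measure. f t * indicator A t) = 0"
proof -
  have int: "integrable circle_measure (\<lambda>t. f t * indicator B t)" if "B \<in> sets borel" for B
    by (rule integrable_mult_bounded[OF f, of _ 1]) (use that in \<open>auto simp: indicator_def\<close>)
  have "Int_stable (range (\<lambda>a::real. {..a}))"
    by (rule Int_stableI) (auto intro!: exI[of _ "min _ _"])
  moreover have "range (\<lambda>a::real. {..a}) \<subseteq> Pow UNIV" by simp
  moreover have A': "A \<in> sigma_sets UNIV (range (\<lambda>a::real. {..a}))"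
    using A unfolding borel_eq_atMost by simp
  ultimately show ?thesis
  proof (induction rule: sigma_sets_induct_disjoint)
    case (basic A) then show ?case using integral_arc_eq_0[OF f z] by auto
  next
    case empty then show ?case by simp
  next
    case (compl A)
    have Ab: "A \<in> sets borel" using compl(1) unfolding borel_eq_atMost by simp
    have "(LINT t|circle_measure. f t * indicator (UNIV - A) t) =
        (LINT t|circle_measure. f t * cis (- (of_int 0 * t)) - f t * indicator A t)"
      by (intro Bochner_Integration.integral_cong) (auto simp: indicator_def)
    also have "\<dots> = fourier_coeff f 0 - (LINT t|circle_measure. f t * indicator A t)"
      unfolding fourier_coeff_def using f int[OF Ab] by (intro Bochner_Integration.integral_diff) auto
    finally show ?case using z compl by simp
  next
    case (union A)
    have Ab: "A i \<in> sets borel" for i using union(2) unfolding borel_eq_atMost by auto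
    then have Au: "(\<Union>i. A i) \<in> sets borel" by auto
    have si: "(LINT t|circle_measure. f t * indicator B t) = (LINT t:B|circle_measure. f t)" for B
      unfolding set_lebesgue_integral_def by (intro Bochner_Integration.integral_cong) (auto simp: indicator_def)
    have "set_integrable circle_measure (\<Union>i. A i) f"
      using int[OF Au] unfolding set_integrable_def
      by (rule Bochner_Integration.integrable_cong[THEN iffD1, rotated 2]) (auto simp: indicator_def)
    then have "(LINT t:(\<Union>i. A i)|circle_measure. f t) = (\<Sum>i. (LINT t:(A i)|circle_measure. f t))"
      using union(1) Ab by (intro lebesgue_integral_countable_add) (auto simp: disjoint_family_on_def)
    also have "\<dots> = (\<Sum>i. 0)" using union(3) by (simp add: si)
    finally show ?case by (simp add: si)
  qed
qed

text \<open>Trigonometric polynomials are dense in the continuous functions on the circle, these approximate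
  indicator functions of arcs, and arcs generate the Borel sets. So if all Fourier coefficients of \<open>f\<close>
  vanish then so does its integral over every Borel set.\<close>

theorem fourier_eq_0_imp_eq_0:
  assumes "\<And>n. fourier x n = 0"
  shows "x = 0"
proof -
  obtain f where f: "square_integrable f" "x = abs_l2 f" by (rule obtain_l2_rep)
  have rel: "l2_rel f f" using f by (simp add: l2_rel_def)
  have z: "fourier_coeff f n = 0" for n using assms[of n] by (simp add: f(2) fourier.abs_eq[OF rel])
  have int: "integrable circle_measure f" by (rule square_integrable_integrable[OF f(1)])
  have set0: "(LINT t:A|circle_measure. f t) = 0" if "A \<in> sets circle_measure" for A
  proof -
    have "(LINT t:A|circle_measure. f t) = (LINT t|circle_measure. f t * indicator A t)"
      unfolding set_lebesgue_integral_def by (intro Bochner_Integration.integral_cong) (auto simp: indicator_def)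
    then show ?thesis using integral_set_eq_0[OF int z] that by simp
  qed
  have si: "integrable circle_measure (\<lambda>t. indicat_real A t *\<^sub>R f t)" if "A \<in> sets circle_measure" for A
    using integrable_mult_indicator[OF that int] .
  have "AE t in circle_measure. Re (f t) = 0"
  proof (rule density_unique_real)
    fix A assume A: "A \<in> sets circle_measure"
    have "(LINT t:A|circle_measure. Re (f t)) = Re (LINT t:A|circle_measure. f t)"
      unfolding set_lebesgue_integral_def by (subst integral_Re[OF si[OF A], symmetric]) simp
    then show "(LINT t:A|circle_measure. Re (f t)) = (LINT t:A|circle_measure. 0)"
      using set0[OF A] by (simp add: set_lebesgue_integral_def)
  qed (use int in auto)
  moreover have "AE t in circle_measure. Im (f t) = 0"
  proof (rule density_unique_real)
    fix A assume A: "A \<in> sets circle_measure"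
    have "(LINT t:A|circle_measure. Im (f t)) = Im (LINT t:A|circle_measure. f t)"
      unfolding set_lebesgue_integral_def by (subst integral_Im[OF si[OF A], symmetric]) simp
    then show "(LINT t:A|circle_measure. Im (f t)) = (LINT t:A|circle_measure. 0)"
      using set0[OF A] by (simp add: set_lebesgue_integral_def)
  qed (use int in auto)
  ultimately have "AE t in circle_measure. (cmod (f t))\<^sup>2 = 0"
    by eventually_elim (simp add: cmod_def)
  then have "(LINT t|circle_measure. (cmod (f t))\<^sup>2) = 0" by (rule integral_eq_zero_AE)
  then have "(norm x)\<^sup>2 = 0" by (simp add: f(2) norm_abs_l2[OF f(1)])
  then show ?thesis by simp
qed


section \<open>The monomial basis of the Hardy space\<close>

definition trig :: "int \<Rightarrow> l2" where
  "trig n = abs_l2 (\<lambda>t. cis (of_int n * t))"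

lemma fourier_eq_cinner_trig: "fourier f n = cinner f (trig n)"
  by (simp add: trig_def fourier_eq_cinner)

lemma square_integrable_trig: "square_integrable (\<lambda>t. cis (of_int n * t))"
  by (rule square_integrable_bounded[where C = 1]) auto

lemma cinner_abs_l2:
  assumes "square_integrable f" "square_integrable g"
  shows "cinner (abs_l2 f) (abs_l2 g) = (LINT t|circle_measure. f t * cnj (g t))"
  using assms by (simp add: cinner_l2_def l2_cinner.abs_eq l2_rel_def)

lemma integral_circle_measure:
  fixes f :: "real \<Rightarrow> complex"
  assumes [measurable]: "f \<in> borel_measurable borel"
  shows "(LINT t|circle_measure. f t) = (LINT t|lborel. (indicator {0..<2*pi} t / (2*pi)) *\<^sub>R f t)"
proof -
  have "circle_measure = density lborel (\<lambda>t. ennreal (indicator {0..<2*pi} t / (2*pi)))"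
    unfolding circle_measure_def uniform_measure_def
  proof (rule density_cong)
    show "AE t in lborel. indicator {0..<2*pi} t / emeasure lborel {0..<2*pi} = ennreal (indicator {0..<2*pi} t / (2*pi))"
      by (intro AE_I2) (auto simp: indicator_def divide_ennreal[symmetric])
  qed auto
  moreover have "(LINT t|density lborel (\<lambda>t. ennreal (indicator {0..<2*pi} t / (2*pi))). f t) =
      (LINT t|lborel. (indicator {0..<2*pi} t / (2*pi)) *\<^sub>R f t)"
    by (rule integral_density) auto
  ultimately show ?thesis by (simp only:)
qed

lemma integral_cis_circle:
  assumes "n \<noteq> 0"
  shows "(LINT t|circle_measure. cis (of_int n * t)) = 0"
proof -
  define c where "c = \<i> * of_int n"
  have c: "c \<noteq> 0" using assms by (simp add: c_def)
  have e: "cis (of_int n * t) = exp (c * of_real t)" for t by (simp add: cis_conv_exp c_def mult_ac)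
  have "(LINT t|circle_measure. cis (of_int n * t)) =
      (LINT t|lborel. (indicator {0..<2*pi} t / (2*pi)) *\<^sub>R cis (of_int n * t))"
    by (rule integral_circle_measure) measurable
  also have "\<dots> = (LINT t|lborel. (1 / (2*pi)) *\<^sub>R (indicator {0..2*pi} t *\<^sub>R exp (c * of_real t)))"
  proof (rule integral_cong_AE)
    show "AE t in lborel. (indicator {0..<2*pi} t / (2*pi)) *\<^sub>R cis (of_int n * t) =
        (1 / (2*pi)) *\<^sub>R (indicator {0..2*pi} t *\<^sub>R exp (c * of_real t))"
      using AE_lborel_singleton[of "2*pi"] by eventually_elim (auto simp: indicator_def e)
  qed measurable
  also have "\<dots> = (1 / (2*pi)) *\<^sub>R (LINT t|lborel. indicator {0..2*pi} t *\<^sub>R exp (c * of_real t))"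
    by (rule integral_scaleR_right)
  also have "(LINT t|lborel. indicator {0..2*pi} t *\<^sub>R exp (c * of_real t)) =
      exp (c * of_real (2*pi)) / c - exp (c * of_real 0) / c"
  proof (rule integral_FTC_atLeastAtMost)
    fix t :: real
    show "((\<lambda>x. exp (c * of_real x) / c) has_vector_derivative exp (c * of_real t)) (at t within {0..2*pi})"
    proof (rule has_vector_derivative_real_field)
      show "((\<lambda>z. exp (c * z) / c) has_field_derivative exp (c * of_real t)) (at (of_real t))"
        using c by (auto intro!: derivative_eq_intros)
    qed
  qed (auto intro!: continuous_intros)
  also have "exp (c * of_real (2*pi)) = cis (of_int n * (2 * pi))" by (rule e[symmetric])
  also have "\<dots> = 1" using cis_multiple_2pi[of "of_int n"] by (simp add: mult_ac)
  finally show ?thesis by simp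
qed

lemma cinner_trig: "cinner (trig m) (trig n) = (if m = n then 1 else 0)"
proof -
  have "cinner (trig m) (trig n) = (LINT t|circle_measure. cis (of_int (m - n) * t))"
    unfolding trig_def cinner_abs_l2[OF square_integrable_trig square_integrable_trig]
    by (intro Bochner_Integration.integral_cong) (auto simp: cis_cnj cis_mult left_diff_distrib)
  then show ?thesis using integral_cis_circle[of "m - n"] circle.prob_space by auto
qed

lemma trig_in_H2: "n \<ge> 0 \<Longrightarrow> trig n \<in> H2"
  by (simp add: H2_def fourier_eq_cinner_trig cinner_trig)

definition zpow :: "nat \<Rightarrow> h2" where
  "zpow n = Abs_h2 (trig (int n))"

lemma h2_l2_zpow: "h2_l2 (zpow n) = trig (int n)"
  by (simp add: zpow_def Abs_h2_inverse trig_in_H2)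

definition hcoef :: "h2 \<Rightarrow> nat \<Rightarrow> complex" where
  "hcoef h n = cinner h (zpow n)"

lemma hcoef_fourier: "hcoef h n = fourier (h2_l2 h) (int n)"
  by (simp add: hcoef_def cinner_h2.rep_eq h2_l2_zpow fourier_eq_cinner_trig)

lemma cinner_zpow: "cinner (zpow m) (zpow n) = (if m = n then 1 else 0)"
  by (simp add: cinner_h2.rep_eq h2_l2_zpow cinner_trig)

lemma hcoef_zpow: "hcoef (zpow m) n = (if m = n then 1 else 0)"
  by (simp add: hcoef_def cinner_zpow)

lemma inj_zpow: "inj zpow"
  by (rule injI) (metis cinner_zpow zero_neq_one)

lemma hcoef_ext: "(\<And>n. hcoef x n = hcoef y n) \<Longrightarrow> x = y"
proof -
  assume eq: "\<And>n. hcoef x n = hcoef y n"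
  have "fourier (h2_l2 (x - y)) n = 0" for n
  proof (cases "n < 0")
    case True then show ?thesis using h2_l2[of "x - y"] by (simp add: H2_def)
  next
    case False
    then obtain k where "n = int k" by (metis nonneg_int_cases not_less)
    then show ?thesis using eq[of k] hcoef_fourier[of "x - y" k] by (simp add: hcoef_def cinner.diff_left)
  qed
  then have "h2_l2 (x - y) = 0" by (rule fourier_eq_0_imp_eq_0)
  then have "x - y = 0" by (metis h2_l2_inject zero_h2.rep_eq)
  then show "x = y" by simp
qed

lemma orthonormal_zpow: "orthonormal (range zpow)"
  using inj_zpow by (auto simp: orthonormal_def cinner_zpow inj_eq)

lemma orthonormal_basis_zpow: "orthonormal_basis (range zpow)"
  using orthonormal_zpow hcoef_ext[of _ 0]
  by (auto simp: orthonormal_basis_def orthonormal_def hcoef_def)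

lemma hcoef_sums: "(\<lambda>n. hcoef x n *\<^sub>C zpow n) sums x"
proof -
  have "((\<lambda>n. cinner x (zpow n) *\<^sub>C zpow n) has_sum x) UNIV"
    using orthonormal_expansion[OF orthonormal_basis_zpow, of x] has_sum_reindex[OF inj_zpow, of "\<lambda>e. cinner x e *\<^sub>C e" x]
    by (simp add: o_def)
  then show ?thesis unfolding hcoef_def by (rule has_sum_imp_sums)
qed

lemma cinner_sums: "(\<lambda>n. hcoef x n * cnj (hcoef y n)) sums cinner x y"
proof -
  have "((\<lambda>n. cinner x (zpow n) * cinner (zpow n) y) has_sum cinner x y) UNIV"
    using parseval[OF orthonormal_basis_zpow, of x y] has_sum_reindex[OF inj_zpow, of "\<lambda>e. cinner x e * cinner e y"]
    by (simp add: o_def)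
  then have "(\<lambda>n. cinner x (zpow n) * cinner (zpow n) y) sums cinner x y" by (rule has_sum_imp_sums)
  moreover have "cinner (zpow n) y = cnj (hcoef y n)" for n unfolding hcoef_def by (rule cinner_commute)
  ultimately show ?thesis by (simp add: hcoef_def)
qed

lemma norm_sums: "(\<lambda>n. (cmod (hcoef x n))\<^sup>2) sums (norm x)\<^sup>2"
proof -
  have "((\<lambda>n. (cmod (cinner x (zpow n)))\<^sup>2) has_sum (norm x)\<^sup>2) UNIV"
    using parseval_norm[OF orthonormal_basis_zpow, of x] has_sum_reindex[OF inj_zpow, of "\<lambda>e. (cmod (cinner x e))\<^sup>2"]
    by (simp add: o_def)
  then show ?thesis unfolding hcoef_def by (rule has_sum_imp_sums)
qed

lemma norm_zpow_combination:
  assumes "finite I"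
  shows "(norm (\<Sum>n\<in>I. c n *\<^sub>C zpow n))\<^sup>2 = (\<Sum>n\<in>I. (cmod (c n))\<^sup>2)"
proof -
  define d where "d = (\<lambda>e. c (inv zpow e))"
  have d: "d (zpow n) = c n" for n by (simp add: d_def inj_zpow)
  have inj: "inj_on zpow I" using inj_zpow inj_on_subset by blast
  have "(norm (\<Sum>e\<in>zpow ` I. d e *\<^sub>C e))\<^sup>2 = (\<Sum>e\<in>zpow ` I. (cmod (d e))\<^sup>2)"
    using assms by (intro norm_combination orthonormal_subset[OF orthonormal_zpow]) auto
  then show ?thesis by (simp add: sum.reindex[OF inj] d)
qed

text \<open>The Riesz-Fischer theorem: the partial sums of \<open>\<Sum>\<^sub>n c\<^sub>n z\<^sup>n\<close> form a Cauchy sequence by Pythagoras.\<close>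

lemma ex_hcoef:
  assumes "summable (\<lambda>n. (cmod (c n))\<^sup>2)"
  shows "\<exists>h. \<forall>n. hcoef h n = c n"
proof -
  have "summable (\<lambda>n. c n *\<^sub>C zpow n)"
    unfolding summable_Cauchy
  proof (intro allI impI)
    fix e :: real assume e: "e > 0"
    then have "e\<^sup>2 > 0" by simp
    then obtain N where N: "\<And>m n. m \<ge> N \<Longrightarrow> norm (\<Sum>i=m..<n. (cmod (c i))\<^sup>2) < e\<^sup>2"
      using assms unfolding summable_Cauchy by meson
    have "norm (\<Sum>i=m..<n. c i *\<^sub>C zpow i) < e" if "m \<ge> N" for m n
    proof -
      have "(norm (\<Sum>i=m..<n. c i *\<^sub>C zpow i))\<^sup>2 < e\<^sup>2"
        using N[OF that, of n] by (simp add: norm_zpow_combination sum_nonneg)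
      then show ?thesis using e by (simp add: power2_less_imp_less)
    qed
    then show "\<exists>N. \<forall>m\<ge>N. \<forall>n. norm (\<Sum>i=m..<n. c i *\<^sub>C zpow i) < e" by blast
  qed
  then obtain h where h: "(\<lambda>n. c n *\<^sub>C zpow n) sums h" by (auto simp: summable_def)
  have "hcoef h n = c n" for n
  proof -
    have "(\<lambda>k. cinner (c k *\<^sub>C zpow k) (zpow n)) sums cinner h (zpow n)"
      by (rule bounded_linear.sums[OF cinner.bounded_linear_left h])
    moreover have "(\<lambda>k. cinner (c k *\<^sub>C zpow k) (zpow n)) = (\<lambda>k. if k = n then c k else 0)"
      by (auto simp: cinner_scaleC_left cinner_zpow)
    moreover have "(\<lambda>k. if k = n then c k else 0) sums c n" by (rule sums_single)
    ultimately show ?thesis unfolding hcoef_def using sums_unique2 by metis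
  qed
  then show ?thesis by blast
qed

text \<open>For fixed \<open>y\<close> the numbers \<open>c\<^sub>n = cnj \<langle>A z\<^sup>n, y\<rangle>\<close> are the coefficients of \<open>A* y\<close>. They are square summable:
  applying \<open>A\<close> to \<open>v = \<Sum> c\<^sub>n z\<^sup>n\<close>, over \<open>n < N\<close>, gives \<open>\<parallel>v\<parallel>\<^sup>2 = \<langle>A v, y\<rangle> \<le> \<parallel>A\<parallel> \<parallel>v\<parallel> \<parallel>y\<parallel>\<close>.\<close>

lemma ex_adjoint_pair:
  fixes A :: "h2 \<Rightarrow>\<^sub>L h2"
  assumes cl: "complex_linear A"
  shows "\<exists>B. adjoint_pair A B"
proof -
  have ex: "\<exists>w. \<forall>x. cinner (A x) y = cinner x w" for y
  proof -
    define c where "c = (\<lambda>n. cnj (cinner (A (zpow n)) y))"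
    have "(\<Sum>n<N. (cmod (c n))\<^sup>2) \<le> (norm A * norm y)\<^sup>2" for N
    proof -
      define s where "s = (\<Sum>n<N. (cmod (c n))\<^sup>2)"
      define v where "v = (\<Sum>n<N. c n *\<^sub>C zpow n)"
      have s0: "s \<ge> 0" unfolding s_def by (intro sum_nonneg) auto
      have nv: "(norm v)\<^sup>2 = s" unfolding v_def s_def by (rule norm_zpow_combination) simp
      have "cinner (A v) y = (\<Sum>n<N. c n * cnj (c n))"
        using cl by (simp add: v_def blinfun.sum_right cinner.sum_left complex_linear_def cinner_scaleC_left c_def)
      also have "\<dots> = complex_of_real s" by (simp only: s_def of_real_sum complex_norm_square)
      finally have "s = cmod (cinner (A v) y)" using s0 by simp
      also have "\<dots> \<le> norm (A v) * norm y" by (rule cinner_norm_le)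
      also have "\<dots> \<le> (norm A * norm v) * norm y" by (intro mult_right_mono norm_blinfun) auto
      finally have le: "norm v * norm v \<le> (norm A * norm y) * norm v" using nv by (simp add: power2_eq_square mult_ac)
      have "norm v \<le> norm A * norm y"
      proof (cases "norm v = 0")
        case False
        then have "norm v > 0" by simp
        then show ?thesis using le mult_le_cancel_right_pos by blast
      qed auto
      then have "(norm v)\<^sup>2 \<le> (norm A * norm y)\<^sup>2" by (intro power_mono) auto
      then show ?thesis by (simp add: nv s_def)
    qed
    then have "summable (\<lambda>n. (cmod (c n))\<^sup>2)" by (intro summableI_nonneg_bounded) auto
    then obtain w where w: "\<And>n. hcoef w n = c n" using ex_hcoef by blast
    have "cinner (A x) y = cinner x w" for x
    proof -
      have "(\<lambda>n. cinner (A (hcoef x n *\<^sub>C zpow n)) y) sums cinner (A x) y"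
        by (intro bounded_linear.sums[OF cinner.bounded_linear_left] bounded_linear.sums[OF blinfun.bounded_linear_right] hcoef_sums)
      moreover have "(\<lambda>n. cinner (A (hcoef x n *\<^sub>C zpow n)) y) = (\<lambda>n. hcoef x n * cnj (hcoef w n))"
        using cl by (simp add: w c_def complex_linear_def cinner_scaleC_left)
      ultimately show ?thesis using cinner_sums[of x w] sums_unique2 by metis
    qed
    then show ?thesis by blast
  qed
  have "\<forall>y. \<exists>w. \<forall>x. cinner (A x) y = cinner x w" using ex by blast
  from choice[OF this] obtain B where B: "\<And>y x. cinner (A x) y = cinner x (B y)" by blast
  have "bounded_linear B"
  proof (rule bounded_linear_intro[where K = "norm A"])
    show "B (x + y) = B x + B y" for x y
      by (rule cinner_ext_right) (simp add: B[symmetric] cinner_add_right)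
    show "B (r *\<^sub>R x) = r *\<^sub>R B x" for r x
      by (rule cinner_ext_right) (simp add: B[symmetric] cinner_scaleR_right)
    show "norm (B y) \<le> norm y * norm A" for y
    proof (cases "norm (B y) = 0")
      case False
      have "norm (B y) * norm (B y) = cmod (cinner (A (B y)) y)"
        by (simp add: B cinner_self norm_power power2_eq_square[symmetric])
      also have "\<dots> \<le> norm (A (B y)) * norm y" by (rule cinner_norm_le)
      also have "\<dots> \<le> (norm A * norm (B y)) * norm y" by (intro mult_right_mono norm_blinfun) auto
      finally have "norm (B y) * norm (B y) \<le> (norm y * norm A) * norm (B y)" by (simp add: mult_ac)
      moreover have "norm (B y) > 0" using False by simp
      ultimately show ?thesis using mult_le_cancel_right_pos by blast
    qed auto
  qed
  then have "blinfun_apply (Blinfun B) = B" by (rule bounded_linear_Blinfun_apply)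
  then have "adjoint_pair A (Blinfun B)" by (simp add: adjoint_pair_def B)
  then show ?thesis by blast
qed


section \<open>Analytic Toeplitz operators\<close>

lemma L_infinity_bound:
  assumes f: "abs_l2 F \<in> L_infinity" and F: "square_integrable F"
  shows "AE t in circle_measure. cmod (F t) \<le> linf_norm (abs_l2 F)" and "linf_norm (abs_l2 F) \<ge> 0"
proof -
  have [measurable]: "F \<in> borel_measurable borel" using F by auto
  have rel: "l2_rel F F" using F by (simp add: l2_rel_def)
  define e where "e = ess_bound (abs_l2 F)"
  have e: "e = esssup circle_measure (\<lambda>t. ereal (cmod (F t)))"
    unfolding e_def by (rule ess_bound.abs_eq[OF rel])
  have ae: "AE t in circle_measure. ereal (cmod (F t)) \<le> e"
    unfolding e by (rule esssup_AE)
  have "e \<ge> 0"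
  proof (rule ccontr)
    assume neg: "\<not> e \<ge> 0"
    have "AE t in circle_measure. False"
      using ae
    proof eventually_elim
      case (elim t)
      have "0 \<le> ereal (cmod (F t))" by simp
      then have "0 \<le> e" using elim order_trans by blast
      then show False using neg by blast
    qed
    then show False by simp
  qed
  moreover have "e < \<infinity>" using f by (simp add: L_infinity_def e_def)
  ultimately obtain m where m: "e = ereal m" "m \<ge> 0" by (cases e) auto
  then have "linf_norm (abs_l2 F) = m" by (simp add: linf_norm_def e_def)
  then show "AE t in circle_measure. cmod (F t) \<le> linf_norm (abs_l2 F)" "linf_norm (abs_l2 F) \<ge> 0"
    using ae m by auto
qed

lemma linf_norm_nonneg: "f \<in> L_infinity \<Longrightarrow> linf_norm f \<ge> 0"
  using L_infinity_bound(2) obtain_l2_rep by metis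

lemma l2_mult_rep:
  assumes f: "abs_l2 F \<in> L_infinity" and F: "square_integrable F" and H: "square_integrable H"
  shows "square_integrable (\<lambda>t. F t * H t)" "l2_mult (abs_l2 F) (abs_l2 H) = abs_l2 (\<lambda>t. F t * H t)"
    and "norm (l2_mult (abs_l2 F) (abs_l2 H)) \<le> linf_norm (abs_l2 F) * norm (abs_l2 H)"
proof -
  have [measurable]: "F \<in> borel_measurable borel" "H \<in> borel_measurable borel" using F H by auto
  define M where "M = linf_norm (abs_l2 F)"
  have M: "M \<ge> 0" unfolding M_def by (rule L_infinity_bound[OF f F])
  have ae: "AE t in circle_measure. (cmod (F t * H t))\<^sup>2 \<le> M\<^sup>2 * (cmod (H t))\<^sup>2"
    using L_infinity_bound(1)[OF f F]
  proof eventually_elim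
    case (elim t)
    then have "cmod (F t) * cmod (H t) \<le> M * cmod (H t)" by (intro mult_right_mono) (auto simp: M_def)
    from power_mono[OF this, of 2] show ?case by (simp add: norm_mult power_mult_distrib)
  qed
  have Hi: "integrable circle_measure (\<lambda>t. M\<^sup>2 * (cmod (H t))\<^sup>2)" using H by (simp add: square_integrable_def)
  have int: "integrable circle_measure (\<lambda>t. (cmod (F t * H t))\<^sup>2)"
    by (rule Bochner_Integration.integrable_bound[OF Hi]) (use ae in \<open>auto elim!: eventually_mono\<close>)
  then show sq: "square_integrable (\<lambda>t. F t * H t)" by (simp add: square_integrable_def)
  show eq: "l2_mult (abs_l2 F) (abs_l2 H) = abs_l2 (\<lambda>t. F t * H t)"
    using sq F H by (subst l2_mult.abs_eq) (auto simp: l2_rel_def)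
  have "(norm (abs_l2 (\<lambda>t. F t * H t)))\<^sup>2 \<le> (LINT t|circle_measure. M\<^sup>2 * (cmod (H t))\<^sup>2)"
    unfolding norm_abs_l2[OF sq] by (rule integral_mono_AE[OF int Hi ae])
  also have "\<dots> = (M * norm (abs_l2 H))\<^sup>2" by (simp add: norm_abs_l2[OF H] power_mult_distrib)
  finally show "norm (l2_mult (abs_l2 F) (abs_l2 H)) \<le> linf_norm (abs_l2 F) * norm (abs_l2 H)"
    using M unfolding eq M_def[symmetric] by (simp add: power2_le_iff_abs_le)
qed

text \<open>For bounded \<open>f\<close> the \<open>n\<close>-th coefficient of \<open>f h\<close> is \<open>\<langle>h, W\<rangle>\<close> with the square integrable function
  \<open>W = cnj f \<sqdot> exp(i n t)\<close>, so it may be computed from the expansion of \<open>h\<close> in \<open>H\<^sup>2\<close>. Only the terms with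
  \<open>k \<le> n\<close> survive because \<open>f\<close> has no negative coefficients.\<close>

lemma fourier_l2_mult:
  assumes f: "f \<in> H_infinity"
  shows "fourier (l2_mult f (h2_l2 h)) n = (\<Sum>k<nat (n + 1). hcoef h k * fourier f (n - int k))"
proof -
  obtain F where F: "square_integrable F" "f = abs_l2 F" by (rule obtain_l2_rep)
  obtain H where H: "square_integrable H" "h2_l2 h = abs_l2 H" by (rule obtain_l2_rep)
  have fi: "abs_l2 F \<in> L_infinity" using f F by (simp add: H_infinity_def)
  have [measurable]: "F \<in> borel_measurable borel" "H \<in> borel_measurable borel" using F H by auto
  define W where "W = (\<lambda>t. cnj (F t) * cis (of_int n * t))"
  have W: "square_integrable W"
    using F(1) unfolding square_integrable_def W_def by (auto simp: norm_mult)
  have rel: "l2_rel (\<lambda>t. F t * H t) (\<lambda>t. F t * H t)" using l2_mult_rep(1)[OF fi F(1) H(1)] by (simp add: l2_rel_def)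
  have "fourier (l2_mult f (h2_l2 h)) n = (LINT t|circle_measure. F t * H t * cis (- (of_int n * t)))"
    unfolding F(2) H(2) l2_mult_rep(2)[OF fi F(1) H(1)] fourier.abs_eq[OF rel] fourier_coeff_def ..
  also have "\<dots> = cinner (h2_l2 h) (abs_l2 W)"
    unfolding H(2) cinner_abs_l2[OF H(1) W]
    by (intro Bochner_Integration.integral_cong) (auto simp: W_def cis_cnj mult_ac)
  finally have 1: "fourier (l2_mult f (h2_l2 h)) n = cinner (h2_l2 h) (abs_l2 W)" .
  have 2: "cinner (trig (int k)) (abs_l2 W) = fourier f (n - int k)" for k
  proof -
    have rF: "l2_rel F F" using F by (simp add: l2_rel_def)
    have "cinner (trig (int k)) (abs_l2 W) = (LINT t|circle_measure. cis (of_int (int k) * t) * cnj (W t))"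
      unfolding trig_def by (rule cinner_abs_l2[OF square_integrable_trig W])
    also have "\<dots> = fourier f (n - int k)"
      unfolding F(2) fourier.abs_eq[OF rF] fourier_coeff_def W_def
    proof (intro Bochner_Integration.integral_cong refl)
      fix t
      have "cis (of_int (int k) * t) * cis (- (of_int n * t)) = cis (- (of_int (n - int k) * t))"
        by (simp add: cis_mult left_diff_distrib)
      then show "cis (of_int (int k) * t) * cnj (cnj (F t) * cis (of_int n * t)) = F t * cis (- (of_int (n - int k) * t))"
        by (simp add: cis_cnj mult_ac)
    qed
    finally show ?thesis .
  qed
  have bl: "bounded_linear h2_l2"
    by (rule bounded_linear_intro[where K = 1]) (auto simp: plus_h2.rep_eq scaleR_h2.rep_eq norm_h2.rep_eq)
  have "(\<lambda>k. cinner (h2_l2 (hcoef h k *\<^sub>C zpow k)) (abs_l2 W)) sums cinner (h2_l2 h) (abs_l2 W)"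
    by (intro bounded_linear.sums[OF cinner.bounded_linear_left] bounded_linear.sums[OF bl] hcoef_sums)
  then have "(\<lambda>k. hcoef h k * fourier f (n - int k)) sums cinner (h2_l2 h) (abs_l2 W)"
    by (simp add: scaleC_h2.rep_eq h2_l2_zpow cinner_scaleC_left 2)
  moreover have "(\<lambda>k. hcoef h k * fourier f (n - int k)) sums (\<Sum>k<nat (n + 1). hcoef h k * fourier f (n - int k))"
  proof (rule sums_finite)
    fix k assume "k \<notin> {..<nat (n + 1)}"
    then have "n - int k < 0" by auto
    then show "hcoef h k * fourier f (n - int k) = 0" using f by (simp add: H_infinity_def H2_def)
  qed simp
  ultimately show ?thesis unfolding 1 by (rule sums_unique2)
qed

lemma riesz_projection_h2: "riesz_projection (h2_l2 g) = g"
  unfolding riesz_projection_def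
proof (rule the_equality)
  show "\<forall>h. cinner (h2_l2 g - h2_l2 g) (h2_l2 h) = 0" by simp
  fix g' assume "\<forall>h. cinner (h2_l2 g - h2_l2 g') (h2_l2 h) = 0"
  then have "cinner (h2_l2 g - h2_l2 g') (h2_l2 (g - g')) = 0" by blast
  then have "cinner (g - g') (g - g') = 0" by (simp add: cinner_h2.rep_eq minus_h2.rep_eq)
  then show "g' = g" by (simp add: cinner_self)
qed

definition fcoef :: "l2 \<Rightarrow> nat \<Rightarrow> complex" where
  "fcoef f n = fourier f (int n)"

text \<open>The product of \<open>f\<close> with a function of \<open>H\<^sup>2\<close> stays in \<open>H\<^sup>2\<close>, so that no projection takes place: \<open>T\<^sub>f\<close> is
  multiplication by \<open>f\<close>, and on coefficients it is a Cauchy product.\<close>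

lemma toeplitz_analytic:
  assumes f: "f \<in> H_infinity"
  shows "hcoef (toeplitz f h) n = (\<Sum>k\<le>n. hcoef h k * fcoef f (n - k))"
    and "norm (toeplitz f) \<le> linf_norm f"
    and "complex_linear (toeplitz f)"
proof -
  have M: "linf_norm f \<ge> 0" using f by (intro linf_norm_nonneg) (simp add: H_infinity_def)
  define g where "g = (\<lambda>h. Abs_h2 (l2_mult f (h2_l2 h)))"
  have in_H2: "l2_mult f (h2_l2 h) \<in> H2" for h
    by (simp add: H2_def fourier_l2_mult[OF f])
  then have g: "h2_l2 (g h) = l2_mult f (h2_l2 h)" for h by (simp add: g_def Abs_h2_inverse)
  have coef: "hcoef (g h) n = (\<Sum>k\<le>n. hcoef h k * fcoef f (n - k))" for h n
  proof -
    have "hcoef (g h) n = (\<Sum>k<nat (int n + 1). hcoef h k * fourier f (int n - int k))"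
      by (simp add: hcoef_fourier g fourier_l2_mult[OF f])
    also have "{..<nat (int n + 1)} = {..n}" by auto
    also have "(\<Sum>k\<le>n. hcoef h k * fourier f (int n - int k)) = (\<Sum>k\<le>n. hcoef h k * fcoef f (n - k))"
      by (intro sum.cong) (auto simp: fcoef_def of_nat_diff)
    finally show ?thesis .
  qed
  have lin: "hcoef (x + y) n = hcoef x n + hcoef y n" "hcoef (c *\<^sub>C x) n = c * hcoef x n"
    "hcoef (r *\<^sub>R x) n = r *\<^sub>R hcoef x n" for x y c r n
    by (simp_all add: hcoef_def cinner_add_left cinner_scaleC_left cinner_scaleR_left)
  have norm: "norm (g h) \<le> linf_norm f * norm h" for h
  proof -
    obtain F where F: "square_integrable F" "f = abs_l2 F" by (rule obtain_l2_rep)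
    obtain H where H: "square_integrable H" "h2_l2 h = abs_l2 H" by (rule obtain_l2_rep)
    show ?thesis
      using l2_mult_rep(3)[of F H] f F H by (simp add: norm_h2.rep_eq g H_infinity_def)
  qed
  have "bounded_linear g"
  proof (rule bounded_linear_intro[where K = "linf_norm f"])
    show "g (x + y) = g x + g y" for x y
      by (rule hcoef_ext) (simp add: coef lin distrib_right sum.distrib)
    show "g (r *\<^sub>R x) = r *\<^sub>R g x" for r x
      by (rule hcoef_ext) (simp add: coef lin scaleR_sum_right)
    show "norm (g x) \<le> norm x * linf_norm f" for x
      using norm[of x] by (simp add: mult.commute)
  qed
  moreover have "toeplitz f = Blinfun g"
    unfolding toeplitz_def g[symmetric] riesz_projection_h2 ..
  ultimately have ap: "blinfun_apply (toeplitz f) = g" by (simp add: bounded_linear_Blinfun_apply)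
  show "hcoef (toeplitz f h) n = (\<Sum>k\<le>n. hcoef h k * fcoef f (n - k))" by (simp add: ap coef)
  show "norm (toeplitz f) \<le> linf_norm f"
    by (rule norm_blinfun_bound[OF M]) (simp add: ap norm)
  show "complex_linear (toeplitz f)"
    unfolding complex_linear_def ap by (intro allI hcoef_ext) (simp add: coef lin sum_distrib_left mult.assoc)
qed


section \<open>Multiplication operators and backward shifts\<close>

text \<open>Symbols are formal power series, so that identities between products and powers of such operators, and derivatives
  of symbols, are computed in a ring, without convergence.\<close>

definition mult_op :: "(h2 \<Rightarrow>\<^sub>L h2) \<Rightarrow> complex fps \<Rightarrow> bool" where
  "mult_op T G \<longleftrightarrow> complex_linear T \<and> (\<forall>h. Abs_fps (hcoef (T h)) = Abs_fps (hcoef h) * G)"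

lemma mult_op_toeplitz:
  assumes "f \<in> H_infinity"
  shows "mult_op (toeplitz f) (Abs_fps (fcoef f))"
  unfolding mult_op_def
  by (auto simp: fps_eq_iff fps_mult_nth toeplitz_analytic(1)[OF assms] toeplitz_analytic(3)[OF assms] atLeast0AtMost)

lemma mult_op_coef:
  assumes "mult_op T G"
  shows "hcoef (T h) n = (\<Sum>k\<le>n. hcoef h k * fps_nth G (n - k))"
proof -
  have "fps_nth (Abs_fps (hcoef (T h))) n = fps_nth (Abs_fps (hcoef h) * G) n"
    using assms by (simp add: mult_op_def)
  then show ?thesis by (simp add: fps_mult_nth atLeast0AtMost)
qed

lemma mult_op_compose: "mult_op T G \<Longrightarrow> mult_op S H \<Longrightarrow> mult_op (T \<odot> S) (G * H)"
  by (simp add: mult_op_def complex_linear_def mult_ac)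

lemma mult_op_opow: "mult_op T G \<Longrightarrow> mult_op (opow T n) (G ^ n)"
proof (induction n)
  case 0
  then show ?case by (simp add: mult_op_def complex_linear_def)
next
  case (Suc n)
  then show ?case using mult_op_compose[of T G "opow T n" "G ^ n"] by simp
qed

lemma fps_hcoef_zpow: "Abs_fps (hcoef (zpow n)) = fps_X ^ n"
  by (simp add: fps_eq_iff hcoef_zpow fps_X_power_iff)

lemma mult_op_zpow_coef:
  assumes "mult_op T G"
  shows "hcoef (T (zpow a)) n = (if n < a then 0 else fps_nth G (n - a))"
proof -
  have "fps_nth (Abs_fps (hcoef (T (zpow a)))) n = fps_nth (fps_X ^ a * G) n"
    using assms by (simp add: mult_op_def fps_hcoef_zpow)
  then show ?thesis by (simp add: fps_X_power_mult_nth)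
qed

lemma mult_op_summable:
  assumes "mult_op T G"
  shows "summable (\<lambda>n. (cmod (fps_nth G n))\<^sup>2)"
  using norm_sums[of "T (zpow 0)"] by (auto simp: mult_op_zpow_coef[OF assms] sums_iff)

text \<open>The vector with the coefficients of \<open>S*\<^sup>k G\<close>, where \<open>S*\<close> is the backward shift.\<close>

definition bshift :: "complex fps \<Rightarrow> nat \<Rightarrow> h2" where
  "bshift G k = (SOME h. \<forall>n. hcoef h n = fps_nth G (n + k))"

lemma hcoef_bshift:
  assumes "summable (\<lambda>n. (cmod (fps_nth G n))\<^sup>2)"
  shows "hcoef (bshift G k) n = fps_nth G (n + k)"
proof -
  have "summable (\<lambda>n. (cmod (fps_nth G (n + k)))\<^sup>2)"
    using summable_iff_shift[of "\<lambda>n. (cmod (fps_nth G n))\<^sup>2" k] assms by simp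
  then have "\<exists>h. \<forall>n. hcoef h n = fps_nth G (n + k)" by (rule ex_hcoef)
  then have "\<forall>n. hcoef (bshift G k) n = fps_nth G (n + k)"
    unfolding bshift_def by (rule someI_ex)
  then show ?thesis by blast
qed

text \<open>The coefficient \<open>G\<^sub>l\<close> occurs in \<open>S*\<^sup>k G\<close> exactly for \<open>k \<le> l\<close>, hence \<open>l\<close> times for \<open>k \<ge> 1\<close>.\<close>

lemma bshift_norm_sums:
  assumes sm: "summable (\<lambda>l. real l * (cmod (fps_nth G l))\<^sup>2)"
  shows "(\<lambda>k. (norm (bshift G (Suc k)))\<^sup>2) sums (\<Sum>l. real l * (cmod (fps_nth G l))\<^sup>2)"
proof -
  define a where "a = (\<lambda>l. (cmod (fps_nth G l))\<^sup>2)"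
  have a0: "a l \<ge> 0" for l by (simp add: a_def)
  have al: "a l \<le> real l * a l" if "l \<ge> 1" for l
    using mult_right_mono[of 1 "real l" "a l"] that a0 by simp
  have sa: "summable a"
  proof (rule summable_comparison_test)
    show "\<exists>N. \<forall>l\<ge>N. norm (a l) \<le> real l * (cmod (fps_nth G l))\<^sup>2"
      using al a0 by (intro exI[of _ 1]) (auto simp: a_def)
  qed (rule sm)
  define g where "g = (\<lambda>(l::nat, k::nat). if k < l then a l else 0)"
  have inner1: "((\<lambda>k. g (l, k)) has_sum real l * a l) UNIV" for l
  proof (rule has_sum_finite_neutralI[of "{..<l}"])
    show "real l * a l = sum (\<lambda>k. g (l, k)) {..<l}" by (simp add: g_def)
  qed (auto simp: g_def)
  have outer1: "((\<lambda>l. real l * a l) has_sum (\<Sum>l. real l * a l)) UNIV"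
    using sm a0 by (intro norm_summable_imp_has_sum summable_sums) (auto simp: a_def)
  have g_sum: "g summable_on (UNIV \<times> UNIV)"
    by (rule summable_on_SigmaI[OF inner1]) (use outer1 in \<open>auto simp: summable_on_def g_def a0\<close>)
  have gs: "(g has_sum (\<Sum>l. real l * a l)) (UNIV \<times> UNIV)"
    by (rule has_sum_SigmaI[OF inner1 outer1 g_sum])
  have inner2: "((\<lambda>l. g (l, k)) has_sum (norm (bshift G (Suc k)))\<^sup>2) UNIV" for k
  proof -
    have "((\<lambda>n. a (n + Suc k)) has_sum (norm (bshift G (Suc k)))\<^sup>2) UNIV"
      using norm_sums[of "bshift G (Suc k)"] hcoef_bshift[of G] sa
      by (intro norm_summable_imp_has_sum) (auto simp: a_def sums_iff)
    moreover have "inj (\<lambda>n. n + Suc k)" by (auto intro: injI)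
    ultimately have "((\<lambda>l. g (l, k)) has_sum (norm (bshift G (Suc k)))\<^sup>2) (range (\<lambda>n. n + Suc k))"
      by (subst has_sum_reindex) (auto simp: o_def g_def)
    then show ?thesis
    proof (subst (asm) has_sum_cong_neutral[where T = UNIV and g = "\<lambda>l. g (l, k)"])
      fix x assume "x \<in> UNIV - range (\<lambda>n. n + Suc k)"
      then have "\<not> k < x" by (metis DiffD2 add.commute le_add_diff_inverse Suc_leI rangeI)
      then show "g (x, k) = 0" by (simp add: g_def)
    qed auto
  qed
  have "((\<lambda>(k, l). g (l, k)) has_sum (\<Sum>l. real l * a l)) (UNIV \<times> UNIV)"
    using gs by (subst (asm) has_sum_swap) simp
  then have "((\<lambda>k. (norm (bshift G (Suc k)))\<^sup>2) has_sum (\<Sum>l. real l * a l)) UNIV"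
    by (rule has_sum_SigmaD) (use inner2 in simp)
  then show ?thesis unfolding a_def by (rule has_sum_imp_sums)
qed


section \<open>The commutator of an analytic and a coanalytic Toeplitz operator\<close>

lemma ex_nuclear_sum:
  fixes v w :: "nat \<Rightarrow> 'a::complex_hilbert"
  assumes sm: "summable (\<lambda>k. norm (v k) * norm (w k))"
  shows "\<exists>N. complex_linear N \<and> nuclear_sum N v w"
proof -
  define r where "r = (\<lambda>k. Blinfun (\<lambda>x. cinner x (v k) *\<^sub>C w k))"
  have bl: "bounded_linear (\<lambda>x. cinner x (v k) *\<^sub>C w k)" for k
    by (rule bounded_linear_compose[OF scaleC.bounded_linear_left cinner.bounded_linear_left])
  have r: "blinfun_apply (r k) x = cinner x (v k) *\<^sub>C w k" for k x
    unfolding r_def by (simp add: bounded_linear_Blinfun_apply[OF bl])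
  have nr: "norm (r k) \<le> norm (v k) * norm (w k)" for k
  proof (rule norm_blinfun_bound)
    fix x
    have "cmod (cinner x (v k)) * norm (w k) \<le> (norm x * norm (v k)) * norm (w k)"
      by (intro mult_right_mono cinner_norm_le) auto
    then show "norm (r k x) \<le> norm (v k) * norm (w k) * norm x" by (simp add: r norm_scaleC mult_ac)
  qed simp
  have "summable r" by (rule summable_comparison_test'[OF sm]) (use nr in auto)
  then obtain N where N: "r sums N" by (auto simp: summable_def)
  have s: "(\<lambda>k. cinner x (v k) * cinner (w k) y) sums cinner (N x) y" for x y
  proof -
    have "(\<lambda>k. cinner (r k x) y) sums cinner (N x) y"
      by (intro bounded_linear.sums[OF cinner.bounded_linear_left] bounded_linear.sums[OF blinfun.bounded_linear_left] N)
    then show ?thesis by (simp add: r cinner_scaleC_left)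
  qed
  have "complex_linear N"
    unfolding complex_linear_def
  proof (intro allI)
    fix c x
    show "N (c *\<^sub>C x) = c *\<^sub>C N x"
    proof (rule cinner_ext_left)
      fix y
      have "(\<lambda>k. c * (cinner x (v k) * cinner (w k) y)) sums (c * cinner (N x) y)" by (intro sums_mult s)
      moreover have "(\<lambda>k. c * (cinner x (v k) * cinner (w k) y)) sums cinner (N (c *\<^sub>C x)) y"
        using s[of "c *\<^sub>C x" y] by (simp add: cinner_scaleC_left mult.assoc)
      ultimately show "cinner (N (c *\<^sub>C x)) y = cinner (c *\<^sub>C N x) y"
        using sums_unique2 by (metis cinner_scaleC_left)
    qed
  qed
  then show ?thesis using s sm unfolding nuclear_sum_def by blast
qed

lemma blinfun_eq_on_zpow:
  fixes P Q :: "h2 \<Rightarrow>\<^sub>L h2"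
  assumes "complex_linear P" "complex_linear Q"
    and eq: "\<And>a b. cinner (P (zpow a)) (zpow b) = cinner (Q (zpow a)) (zpow b)"
  shows "P = Q"
proof (rule blinfun_eqI)
  fix x
  have z: "P (zpow a) = Q (zpow a)" for a by (rule hcoef_ext) (simp add: hcoef_def eq)
  have sP: "(\<lambda>n. P (hcoef x n *\<^sub>C zpow n)) sums P x" and sQ: "(\<lambda>n. Q (hcoef x n *\<^sub>C zpow n)) sums Q x"
    by (intro bounded_linear.sums[OF blinfun.bounded_linear_right] hcoef_sums)+
  have "P (hcoef x n *\<^sub>C zpow n) = Q (hcoef x n *\<^sub>C zpow n)" for n
    using assms(1,2) z by (simp add: complex_linear_def)
  then show "P x = Q x" using sums_unique2[OF sP] sQ by simp
qed

text \<open>The Dirichlet integral of \<open>G\<close> divided by \<open>\<pi>\<close>.\<close>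

definition energy :: "complex fps \<Rightarrow> real" where
  "energy G = (\<Sum>l. real l * (cmod (fps_nth G l))\<^sup>2)"

definition finite_energy :: "complex fps \<Rightarrow> bool" where
  "finite_energy G \<longleftrightarrow> summable (\<lambda>l. real l * (cmod (fps_nth G l))\<^sup>2)"

lemma bshift_energy:
  "finite_energy G \<Longrightarrow> (\<lambda>k. (norm (bshift G (Suc k)))\<^sup>2) sums energy G"
  unfolding finite_energy_def energy_def by (rule bshift_norm_sums)

lemma mult_le_sum_squares: "(a::real) * b \<le> a\<^sup>2 + b\<^sup>2"
proof -
  have "0 \<le> (a - b)\<^sup>2 + a\<^sup>2 + b\<^sup>2" by simp
  then show ?thesis by (simp add: power2_eq_square algebra_simps)
qed

lemma summable_bshift_mult:
  assumes "finite_energy F" "finite_energy G"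
  shows "summable (\<lambda>k. norm (bshift F (Suc k)) * norm (bshift G (Suc k)))"
proof (rule summable_comparison_test')
  show "summable (\<lambda>k. (norm (bshift F (Suc k)))\<^sup>2 + (norm (bshift G (Suc k)))\<^sup>2)"
    using bshift_energy[OF assms(1)] bshift_energy[OF assms(2)] by (intro summable_add) (auto simp: sums_iff)
  show "norm (norm (bshift F (Suc k)) * norm (bshift G (Suc k))) \<le>
      (norm (bshift F (Suc k)))\<^sup>2 + (norm (bshift G (Suc k)))\<^sup>2" if "k \<ge> 0" for k
    using mult_le_sum_squares by simp
qed

text \<open>On \<open>z\<^sup>a\<close> and \<open>z\<^sup>b\<close> the form of \<open>T*R\<close> is the sum over all \<open>m \<ge> 0\<close> of \<open>u m = G\<^sub>m\<^sub>-\<^sub>a cnj F\<^sub>m\<^sub>-\<^sub>b\<close>, while that of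
  \<open>R T*\<close> is \<open>\<Sum>\<^sub>m cnj F\<^sub>a\<^sub>-\<^sub>m G\<^sub>b\<^sub>-\<^sub>m\<close>. The substitution \<open>m \<mapsto> a + b - m\<close> identifies the latter with the part
  \<open>m \<le> a + b\<close> of the former. What is left is the sum over \<open>m = a + b + 1 + k\<close> of
  \<open>G\<^sub>b\<^sub>+\<^sub>1\<^sub>+\<^sub>k cnj F\<^sub>a\<^sub>+\<^sub>1\<^sub>+\<^sub>k\<close>, a product of coefficients of backward shifts.\<close>

theorem nuclear_sum_commutator:
  assumes T: "mult_op T F" and R: "mult_op R G" and T': "adjoint_pair T T'" and R': "adjoint_pair R R'"
    and F: "finite_energy F" and G: "finite_energy G"
  shows "nuclear_sum (T' \<odot> R - R \<odot> T') (\<lambda>k. bshift F (Suc k)) (\<lambda>k. bshift G (Suc k))"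
proof -
  define v where "v = (\<lambda>k. bshift F (Suc k))"
  define w where "w = (\<lambda>k. bshift G (Suc k))"
  have v: "hcoef (v k) n = fps_nth F (n + Suc k)" for k n
    unfolding v_def by (rule hcoef_bshift[OF mult_op_summable[OF T]])
  have w: "hcoef (w k) n = fps_nth G (n + Suc k)" for k n
    unfolding w_def by (rule hcoef_bshift[OF mult_op_summable[OF R]])
  have "summable (\<lambda>k. norm (v k) * norm (w k))" unfolding v_def w_def by (rule summable_bshift_mult[OF F G])
  then obtain N where N: "complex_linear N" "nuclear_sum N v w" using ex_nuclear_sum by blast
  let ?Q = "T' \<odot> R - R \<odot> T'"
  have clQ: "complex_linear ?Q"
    by (rule adjoint_pair_complex_linear[OF adjoint_pair_diff[OF
          adjoint_pair_compose[OF adjoint_pair_sym[OF T'] R'] adjoint_pair_compose[OF R' adjoint_pair_sym[OF T']]]])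
  have "?Q = N"
  proof (rule blinfun_eq_on_zpow[OF clQ N(1)])
    fix a b
    \<comment> \<open>Extending the coefficients by \<open>0\<close> to negative indices avoids case distinctions in the substitution.\<close>
    define f where "f = (\<lambda>j::int. if j < 0 then 0 else fps_nth F (nat j))"
    define g where "g = (\<lambda>j::int. if j < 0 then 0 else fps_nth G (nat j))"
    have Tz: "hcoef (T (zpow i)) m = f (int m - int i)" for i m
      by (auto simp: mult_op_zpow_coef[OF T] f_def nat_diff_distrib)
    have Rz: "hcoef (R (zpow i)) m = g (int m - int i)" for i m
      by (auto simp: mult_op_zpow_coef[OF R] g_def nat_diff_distrib)
    have T'z: "hcoef (T' (zpow i)) m = cnj (f (int i - int m))" for i m
      unfolding hcoef_def adjoint_pairD[OF adjoint_pair_sym[OF T']] Tz[symmetric]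
      by (subst cinner_commute) (simp add: hcoef_def)
    have R'z: "hcoef (R' (zpow i)) m = cnj (g (int i - int m))" for i m
      unfolding hcoef_def adjoint_pairD[OF adjoint_pair_sym[OF R']] Rz[symmetric]
      by (subst cinner_commute) (simp add: hcoef_def)
    define u where "u = (\<lambda>m::nat. g (int m - int a) * cnj (f (int m - int b)))"
    define n where "n = a + b + 1"
    have "u sums cinner (R (zpow a)) (T (zpow b))"
      using cinner_sums[of "R (zpow a)" "T (zpow b)"] by (simp add: Rz Tz u_def)
    then have 1: "u sums cinner ((T' \<odot> R) (zpow a)) (zpow b)"
      by (simp add: adjoint_pairD[OF adjoint_pair_sym[OF T']])
    have "(\<lambda>m. cnj (f (int a - int m)) * g (int b - int m)) sums cinner (T' (zpow a)) (R' (zpow b))"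
      using cinner_sums[of "T' (zpow a)" "R' (zpow b)"] by (simp add: R'z T'z)
    moreover have "(\<lambda>m. cnj (f (int a - int m)) * g (int b - int m)) sums
        (\<Sum>m<n. cnj (f (int a - int m)) * g (int b - int m))"
      by (rule sums_finite) (auto simp: f_def g_def n_def)
    ultimately have "cinner ((R \<odot> T') (zpow a)) (zpow b) = (\<Sum>m<n. cnj (f (int a - int m)) * g (int b - int m))"
      using sums_unique2 by (auto simp: adjoint_pairD[OF R'])
    also have "\<dots> = (\<Sum>m<n. u (n - Suc m))"
    proof (rule sum.cong)
      fix m assume "m \<in> {..<n}"
      then have "int (n - Suc m) = int a + int b - int m" by (auto simp: n_def of_nat_diff)
      then show "cnj (f (int a - int m)) * g (int b - int m) = u (n - Suc m)"
        by (simp add: u_def mult.commute)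
    qed simp
    also have "\<dots> = sum u {..<n}" by (rule sum.nat_diff_reindex)
    finally have 2: "cinner ((R \<odot> T') (zpow a)) (zpow b) = sum u {..<n}" .
    have "(\<lambda>k. u (k + n)) sums (cinner ((T' \<odot> R) (zpow a)) (zpow b) - sum u {..<n})"
      using 1 by (simp add: sums_iff_shift')
    then have 3: "(\<lambda>k. u (k + n)) sums cinner (?Q (zpow a)) (zpow b)"
      using 2 by (simp add: blinfun.diff_left cinner.diff_left)
    have "u (k + n) = cinner (zpow a) (v k) * cinner (w k) (zpow b)" for k
    proof -
      have eqs: "int (k + n) - int a = int (b + Suc k)" "int (k + n) - int b = int (a + Suc k)" by (auto simp: n_def)
      have nn: "f (int j) = fps_nth F j" "g (int j) = fps_nth G j" for j by (simp_all add: f_def g_def)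
      have "u (k + n) = fps_nth G (b + Suc k) * cnj (fps_nth F (a + Suc k))"
        unfolding u_def eqs nn ..
      moreover have "cinner (zpow a) (v k) = cnj (hcoef (v k) a)" unfolding hcoef_def by (rule cinner_commute)
      moreover have "cinner (w k) (zpow b) = hcoef (w k) b" by (simp add: hcoef_def)
      ultimately show ?thesis by (simp only: v w mult.commute)
    qed
    then have "(\<lambda>k. cinner (zpow a) (v k) * cinner (w k) (zpow b)) sums cinner (?Q (zpow a)) (zpow b)"
      using 3 by simp
    moreover have "(\<lambda>k. cinner (zpow a) (v k) * cinner (w k) (zpow b)) sums cinner (N (zpow a)) (zpow b)"
      using N(2) by (simp add: nuclear_sum_def)
    ultimately show "cinner (?Q (zpow a)) (zpow b) = cinner (N (zpow a)) (zpow b)" by (rule sums_unique2)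
  qed
  then show ?thesis using N(2) by (simp add: v_def w_def)
qed

lemma triangle_sum:
  fixes q :: "nat \<Rightarrow> 'a::comm_semiring_1"
  shows "(\<Sum>k\<le>l. \<Sum>j\<le>l - k. q (j + k)) = (\<Sum>p\<le>l. of_nat (Suc p) * q p)"
proof -
  have "(\<Sum>k\<le>l. \<Sum>j\<le>l - k. q (j + k)) = (\<Sum>(k, j)\<in>Sigma {..l} (\<lambda>k. {..l - k}). q (j + k))"
    by (rule sum.Sigma) auto
  also have "Sigma {..l} (\<lambda>k. {..l - k}) = {(i, j). i + j \<le> l}" by auto
  also have "(\<Sum>(k, j)\<in>{(i, j). i + j \<le> l}. q (j + k)) = (\<Sum>p\<le>l. \<Sum>i\<le>p. q ((p - i) + i))"
    using sum.triangle_reindex_eq[of "\<lambda>k j. q (j + k)" l] by simp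
  also have "\<dots> = (\<Sum>p\<le>l. of_nat (Suc p) * q p)" by (intro sum.cong refl) (simp del: of_nat_Suc)
  finally show ?thesis .
qed

text \<open>Let \<open>G = F\<^sup>m\<^sup>+\<^sup>1\<close>. The inner product of \<open>S*\<^sup>k\<^sup>+\<^sup>1 G\<close> with \<open>F\<^sup>m \<sqdot> S*\<^sup>k\<^sup>+\<^sup>1 F\<close> is a sum over \<open>i\<close>; collecting the terms
  with \<open>i + k = l\<close> leaves \<open>G\<^sub>l\<^sub>+\<^sub>1\<close> times the conjugate of \<open>\<Sum>\<^sub>p (p + 1) F\<^sub>p\<^sub>+\<^sub>1 (F\<^sup>m)\<^sub>l\<^sub>-\<^sub>p\<close>, which is the \<open>l\<close>-th
  coefficient of \<open>F' F\<^sup>m = G'/(m + 1)\<close>.\<close>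

lemma trace_commutator_sum:
  assumes T: "mult_op T F" and F: "finite_energy F" and G: "finite_energy (F ^ Suc m)"
  shows "(\<lambda>k. cinner (bshift (F ^ Suc m) (Suc k)) (opow T m (bshift F (Suc k))))
     sums complex_of_real (energy (F ^ Suc m) / real (Suc m))"
proof -
  define G' where "G' = F ^ Suc m"
  define v where "v = (\<lambda>k. bshift F (Suc k))"
  define w where "w = (\<lambda>k. bshift G' (Suc k))"
  define y where "y = (\<lambda>k. opow T m (v k))"
  have v: "hcoef (v k) n = fps_nth F (n + Suc k)" for k n
    unfolding v_def by (rule hcoef_bshift[OF mult_op_summable[OF T]])
  have w: "hcoef (w k) n = fps_nth G' (n + Suc k)" for k n
    unfolding w_def G'_def by (rule hcoef_bshift[OF mult_op_summable[OF mult_op_opow[OF T]]])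
  have y: "hcoef (y k) n = (\<Sum>j\<le>n. fps_nth F (j + Suc k) * fps_nth (F ^ m) (n - j))" for k n
    unfolding y_def mult_op_coef[OF mult_op_opow[OF T]] v ..
  define a where "a = (\<lambda>(k, i). hcoef (w k) i * cnj (hcoef (y k) i))"
  \<comment> \<open>A summable majorant of \<open>|a|\<close>, which justifies the rearrangement of the double sum.\<close>
  define b where "b = (\<lambda>(k, i). (cmod (hcoef (w k) i))\<^sup>2 + (cmod (hcoef (y k) i))\<^sup>2)"
  have "b summable_on (UNIV \<times> UNIV)"
  proof (rule summable_on_SigmaI)
    show "((\<lambda>i. b (k, i)) has_sum ((norm (w k))\<^sup>2 + (norm (y k))\<^sup>2)) UNIV" for k
      unfolding b_def using norm_sums[of "w k"] norm_sums[of "y k"]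
      by (simp, intro has_sum_add norm_summable_imp_has_sum) (auto simp: sums_iff)
    show "(\<lambda>k. (norm (w k))\<^sup>2 + (norm (y k))\<^sup>2) summable_on UNIV"
    proof (subst summable_on_UNIV_nonneg_real_iff)
      show "summable (\<lambda>k. (norm (w k))\<^sup>2 + (norm (y k))\<^sup>2)"
      proof (intro summable_add)
        show "summable (\<lambda>k. (norm (w k))\<^sup>2)" using bshift_energy[OF G] by (simp add: w_def G'_def sums_iff)
        show "summable (\<lambda>k. (norm (y k))\<^sup>2)"
        proof (rule summable_comparison_test')
          show "summable (\<lambda>k. (norm (opow T m))\<^sup>2 * (norm (v k))\<^sup>2)"
            using bshift_energy[OF F] by (intro summable_mult) (simp add: v_def sums_iff)
          show "norm ((norm (y k))\<^sup>2) \<le> (norm (opow T m))\<^sup>2 * (norm (v k))\<^sup>2" if "k \<ge> 0" for k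
            using power_mono[OF norm_blinfun[of "opow T m" "v k"] norm_ge_zero, of 2]
            by (simp add: y_def power_mult_distrib)
        qed
      qed
    qed simp
  qed (auto simp: b_def)
  then have "(\<lambda>x. norm (a x)) summable_on (UNIV \<times> UNIV)"
  proof (rule Infinite_Sum.abs_summable_on_comparison_test')
    fix x :: "nat \<times> nat"
    obtain k i where x: "x = (k, i)" by force
    have "cmod (hcoef (w k) i) * cmod (hcoef (y k) i) \<le> (cmod (hcoef (w k) i))\<^sup>2 + (cmod (hcoef (y k) i))\<^sup>2"
      by (rule mult_le_sum_squares)
    then show "norm (a x) \<le> b x" by (simp add: x a_def b_def norm_mult)
  qed
  then obtain S where S: "(a has_sum S) (UNIV \<times> UNIV)"
    using Infinite_Sum.abs_summable_summable summable_on_def by blast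
  have "((\<lambda>k. cinner (w k) (y k)) has_sum S) UNIV"
  proof (rule has_sum_SigmaD[OF S])
    fix k
    have "summable (\<lambda>i. norm (a (k, i)))"
    proof (rule summable_comparison_test')
      show "summable (\<lambda>i. (cmod (hcoef (w k) i))\<^sup>2 + (cmod (hcoef (y k) i))\<^sup>2)"
        using norm_sums[of "w k"] norm_sums[of "y k"] by (intro summable_add) (auto simp: sums_iff)
      show "norm (norm (a (k, i))) \<le> (cmod (hcoef (w k) i))\<^sup>2 + (cmod (hcoef (y k) i))\<^sup>2" if "i \<ge> 0" for i
        using mult_le_sum_squares by (simp add: a_def norm_mult)
    qed
    then show "((\<lambda>i. a (k, i)) has_sum cinner (w k) (y k)) UNIV"
      using cinner_sums[of "w k" "y k"] by (intro norm_summable_imp_has_sum) (auto simp: a_def)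
  qed
  then have sums_S: "(\<lambda>k. cinner (w k) (y k)) sums S" by (rule has_sum_imp_sums)
  have bij: "bij_betw (\<lambda>(l, k). (k, l - k)) (Sigma UNIV (\<lambda>l. {..l})) (UNIV \<times> UNIV :: (nat \<times> nat) set)"
    by (rule bij_betwI[where g = "\<lambda>(k, i). (i + k, k)"]) auto
  have "((\<lambda>x. a (case x of (l, k) \<Rightarrow> (k, l - k))) has_sum S) (Sigma UNIV (\<lambda>l. {..l}))"
    using has_sum_reindex_bij_betw[OF bij, of a S] S by simp
  then have "((\<lambda>l. \<Sum>k\<le>l. a (k, l - k)) has_sum S) UNIV"
    by (rule has_sum_SigmaD) (auto intro: has_sum_finiteI)
  then have 1: "(\<lambda>l. \<Sum>k\<le>l. a (k, l - k)) sums S" by (rule has_sum_imp_sums)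
  have "(\<Sum>k\<le>l. a (k, l - k)) = complex_of_real (real (Suc l) * (cmod (fps_nth G' (Suc l)))\<^sup>2 / real (Suc m))" for l
  proof -
    have "(\<Sum>k\<le>l. a (k, l - k)) = (\<Sum>k\<le>l. fps_nth G' (Suc l) * cnj (hcoef (y k) (l - k)))"
      by (intro sum.cong) (auto simp: a_def w)
    also have "\<dots> = fps_nth G' (Suc l) * cnj (\<Sum>k\<le>l. hcoef (y k) (l - k))"
      by (simp add: sum_distrib_left cnj_sum)
    also have "(\<Sum>k\<le>l. hcoef (y k) (l - k)) =
        (\<Sum>k\<le>l. \<Sum>j\<le>l - k. (\<lambda>p. fps_nth F (Suc p) * fps_nth (F ^ m) (l - p)) (j + k))"
      unfolding y by (intro sum.cong refl) (simp add: diff_diff_eq add.commute)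
    also have "\<dots> = (\<Sum>p\<le>l. of_nat (Suc p) * (fps_nth F (Suc p) * fps_nth (F ^ m) (l - p)))"
      by (rule triangle_sum)
    also have "\<dots> = fps_nth (fps_deriv F * F ^ m) l"
      by (simp add: fps_mult_nth atLeast0AtMost mult.assoc)
    finally have e: "(\<Sum>k\<le>l. a (k, l - k)) = fps_nth G' (Suc l) * cnj (fps_nth (fps_deriv F * F ^ m) l)" .
    have "fps_deriv G' = fps_const (of_nat (Suc m)) * (fps_deriv F * F ^ m)"
      unfolding G'_def by (simp only: fps_deriv_power diff_Suc_1 mult.assoc)
    then have "fps_nth (fps_deriv G') l = of_nat (Suc m) * fps_nth (fps_deriv F * F ^ m) l"
      by (simp only: fps_mult_left_const_nth)
    then have "fps_nth (fps_deriv F * F ^ m) l = of_nat (Suc l) * fps_nth G' (Suc l) / of_nat (Suc m)"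
      by (simp add: field_simps del: of_nat_Suc)
    then have "(\<Sum>k\<le>l. a (k, l - k)) = of_nat (Suc l) * (fps_nth G' (Suc l) * cnj (fps_nth G' (Suc l))) / of_nat (Suc m)"
      unfolding e by (simp del: of_nat_Suc)
    also have "\<dots> = complex_of_real (real (Suc l) * (cmod (fps_nth G' (Suc l)))\<^sup>2 / real (Suc m))"
      unfolding complex_norm_square[symmetric] by (simp del: of_nat_Suc)
    finally show ?thesis .
  qed
  then have 2: "(\<lambda>l. complex_of_real (real (Suc l) * (cmod (fps_nth G' (Suc l)))\<^sup>2 / real (Suc m))) sums S"
    using 1 by simp
  have "(\<lambda>l. real l * (cmod (fps_nth G' l))\<^sup>2) sums energy G'"
    using G unfolding finite_energy_def energy_def G'_def by (rule summable_sums)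
  then have "(\<lambda>l. real (Suc l) * (cmod (fps_nth G' (Suc l)))\<^sup>2) sums energy G'"
    by (subst sums_Suc_iff) simp
  then have "(\<lambda>l. complex_of_real (real (Suc l) * (cmod (fps_nth G' (Suc l)))\<^sup>2 / real (Suc m))) sums
      complex_of_real (energy G' / real (Suc m))"
    by (intro sums_of_real sums_divide)
  then have "S = complex_of_real (energy G' / real (Suc m))" using 2 sums_unique2 by blast
  then show ?thesis using sums_S by (simp only: v_def w_def y_def G'_def)
qed

lemma traceable_zero: "traceable 0 (\<lambda>_. 0)"
  by (auto simp: traceable_def)

lemma traceable_minus: "traceable X \<tau> \<Longrightarrow> traceable (- X) (\<lambda>Z. - \<tau> Z)"
  unfolding traceable_def
  by (simp add: blinfun.minus_left blinfun.minus_right cinner.minus_left has_sum_uminus)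

text \<open>With \<open>A = T*T\<close> put \<open>Q\<^sub>n = T* T\<^sup>n\<^sup>+\<^sup>1 - T\<^sup>n\<^sup>+\<^sup>1 T*\<close> and \<open>Y\<^sub>n = T A\<^sup>n - T*\<^sup>n T\<^sup>n\<^sup>+\<^sup>1\<close>. Then
  \<open>(T*T)\<^sup>m\<^sup>+\<^sup>1 - (TT*)\<^sup>m\<^sup>+\<^sup>1 = [T*, Y\<^sub>m] + T*\<^sup>m Q\<^sub>m\<close>. Moving one factor \<open>T*\<close> past \<open>T\<^sup>n\<^sup>+\<^sup>1\<close> shows
  \<open>Y\<^sub>n\<^sub>+\<^sub>1 = Y\<^sub>n A - T*\<^sup>n Q\<^sub>n T\<close>, so every \<open>Y\<^sub>n\<close> is a sum of products with nuclear factors \<open>Q\<^sub>j\<close>. Hence the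
  commutator \<open>[T*, Y\<^sub>m]\<close> has trace \<open>0\<close>.\<close>

theorem trace_power_difference:
  assumes T: "mult_op T F" and T': "adjoint_pair T T'" and F: "\<And>m. finite_energy (F ^ Suc m)"
    and E: "orthonormal_basis E"
  shows "((\<lambda>e. cinner ((opow (T' \<odot> T) (Suc m) - opow (T \<odot> T') (Suc m)) e) e) has_sum
     complex_of_real (energy (F ^ Suc m) / real (Suc m))) E"
proof -
  have F1: "finite_energy F" using F[of 0] by simp
  define A where "A = T' \<odot> T"
  note T'T = adjoint_pair_sym[OF T']
  have A: "adjoint_pair A A" unfolding A_def by (rule adjoint_pair_compose[OF T'T T'])
  have op: "adjoint_pair (opow T n) (opow T' n)" for n by (rule adjoint_pair_opow[OF T'])
  define Q where "Q = (\<lambda>n. T' \<odot> opow T (Suc n) - opow T (Suc n) \<odot> T')"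
  have nQ: "nuclear_sum (Q n) (\<lambda>k. bshift F (Suc k)) (\<lambda>k. bshift (F ^ Suc n) (Suc k))" for n
    unfolding Q_def by (rule nuclear_sum_commutator[OF T mult_op_opow[OF T] T' op F1 F])
  define Y where "Y = (\<lambda>n. T \<odot> opow A n - opow T' n \<odot> opow T (Suc n))"
  have Y: "\<exists>\<tau>. traceable (Y n) \<tau>" for n
  proof (induction n)
    case 0
    have "Y 0 = 0" by (simp add: Y_def)
    then show ?case using traceable_zero by auto
  next
    case (Suc n)
    then obtain \<tau> where \<tau>: "traceable (Y n) \<tau>" by blast
    have YS: "Y (Suc n) = Y n \<odot> A + - (opow T' n \<odot> (Q n \<odot> T))"
    proof (rule blinfun_eqI)
      fix x
      have c: "opow X n (X z) = X (opow X n z)" for X :: "h2 \<Rightarrow>\<^sub>L h2" and n z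
        using arg_cong[OF opow_commute[of X n], of "\<lambda>W. blinfun_apply W z"] by simp
      show "blinfun_apply (Y (Suc n)) x = blinfun_apply (Y n \<odot> A + - (opow T' n \<odot> (Q n \<odot> T))) x"
        using c[of "T' \<odot> T"] by (simp add: Y_def Q_def A_def blinfun.bilinear_simps c)
    qed
    note traceable_minus[OF traceable_left[OF traceable_right[OF traceable_nuclear_sum[OF nQ[of n]] T']
          adjoint_pair_opow[OF T'T, of n]]]
    then show ?case unfolding YS by - (rule exI, rule traceable_add[OF traceable_right[OF \<tau> A]])
  qed
  obtain \<tau> where \<tau>: "traceable (Y m) \<tau>" using Y by blast
  have B: "opow (T \<odot> T') (Suc m) = T \<odot> opow A m \<odot> T'"
  proof (induction m)
    case (Suc m)
    have "opow (T \<odot> T') (Suc (Suc m)) = (T \<odot> T') \<odot> (T \<odot> opow A m \<odot> T')" using Suc by simp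
    then show ?case by (simp add: A_def compose_assoc)
  qed simp
  have dec: "opow (T' \<odot> T) (Suc m) - opow (T \<odot> T') (Suc m) = (T' \<odot> Y m - Y m \<odot> T') + opow T' m \<odot> Q m"
  proof (rule blinfun_eqI)
    fix x
    have c: "opow X n (X z) = X (opow X n z)" for X :: "h2 \<Rightarrow>\<^sub>L h2" and n z
      using arg_cong[OF opow_commute[of X n], of "\<lambda>W. blinfun_apply W z"] by simp
    show "blinfun_apply (opow (T' \<odot> T) (Suc m) - opow (T \<odot> T') (Suc m)) x =
        blinfun_apply ((T' \<odot> Y m - Y m \<odot> T') + opow T' m \<odot> Q m) x"
      unfolding B by (simp add: Y_def Q_def A_def[symmetric] blinfun.bilinear_simps) (simp add: A_def c)
  qed
  have "((\<lambda>e. cinner ((opow T' m \<odot> Q m) e) e) has_sum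
      (\<Sum>k. cinner (opow T' m (bshift (F ^ Suc m) (Suc k))) (bshift F (Suc k)))) E"
    using traceableD[OF traceable_nuclear_sum[OF nQ] adjoint_pair_opow[OF T'T] adjoint_pair_id E, of m m] by simp
  also have "(\<Sum>k. cinner (opow T' m (bshift (F ^ Suc m) (Suc k))) (bshift F (Suc k))) =
      complex_of_real (energy (F ^ Suc m) / real (Suc m))"
    using trace_commutator_sum[OF T F1 F, of m]
    by (simp only: adjoint_pairD[OF adjoint_pair_opow[OF T'T]] sums_iff)
  finally have 2: "((\<lambda>e. cinner ((opow T' m \<odot> Q m) e) e) has_sum
      complex_of_real (energy (F ^ Suc m) / real (Suc m))) E" .
  have 1: "((\<lambda>e. cinner ((T' \<odot> Y m - Y m \<odot> T') e) e) has_sum 0) E"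
    by (rule traceable_commutator[OF \<tau> T'T E])
  show ?thesis
    using has_sum_add[OF 1 2] unfolding dec by (simp add: blinfun.add_left cinner.add_left)
qed


section \<open>Area integrals of power series\<close>

lemma lborel_complex_eq: "(lborel :: complex measure) = distr (lborel \<Otimes>\<^sub>M lborel) borel (\<lambda>(x, y). Complex x y)"
proof (rule lborel_eqI)
  have m [measurable]: "(\<lambda>(x, y). Complex x y) \<in> borel_measurable (lborel \<Otimes>\<^sub>M lborel)"
    unfolding Complex_eq by measurable
  fix l u :: complex assume le: "\<And>b. b \<in> Basis \<Longrightarrow> l \<bullet> b \<le> u \<bullet> b"
  have le': "Re l \<le> Re u" "Im l \<le> Im u"
    using le[of 1] le[of \<i>] by (auto simp: Basis_complex_def)
  have "emeasure (distr (lborel \<Otimes>\<^sub>M lborel) borel (\<lambda>(x, y). Complex x y)) (box l u) =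
      emeasure (lborel \<Otimes>\<^sub>M lborel) ((\<lambda>(x, y). Complex x y) -` box l u \<inter> space (lborel \<Otimes>\<^sub>M lborel))"
    by (rule emeasure_distr) auto
  also have "(\<lambda>(x, y). Complex x y) -` box l u \<inter> space (lborel \<Otimes>\<^sub>M lborel) = {Re l<..<Re u} \<times> {Im l<..<Im u}"
    by (auto simp: box_def Basis_complex_def space_pair_measure)
  also have "emeasure (lborel \<Otimes>\<^sub>M lborel) ({Re l<..<Re u} \<times> {Im l<..<Im u}) =
      emeasure lborel {Re l<..<Re u} * emeasure lborel {Im l<..<Im u}"
    by (rule lborel.emeasure_pair_measure_Times) auto
  also have "\<dots> = ennreal (\<Prod>b\<in>Basis. (u - l) \<bullet> b)"
    using le' by (simp add: Basis_complex_def ennreal_mult)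
  finally show "emeasure (distr (lborel \<Otimes>\<^sub>M lborel) borel (\<lambda>(x, y). Complex x y)) (box l u) =
      ennreal (\<Prod>b\<in>Basis. (u - l) \<bullet> b)" .
qed simp

lemma Complex_measurable [measurable]:
  "f \<in> borel_measurable M \<Longrightarrow> g \<in> borel_measurable M \<Longrightarrow> (\<lambda>x. Complex (f x) (g x)) \<in> borel_measurable M"
  by (subst borel_measurable_complex_iff) simp

lemma indicator_disc_measurable [measurable]:
  "(\<lambda>z. indicator (ball 0 1) z :: ennreal) \<in> borel_measurable (borel :: complex measure)"
  "(\<lambda>z. indicator (ball 0 1) z :: real) \<in> borel_measurable (borel :: complex measure)"
  by (intro borel_measurable_indicator; simp)+

lemma nn_integral_complex:
  fixes u :: "complex \<Rightarrow> ennreal"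
  assumes [measurable]: "u \<in> borel_measurable borel"
  shows "(\<integral>\<^sup>+z. u z \<partial>lborel) = (\<integral>\<^sup>+x. \<integral>\<^sup>+y. u (Complex x y) \<partial>lborel \<partial>lborel)"
    and "(\<integral>\<^sup>+z. u z \<partial>lborel) = (\<integral>\<^sup>+y. \<integral>\<^sup>+x. u (Complex x y) \<partial>lborel \<partial>lborel)"
proof -
  have "(\<integral>\<^sup>+z. u z \<partial>lborel) = (\<integral>\<^sup>+(x, y). u (Complex x y) \<partial>(lborel \<Otimes>\<^sub>M lborel))"
    unfolding lborel_complex_eq by (subst nn_integral_distr) (auto simp: case_prod_unfold)
  also have "\<dots> = (\<integral>\<^sup>+x. \<integral>\<^sup>+y. u (Complex x y) \<partial>lborel \<partial>lborel)"
    by (subst lborel.nn_integral_fst[symmetric]) auto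
  finally show 1: "(\<integral>\<^sup>+z. u z \<partial>lborel) = (\<integral>\<^sup>+x. \<integral>\<^sup>+y. u (Complex x y) \<partial>lborel \<partial>lborel)" .
  show "(\<integral>\<^sup>+z. u z \<partial>lborel) = (\<integral>\<^sup>+y. \<integral>\<^sup>+x. u (Complex x y) \<partial>lborel \<partial>lborel)"
    unfolding 1 by (rule lborel_pair.Fubini') measurable
qed

lemma nn_integral_translate:
  fixes h :: "real \<Rightarrow> ennreal"
  assumes [measurable]: "h \<in> borel_measurable borel"
  shows "(\<integral>\<^sup>+x. h (x + t) \<partial>lborel) = (\<integral>\<^sup>+x. h x \<partial>lborel)"
  using nn_integral_real_affine[of h 1 t] by (simp add: add.commute)

text \<open>A shear translates each horizontal, or each vertical, line.\<close>

lemma nn_integral_shear: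
  fixes u :: "complex \<Rightarrow> ennreal"
  assumes [measurable]: "u \<in> borel_measurable borel"
  shows "(\<integral>\<^sup>+z. u (Complex (Re z + a * Im z) (Im z)) \<partial>lborel) = (\<integral>\<^sup>+z. u z \<partial>lborel)"
    and "(\<integral>\<^sup>+z. u (Complex (Re z) (Im z + a * Re z)) \<partial>lborel) = (\<integral>\<^sup>+z. u z \<partial>lborel)"
proof -
  have "(\<integral>\<^sup>+z. u (Complex (Re z + a * Im z) (Im z)) \<partial>lborel) =
      (\<integral>\<^sup>+y. \<integral>\<^sup>+x. u (Complex (x + a * y) y) \<partial>lborel \<partial>lborel)"
    by (subst nn_integral_complex(2)) simp_all
  also have "\<dots> = (\<integral>\<^sup>+y. \<integral>\<^sup>+x. u (Complex x y) \<partial>lborel \<partial>lborel)"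
    by (intro nn_integral_cong nn_integral_translate) measurable
  finally show "(\<integral>\<^sup>+z. u (Complex (Re z + a * Im z) (Im z)) \<partial>lborel) = (\<integral>\<^sup>+z. u z \<partial>lborel)"
    by (simp add: nn_integral_complex(2))
  have "(\<integral>\<^sup>+z. u (Complex (Re z) (Im z + a * Re z)) \<partial>lborel) =
      (\<integral>\<^sup>+x. \<integral>\<^sup>+y. u (Complex x (y + a * x)) \<partial>lborel \<partial>lborel)"
    by (subst nn_integral_complex(1)) simp_all
  also have "\<dots> = (\<integral>\<^sup>+x. \<integral>\<^sup>+y. u (Complex x y) \<partial>lborel \<partial>lborel)"
    by (intro nn_integral_cong nn_integral_translate) measurable
  finally show "(\<integral>\<^sup>+z. u (Complex (Re z) (Im z + a * Re z)) \<partial>lborel) = (\<integral>\<^sup>+z. u z \<partial>lborel)"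
    by (simp add: nn_integral_complex(1))
qed

text \<open>A rotation whose angle is not a multiple of \<open>\<pi>\<close> is a product of three shears.\<close>

lemma nn_integral_rotate_aux:
  fixes u :: "complex \<Rightarrow> ennreal"
  assumes [measurable]: "u \<in> borel_measurable borel" and w: "cmod w = 1" "Im w \<noteq> 0"
  shows "(\<integral>\<^sup>+z. u (w * z) \<partial>lborel) = (\<integral>\<^sup>+z. u z \<partial>lborel)"
proof -
  define c where "c = Re w"
  define s where "s = Im w"
  define a where "a = (c - 1) / s"
  have s: "s \<noteq> 0" and cs: "c\<^sup>2 + s\<^sup>2 = 1" using w by (auto simp: c_def s_def cmod_def)
  have 1: "1 + a * s = c" using s by (simp add: a_def)
  have 2: "a * (1 + c) = - s"
  proof -
    have "(c - 1) * (1 + c) = - s * s" using cs by (simp add: power2_eq_square algebra_simps)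
    then show ?thesis using s by (simp add: a_def field_simps)
  qed
  define v1 where "v1 = (\<lambda>z. u (Complex (Re z + a * Im z) (Im z)))"
  define v2 where "v2 = (\<lambda>z. v1 (Complex (Re z) (Im z + s * Re z)))"
  have [measurable]: "v1 \<in> borel_measurable borel" unfolding v1_def by measurable
  have [measurable]: "v2 \<in> borel_measurable borel" unfolding v2_def by measurable
  have "u (w * z) = v2 (Complex (Re z + a * Im z) (Im z))" for z
  proof -
    define x where "x = Re z"
    define y where "y = Im z"
    have i: "y + s * (x + a * y) = s * x + c * y"
      using 1 by (simp add: algebra_simps) (metis distrib_left mult.assoc mult.commute mult.right_neutral)
    have "x + a * y + a * (s * x + c * y) = (1 + a * s) * x + a * (1 + c) * y" by (simp add: algebra_simps)
    then have r: "x + a * y + a * (s * x + c * y) = c * x - s * y" unfolding 1 2 by simp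
    have "w * z = Complex (c * x - s * y) (s * x + c * y)"
      by (simp add: complex_eq_iff c_def s_def x_def y_def)
    then show ?thesis unfolding v2_def v1_def by (simp flip: x_def y_def add: i r)
  qed
  then have "(\<integral>\<^sup>+z. u (w * z) \<partial>lborel) = (\<integral>\<^sup>+z. v2 (Complex (Re z + a * Im z) (Im z)) \<partial>lborel)" by simp
  also have "\<dots> = (\<integral>\<^sup>+z. v2 z \<partial>lborel)" by (rule nn_integral_shear) measurable
  also have "\<dots> = (\<integral>\<^sup>+z. v1 z \<partial>lborel)" unfolding v2_def by (rule nn_integral_shear) measurable
  also have "\<dots> = (\<integral>\<^sup>+z. u z \<partial>lborel)" unfolding v1_def by (rule nn_integral_shear) measurable
  finally show ?thesis .
qed

lemma nn_integral_rotate: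
  fixes u :: "complex \<Rightarrow> ennreal"
  assumes u [measurable]: "u \<in> borel_measurable borel" and w: "cmod w = 1"
  shows "(\<integral>\<^sup>+z. u (w * z) \<partial>lborel) = (\<integral>\<^sup>+z. u z \<partial>lborel)"
proof (cases "Im w = 0")
  case True
  \<comment> \<open>Here \<open>w = 1\<close> or \<open>w = - 1\<close>, and \<open>w = (- \<i> w) \<sqdot> \<i>\<close> is a product of two rotations that are not real.\<close>
  have "(\<integral>\<^sup>+z. u (w * z) \<partial>lborel) = (\<integral>\<^sup>+z. u ((- \<i> * w) * (\<i> * z)) \<partial>lborel)" by (simp add: mult_ac)
  also have "\<dots> = (\<integral>\<^sup>+z. u ((- \<i> * w) * z) \<partial>lborel)"
    by (rule nn_integral_rotate_aux[where u = "\<lambda>z. u ((- \<i> * w) * z)"]) auto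
  also have "\<dots> = (\<integral>\<^sup>+z. u z \<partial>lborel)"
    using True w by (intro nn_integral_rotate_aux) (auto simp: norm_mult cmod_def)
  finally show ?thesis .
qed (use nn_integral_rotate_aux[OF u w] in auto)

text \<open>The set where \<open>x < |z|\<^sup>2 < 1\<close> is an annulus of area \<open>\<pi> (1 - x)\<close>. So \<open>|z|\<^sup>2\<close> carries area measure on the disc
  to \<open>\<pi>\<close> times Lebesgue measure on \<open>[0, 1]\<close>, and the integral becomes that of \<open>\<pi> r\<^sup>m\<close>.\<close>

lemma nn_integral_disc_power:
  "(\<integral>\<^sup>+z. indicator (ball 0 1) z * ennreal (cmod z ^ (2 * m)) \<partial>lborel) = ennreal (pi / real (Suc m))"
proof -
  define M where "M = distr (density lborel (indicator (ball 0 1))) borel (\<lambda>z::complex. (cmod z)\<^sup>2)"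
  define N where "N = density lborel (\<lambda>r::real. ennreal pi * indicator {0..1} r)"
  have "M = N"
  proof (rule measure_eqI_lessThan)
    fix x :: real
    \<comment> \<open>The inner radius of the annulus, for \<open>x\<close> outside \<open>[0, 1]\<close> as well.\<close>
    define r where "r = min 1 (sqrt (max 0 x))"
    have r: "0 \<le> r" "r \<le> 1" "r\<^sup>2 = min 1 (max 0 x)"
      by (auto simp: r_def min_def max_def)
    have "emeasure M {x<..} = emeasure lborel (ball (0::complex) 1 - (if x < 0 then {} else cball 0 r))"
    proof -
      have iff: "cmod z \<le> r \<longleftrightarrow> (cmod z)\<^sup>2 \<le> x" if "x \<ge> 0" "cmod z < 1" for z
        using that real_le_rsqrt[of "cmod z" x] power_mono[of "cmod z" "sqrt x" 2] by (auto simp: r_def)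
      have "indicator (ball 0 1) z * indicator ((\<lambda>z. (cmod z)\<^sup>2) -` {x<..}) z =
          (indicator (ball (0::complex) 1 - (if x < 0 then {} else cball 0 r)) z :: ennreal)" for z
        using iff[of z] less_le_trans[of x 0 "(cmod z)\<^sup>2"]
        by (cases "cmod z < 1") (auto simp: indicator_def not_less)
      note ind = this
      have "(\<lambda>z::complex. (cmod z)\<^sup>2) \<in> borel_measurable borel" by measurable
      from measurable_sets[OF this, of "{x<..}"]
      have X: "(\<lambda>z::complex. (cmod z)\<^sup>2) -` {x<..} \<in> sets borel" by simp
      have "emeasure M {x<..} = emeasure (density lborel (indicator (ball 0 1))) ((\<lambda>z::complex. (cmod z)\<^sup>2) -` {x<..})"
        unfolding M_def by (subst emeasure_distr) auto
      also have "\<dots> = (\<integral>\<^sup>+z. indicator (ball (0::complex) 1 - (if x < 0 then {} else cball 0 r)) z \<partial>lborel)"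
        using X by (subst emeasure_density) (simp_all add: ind)
      finally show ?thesis by simp
    qed
    also have "\<dots> = ennreal (pi * (1 - r\<^sup>2))"
    proof -
      consider "x < 0" | "0 \<le> x" "x < 1" | "x \<ge> 1" by linarith
      then show ?thesis
      proof cases
        case 2
        then have "r < 1" by (simp add: r_def)
        then have "cball 0 r \<subseteq> ball (0::complex) 1" by auto
        then show ?thesis
          using 2 r emeasure_ball[of 1 "0::complex"] emeasure_cball[of r "0::complex"]
          by (simp add: emeasure_Diff unit_ball_vol_2 ennreal_minus right_diff_distrib)
      next
        case 3
        then have empty: "ball 0 1 - cball 0 r = ({} :: complex set)" by (auto simp: r_def)
        have "\<not> x < 0" using 3 by simp
        then show ?thesis unfolding if_not_P[OF \<open>\<not> x < 0\<close>] empty using 3 r by simp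
      qed (use r emeasure_ball[of 1 "0::complex"] in \<open>simp add: unit_ball_vol_2\<close>)
    qed
    finally have 1: "emeasure M {x<..} = ennreal (pi * (1 - r\<^sup>2))" .
    then show "emeasure M {x<..} < \<infinity>" by simp
    have "emeasure N {x<..} = ennreal pi * emeasure lborel ({0..1} \<inter> {x<..})"
      by (simp add: N_def emeasure_density mult.assoc nn_integral_cmult indicator_inter_arith[symmetric])
    also have "{0..1} \<inter> {x<..} = (if x < 0 then {0..1} else {x<..1})" by auto
    finally show "emeasure M {x<..} = emeasure N {x<..}"
      using r by (auto simp: 1 ennreal_mult r_def min_def max_def)
  qed (auto simp: M_def N_def)
  have "(\<integral>\<^sup>+z. indicator (ball 0 1) z * ennreal (cmod z ^ (2 * m)) \<partial>lborel) = (\<integral>\<^sup>+r. ennreal (r ^ m) \<partial>M)"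
    by (simp add: M_def nn_integral_distr nn_integral_density power_mult)
  also have "\<dots> = (\<integral>\<^sup>+r. ennreal (pi * r ^ m) * indicator {0..1} r \<partial>lborel)"
    unfolding \<open>M = N\<close> N_def
    by (subst nn_integral_density) (auto intro!: nn_integral_cong simp: indicator_def ennreal_mult)
  also have "\<dots> = ennreal (pi * 1 ^ Suc m / real (Suc m) - pi * 0 ^ Suc m / real (Suc m))"
  proof (rule nn_integral_FTC_Icc)
    show "((\<lambda>r. pi * r ^ Suc m / real (Suc m)) has_field_derivative pi * r ^ m) (at r)" for r
      by (rule DERIV_cong[OF DERIV_cdivide[OF DERIV_cmult[OF DERIV_pow]]]) (simp del: of_nat_Suc)
  qed auto
  finally show ?thesis by simp
qed

lemma abs_l2_trig_sum:
  "square_integrable (\<lambda>t. \<Sum>l<N. d l * cis (of_int (int l) * t)) \<and>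
   abs_l2 (\<lambda>t. \<Sum>l<N. d l * cis (of_int (int l) * t)) = h2_l2 (\<Sum>l<N. d l *\<^sub>C zpow l)"
proof (induction N)
  case 0
  have "square_integrable (\<lambda>_. 0)" by (rule square_integrable_bounded[where C = 0]) auto
  then show ?case by (simp add: zero_h2.rep_eq zero_l2_def)
next
  case (Suc N)
  let ?p = "\<lambda>t. \<Sum>l<N. d l * cis (of_int (int l) * t)"
  let ?q = "\<lambda>t. d N * cis (of_int (int N) * t)"
  have p: "square_integrable ?p" and q: "square_integrable ?q"
    using Suc square_integrable_scale[OF square_integrable_trig[of "int N"], of "d N"] by simp_all
  have "abs_l2 (\<lambda>t. ?p t + ?q t) = abs_l2 ?p + abs_l2 ?q"
    using p q by (simp add: plus_l2.abs_eq l2_rel_def)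
  also have "abs_l2 ?q = d N *\<^sub>C trig (int N)"
    unfolding trig_def using square_integrable_trig[of "int N"] by (subst scaleC_l2.abs_eq) (simp_all add: l2_rel_def)
  finally show ?case
    using Suc square_integrable_add[OF p q] by (simp add: plus_h2.rep_eq scaleC_h2.rep_eq h2_l2_zpow)
qed

text \<open>Parseval's identity for the partial sums, which are bounded by \<open>\<Sum>\<^sub>l |d\<^sub>l|\<close>, so that dominated convergence applies.\<close>

lemma nn_integral_circle_power_series:
  assumes sm: "summable (\<lambda>l. cmod (d l))"
  shows "(\<integral>\<^sup>+t. ennreal ((cmod (\<Sum>l. d l * cis (of_int (int l) * t)))\<^sup>2) \<partial>circle_measure) = (\<Sum>l. ennreal ((cmod (d l))\<^sup>2))"
proof -
  define C where "C = (\<Sum>l. cmod (d l))"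
  have C: "C \<ge> 0" unfolding C_def by (intro suminf_nonneg sm) auto
  define p where "p = (\<lambda>N t. \<Sum>l<N. d l * cis (of_int (int l) * t))"
  define P where "P = (\<lambda>t. \<Sum>l. d l * cis (of_int (int l) * t))"
  have pm [measurable]: "p N \<in> borel_measurable borel" for N unfolding p_def by measurable
  have s: "summable (\<lambda>l. d l * cis (of_int (int l) * t))" for t
    by (rule summable_norm_cancel) (simp add: norm_mult sm)
  have lim: "(\<lambda>N. p N t) \<longlonglongrightarrow> P t" for t
    unfolding p_def P_def by (rule summable_LIMSEQ[OF s])
  have pb: "cmod (p N t) \<le> C" for N t
  proof -
    have "cmod (p N t) \<le> (\<Sum>l<N. cmod (d l))"
      unfolding p_def by (rule order_trans[OF norm_sum]) (simp add: norm_mult)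
    also have "\<dots> \<le> C" unfolding C_def by (rule sum_le_suminf[OF sm]) auto
    finally show ?thesis .
  qed
  have "P \<in> borel_measurable borel" by (rule borel_measurable_LIMSEQ_metric[OF pm lim])
  have Pb: "cmod (P t) \<le> C" for t
    by (rule Lim_bounded[OF tendsto_norm[OF lim]]) (use pb in auto)
  have P: "square_integrable P"
    by (rule square_integrable_bounded[where C = C]) (use \<open>P \<in> borel_measurable borel\<close> Pb in auto)
  have [measurable]: "P \<in> borel_measurable borel" by fact
  have "(\<lambda>N. LINT t|circle_measure. (cmod (p N t))\<^sup>2) \<longlonglongrightarrow> (LINT t|circle_measure. (cmod (P t))\<^sup>2)"
  proof (rule integral_dominated_convergence[where w = "\<lambda>_. C\<^sup>2"])
    show "AE t in circle_measure. (\<lambda>N. (cmod (p N t))\<^sup>2) \<longlonglongrightarrow> (cmod (P t))\<^sup>2"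
      by (intro AE_I2 tendsto_intros lim)
    show "AE t in circle_measure. norm ((cmod (p N t))\<^sup>2) \<le> C\<^sup>2" for N
      using pb by (intro AE_I2) (simp add: power_mono)
  qed auto
  moreover have "(LINT t|circle_measure. (cmod (p N t))\<^sup>2) = (\<Sum>l<N. (cmod (d l))\<^sup>2)" for N
  proof -
    have "(LINT t|circle_measure. (cmod (p N t))\<^sup>2) = (norm (abs_l2 (p N)))\<^sup>2"
      by (simp only: p_def norm_abs_l2[OF conjunct1[OF abs_l2_trig_sum]])
    also have "\<dots> = (norm (\<Sum>l<N. d l *\<^sub>C zpow l))\<^sup>2"
      using abs_l2_trig_sum[of d N] by (simp add: p_def norm_h2.rep_eq)
    finally show ?thesis by (simp add: norm_zpow_combination)
  qed
  ultimately have "(\<lambda>l. (cmod (d l))\<^sup>2) sums (LINT t|circle_measure. (cmod (P t))\<^sup>2)" by (simp add: sums_def)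
  then have "(\<Sum>l. ennreal ((cmod (d l))\<^sup>2)) = ennreal (LINT t|circle_measure. (cmod (P t))\<^sup>2)"
    by (subst suminf_ennreal2) (auto simp: sums_iff)
  also have "\<dots> = (\<integral>\<^sup>+t. ennreal ((cmod (P t))\<^sup>2) \<partial>circle_measure)"
    using nn_integral_norm_abs_l2[OF P] norm_abs_l2[OF P] by simp
  finally show ?thesis by (simp add: P_def)
qed

lemma eval_fps_measurable [measurable]: "eval_fps (G :: complex fps) \<in> borel_measurable borel"
  unfolding eval_fps_def by measurable

text \<open>By rotation invariance the integrand may be replaced by its mean over circles centred at \<open>0\<close>. By Parseval's
  identity this mean is \<open>\<Sum>\<^sub>l |G\<^sub>l|\<^sup>2 |z|\<^sup>2\<^sup>l\<close>.\<close>

lemma nn_integral_disc_power_series: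
  fixes G :: "complex fps"
  assumes R: "fps_conv_radius G \<ge> 1"
  shows "(\<integral>\<^sup>+z. indicator (ball 0 1) z * ennreal ((cmod (eval_fps G z))\<^sup>2) \<partial>lborel) =
     (\<Sum>l. ennreal (pi * (cmod (fps_nth G l))\<^sup>2 / real (Suc l)))"
proof -
  interpret pair_sigma_finite circle_measure "lborel :: complex measure"
    by (intro pair_sigma_finite.intro circle.sigma_finite_measure_axioms sigma_finite_lborel)
  define u where "u = (\<lambda>z. indicator (ball 0 1) z * ennreal ((cmod (eval_fps G z))\<^sup>2))"
  have [measurable]: "u \<in> borel_measurable borel" unfolding u_def by measurable
  have "(\<integral>\<^sup>+z. u z \<partial>lborel) = (\<integral>\<^sup>+t. \<integral>\<^sup>+z. u (cis t * z) \<partial>lborel \<partial>circle_measure)"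
    by (simp add: nn_integral_rotate circle.emeasure_space_1[unfolded space_circle_measure])
  also have "\<dots> = (\<integral>\<^sup>+z. \<integral>\<^sup>+t. u (cis t * z) \<partial>circle_measure \<partial>lborel)"
    by (rule Fubini'[symmetric]) measurable
  also have "\<dots> = (\<integral>\<^sup>+z. (\<Sum>l. ennreal ((cmod (fps_nth G l))\<^sup>2) * (indicator (ball 0 1) z * ennreal (cmod z ^ (2 * l)))) \<partial>lborel)"
  proof (rule nn_integral_cong)
    fix z :: complex
    show "(\<integral>\<^sup>+t. u (cis t * z) \<partial>circle_measure) =
        (\<Sum>l. ennreal ((cmod (fps_nth G l))\<^sup>2) * (indicator (ball 0 1) z * ennreal (cmod z ^ (2 * l))))"
    proof (cases "z \<in> ball 0 1")
      case True
      then have "ereal (cmod z) < 1" by simp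
      then have zR: "ereal (cmod z) < fps_conv_radius G" using R by (rule less_le_trans)
      have sm: "summable (\<lambda>l. cmod (fps_nth G l * z ^ l))" by (rule norm_summable_fps[OF zR])
      have "u (cis t * z) = ennreal ((cmod (\<Sum>l. (fps_nth G l * z ^ l) * cis (of_int (int l) * t)))\<^sup>2)" for t
      proof -
        have "eval_fps G (cis t * z) = (\<Sum>l. (fps_nth G l * z ^ l) * cis (of_int (int l) * t))"
          unfolding eval_fps_def by (intro suminf_cong) (simp add: power_mult_distrib Complex.DeMoivre mult_ac)
        then show ?thesis using True by (simp add: u_def norm_mult indicator_def)
      qed
      then have "(\<integral>\<^sup>+t. u (cis t * z) \<partial>circle_measure) = (\<Sum>l. ennreal ((cmod (fps_nth G l * z ^ l))\<^sup>2))"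
        using nn_integral_circle_power_series[OF sm] by simp
      then show ?thesis using True
        by (simp add: norm_mult norm_power power_mult_distrib ennreal_mult power_mult[symmetric] mult.commute[of _ 2])
    next
      case False
      then show ?thesis by (simp add: u_def norm_mult indicator_def)
    qed
  qed
  also have "\<dots> = (\<Sum>l. ennreal ((cmod (fps_nth G l))\<^sup>2) * (\<integral>\<^sup>+z. indicator (ball 0 1) z * ennreal (cmod z ^ (2 * l)) \<partial>lborel))"
    by (subst nn_integral_suminf) (auto simp: nn_integral_cmult)
  also have "\<dots> = (\<Sum>l. ennreal (pi * (cmod (fps_nth G l))\<^sup>2 / real (Suc l)))"
    unfolding nn_integral_disc_power
    by (intro suminf_cong) (simp add: ennreal_mult[symmetric] mult.commute del: of_nat_Suc)
  finally show ?thesis by (simp add: u_def)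
qed

lemma nn_integral_disc_deriv:
  fixes G :: "complex fps"
  assumes R: "fps_conv_radius G \<ge> 1"
  shows "(\<integral>\<^sup>+z. indicator (ball 0 1) z * ennreal ((cmod (eval_fps (fps_deriv G) z))\<^sup>2) \<partial>lborel) =
     (\<Sum>l. ennreal (pi * (real (Suc l) * (cmod (fps_nth G (Suc l)))\<^sup>2)))"
proof -
  have R': "fps_conv_radius (fps_deriv G) \<ge> 1" using R fps_conv_radius_deriv[of G] by (rule order_trans)
  have "pi * (cmod (fps_nth (fps_deriv G) l))\<^sup>2 / real (Suc l) = pi * (real (Suc l) * (cmod (fps_nth G (Suc l)))\<^sup>2)" for l
    by (simp add: norm_mult power_mult_distrib power2_eq_square field_simps del: of_nat_Suc)
  then show ?thesis using nn_integral_disc_power_series[OF R'] by simp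
qed

lemma finite_energy_iff:
  assumes R: "fps_conv_radius G \<ge> 1"
  shows "finite_energy G \<longleftrightarrow> (\<integral>\<^sup>+z. indicator (ball 0 1) z * ennreal ((cmod (eval_fps (fps_deriv G) z))\<^sup>2) \<partial>lborel) < \<infinity>"
    and "finite_energy G \<Longrightarrow> (\<integral>\<^sup>+z. indicator (ball 0 1) z * ennreal ((cmod (eval_fps (fps_deriv G) z))\<^sup>2) \<partial>lborel) = ennreal (pi * energy G)"
proof -
  define a where "a = (\<lambda>l. real l * (cmod (fps_nth G l))\<^sup>2)"
  have a0: "a l \<ge> 0" for l by (simp add: a_def)
  have I: "(\<integral>\<^sup>+z. indicator (ball 0 1) z * ennreal ((cmod (eval_fps (fps_deriv G) z))\<^sup>2) \<partial>lborel) = (\<Sum>l. ennreal (pi * a (Suc l)))"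
    unfolding nn_integral_disc_deriv[OF R] a_def ..
  show 2: "(\<integral>\<^sup>+z. indicator (ball 0 1) z * ennreal ((cmod (eval_fps (fps_deriv G) z))\<^sup>2) \<partial>lborel) = ennreal (pi * energy G)"
    if "finite_energy G"
  proof -
    have "a sums energy G" using that unfolding finite_energy_def energy_def a_def by (rule summable_sums)
    then have "(\<lambda>l. a (Suc l)) sums energy G" by (subst sums_Suc_iff) (simp add: a_def)
    then have "(\<lambda>l. pi * a (Suc l)) sums (pi * energy G)" by (rule sums_mult)
    then show ?thesis unfolding I by (subst suminf_ennreal2) (auto simp: sums_iff a0)
  qed
  show "finite_energy G \<longleftrightarrow> (\<integral>\<^sup>+z. indicator (ball 0 1) z * ennreal ((cmod (eval_fps (fps_deriv G) z))\<^sup>2) \<partial>lborel) < \<infinity>"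
  proof
    assume "(\<integral>\<^sup>+z. indicator (ball 0 1) z * ennreal ((cmod (eval_fps (fps_deriv G) z))\<^sup>2) \<partial>lborel) < \<infinity>"
    then have "(\<Sum>l. ennreal (pi * a (Suc l))) \<noteq> top" unfolding I by auto
    then have "summable (\<lambda>l. pi * a (Suc l))" by (intro summable_suminf_not_top) (auto simp: a0)
    then have "summable (\<lambda>l. a (Suc l))" by (simp add: summable_cmult_iff)
    then show "finite_energy G" unfolding finite_energy_def a_def by (subst (asm) summable_Suc_iff)
  qed (simp add: 2)
qed


section \<open>Bounded analytic functions on the disc\<close>

lemma fps_conv_radius_ge_1:
  fixes G :: "complex fps"
  assumes "\<And>n. cmod (fps_nth G n) \<le> C"
  shows "fps_conv_radius G \<ge> 1"
  unfolding fps_conv_radius_def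
proof (rule conv_radius_geI_ex')
  fix r :: real assume r: "0 < r" "ereal r < 1"
  show "summable (\<lambda>n. fps_nth G n * of_real r ^ n)"
  proof (rule summable_comparison_test')
    show "summable (\<lambda>n. C * r ^ n)" using r by (intro summable_mult summable_geometric) auto
    show "norm (fps_nth G n * of_real r ^ n) \<le> C * r ^ n" if "n \<ge> 0" for n
      using assms[of n] r by (simp add: norm_mult norm_power mult_right_mono)
  qed
qed

lemma mult_op_conv_radius:
  assumes "mult_op T G"
  shows "fps_conv_radius G \<ge> 1"
proof (rule fps_conv_radius_ge_1)
  fix n
  have "fps_nth G n = hcoef (T (zpow 0)) n" by (simp add: mult_op_zpow_coef[OF assms])
  also have "cmod \<dots> \<le> norm (T (zpow 0)) * norm (zpow n)" unfolding hcoef_def by (rule cinner_norm_le)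
  also have "norm (zpow n) = 1" using cinner_self[of "zpow n"] cinner_zpow[of n n]
    by (metis norm_ge_zero of_real_eq_1_iff power2_eq_1_iff abs_norm_cancel abs_1 power2_abs one_power2 power2_eq_iff_nonneg zero_le_one)
  finally show "cmod (fps_nth G n) \<le> norm (T (zpow 0))" by simp
qed

text \<open>The vector \<open>k\<close> with coefficients \<open>cnj z\<^sup>n\<close> reproduces the value at \<open>z\<close>, so \<open>T* k = cnj G(z) \<sqdot> k\<close>, and an
  eigenvalue is bounded by the norm.\<close>

lemma mult_op_eval_le:
  assumes T: "mult_op T G" and M: "norm T \<le> M" and z: "cmod z < 1"
  shows "cmod (eval_fps G z) \<le> M"
proof -
  have zz: "cmod z ^ 2 < 1" using z by (simp add: power_less_one_iff abs_square_less_1)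
  have "summable (\<lambda>n. (cmod (cnj z ^ n))\<^sup>2)"
    using zz by (simp add: norm_power power_mult[symmetric] mult.commute[of _ 2]) (simp add: power_mult summable_geometric)
  then obtain k where k: "\<And>n. hcoef k n = cnj z ^ n" using ex_hcoef by blast
  have zR: "ereal (cmod z) < fps_conv_radius G"
    using mult_op_conv_radius[OF T] z by (metis ereal_less(3) less_le_trans one_ereal_def)
  define p where "p = (\<lambda>n. cnj z ^ n * z ^ n)"
  define q where "q = (\<lambda>n. fps_nth G n * z ^ n)"
  have sp: "summable (\<lambda>n. cmod (p n))"
    using zz by (simp add: p_def norm_mult norm_power power_mult_distrib[symmetric] power2_eq_square[symmetric] summable_geometric)
  have sq: "summable (\<lambda>n. cmod (q n))" unfolding q_def by (rule norm_summable_fps[OF zR])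
  have kk: "cinner k k = (\<Sum>n. p n)"
    using cinner_sums[of k k] by (simp add: k p_def sums_iff)
  have "cinner (T k) k = (\<Sum>n. \<Sum>i\<le>n. p i * q (n - i))"
  proof -
    have "hcoef (T k) n * cnj (hcoef k n) = (\<Sum>i\<le>n. p i * q (n - i))" for n
      unfolding mult_op_coef[OF T] k p_def q_def sum_distrib_right
    proof (rule sum.cong)
      fix i assume "i \<in> {..n}"
      then have "z ^ n = z ^ i * z ^ (n - i)" by (simp add: power_add[symmetric])
      then show "cnj z ^ i * fps_nth G (n - i) * cnj (cnj z ^ n) = cnj z ^ i * z ^ i * (fps_nth G (n - i) * z ^ (n - i))"
        by (simp add: mult_ac)
    qed simp
    then show ?thesis using cinner_sums[of "T k" k] by (simp add: sums_iff)
  qed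
  also have "\<dots> = (\<Sum>n. p n) * (\<Sum>n. q n)" by (rule Cauchy_product[OF sp sq, symmetric])
  finally have "cinner (T k) k = cinner k k * eval_fps G z" by (simp add: kk q_def eval_fps_def)
  then have "(norm k)\<^sup>2 * cmod (eval_fps G z) = cmod (cinner (T k) k)"
    by (simp add: norm_mult cinner_self norm_power)
  also have "\<dots> \<le> norm (T k) * norm k" by (rule cinner_norm_le)
  also have "\<dots> \<le> (norm T * norm k) * norm k" by (intro mult_right_mono norm_blinfun) auto
  also have "\<dots> \<le> (M * norm k) * norm k" by (intro mult_right_mono M) auto
  finally have le: "(norm k)\<^sup>2 * cmod (eval_fps G z) \<le> (norm k)\<^sup>2 * M" by (simp add: power2_eq_square mult_ac)
  have "hcoef k 0 = 1" by (simp add: k)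
  then have "k \<noteq> 0" by (auto simp: hcoef_def)
  then have "(norm k)\<^sup>2 > 0" by simp
  then show ?thesis using le mult_le_cancel_left_pos by blast
qed

lemma eval_fps_power_disc:
  assumes R: "fps_conv_radius F \<ge> 1" and z: "cmod z < 1"
  shows "eval_fps (F ^ m) z = eval_fps F z ^ m"
    and "eval_fps (fps_deriv (F ^ Suc m)) z = of_nat (Suc m) * eval_fps F z ^ m * eval_fps (fps_deriv F) z"
proof -
  have zR: "ereal (cmod z) < 1" using z by simp
  have R': "fps_conv_radius (fps_deriv F) \<ge> 1" using R fps_conv_radius_deriv[of F] by (rule order_trans)
  have Rm: "fps_conv_radius (F ^ m) \<ge> 1" for m using R fps_conv_radius_power[of F m] by (rule order_trans)
  show p: "eval_fps (F ^ m) z = eval_fps F z ^ m" for m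
  proof (induction m)
    case (Suc m)
    then show ?case
      using eval_fps_mult[of z F "F ^ m"] less_le_trans[OF zR R] less_le_trans[OF zR Rm] by simp
  qed simp
  have "fps_deriv (F ^ Suc m) = fps_const (of_nat (Suc m)) * (F ^ m * fps_deriv F)"
    by (simp only: fps_deriv_power diff_Suc_1 mult.assoc mult.commute[of "fps_deriv F"])
  moreover have "fps_conv_radius (F ^ m * fps_deriv F) \<ge> 1"
    using fps_conv_radius_mult[of "F ^ m" "fps_deriv F"] Rm[of m] R' by (meson min.boundedI order_trans)
  ultimately show "eval_fps (fps_deriv (F ^ Suc m)) z = of_nat (Suc m) * eval_fps F z ^ m * eval_fps (fps_deriv F) z"
    using eval_fps_mult[of z "fps_const (of_nat (Suc m))" "F ^ m * fps_deriv F"]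
      eval_fps_mult[of z "F ^ m" "fps_deriv F"] less_le_trans[OF zR Rm[of m]] less_le_trans[OF zR R']
      less_le_trans[OF zR] p
    by (simp add: mult.assoc del: of_nat_Suc)
qed

text \<open>The formula is the area integral of \<open>|(F\<^sup>m\<^sup>+\<^sup>1)'|\<^sup>2\<close>, by the chain rule. That this is finite follows from the
  case \<open>m = 0\<close> because \<open>F\<close> is bounded by \<open>M\<close>.\<close>

theorem energy_power:
  assumes T: "mult_op T F" and M: "norm T \<le> M" and F: "finite_energy F"
  shows "set_integrable lborel (ball 0 1) (\<lambda>z. (cmod (eval_fps (fps_deriv F) z))\<^sup>2)"
    and "finite_energy (F ^ Suc m)"
    and "energy (F ^ Suc m) / real (Suc m) =
      1 / pi * (LINT z:ball 0 1|lborel. real (Suc m) * ((cmod (eval_fps F z))\<^sup>2) ^ m * (cmod (eval_fps (fps_deriv F) z))\<^sup>2)"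
proof -
  note R = mult_op_conv_radius[OF T]
  have M0: "M \<ge> 0" using M norm_ge_zero order_trans by blast
  have R': "fps_conv_radius (F ^ Suc m) \<ge> 1" using R fps_conv_radius_power[of F "Suc m"] by (rule order_trans)
  define D where "D = (\<lambda>z. (cmod (eval_fps (fps_deriv F) z))\<^sup>2)"
  have [measurable]: "D \<in> borel_measurable borel" unfolding D_def by measurable
  have fin: "(\<integral>\<^sup>+z. indicator (ball 0 1) z * ennreal (D z) \<partial>lborel) < \<infinity>"
    using finite_energy_iff(1)[OF R] F by (simp add: D_def)
  have "(\<integral>\<^sup>+z. ennreal (norm (indicat_real (ball 0 1) z *\<^sub>R D z)) \<partial>lborel) = (\<integral>\<^sup>+z. indicator (ball 0 1) z * ennreal (D z) \<partial>lborel)"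
    by (intro nn_integral_cong) (auto simp: indicator_def D_def)
  then have "integrable lborel (\<lambda>z. indicat_real (ball 0 1) z *\<^sub>R D z)"
    using fin by (intro integrableI_bounded) auto
  then show "set_integrable lborel (ball 0 1) (\<lambda>z. (cmod (eval_fps (fps_deriv F) z))\<^sup>2)"
    by (simp add: set_integrable_def D_def)
  define H where "H = (\<lambda>z. real (Suc m) * ((cmod (eval_fps F z))\<^sup>2) ^ m * D z)"
  have [measurable]: "H \<in> borel_measurable borel" unfolding H_def by measurable
  have H0: "H z \<ge> 0" for z by (simp add: H_def D_def)
  have e: "(cmod (eval_fps (fps_deriv (F ^ Suc m)) z))\<^sup>2 = real (Suc m) * H z" if "z \<in> ball 0 1" for z
    using that eval_fps_power_disc(2)[OF R, of z m]
    by (simp add: H_def D_def norm_mult norm_power power_mult_distrib power2_eq_square mult_ac del: of_nat_Suc)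
  have Hle: "real (Suc m) * H z \<le> (real (Suc m))\<^sup>2 * (M\<^sup>2) ^ m * D z" if "z \<in> ball 0 1" for z
  proof -
    have "cmod (eval_fps F z) \<le> M" using mult_op_eval_le[OF T M] that by simp
    then have "((cmod (eval_fps F z))\<^sup>2) ^ m \<le> (M\<^sup>2) ^ m" by (intro power_mono) auto
    then have "(real (Suc m))\<^sup>2 * ((cmod (eval_fps F z))\<^sup>2) ^ m * D z \<le> (real (Suc m))\<^sup>2 * (M\<^sup>2) ^ m * D z"
      by (intro mult_right_mono mult_left_mono) (auto simp: D_def)
    moreover have "real (Suc m) * H z = (real (Suc m))\<^sup>2 * ((cmod (eval_fps F z))\<^sup>2) ^ m * D z"
      unfolding H_def power2_eq_square[of "real (Suc m)"] by (simp only: mult.assoc)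
    ultimately show ?thesis by simp
  qed
  have "(\<integral>\<^sup>+z. indicator (ball 0 1) z * ennreal ((cmod (eval_fps (fps_deriv (F ^ Suc m)) z))\<^sup>2) \<partial>lborel) \<le>
      (\<integral>\<^sup>+z. ennreal ((real (Suc m))\<^sup>2 * (M\<^sup>2) ^ m) * (indicator (ball 0 1) z * ennreal (D z)) \<partial>lborel)"
  proof (rule nn_integral_mono)
    fix z :: complex
    have "ennreal ((real (Suc m))\<^sup>2 * (M\<^sup>2) ^ m) * ennreal (D z) = ennreal ((real (Suc m))\<^sup>2 * (M\<^sup>2) ^ m * D z)"
      by (rule ennreal_mult[symmetric]) (auto simp: D_def)
    then show "indicator (ball 0 1) z * ennreal ((cmod (eval_fps (fps_deriv (F ^ Suc m)) z))\<^sup>2) \<le>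
        ennreal ((real (Suc m))\<^sup>2 * (M\<^sup>2) ^ m) * (indicator (ball 0 1) z * ennreal (D z))"
      using Hle[of z] e[of z] by (cases "z \<in> ball 0 1") (auto simp: indicator_def intro!: ennreal_leI)
  qed
  also have "\<dots> = ennreal ((real (Suc m))\<^sup>2 * (M\<^sup>2) ^ m) * (\<integral>\<^sup>+z. indicator (ball 0 1) z * ennreal (D z) \<partial>lborel)"
    by (rule nn_integral_cmult) auto
  also have "\<dots> < \<infinity>" using fin by (simp add: ennreal_mult_less_top)
  finally show fe: "finite_energy (F ^ Suc m)" using finite_energy_iff(1)[OF R'] by simp
  have "ennreal (pi * energy (F ^ Suc m)) = (\<integral>\<^sup>+z. ennreal (indicat_real (ball 0 1) z *\<^sub>R (real (Suc m) * H z)) \<partial>lborel)"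
    unfolding finite_energy_iff(2)[OF R' fe, symmetric]
    by (intro nn_integral_cong) (auto simp: indicator_def e simp del: of_nat_Suc power_Suc)
  then have "pi * energy (F ^ Suc m) = (LINT z|lborel. indicat_real (ball 0 1) z *\<^sub>R (real (Suc m) * H z))"
  proof (subst integral_eq_nn_integral)
    assume eq: "ennreal (pi * energy (F ^ Suc m)) = (\<integral>\<^sup>+z. ennreal (indicat_real (ball 0 1) z *\<^sub>R (real (Suc m) * H z)) \<partial>lborel)"
    have "energy (F ^ Suc m) \<ge> 0" using fe unfolding energy_def finite_energy_def by (intro suminf_nonneg) auto
    then show "pi * energy (F ^ Suc m) = enn2real (\<integral>\<^sup>+z. ennreal (indicat_real (ball 0 1) z *\<^sub>R (real (Suc m) * H z)) \<partial>lborel)"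
      unfolding eq[symmetric] by simp
  qed (auto simp: H0)
  also have "\<dots> = real (Suc m) * (LINT z:ball 0 1|lborel. H z)"
    unfolding set_lebesgue_integral_def by (subst integral_mult_right_zero[symmetric]) (simp add: mult_ac)
  finally show "energy (F ^ Suc m) / real (Suc m) =
      1 / pi * (LINT z:ball 0 1|lborel. real (Suc m) * ((cmod (eval_fps F z))\<^sup>2) ^ m * (cmod (eval_fps (fps_deriv F) z))\<^sup>2)"
    by (simp add: H_def D_def field_simps del: of_nat_Suc)
qed


section \<open>Primitives of exponentials\<close>

text \<open>The primitive of \<open>x \<mapsto> exp(i x y)\<close> that vanishes at \<open>0\<close>. Its Taylor coefficients, without the vanishing constant
  term, are \<open>psi_coef\<close>.\<close>

definition psi :: "real \<Rightarrow> real \<Rightarrow> complex" where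
  "psi y x = (if y = 0 then complex_of_real x else (cis (x * y) - 1) / (\<i> * complex_of_real y))"

definition psi_coef :: "real \<Rightarrow> nat \<Rightarrow> complex" where
  "psi_coef y k = (\<i> * complex_of_real y) ^ k / fact (Suc k)"

lemma psi_deriv_sums:
  "(\<lambda>k. psi_coef y k * of_nat (Suc k) * complex_of_real x ^ k) sums cis (x * y)"
proof -
  have "(\<lambda>k. (\<i> * complex_of_real (x * y)) ^ k /\<^sub>R fact k) sums exp (\<i> * complex_of_real (x * y))"
    by (rule exp_converges)
  moreover have "(\<i> * complex_of_real (x * y)) ^ k /\<^sub>R fact k = psi_coef y k * of_nat (Suc k) * complex_of_real x ^ k" for k
  proof -
    have "psi_coef y k * of_nat (Suc k) = (\<i> * complex_of_real y) ^ k / fact k"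
      by (simp add: psi_coef_def field_simps del: of_nat_Suc)
    moreover have "(\<i> * complex_of_real (x * y)) ^ k /\<^sub>R fact k = (\<i> * complex_of_real y) ^ k / fact k * complex_of_real x ^ k"
      by (simp add: power_mult_distrib scaleR_conv_of_real field_simps)
    ultimately show ?thesis by simp
  qed
  ultimately show ?thesis by (simp add: cis_conv_exp)
qed

lemma psi_sums: "(\<lambda>k. psi_coef y k * complex_of_real x ^ Suc k) sums psi y x"
proof (cases "y = 0")
  case True
  have "(\<lambda>k. if k = 0 then complex_of_real x else 0) sums complex_of_real x"
    using sums_single[of 0 "\<lambda>_. complex_of_real x"] by simp
  moreover have "psi_coef y k * complex_of_real x ^ Suc k = (if k = 0 then complex_of_real x else 0)" for k
    using True by (simp add: psi_coef_def)
  ultimately show ?thesis using True by (simp add: psi_def)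
next
  case False
  have "(\<lambda>k. (\<i> * complex_of_real (x * y)) ^ k /\<^sub>R fact k) sums exp (\<i> * complex_of_real (x * y))"
    by (rule exp_converges)
  then have "(\<lambda>k. (\<i> * complex_of_real (x * y)) ^ Suc k /\<^sub>R fact (Suc k)) sums (cis (x * y) - 1)"
    by (subst sums_Suc_iff) (simp add: cis_conv_exp)
  then have "(\<lambda>k. (\<i> * complex_of_real (x * y)) ^ Suc k /\<^sub>R fact (Suc k) / (\<i> * complex_of_real y)) sums psi y x"
    using False by (simp add: psi_def sums_divide)
  moreover have "(\<i> * complex_of_real (x * y)) ^ Suc k /\<^sub>R fact (Suc k) / (\<i> * complex_of_real y) = psi_coef y k * complex_of_real x ^ Suc k" for k
    using False by (simp add: psi_coef_def power_mult_distrib scaleR_conv_of_real field_simps del: fact_Suc)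
  ultimately show ?thesis by simp
qed

lemma cmod_psi_le: "cmod (psi y x) \<le> \<bar>x\<bar>"
proof (cases "y = 0")
  case False
  have "cmod (cis (x * y) - 1) \<le> \<bar>x * y\<bar>"
    using iexp_approx1[of "x * y" 0] by (simp add: cis_conv_exp)
  then show ?thesis using False by (simp add: psi_def norm_divide norm_mult abs_mult field_simps)
qed (simp add: psi_def)

lemma psi_measurable [measurable]: "(\<lambda>y. psi y x) \<in> borel_measurable borel"
  unfolding psi_def by measurable

lemma power_diff_le:
  fixes v w R :: real
  assumes "\<bar>v\<bar> \<le> R" "\<bar>w\<bar> \<le> R"
  shows "\<bar>v ^ k - w ^ k\<bar> \<le> real k * R ^ (k - 1) * \<bar>v - w\<bar>"
proof (induction k)
  case (Suc k)
  have R: "R \<ge> 0" using assms by linarith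
  have "v ^ Suc k - w ^ Suc k = v * (v ^ k - w ^ k) + (v - w) * w ^ k" by (simp add: algebra_simps)
  then have "\<bar>v ^ Suc k - w ^ Suc k\<bar> \<le> \<bar>v\<bar> * \<bar>v ^ k - w ^ k\<bar> + \<bar>v - w\<bar> * \<bar>w\<bar> ^ k"
    by (metis abs_mult abs_triangle_ineq power_abs)
  also have "\<dots> \<le> R * (real k * R ^ (k - 1) * \<bar>v - w\<bar>) + \<bar>v - w\<bar> * R ^ k"
    by (intro add_mono mult_mono Suc power_mono assms) (use R in auto)
  also have "\<dots> = real (Suc k) * R ^ (Suc k - 1) * \<bar>v - w\<bar>"
    by (cases k) (auto simp: algebra_simps)
  finally show ?case .
qed simp

lemma exp_deriv_sums: "(\<lambda>k. real k * R ^ (k - 1) * c ^ k / fact k) sums (c * exp (R * c :: real))"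
proof -
  have "(\<lambda>k. c * ((R * c) ^ k /\<^sub>R fact k)) sums (c * exp (R * c))" by (intro sums_mult exp_converges)
  moreover have "c * ((R * c) ^ k /\<^sub>R fact k) = real (Suc k) * R ^ (Suc k - 1) * c ^ Suc k / fact (Suc k)" for k
    by (simp add: power_mult_distrib divide_simps del: of_nat_Suc)
  ultimately have "(\<lambda>k. real (Suc k) * R ^ (Suc k - 1) * c ^ Suc k / fact (Suc k)) sums (c * exp (R * c))" by simp
  then show ?thesis by (subst (asm) sums_Suc_iff) simp
qed

text \<open>The termwise estimate \<open>|v\<^sup>k - w\<^sup>k| \<le> k R\<^sup>k\<^sup>-\<^sup>1 |v - w|\<close> sums to a derivative of the exponential series. The
  weighted sum on the left controls the functions, their derivatives and the trace norm all at once.\<close>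

lemma psi_coef_diff_summable:
  assumes "\<bar>v\<bar> \<le> R" "\<bar>w\<bar> \<le> R" and c: "c \<ge> 0"
  shows "summable (\<lambda>k. cmod (psi_coef v k - psi_coef w k) * real (Suc k) * c ^ k)"
    and "(\<Sum>k. cmod (psi_coef v k - psi_coef w k) * real (Suc k) * c ^ k) \<le> c * exp (R * c) * \<bar>v - w\<bar>"
proof -
  have le: "cmod (psi_coef v k - psi_coef w k) * real (Suc k) * c ^ k \<le> real k * R ^ (k - 1) * c ^ k / fact k * \<bar>v - w\<bar>" for k
  proof -
    have "psi_coef v k - psi_coef w k = \<i> ^ k * complex_of_real ((v ^ k - w ^ k) / fact (Suc k))"
      by (simp add: psi_coef_def power_mult_distrib diff_divide_distrib right_diff_distrib del: fact_Suc)
    then have "cmod (psi_coef v k - psi_coef w k) = \<bar>v ^ k - w ^ k\<bar> / fact (Suc k)"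
      by (simp only: norm_mult norm_power norm_ii norm_of_real) (simp del: fact_Suc)
    then have "cmod (psi_coef v k - psi_coef w k) * real (Suc k) * c ^ k = \<bar>v ^ k - w ^ k\<bar> * (c ^ k / fact k)"
      by (simp add: field_simps del: of_nat_Suc)
    also have "\<dots> \<le> (real k * R ^ (k - 1) * \<bar>v - w\<bar>) * (c ^ k / fact k)"
      using c by (intro mult_right_mono power_diff_le assms) auto
    finally show ?thesis by (simp add: mult_ac)
  qed
  have s: "(\<lambda>k. real k * R ^ (k - 1) * c ^ k / fact k * \<bar>v - w\<bar>) sums (c * exp (R * c) * \<bar>v - w\<bar>)"
    by (intro sums_mult2 exp_deriv_sums)
  show sm: "summable (\<lambda>k. cmod (psi_coef v k - psi_coef w k) * real (Suc k) * c ^ k)"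
    by (rule summable_comparison_test'[OF sums_summable[OF s]]) (use le c in auto)
  show "(\<Sum>k. cmod (psi_coef v k - psi_coef w k) * real (Suc k) * c ^ k) \<le> c * exp (R * c) * \<bar>v - w\<bar>"
    using suminf_le[OF le sm sums_summable[OF s]] s by (simp add: sums_iff)
qed


section \<open>Integrals against complex measures\<close>

lemma finite_range_integral:
  fixes h :: "real \<Rightarrow> complex" and s :: "real \<Rightarrow> real" and \<nu> :: "real measure"
  assumes \<nu>: "finite_measure \<nu>" "sets \<nu> = sets borel"
    and s: "finite (range s)" "s \<in> borel_measurable borel"
  shows "integrable \<nu> (\<lambda>y. h (s y))"
    and "(LINT y|\<nu>. h (s y)) = (\<Sum>v\<in>range s. complex_of_real (measure \<nu> (s -` {v})) * h v)"
proof -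
  interpret finite_measure \<nu> by fact
  have sp: "space \<nu> = UNIV" using sets_eq_imp_space_eq[OF \<nu>(2)] by simp
  have S: "s -` {v} \<in> sets \<nu>" for v
    using measurable_sets[OF s(2), of "{v}"] \<nu>(2) by simp
  have eq: "h (s y) = (\<Sum>v\<in>range s. indicator (s -` {v}) y *\<^sub>R h v)" for y :: real
  proof -
    have "(\<Sum>v\<in>range s. indicator (s -` {v}) y *\<^sub>R h v) = (\<Sum>v\<in>range s. if v = s y then h v else 0)"
      by (intro sum.cong) (auto simp: indicator_def)
    then show ?thesis using s(1) by simp
  qed
  have int: "integrable \<nu> (\<lambda>y. indicator (s -` {v}) y *\<^sub>R h v)" for v
    by (intro integrable_scaleR_left integrable_real_indicator S) (simp add: less_top[symmetric] emeasure_finite)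
  show "integrable \<nu> (\<lambda>y. h (s y))"
    unfolding eq by (intro Bochner_Integration.integrable_sum int)
  have "(LINT y|\<nu>. h (s y)) = (\<Sum>v\<in>range s. LINT y|\<nu>. indicator (s -` {v}) y *\<^sub>R h v)"
    unfolding eq by (rule Bochner_Integration.integral_sum) (rule int)
  also have "\<dots> = (\<Sum>v\<in>range s. complex_of_real (measure \<nu> (s -` {v})) * h v)"
  proof (rule sum.cong)
    fix v
    have "(LINT y|\<nu>. indicator (s -` {v}) y *\<^sub>R h v) = (LINT y|\<nu>. indicator (s -` {v}) y) *\<^sub>R h v"
      by (intro integral_scaleR_left integrable_real_indicator S) (simp add: less_top[symmetric] emeasure_finite)
    then show "(LINT y|\<nu>. indicator (s -` {v}) y *\<^sub>R h v) = complex_of_real (measure \<nu> (s -` {v})) * h v"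
      using sp by (simp add: scaleR_conv_of_real)
  qed simp
  finally show "(LINT y|\<nu>. h (s y)) = (\<Sum>v\<in>range s. complex_of_real (measure \<nu> (s -` {v})) * h v)" .
qed

lemma ex_finite_range_approx:
  "\<exists>s :: nat \<Rightarrow> real \<Rightarrow> real. (\<forall>n. finite (range (s n))) \<and> (\<forall>n. s n \<in> borel_measurable borel) \<and>
     (\<forall>y. (\<lambda>n. s n y) \<longlonglongrightarrow> y) \<and> (\<forall>n y. \<bar>s n y\<bar> \<le> 2 * \<bar>y\<bar>)"
proof -
  have "(\<lambda>x::real. x) \<in> borel_measurable borel" by measurable
  from borel_measurable_implies_sequence_metric[OF this, of 0] obtain s :: "nat \<Rightarrow> real \<Rightarrow> real"
    where s: "(\<forall>n. simple_function borel (s n)) \<and> (\<forall>y\<in>space borel. (\<lambda>n. s n y) \<longlonglongrightarrow> y) \<and>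
      (\<forall>n. \<forall>y\<in>space borel. dist (s n y) 0 \<le> 2 * dist y 0)" by blast
  have "finite (range (s n)) \<and> s n \<in> borel_measurable borel" for n
    using s simple_functionD(1)[of borel "s n"] borel_measurable_simple_function[of borel "s n"] by simp
  then show ?thesis using s by (intro exI[of _ s]) simp
qed

text \<open>A function of finite range only sees the values of the complex measure on Borel sets, and \<open>g\<close> is a bounded
  pointwise limit of such functions.\<close>

lemma complex_measure_integral_unique:
  fixes g :: "real \<Rightarrow> complex"
  assumes \<nu>: "\<And>k. k < 4 \<Longrightarrow> finite_measure (\<nu> k) \<and> sets (\<nu> k) = sets borel"
    and \<nu>': "\<And>k. k < 4 \<Longrightarrow> finite_measure (\<nu>' k) \<and> sets (\<nu>' k) = sets borel"
    and eq: "\<And>A. A \<in> sets borel \<Longrightarrow> (\<Sum>k<4::nat. \<i> ^ k * complex_of_real (measure (\<nu> k) A)) =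
        (\<Sum>k<4. \<i> ^ k * complex_of_real (measure (\<nu>' k) A))"
    and g: "continuous_on UNIV g" "\<And>y. cmod (g y) \<le> C"
  shows "(\<Sum>k<4. \<i> ^ k * (LINT y|\<nu> k. g y)) = (\<Sum>k<4. \<i> ^ k * (LINT y|\<nu>' k. g y))"
proof -
  obtain s :: "nat \<Rightarrow> real \<Rightarrow> real" where s: "\<And>n. finite (range (s n))" "\<And>n. s n \<in> borel_measurable borel"
    "\<And>y. (\<lambda>n. s n y) \<longlonglongrightarrow> y" "\<And>n y. \<bar>s n y\<bar> \<le> 2 * \<bar>y\<bar>" using ex_finite_range_approx by blast
  have gm: "g \<in> borel_measurable borel" by (rule borel_measurable_continuous_onI[OF g(1)])
  have lim: "(\<lambda>n. LINT y|\<mu>. g (s n y)) \<longlonglongrightarrow> (LINT y|\<mu>. g y)" if \<mu>: "finite_measure \<mu>" "sets \<mu> = sets borel" for \<mu>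
  proof (rule integral_dominated_convergence[where w = "\<lambda>_. C"])
    show "integrable \<mu> (\<lambda>_. C)" by (rule finite_measure.integrable_const[OF \<mu>(1)])
    show "g \<in> borel_measurable \<mu>" using gm by (simp add: measurable_cong_sets[OF \<mu>(2)])
    show "(\<lambda>y. g (s n y)) \<in> borel_measurable \<mu>" for n
      using measurable_compose[OF s(2) gm] by (simp add: measurable_cong_sets[OF \<mu>(2)])
    show "AE y in \<mu>. (\<lambda>n. g (s n y)) \<longlonglongrightarrow> g y"
      using g(1) by (intro AE_I2 isCont_tendsto_compose[of _ g] s(3)) (simp add: continuous_on_eq_continuous_at)
  qed (use g(2) in auto)
  have sum_eq: "(\<Sum>k<4. \<i> ^ k * (LINT y|\<mu> k. g (s n y))) = (\<Sum>v\<in>range (s n). (\<Sum>k<4. \<i> ^ k * complex_of_real (measure (\<mu> k) (s n -` {v}))) * g v)"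
    if \<mu>: "\<And>k. k < 4 \<Longrightarrow> finite_measure (\<mu> k) \<and> sets (\<mu> k) = sets borel" for \<mu> :: "nat \<Rightarrow> real measure" and n
  proof -
    have "(\<Sum>k<4. \<i> ^ k * (LINT y|\<mu> k. g (s n y))) =
        (\<Sum>k<4. \<Sum>v\<in>range (s n). \<i> ^ k * complex_of_real (measure (\<mu> k) (s n -` {v})) * g v)"
      using \<mu> by (intro sum.cong refl) (simp add: finite_range_integral[OF _ _ s(1,2)] sum_distrib_left mult.assoc)
    also have "\<dots> = (\<Sum>v\<in>range (s n). \<Sum>k<4. \<i> ^ k * complex_of_real (measure (\<mu> k) (s n -` {v})) * g v)"
      by (rule sum.swap)
    finally show ?thesis by (simp only: sum_distrib_right)
  qed
  have "s n -` {v} \<in> sets borel" for n v using measurable_sets[OF s(2), of "{v}" n] by simp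
  then have e: "(\<Sum>k<4. \<i> ^ k * (LINT y|\<nu> k. g (s n y))) = (\<Sum>k<4. \<i> ^ k * (LINT y|\<nu>' k. g (s n y)))" for n
    by (simp only: sum_eq[OF \<nu>] sum_eq[OF \<nu>'] eq)
  have "(\<lambda>n. \<Sum>k<4. \<i> ^ k * (LINT y|\<nu> k. g (s n y))) \<longlonglongrightarrow> (\<Sum>k<4. \<i> ^ k * (LINT y|\<nu> k. g y))"
    using \<nu> by (intro tendsto_sum tendsto_mult tendsto_const lim) auto
  moreover have "(\<lambda>n. \<Sum>k<4. \<i> ^ k * (LINT y|\<nu>' k. g (s n y))) \<longlonglongrightarrow> (\<Sum>k<4. \<i> ^ k * (LINT y|\<nu>' k. g y))"
    using \<nu>' by (intro tendsto_sum tendsto_mult tendsto_const lim) auto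
  ultimately show ?thesis unfolding e by (rule LIMSEQ_unique)
qed

text \<open>The definition of \<open>\<W>\<^sub>1\<close> permits a different decomposition of the measure for every \<open>x\<close>; by uniqueness of the
  integral the decomposition chosen at \<open>x = 0\<close> serves for all of them.\<close>

lemma W1_derivative:
  assumes "\<psi> \<in> W1"
  shows "\<exists>\<nu> :: nat \<Rightarrow> real measure. (\<forall>k<4. finite_measure (\<nu> k) \<and> sets (\<nu> k) = sets borel) \<and>
    (\<forall>x. (\<psi> has_vector_derivative (\<Sum>k<4. \<i> ^ k * (LINT y|\<nu> k. cis (x * y)))) (at x))"
proof -
  obtain \<mu> where diff: "\<psi> C1_differentiable_on UNIV"
    and \<mu>: "\<And>x. has_complex_measure_integral \<mu> (\<lambda>y. cis (x * y)) (vector_derivative \<psi> (at x))"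
    using assms by (auto simp: W1_def)
  have ex: "\<exists>\<nu> :: nat \<Rightarrow> real measure. (\<forall>k<4. finite_measure (\<nu> k) \<and> sets (\<nu> k) = sets borel) \<and>
      (\<forall>A\<in>sets borel. \<mu> A = (\<Sum>k<4. \<i> ^ k * complex_of_real (measure (\<nu> k) A))) \<and>
      vector_derivative \<psi> (at x) = (\<Sum>k<4. \<i> ^ k * (LINT y|\<nu> k. cis (x * y)))" for x
    using \<mu>[of x] unfolding has_complex_measure_integral_def by blast
  obtain \<nu> :: "nat \<Rightarrow> real measure" where \<nu>: "\<And>k. k < 4 \<Longrightarrow> finite_measure (\<nu> k) \<and> sets (\<nu> k) = sets borel"
      "\<And>A. A \<in> sets borel \<Longrightarrow> \<mu> A = (\<Sum>k<4. \<i> ^ k * complex_of_real (measure (\<nu> k) A))"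
    using ex[of 0] by blast
  have "vector_derivative \<psi> (at x) = (\<Sum>k<4. \<i> ^ k * (LINT y|\<nu> k. cis (x * y)))" for x
  proof -
    obtain \<nu>' :: "nat \<Rightarrow> real measure" where \<nu>': "\<And>k. k < 4 \<Longrightarrow> finite_measure (\<nu>' k) \<and> sets (\<nu>' k) = sets borel"
      "\<And>A. A \<in> sets borel \<Longrightarrow> \<mu> A = (\<Sum>k<4. \<i> ^ k * complex_of_real (measure (\<nu>' k) A))"
      "vector_derivative \<psi> (at x) = (\<Sum>k<4. \<i> ^ k * (LINT y|\<nu>' k. cis (x * y)))"
      using ex[of x] by blast
    show ?thesis unfolding \<nu>'(3)
    proof (rule complex_measure_integral_unique[OF \<nu>'(1) \<nu>(1), where C = 1])
      show "continuous_on UNIV (\<lambda>y. cis (x * y))" by (intro continuous_intros)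
    qed (use \<nu>(2) \<nu>'(2) in auto)
  qed
  moreover have "(\<psi> has_vector_derivative vector_derivative \<psi> (at x)) (at x)" for x
  proof -
    obtain D where "(\<psi> has_vector_derivative D x) (at x)"
      using diff unfolding C1_differentiable_on_def by blast
    then show ?thesis by (simp add: vector_derivative_at)
  qed
  ultimately have "(\<psi> has_vector_derivative (\<Sum>k<4. \<i> ^ k * (LINT y|\<nu> k. cis (x * y)))) (at x)" for x
    by simp
  then show ?thesis using \<nu>(1) by blast
qed


section \<open>The trace formula for a perturbation with known moments\<close>

text \<open>The passage from powers to general functions uses nothing about Toeplitz operators beyond the following.
  In the application \<open>A = T*T\<close>, \<open>B = TT*\<close>, \<open>p = |F|\<^sup>2\<close> and \<open>q = |F'|\<^sup>2\<close>.\<close>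

locale trace_formula =
  fixes A B :: "'a::complex_hilbert \<Rightarrow>\<^sub>L 'a" and c \<kappa> :: real and p q :: "complex \<Rightarrow> real"
  assumes A: "selfadjoint_in c A" "norm A \<le> c" and B: "selfadjoint_in c B" "norm B \<le> c"
    and K: "\<And>d. trace_bound d (A - B) \<kappa>"
    and p: "continuous_on (ball 0 1) p" "\<And>z. z \<in> ball 0 1 \<Longrightarrow> p z \<in> {0..c}"
    and q: "continuous_on (ball 0 1) q" "\<And>z. q z \<ge> 0" "set_integrable lborel (ball 0 1) q"
    and moments: "\<And>E m. orthonormal_basis E \<Longrightarrow>
      ((\<lambda>e. cinner ((opow A (Suc m) - opow B (Suc m)) e) e) has_sum
        complex_of_real (1 / pi * (LINT z:ball 0 1|lborel. real (Suc m) * p z ^ m * q z))) E"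
begin

lemma c_nonneg: "c \<ge> 0"
  using A(2) norm_ge_zero order_trans by blast

lemma kappa_nonneg: "\<kappa> \<ge> 0"
  using K trace_bound_nonneg by blast

definition diff_op :: "(real \<Rightarrow> complex) \<Rightarrow> ('a \<Rightarrow>\<^sub>L 'a)" where
  "diff_op \<phi> = cfc \<phi> A - cfc \<phi> B"

definition area :: "(real \<Rightarrow> complex) \<Rightarrow> complex" where
  "area g = 1 / complex_of_real pi * (LINT z:ball 0 1|lborel. g (p z) * complex_of_real (q z))"

lemma area_integrable:
  assumes g: "continuous_on {0..c} g"
  shows "set_integrable lborel (ball 0 1) (\<lambda>z. g (p z) * complex_of_real (q z))"
proof -
  have "bounded (g ` {0..c})" by (intro compact_imp_bounded compact_continuous_image g compact_Icc)
  then obtain C where "\<forall>y\<in>g ` {0..c}. cmod y \<le> C" unfolding bounded_iff by blast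
  then have C: "cmod (g x) \<le> C" if "x \<in> {0..c}" for x using that by blast
  show ?thesis
  proof (rule set_integrable_bound)
    show "set_integrable lborel (ball 0 1) (\<lambda>z. C * q z)" using q(3) by simp
    have "continuous_on (ball 0 1) (\<lambda>z. g (p z) * complex_of_real (q z))"
      using p(2) by (intro continuous_intros continuous_on_compose2[OF g p(1)] q(1)) auto
    then show "set_borel_measurable lborel (ball 0 1) (\<lambda>z. g (p z) * complex_of_real (q z))"
      unfolding set_borel_measurable_def
      using borel_measurable_continuous_on_indicator[of "ball (0::complex) 1"] by simp
    show "AE z in lborel. z \<in> ball 0 1 \<longrightarrow> norm (g (p z) * complex_of_real (q z)) \<le> norm (C * q z)"
    proof (intro AE_I2 impI)
      fix z :: complex assume z: "z \<in> ball 0 1"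
      have "cmod (g (p z)) * q z \<le> C * q z" by (intro mult_right_mono C p(2) z q(2))
      then have "cmod (g (p z)) * q z \<le> \<bar>C\<bar> * q z"
        using mult_right_mono[OF abs_ge_self[of C] q(2)[of z]] by linarith
      then show "norm (g (p z) * complex_of_real (q z)) \<le> norm (C * q z)"
        using q(2)[of z] by (simp add: norm_mult abs_mult)
    qed
  qed
qed

lemma area_add:
  "continuous_on {0..c} g \<Longrightarrow> continuous_on {0..c} h \<Longrightarrow> area (\<lambda>x. g x + h x) = area g + area h"
  unfolding area_def using set_integral_add(2)[OF area_integrable area_integrable, of g h]
  by (simp add: distrib_right distrib_left)

lemma area_cmult: "area (\<lambda>x. k * g x) = k * area g"
  unfolding area_def by (simp add: mult.assoc)

lemma area_le:
  assumes g: "continuous_on {0..c} g" and C: "\<And>x. x \<in> {0..c} \<Longrightarrow> cmod (g x) \<le> C"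
  shows "cmod (area g) \<le> C * (1 / pi * (LINT z:ball 0 1|lborel. q z))"
proof -
  have "cmod (LINT z:ball 0 1|lborel. g (p z) * complex_of_real (q z)) \<le>
      (LINT z:ball 0 1|lborel. cmod (g (p z) * complex_of_real (q z)))"
    using set_integral_norm_bound[OF area_integrable[OF g]] by simp
  also have "\<dots> \<le> (LINT z:ball 0 1|lborel. C * q z)"
  proof (rule set_integral_mono)
    show "set_integrable lborel (ball 0 1) (\<lambda>z. cmod (g (p z) * complex_of_real (q z)))"
      by (rule set_integrable_norm[OF area_integrable[OF g]])
    show "set_integrable lborel (ball 0 1) (\<lambda>z. C * q z)" using q(3) by simp
    fix z :: complex assume z: "z \<in> ball 0 1"
    have "cmod (g (p z)) * q z \<le> C * q z" by (intro mult_right_mono C p(2) z q(2))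
    then show "cmod (g (p z) * complex_of_real (q z)) \<le> C * q z" using q(2)[of z] by (simp add: norm_mult)
  qed
  also have "\<dots> = C * (LINT z:ball 0 1|lborel. q z)" by simp
  finally show ?thesis unfolding area_def by (simp add: norm_mult norm_divide field_simps)
qed

lemma diff_op_add:
  "continuous_on {0..c} g \<Longrightarrow> continuous_on {0..c} h \<Longrightarrow> diff_op (\<lambda>x. g x + h x) = diff_op g + diff_op h"
  by (simp add: diff_op_def cfc_add[OF A(1)] cfc_add[OF B(1)])

lemma diff_op_diff:
  "continuous_on {0..c} g \<Longrightarrow> continuous_on {0..c} h \<Longrightarrow> diff_op (\<lambda>x. g x - h x) = diff_op g - diff_op h"
  by (simp add: diff_op_def cfc_diff[OF A(1)] cfc_diff[OF B(1)])

lemma diff_op_cmult: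
  "continuous_on {0..c} g \<Longrightarrow> diff_op (\<lambda>x. k * g x) = scalar_op k \<odot> diff_op g"
  by (simp add: diff_op_def cfc_cmult[OF A(1)] cfc_cmult[OF B(1)] compose_diff)

lemma diff_op_const: "diff_op (\<lambda>x. k) = 0"
  by (simp add: diff_op_def cfc_const[OF A(1)] cfc_const[OF B(1)])

lemma diff_op_power: "diff_op (\<lambda>x. complex_of_real x ^ n) = opow A n - opow B n"
proof -
  have "continuous_on {0..c} complex_of_real" by (intro continuous_intros)
  then show ?thesis
    by (simp add: diff_op_def cfc_power[OF A(1)] cfc_power[OF B(1)] cfc_id[OF A(1)] cfc_id[OF B(1)])
qed

lemma diff_op_sum:
  assumes "finite I" "\<And>i. i \<in> I \<Longrightarrow> continuous_on {0..c} (\<phi> i)"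
  shows "diff_op (\<lambda>x. \<Sum>i\<in>I. \<phi> i x) = (\<Sum>i\<in>I. diff_op (\<phi> i))"
  by (simp add: diff_op_def cfc_sum[OF A(1) assms] cfc_sum[OF B(1) assms] sum_subtractf)

lemma diff_op_cong:
  assumes "continuous_on {0..c} g" "\<And>x. x \<in> {0..c} \<Longrightarrow> g x = h x"
  shows "diff_op h = diff_op g"
  unfolding diff_op_def using cfc_cong[OF A(1) assms] cfc_cong[OF B(1) assms] by simp

lemma diff_op_uniform_limit:
  assumes "\<And>n. continuous_on {0..c} (\<phi> n)" "uniform_limit {0..c} \<phi> g sequentially"
  shows "(\<lambda>n. diff_op (\<phi> n)) \<longlonglongrightarrow> diff_op g"
  unfolding diff_op_def by (intro tendsto_diff cfc_uniform_limit[OF A(1)] cfc_uniform_limit[OF B(1)] assms)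

text \<open>The derivative is an explicit argument, since on a one-point interval it is not determined by \<open>\<phi>\<close>.\<close>

definition formula_holds :: "(real \<Rightarrow> complex) \<Rightarrow> (real \<Rightarrow> complex) \<Rightarrow> bool" where
  "formula_holds \<phi> \<phi>' \<longleftrightarrow> (\<forall>x\<in>{0..c}. (\<phi> has_vector_derivative \<phi>' x) (at x within {0..c})) \<and>
     continuous_on {0..c} \<phi>' \<and>
     (\<forall>E. orthonormal_basis E \<longrightarrow> ((\<lambda>e. cinner (diff_op \<phi> e) e) has_sum area \<phi>') E)"

lemma formula_holds_continuous: "formula_holds \<phi> \<phi>' \<Longrightarrow> continuous_on {0..c} \<phi>"
  unfolding formula_holds_def by (intro continuous_on_vector_derivative) auto

lemma formula_holds_derivD: "formula_holds \<phi> \<phi>' \<Longrightarrow> x \<in> {0..c} \<Longrightarrow> (\<phi> has_vector_derivative \<phi>' x) (at x within {0..c})"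
  by (simp add: formula_holds_def)

lemma formula_holds_deriv_continuous: "formula_holds \<phi> \<phi>' \<Longrightarrow> continuous_on {0..c} \<phi>'"
  by (simp add: formula_holds_def)

lemma formula_holds_traceD: "formula_holds \<phi> \<phi>' \<Longrightarrow> orthonormal_basis E \<Longrightarrow> ((\<lambda>e. cinner (diff_op \<phi> e) e) has_sum area \<phi>') E"
  by (simp add: formula_holds_def)

lemma formula_holds_const: "formula_holds (\<lambda>x. k) (\<lambda>x. 0)"
  by (simp add: formula_holds_def diff_op_const area_def)

lemma formula_holds_add:
  assumes "formula_holds \<phi> \<phi>'" "formula_holds \<psi> \<psi>'"
  shows "formula_holds (\<lambda>x. \<phi> x + \<psi> x) (\<lambda>x. \<phi>' x + \<psi>' x)"
  unfolding formula_holds_def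
proof (intro conjI ballI allI impI)
  show "((\<lambda>x. \<phi> x + \<psi> x) has_vector_derivative \<phi>' x + \<psi>' x) (at x within {0..c})" if "x \<in> {0..c}" for x
    using that assms by (intro has_vector_derivative_add formula_holds_derivD)
  show "continuous_on {0..c} (\<lambda>x. \<phi>' x + \<psi>' x)"
    using assms by (intro continuous_intros formula_holds_deriv_continuous)
  fix E :: "'a set" assume E: "orthonormal_basis E"
  show "((\<lambda>e. cinner (diff_op (\<lambda>x. \<phi> x + \<psi> x) e) e) has_sum area (\<lambda>x. \<phi>' x + \<psi>' x)) E"
    using has_sum_add[OF formula_holds_traceD[OF assms(1) E] formula_holds_traceD[OF assms(2) E]]
    by (simp add: diff_op_add[OF formula_holds_continuous[OF assms(1)] formula_holds_continuous[OF assms(2)]]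
        area_add[OF formula_holds_deriv_continuous[OF assms(1)] formula_holds_deriv_continuous[OF assms(2)]]
        blinfun.add_left cinner.add_left)
qed

lemma formula_holds_cmult:
  assumes "formula_holds \<phi> \<phi>'"
  shows "formula_holds (\<lambda>x. k * \<phi> x) (\<lambda>x. k * \<phi>' x)"
  unfolding formula_holds_def
proof (intro conjI ballI allI impI)
  show "((\<lambda>x. k * \<phi> x) has_vector_derivative k * \<phi>' x) (at x within {0..c})" if "x \<in> {0..c}" for x
    using formula_holds_derivD[OF assms that] by (rule has_vector_derivative_mult_right)
  show "continuous_on {0..c} (\<lambda>x. k * \<phi>' x)"
    using assms by (intro continuous_intros formula_holds_deriv_continuous)
  fix E :: "'a set" assume E: "orthonormal_basis E"
  show "((\<lambda>e. cinner (diff_op (\<lambda>x. k * \<phi> x) e) e) has_sum area (\<lambda>x. k * \<phi>' x)) E"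
    using has_sum_cmult_right[OF formula_holds_traceD[OF assms E], of k]
    by (simp add: diff_op_cmult[OF formula_holds_continuous[OF assms]] area_cmult cinner_scaleC_left)
qed

lemma formula_holds_sum:
  assumes "finite I" "\<And>i. i \<in> I \<Longrightarrow> formula_holds (\<phi> i) (\<phi>' i)"
  shows "formula_holds (\<lambda>x. \<Sum>i\<in>I. k i * \<phi> i x) (\<lambda>x. \<Sum>i\<in>I. k i * \<phi>' i x)"
  using assms
proof (induction I)
  case empty
  then show ?case by (simp add: formula_holds_const)
next
  case (insert i I)
  have "formula_holds (\<lambda>x. k i * \<phi> i x + (\<Sum>i\<in>I. k i * \<phi> i x)) (\<lambda>x. k i * \<phi>' i x + (\<Sum>i\<in>I. k i * \<phi>' i x))"
    by (rule formula_holds_add[OF formula_holds_cmult insert.IH]) (auto intro: insert.prems)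
  then show ?case using insert.hyps by simp
qed

lemma formula_holds_power: "formula_holds (\<lambda>x. complex_of_real x ^ Suc m) (\<lambda>x. of_nat (Suc m) * complex_of_real x ^ m)"
  unfolding formula_holds_def
proof (intro conjI ballI allI impI)
  fix x
  show "((\<lambda>x. complex_of_real x ^ Suc m) has_vector_derivative of_nat (Suc m) * complex_of_real x ^ m) (at x within {0..c})"
  proof (rule has_vector_derivative_real_field)
    show "((\<lambda>z. z ^ Suc m) has_field_derivative of_nat (Suc m) * complex_of_real x ^ m) (at (complex_of_real x))"
      by (rule DERIV_cong[OF DERIV_power[OF DERIV_ident]]) simp
  qed
next
  show "continuous_on {0..c} (\<lambda>x. of_nat (Suc m) * complex_of_real x ^ m)" by (intro continuous_intros)
next
  fix E :: "'a set" assume E: "orthonormal_basis E"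
  have "area (\<lambda>x. of_nat (Suc m) * complex_of_real x ^ m) =
      complex_of_real (1 / pi * (LINT z:ball 0 1|lborel. real (Suc m) * p z ^ m * q z))"
  proof -
    have "(LINT z:ball 0 1|lborel. of_nat (Suc m) * complex_of_real (p z) ^ m * complex_of_real (q z)) =
        (LINT z:ball 0 1|lborel. complex_of_real (real (Suc m) * p z ^ m * q z))" by simp
    also have "\<dots> = complex_of_real (LINT z:ball 0 1|lborel. real (Suc m) * p z ^ m * q z)"
      by (rule set_integral_complex_of_real)
    finally show ?thesis by (simp add: area_def del: of_nat_Suc)
  qed
  then show "((\<lambda>e. cinner (diff_op (\<lambda>x. complex_of_real x ^ Suc m) e) e) has_sum
      area (\<lambda>x. of_nat (Suc m) * complex_of_real x ^ m)) E"
    using moments[OF E, of m] by (simp only: diff_op_power)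
qed

text \<open>The trace norm of \<open>g(A) - g(B) - (\<phi>\<^sub>n(A) - \<phi>\<^sub>n(B))\<close> is small because the sequence is Cauchy in trace norm and
  converges in operator norm; the area integrals converge because \<open>q\<close> is integrable.\<close>

lemma formula_holds_limit:
  assumes formula_holds: "\<And>n. formula_holds (\<phi> n) (\<phi>' n)"
    and lim: "uniform_limit {0..c} \<phi> g sequentially" and lim': "uniform_limit {0..c} \<phi>' g' sequentially"
    and cauchy: "\<And>\<epsilon>. \<epsilon> > 0 \<Longrightarrow> \<exists>N. \<forall>m\<ge>N. \<forall>n\<ge>N. \<forall>d. trace_bound d (diff_op (\<phi> m) - diff_op (\<phi> n)) \<epsilon>"
  shows "formula_holds g g'"
proof -
  have cont': "continuous_on {0..c} g'"
    by (rule uniform_limit_theorem[OF _ lim']) (auto simp: formula_holds_deriv_continuous[OF formula_holds])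
  have deriv: "(g has_vector_derivative g' x) (at x within {0..c})" if x: "x \<in> {0..c}" for x
  proof -
    have "\<exists>h. \<forall>x\<in>{0..c}. (\<lambda>n. \<phi> n x) \<longlonglongrightarrow> h x \<and> (h has_derivative (\<lambda>t. t *\<^sub>R g' x)) (at x within {0..c})"
    proof (rule has_derivative_sequence[where f = \<phi> and f' = "\<lambda>n x t. t *\<^sub>R \<phi>' n x"
          and g' = "\<lambda>x t. t *\<^sub>R g' x" and ?x0.0 = x and l = "g x"])
      show "(\<phi> n has_derivative (\<lambda>t. t *\<^sub>R \<phi>' n x)) (at x within {0..c})" if "x \<in> {0..c}" for n x
        using formula_holds_derivD[OF formula_holds that] by (simp add: has_vector_derivative_def)
      fix e :: real assume e: "e > 0"
      show "\<forall>\<^sub>F n in sequentially. \<forall>x\<in>{0..c}. \<forall>h. norm (h *\<^sub>R \<phi>' n x - h *\<^sub>R g' x) \<le> e * norm h"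
        using uniform_limitD[OF lim' e]
      proof eventually_elim
        case (elim n)
        show ?case
        proof (intro ballI allI)
          fix x h assume "x \<in> {0..c}"
          then have "cmod (\<phi>' n x - g' x) \<le> e" using elim by (auto simp: dist_norm less_imp_le)
          then have "\<bar>h\<bar> * cmod (\<phi>' n x - g' x) \<le> \<bar>h\<bar> * e" by (intro mult_left_mono) auto
          then show "norm (h *\<^sub>R \<phi>' n x - h *\<^sub>R g' x) \<le> e * norm h"
            by (simp add: scaleR_diff_right[symmetric] mult.commute)
        qed
      qed
    next
      show "(\<lambda>n. \<phi> n x) \<longlonglongrightarrow> g x" by (rule tendsto_uniform_limitI[OF lim x])
    qed (use x in auto)
    then obtain h where h: "\<And>x. x \<in> {0..c} \<Longrightarrow> (\<lambda>n. \<phi> n x) \<longlonglongrightarrow> h x"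
      "\<And>x. x \<in> {0..c} \<Longrightarrow> (h has_derivative (\<lambda>t. t *\<^sub>R g' x)) (at x within {0..c})" by blast
    have "h y = g y" if "y \<in> {0..c}" for y
      using LIMSEQ_unique[OF h(1)[OF that] tendsto_uniform_limitI[OF lim that]] .
    then have "(g has_derivative (\<lambda>t. t *\<^sub>R g' x)) (at x within {0..c})"
      by (intro has_derivative_transform[OF x _ h(2)[OF x]]) simp
    then show ?thesis by (simp add: has_vector_derivative_def)
  qed
  have op_lim: "(\<lambda>n. diff_op (\<phi> n)) \<longlonglongrightarrow> diff_op g"
    by (rule diff_op_uniform_limit[OF formula_holds_continuous[OF formula_holds] lim])
  \<comment> \<open>The mass of \<open>q\<close> divided by \<open>\<pi>\<close>; adding \<open>1\<close> avoids a division by \<open>0\<close>.\<close>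
  define J0 where "J0 = 1 / pi * (LINT z:ball 0 1|lborel. q z)"
  have J0: "J0 \<ge> 0" unfolding J0_def using q(2)
    by (intro mult_nonneg_nonneg) (auto simp: set_lebesgue_integral_def intro!: Bochner_Integration.integral_nonneg)
  have "((\<lambda>e. cinner (diff_op g e) e) has_sum area g') E" if E: "orthonormal_basis E" for E
    unfolding has_sum_def
  proof (rule tendstoI)
    fix \<epsilon> :: real assume "\<epsilon> > 0"
    then have e3: "\<epsilon> / 4 > 0" by simp
    obtain N1 where N1: "\<And>m n d. m \<ge> N1 \<Longrightarrow> n \<ge> N1 \<Longrightarrow> trace_bound d (diff_op (\<phi> m) - diff_op (\<phi> n)) (\<epsilon> / 4)"
      using cauchy[OF e3] by blast
    have "\<epsilon> / 4 / (J0 + 1) > 0" using e3 J0 by simp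
    then obtain N2 where N2: "\<And>n x. n \<ge> N2 \<Longrightarrow> x \<in> {0..c} \<Longrightarrow> dist (\<phi>' n x) (g' x) < \<epsilon> / 4 / (J0 + 1)"
      using lim' unfolding uniform_limit_sequentially_iff by blast
    define n where "n = max N1 N2"
    have tb: "trace_bound d (diff_op g - diff_op (\<phi> n)) (\<epsilon> / 4)" for d
    proof (rule trace_bound_LIMSEQ)
      show "(\<lambda>m. diff_op (\<phi> m) - diff_op (\<phi> n)) \<longlonglongrightarrow> diff_op g - diff_op (\<phi> n)" by (intro tendsto_intros op_lim)
      show "\<forall>\<^sub>F m in sequentially. trace_bound d (diff_op (\<phi> m) - diff_op (\<phi> n)) (\<epsilon> / 4)"
        using N1[of _ n] by (intro eventually_sequentiallyI[of N1]) (simp add: n_def)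
    qed simp
    have ar: "cmod (area (\<phi>' n) - area g') \<le> \<epsilon> / 4"
    proof -
      have "area (\<lambda>x. (\<phi>' n x - g' x) + g' x) = area (\<lambda>x. \<phi>' n x - g' x) + area g'"
        by (intro area_add continuous_intros cont' formula_holds_deriv_continuous[OF formula_holds])
      then have "area (\<phi>' n) - area g' = area (\<lambda>x. \<phi>' n x - g' x)" by simp
      also have "cmod \<dots> \<le> \<epsilon> / 4 / (J0 + 1) * J0"
        unfolding J0_def
      proof (rule area_le)
        show "continuous_on {0..c} (\<lambda>x. \<phi>' n x - g' x)" by (intro continuous_intros cont' formula_holds_deriv_continuous[OF formula_holds])
        show "cmod (\<phi>' n x - g' x) \<le> \<epsilon> / 4 / (1 / pi * (LINT z:ball 0 1|lborel. q z) + 1)" if "x \<in> {0..c}" for x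
          using N2[of n x] that unfolding J0_def[symmetric] by (simp add: n_def dist_norm less_imp_le)
      qed
      also have "\<dots> \<le> \<epsilon> / 4" using J0 e3 by (simp add: field_simps)
      finally show ?thesis .
    qed
    have "\<forall>\<^sub>F F in finite_subsets_at_top E. dist (\<Sum>e\<in>F. cinner (diff_op (\<phi> n) e) e) (area (\<phi>' n)) < \<epsilon> / 4"
      using formula_holds_traceD[OF formula_holds E, of n] e3 unfolding has_sum_def by (rule tendstoD)
    moreover have "\<forall>\<^sub>F F in finite_subsets_at_top E. cmod (\<Sum>e\<in>F. cinner ((diff_op g - diff_op (\<phi> n)) e) e) \<le> \<epsilon> / 4"
    proof (rule eventually_finite_subsets_at_top_weakI)
      fix F assume F: "finite F" "F \<subseteq> E"
      have on: "orthonormal F" using orthonormal_subset[OF orthonormal_basis_orthonormal[OF E] F(2)] .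
      obtain a where a: "bij_betw a {..<card F} F"
        using ex_bij_betw_nat_finite[OF F(1)] by (auto simp: atLeast0LessThan)
      have bf: "bessel_family (card F) a" by (rule bessel_family_orthonormal[OF a on])
      have "(\<Sum>e\<in>F. cinner ((diff_op g - diff_op (\<phi> n)) e) e) = (\<Sum>i<card F. cinner ((diff_op g - diff_op (\<phi> n)) (a i)) (a i))"
        by (rule sum.reindex_bij_betw[OF a, symmetric])
      also have "cmod \<dots> \<le> (\<Sum>i<card F. cmod (cinner ((diff_op g - diff_op (\<phi> n)) (a i)) (a i)))" by (rule norm_sum)
      also have "\<dots> \<le> \<epsilon> / 4" by (rule trace_boundD[OF tb bf bf])
      finally show "cmod (\<Sum>e\<in>F. cinner ((diff_op g - diff_op (\<phi> n)) e) e) \<le> \<epsilon> / 4" .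
    qed
    ultimately show "\<forall>\<^sub>F F in finite_subsets_at_top E. dist (\<Sum>e\<in>F. cinner (diff_op g e) e) (area g') < \<epsilon>"
    proof eventually_elim
      case (elim F)
      have "(\<Sum>e\<in>F. cinner (diff_op g e) e) - area g' = (\<Sum>e\<in>F. cinner ((diff_op g - diff_op (\<phi> n)) e) e) +
         (((\<Sum>e\<in>F. cinner (diff_op (\<phi> n) e) e) - area (\<phi>' n)) + (area (\<phi>' n) - area g'))"
        by (simp add: blinfun.diff_left cinner.diff_left sum_subtractf)
      then have "cmod ((\<Sum>e\<in>F. cinner (diff_op g e) e) - area g') \<le> cmod (\<Sum>e\<in>F. cinner ((diff_op g - diff_op (\<phi> n)) e) e) +
         (cmod ((\<Sum>e\<in>F. cinner (diff_op (\<phi> n) e) e) - area (\<phi>' n)) + cmod (area (\<phi>' n) - area g'))"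
        by (simp only:) (rule order_trans[OF norm_triangle_ineq add_left_mono[OF norm_triangle_ineq]])
      then show ?case using elim ar \<open>\<epsilon> > 0\<close> unfolding dist_norm by linarith
    qed
  qed
  then show ?thesis using deriv cont' by (simp add: formula_holds_def)
qed

lemma diff_op_power_sum:
  fixes a :: "nat \<Rightarrow> complex"
  assumes I: "finite I"
  shows "trace_bound d (diff_op (\<lambda>x. \<Sum>k\<in>I. a k * complex_of_real x ^ Suc k))
     (\<kappa> * (\<Sum>k\<in>I. cmod (a k) * real (Suc k) * c ^ k))"
proof -
  have cont: "continuous_on {0..c} (\<lambda>x. complex_of_real x ^ Suc k)" for k by (intro continuous_intros)
  have "diff_op (\<lambda>x. \<Sum>k\<in>I. a k * complex_of_real x ^ Suc k) = (\<Sum>k\<in>I. diff_op (\<lambda>x. a k * complex_of_real x ^ Suc k))"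
    by (intro diff_op_sum I continuous_intros)
  also have "\<dots> = (\<Sum>k\<in>I. scalar_op (a k) \<odot> (opow A (Suc k) - opow B (Suc k)))"
    by (intro sum.cong refl) (simp only: diff_op_cmult[OF cont] diff_op_power)
  finally have eq: "diff_op (\<lambda>x. \<Sum>k\<in>I. a k * complex_of_real x ^ Suc k) =
      (\<Sum>k\<in>I. scalar_op (a k) \<odot> (opow A (Suc k) - opow B (Suc k)))" .
  have adj: "adjoint_pair A A" "adjoint_pair B B" using A(1) B(1) by (simp_all add: selfadjoint_in_def)
  have "trace_bound d (\<Sum>k\<in>I. scalar_op (a k) \<odot> (opow A (Suc k) - opow B (Suc k)))
      (\<Sum>k\<in>I. cmod (a k) * (real (Suc k) * c ^ (Suc k - 1) * \<kappa>))"
    by (intro trace_bound_sum I trace_bound_scalar_op trace_bound_opow_diff[OF K adj(1) A(2) adj(2) B(2)])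
  moreover have "(\<Sum>k\<in>I. cmod (a k) * (real (Suc k) * c ^ (Suc k - 1) * \<kappa>)) = \<kappa> * (\<Sum>k\<in>I. cmod (a k) * real (Suc k) * c ^ k)"
    unfolding sum_distrib_left by (intro sum.cong refl) (simp add: mult_ac del: of_nat_Suc)
  ultimately show ?thesis by (simp only: eq)
qed

text \<open>For partial sums the trace bounds come from those of \<open>A\<^sup>k - B\<^sup>k\<close>, and \<open>S\<close> majorises everything that has to
  converge.\<close>

lemma formula_holds_power_series:
  fixes a :: "nat \<Rightarrow> complex"
  assumes sm: "summable (\<lambda>k. cmod (a k) * real (Suc k) * c ^ k)"
    and \<phi>: "\<And>x. (\<lambda>k. a k * complex_of_real x ^ Suc k) sums \<phi> x"
    and \<phi>': "\<And>x. (\<lambda>k. a k * of_nat (Suc k) * complex_of_real x ^ k) sums \<phi>' x"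
  defines "S \<equiv> \<Sum>k. cmod (a k) * real (Suc k) * c ^ k"
  shows "formula_holds \<phi> \<phi>'" and "trace_bound d (diff_op \<phi>) (\<kappa> * S)"
    and "x \<in> {0..c} \<Longrightarrow> cmod (\<phi> x) \<le> c * S" and "x \<in> {0..c} \<Longrightarrow> cmod (\<phi>' x) \<le> S"
proof -
  define t where "t = (\<lambda>k. cmod (a k) * real (Suc k) * c ^ k)"
  have t0: "t k \<ge> 0" for k using c_nonneg by (simp add: t_def)
  have st: "summable t" using sm by (simp add: t_def)
  define P where "P = (\<lambda>n x. \<Sum>k<n. a k * complex_of_real x ^ Suc k)"
  define P' where "P' = (\<lambda>n x. \<Sum>k<n. a k * (of_nat (Suc k) * complex_of_real x ^ k))"
  have gP: "formula_holds (P n) (P' n)" for n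
    unfolding P_def P'_def by (rule formula_holds_sum[OF _ formula_holds_power]) simp
  have b': "cmod (a k * (of_nat (Suc k) * complex_of_real x ^ k)) \<le> t k" if "x \<in> {0..c}" for k x
  proof -
    have "cmod (a k) * (real (Suc k) * x ^ k) \<le> cmod (a k) * (real (Suc k) * c ^ k)"
      using that by (intro mult_left_mono power_mono) auto
    then show ?thesis using that by (simp add: norm_mult norm_power t_def mult.assoc del: of_nat_Suc)
  qed
  have b: "cmod (a k * complex_of_real x ^ Suc k) \<le> c * t k" if x: "x \<in> {0..c}" for k x
  proof -
    have "cmod (a k * complex_of_real x ^ Suc k) = x * (cmod (a k) * (1 * x ^ k))"
      using x by (simp add: norm_mult norm_power mult_ac)
    also have "\<dots> \<le> c * (cmod (a k) * (real (Suc k) * c ^ k))"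
      using x by (intro mult_mono power_mono mult_left_mono) auto
    finally show ?thesis by (simp only: t_def mult.assoc)
  qed
  have "uniform_limit {0..c} P (\<lambda>x. \<Sum>k. a k * complex_of_real x ^ Suc k) sequentially"
    unfolding P_def by (rule Weierstrass_m_test[OF b summable_mult[OF st]])
  then have lim: "uniform_limit {0..c} P \<phi> sequentially" using \<phi> by (simp add: sums_iff)
  have "uniform_limit {0..c} P' (\<lambda>x. \<Sum>k. a k * (of_nat (Suc k) * complex_of_real x ^ k)) sequentially"
    unfolding P'_def by (rule Weierstrass_m_test[OF b' st])
  then have lim': "uniform_limit {0..c} P' \<phi>' sequentially" using \<phi>' by (simp add: sums_iff mult.assoc)
  have tb: "trace_bound d (diff_op (P m) - diff_op (P n)) (\<kappa> * (\<Sum>k\<in>{n..<m}. t k))" if "n \<le> m" for m n d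
  proof -
    have "diff_op (P m) - diff_op (P n) = diff_op (\<lambda>x. P m x - P n x)"
      by (rule diff_op_diff[OF formula_holds_continuous[OF gP] formula_holds_continuous[OF gP], symmetric])
    also have "(\<lambda>x. P m x - P n x) = (\<lambda>x. \<Sum>k\<in>{n..<m}. a k * complex_of_real x ^ Suc k)"
      unfolding P_def lessThan_atLeast0 using that by (intro ext sum_diff_nat_ivl) auto
    finally show ?thesis using diff_op_power_sum[of "{n..<m}" d a] by (simp only: t_def finite_atLeastLessThan)
  qed
  show "formula_holds \<phi> \<phi>'"
  proof (rule formula_holds_limit[OF gP lim lim'])
    fix \<epsilon> :: real assume \<epsilon>: "\<epsilon> > 0"
    have "summable (\<lambda>k. \<kappa> * t k)" by (intro summable_mult st)
    then obtain N where N: "\<And>m n. m \<ge> N \<Longrightarrow> norm (\<Sum>k\<in>{m..<n}. \<kappa> * t k) < \<epsilon>"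
      using \<epsilon> unfolding summable_Cauchy by meson
    have le: "\<kappa> * (\<Sum>k\<in>{n..<m}. t k) \<le> \<epsilon>" if "n \<ge> N" for m n
      using N[OF that, of m] by (simp add: sum_distrib_left)
    have "trace_bound d (diff_op (P m) - diff_op (P n)) \<epsilon>" if "m \<ge> N" "n \<ge> N" for m n d
    proof (cases "n \<le> m")
      case True
      then show ?thesis using trace_bound_mono[OF tb le] that by blast
    next
      case False
      then have "trace_bound d (diff_op (P n) - diff_op (P m)) \<epsilon>"
        using trace_bound_mono[OF tb le, of m n] that by simp
      from trace_bound_minus[OF this] show ?thesis by simp
    qed
    then show "\<exists>N. \<forall>m\<ge>N. \<forall>n\<ge>N. \<forall>d. trace_bound d (diff_op (P m) - diff_op (P n)) \<epsilon>" by blast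
  qed
  show "trace_bound d (diff_op \<phi>) (\<kappa> * S)"
  proof (rule trace_bound_LIMSEQ)
    show "(\<lambda>n. diff_op (P n)) \<longlonglongrightarrow> diff_op \<phi>" by (rule diff_op_uniform_limit[OF formula_holds_continuous[OF gP] lim])
    have "trace_bound d (diff_op (P n)) (\<kappa> * S)" for n
    proof (rule trace_bound_mono)
      show "trace_bound d (diff_op (P n)) (\<kappa> * (\<Sum>k\<in>{..<n}. t k))"
        using diff_op_power_sum[of "{..<n}" d a] by (simp only: t_def P_def finite_lessThan)
      show "\<kappa> * (\<Sum>k\<in>{..<n}. t k) \<le> \<kappa> * S"
        unfolding S_def t_def[symmetric] using sum_le_suminf[OF st, of "{..<n}"] t0 kappa_nonneg by (intro mult_left_mono) auto
    qed
    then show "\<forall>\<^sub>F n in sequentially. trace_bound d (diff_op (P n)) (\<kappa> * S)" by simp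
  qed simp
  have S: "t sums S" unfolding S_def t_def[symmetric] by (rule summable_sums[OF st])
  show "cmod (\<phi> x) \<le> c * S" if "x \<in> {0..c}"
    using norm_sums_le[OF \<phi> sums_mult[OF S, of c] b[OF that]] by simp
  show "cmod (\<phi>' x) \<le> S" if "x \<in> {0..c}"
    using norm_sums_le[OF \<phi>' S] b'[OF that] by (simp add: mult.assoc)
qed

lemma formula_holds_psi: "formula_holds (psi y) (\<lambda>x. cis (x * y))"
proof (rule formula_holds_power_series(1)[OF _ psi_sums psi_deriv_sums])
  have "summable (\<lambda>k. (\<bar>y\<bar> * c) ^ k /\<^sub>R fact k)" by (rule summable_exp_generic)
  moreover have "cmod (psi_coef y k) * real (Suc k) * c ^ k = (\<bar>y\<bar> * c) ^ k /\<^sub>R fact k" for k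
    by (simp add: psi_coef_def norm_divide norm_mult norm_power power_mult_distrib field_simps del: of_nat_Suc fact_Suc)
      (simp add: field_simps)
  ultimately show "summable (\<lambda>k. cmod (psi_coef y k) * real (Suc k) * c ^ k)" by simp
qed

text \<open>The bound is uniform in \<open>y\<close>: the factor \<open>|y|\<close> in the estimate for exponentials cancels against the
  denominator of \<open>psi\<close>.\<close>

lemma trace_bound_psi: "trace_bound d (diff_op (psi y)) \<kappa>"
proof (cases "y = 0")
  case True
  have "psi y = (\<lambda>x. complex_of_real x ^ 1)" using True by (simp add: psi_def fun_eq_iff)
  then have "diff_op (psi y) = A - B" using diff_op_power[of 1] by simp
  then show ?thesis using K by simp
next
  case False
  define k where "k = 1 / (\<i> * complex_of_real y)"
  have "psi y = (\<lambda>x. k * (cis (x * y) - 1))" using False by (simp add: psi_def k_def fun_eq_iff)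
  then have "diff_op (psi y) = scalar_op k \<odot> diff_op (\<lambda>x. cis (x * y) - 1)"
    by (simp add: diff_op_cmult continuous_on_diff continuous_on_cis_mult)
  also have "diff_op (\<lambda>x. cis (x * y) - 1) = diff_op (\<lambda>x. cis (x * y))"
    by (subst diff_op_diff[OF continuous_on_cis_mult]) (simp_all add: diff_op_const)
  finally have "trace_bound d (diff_op (psi y)) (cmod k * (\<bar>y\<bar> * \<kappa>))"
    using trace_bound_scalar_op[OF trace_bound_cis[OF A(1) B(1) K, of d y], of k] by (simp add: diff_op_def)
  then show ?thesis using False by (simp add: k_def norm_divide norm_mult)
qed

text \<open>The constant \<open>2\<close> comes from the bounds for \<open>psi v\<close> and \<open>psi w\<close> separately, and makes \<open>e\<close> a bounded function. The
  other term, from the Taylor series, makes it tend to \<open>0\<close> as \<open>v \<rightarrow> w\<close>. So dominated convergence applies to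
  \<open>e\<close>, for every finite measure on the line.\<close>

lemma psi_close:
  assumes "\<bar>v\<bar> \<le> R" "\<bar>w\<bar> \<le> R"
  defines "e \<equiv> min 2 (c * exp (R * c) * \<bar>v - w\<bar>)"
  shows "trace_bound d (diff_op (psi v) - diff_op (psi w)) (\<kappa> * e)"
    and "x \<in> {0..c} \<Longrightarrow> cmod (psi v x - psi w x) \<le> c * e"
    and "x \<in> {0..c} \<Longrightarrow> cmod (cis (x * v) - cis (x * w)) \<le> e"
proof -
  define b where "b = c * exp (R * c) * \<bar>v - w\<bar>"
  let ?a = "\<lambda>k. psi_coef v k - psi_coef w k"
  have s1: "(\<lambda>k. ?a k * complex_of_real x ^ Suc k) sums (psi v x - psi w x)" for x
    using sums_diff[OF psi_sums psi_sums, of v x w x] by (simp add: left_diff_distrib)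
  have s2: "(\<lambda>k. ?a k * of_nat (Suc k) * complex_of_real x ^ k) sums (cis (x * v) - cis (x * w))" for x
    using sums_diff[OF psi_deriv_sums psi_deriv_sums, of v x w x] by (simp add: left_diff_distrib)
  note sm = psi_coef_diff_summable[OF assms(1,2) c_nonneg]
  note ps = formula_holds_power_series[OF sm(1) s1 s2]
  have le: "(\<Sum>k. cmod (?a k) * real (Suc k) * c ^ k) \<le> b" using sm(2) by (simp add: b_def)
  have eq: "diff_op (\<lambda>x. psi v x - psi w x) = diff_op (psi v) - diff_op (psi w)"
    by (rule diff_op_diff[OF formula_holds_continuous[OF formula_holds_psi] formula_holds_continuous[OF formula_holds_psi]])
  have 1: "trace_bound d (diff_op (psi v) - diff_op (psi w)) (\<kappa> * b)"
    using trace_bound_mono[OF ps(2)[of d]] mult_left_mono[OF le kappa_nonneg] by (simp add: eq)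
  have 2: "trace_bound d (diff_op (psi v) - diff_op (psi w)) (\<kappa> * 2)"
    using trace_bound_diff[OF trace_bound_psi trace_bound_psi, of d v w] by (simp add: mult.commute)
  show "trace_bound d (diff_op (psi v) - diff_op (psi w)) (\<kappa> * e)"
    using 1 2 unfolding e_def b_def[symmetric] by (simp add: min_def)
  show "cmod (psi v x - psi w x) \<le> c * e" if x: "x \<in> {0..c}"
  proof -
    have "cmod (psi v x - psi w x) \<le> c * b" using ps(3)[OF x] mult_left_mono[OF le c_nonneg] by linarith
    moreover have "cmod (psi v x - psi w x) \<le> c * 2"
      using norm_triangle_ineq4[of "psi v x" "psi w x"] cmod_psi_le[of v x] cmod_psi_le[of w x] x by simp
    ultimately show ?thesis unfolding e_def b_def[symmetric] by (simp add: min_def)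
  qed
  show "cmod (cis (x * v) - cis (x * w)) \<le> e" if x: "x \<in> {0..c}"
    using ps(4)[OF x] le norm_triangle_ineq4[of "cis (x * v)" "cis (x * w)"]
    unfolding e_def b_def[symmetric] by simp
qed

lemma uniform_limit_boundI:
  assumes "\<And>n x. x \<in> S \<Longrightarrow> cmod (f n x - g x) \<le> b n" "b \<longlonglongrightarrow> 0"
  shows "uniform_limit S f g sequentially"
  unfolding uniform_limit_sequentially_iff
proof (intro allI impI)
  fix e :: real assume "e > 0"
  then obtain N where N: "\<And>n. n \<ge> N \<Longrightarrow> norm (b n) < e" using LIMSEQ_D[OF assms(2)] by auto
  have "dist (f n x) (g x) < e" if "n \<ge> N" "x \<in> S" for n x
    using N[OF that(1)] assms(1)[OF that(2), of n] by (simp add: dist_norm)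
  then show "\<exists>N. \<forall>n\<ge>N. \<forall>x\<in>S. dist (f n x) (g x) < e" by blast
qed

text \<open>Replacing \<open>y\<close> by functions \<open>s\<^sub>n(y)\<close> of finite range turns the integrals into linear combinations of functions
  \<open>psi v\<close>, for which the formula is known. With \<open>e\<^sub>n(y)\<close> the error from \<open>psi_close\<close>, all distances in
  question are bounded by multiples of \<open>\<integral> e\<^sub>n d\<nu>\<close>, which tends to \<open>0\<close>.\<close>

theorem formula_holds_integral:
  fixes \<nu> :: "real measure"
  assumes \<nu>: "finite_measure \<nu>" "sets \<nu> = sets borel"
  shows "formula_holds (\<lambda>x. LINT y|\<nu>. psi y x) (\<lambda>x. LINT y|\<nu>. cis (x * y))"
    and "trace_bound d (diff_op (\<lambda>x. LINT y|\<nu>. psi y x)) (\<kappa> * measure \<nu> (space \<nu>))"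
proof -
  interpret finite_measure \<nu> by fact
  have [measurable_cong]: "sets \<nu> = sets borel" by fact
  obtain s :: "nat \<Rightarrow> real \<Rightarrow> real" where s: "\<And>n. finite (range (s n))" "\<And>n. s n \<in> borel_measurable borel"
    "\<And>y. (\<lambda>n. s n y) \<longlonglongrightarrow> y" "\<And>n y. \<bar>s n y\<bar> \<le> 2 * \<bar>y\<bar>" using ex_finite_range_approx by blast
  note s(2) [measurable]
  define e where "e = (\<lambda>n y. min 2 (c * exp (2 * \<bar>y\<bar> * c) * \<bar>s n y - y\<bar>))"
  have e0: "e n y \<ge> 0" for n y using c_nonneg by (simp add: e_def)
  have [measurable]: "e n \<in> borel_measurable borel" for n unfolding e_def by measurable
  have e_int: "integrable \<nu> (e n)" for n
    by (rule integrable_const_bound[of _ 2]) (use e0 in \<open>auto simp: e_def\<close>)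
  define E where "E = (\<lambda>n. LINT y|\<nu>. e n y)"
  have "E \<longlonglongrightarrow> (LINT y|\<nu>. 0)"
    unfolding E_def
  proof (rule integral_dominated_convergence[where w = "\<lambda>_. 2"])
    show "AE y in \<nu>. (\<lambda>n. e n y) \<longlonglongrightarrow> 0"
    proof (rule AE_I2)
      fix y
      have "(\<lambda>n. min 2 (c * exp (2 * \<bar>y\<bar> * c) * \<bar>s n y - y\<bar>)) \<longlonglongrightarrow> min 2 (c * exp (2 * \<bar>y\<bar> * c) * \<bar>y - y\<bar>)"
        by (intro tendsto_intros s(3))
      then show "(\<lambda>n. e n y) \<longlonglongrightarrow> 0" by (simp add: e_def)
    qed
    show "AE y in \<nu>. norm (e n y) \<le> 2" for n using e0 by (intro AE_I2) (simp add: e_def)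
  qed auto
  then have E: "E \<longlonglongrightarrow> 0" by simp
  have close: "trace_bound d (diff_op (psi (s n y)) - diff_op (psi y)) (\<kappa> * e n y)"
    "x \<in> {0..c} \<Longrightarrow> cmod (psi (s n y) x - psi y x) \<le> c * e n y"
    "x \<in> {0..c} \<Longrightarrow> cmod (cis (x * s n y) - cis (x * y)) \<le> e n y" for n x y d
    using psi_close[of "s n y" "2 * \<bar>y\<bar>" y] s(4) by (auto simp: e_def)
  define \<Phi> where "\<Phi> = (\<lambda>x. LINT y|\<nu>. psi y x)"
  define \<Phi>' where "\<Phi>' = (\<lambda>x. LINT y|\<nu>. cis (x * y))"
  define \<phi> where "\<phi> = (\<lambda>n x. LINT y|\<nu>. psi (s n y) x)"
  define \<phi>' where "\<phi>' = (\<lambda>n x. LINT y|\<nu>. cis (x * s n y))"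
  define m where "m = (\<lambda>n v. complex_of_real (measure \<nu> (s n -` {v})))"
  have \<phi>: "\<phi> n = (\<lambda>x. \<Sum>v\<in>range (s n). m n v * psi v x)" for n
    unfolding \<phi>_def m_def using finite_range_integral(2)[OF \<nu> s(1,2), of "\<lambda>v. psi v _" n] by (intro ext)
  have \<phi>': "\<phi>' n = (\<lambda>x. \<Sum>v\<in>range (s n). m n v * cis (x * v))" for n
    unfolding \<phi>'_def m_def using finite_range_integral(2)[OF \<nu> s(1,2), of "\<lambda>v. cis (_ * v)" n] by (intro ext)
  have g: "formula_holds (\<phi> n) (\<phi>' n)" for n
    unfolding \<phi> \<phi>' by (rule formula_holds_sum[OF s(1) formula_holds_psi])
  have ip: "integrable \<nu> (\<lambda>y. psi y x)" for x
    by (rule integrable_const_bound[of _ "\<bar>x\<bar>"]) (auto simp: cmod_psi_le)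
  have ic: "integrable \<nu> (\<lambda>y. cis (x * y))" for x
    by (rule integrable_const_bound[of _ 1]) auto
  have lim: "uniform_limit {0..c} \<phi> \<Phi> sequentially"
  proof (rule uniform_limit_boundI)
    show "(\<lambda>n. c * E n) \<longlonglongrightarrow> 0" using tendsto_mult[OF tendsto_const E, of c] by simp
    fix n x assume x: "x \<in> {0..c}"
    note i = finite_range_integral(1)[OF \<nu> s(1,2), of "\<lambda>v. psi v x" n]
    have "\<phi> n x - \<Phi> x = (LINT y|\<nu>. psi (s n y) x - psi y x)"
      unfolding \<phi>_def \<Phi>_def by (rule Bochner_Integration.integral_diff[OF i ip, symmetric])
    also have "cmod \<dots> \<le> (LINT y|\<nu>. c * e n y)"
      by (rule Bochner_Integration.integral_norm_bound_integral) (use close(2)[OF x] i ip e_int in auto)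
    finally show "cmod (\<phi> n x - \<Phi> x) \<le> c * E n" by (simp add: E_def)
  qed
  have lim': "uniform_limit {0..c} \<phi>' \<Phi>' sequentially"
  proof (rule uniform_limit_boundI[OF _ E])
    fix n x assume x: "x \<in> {0..c}"
    note i = finite_range_integral(1)[OF \<nu> s(1,2), of "\<lambda>v. cis (x * v)" n]
    have "\<phi>' n x - \<Phi>' x = (LINT y|\<nu>. cis (x * s n y) - cis (x * y))"
      unfolding \<phi>'_def \<Phi>'_def by (rule Bochner_Integration.integral_diff[OF i ic, symmetric])
    also have "cmod \<dots> \<le> (LINT y|\<nu>. e n y)"
      by (rule Bochner_Integration.integral_norm_bound_integral) (use close(3)[OF x] i ic e_int in auto)
    finally show "cmod (\<phi>' n x - \<Phi>' x) \<le> E n" by (simp add: E_def)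
  qed
  have form: "cinner (diff_op (\<phi> n) a) b = (LINT y|\<nu>. cinner (diff_op (psi (s n y)) a) b)" for n a b
  proof -
    have "diff_op (\<phi> n) = (\<Sum>v\<in>range (s n). diff_op (\<lambda>x. m n v * psi v x))"
      unfolding \<phi> by (intro diff_op_sum s(1) continuous_intros formula_holds_continuous[OF formula_holds_psi])
    also have "\<dots> = (\<Sum>v\<in>range (s n). scalar_op (m n v) \<odot> diff_op (psi v))"
      by (intro sum.cong refl diff_op_cmult formula_holds_continuous[OF formula_holds_psi])
    finally have "cinner (diff_op (\<phi> n) a) b = (\<Sum>v\<in>range (s n). m n v * cinner (diff_op (psi v) a) b)"
      by (simp add: blinfun.sum_left cinner.sum_left cinner_scaleC_left)
    also have "\<dots> = (LINT y|\<nu>. cinner (diff_op (psi (s n y)) a) b)"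
      unfolding m_def by (rule finite_range_integral(2)[OF \<nu> s(1,2), symmetric])
    finally show ?thesis .
  qed
  note fi = finite_range_integral(1)[OF \<nu> s(1,2)]
  have tb: "trace_bound d (diff_op (\<phi> k) - diff_op (\<phi> n)) (\<kappa> * (E k + E n))" for d k n
  proof (rule trace_boundI)
    fix a b :: "nat \<Rightarrow> 'a" assume ab: "bessel_family d a" "bessel_family d b"
    define h where "h = (\<lambda>i y. cinner (diff_op (psi (s k y)) (a i)) (b i) - cinner (diff_op (psi (s n y)) (a i)) (b i))"
    have ih: "integrable \<nu> (h i)" for i
      unfolding h_def by (intro Bochner_Integration.integrable_diff fi[of "\<lambda>v. cinner (diff_op (psi v) (a i)) (b i)"])
    have "(\<Sum>i<d. cmod (cinner ((diff_op (\<phi> k) - diff_op (\<phi> n)) (a i)) (b i))) = (\<Sum>i<d. cmod (LINT y|\<nu>. h i y))"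
      unfolding h_def by (intro sum.cong refl, subst Bochner_Integration.integral_diff[OF fi[of "\<lambda>v. cinner (diff_op (psi v) (a _)) (b _)"] fi[of "\<lambda>v. cinner (diff_op (psi v) (a _)) (b _)"]])
        (simp add: blinfun.diff_left cinner.diff_left form)
    also have "\<dots> \<le> (\<Sum>i<d. LINT y|\<nu>. cmod (h i y))" by (intro sum_mono integral_norm_bound)
    also have "\<dots> = (LINT y|\<nu>. (\<Sum>i<d. cmod (h i y)))"
      by (rule Bochner_Integration.integral_sum[symmetric]) (auto intro: ih)
    also have "\<dots> \<le> (LINT y|\<nu>. \<kappa> * (e k y + e n y))"
    proof (rule integral_mono)
      show "integrable \<nu> (\<lambda>y. \<Sum>i<d. cmod (h i y))" by (intro Bochner_Integration.integrable_sum integrable_norm ih)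
      show "integrable \<nu> (\<lambda>y. \<kappa> * (e k y + e n y))" using e_int by auto
      fix y
      have "trace_bound d ((diff_op (psi (s k y)) - diff_op (psi y)) - (diff_op (psi (s n y)) - diff_op (psi y))) (\<kappa> * e k y + \<kappa> * e n y)"
        by (intro trace_bound_diff close(1))
      from trace_boundD[OF this ab] show "(\<Sum>i<d. cmod (h i y)) \<le> \<kappa> * (e k y + e n y)"
        by (simp add: h_def blinfun.diff_left cinner.diff_left distrib_left)
    qed
    also have "\<dots> = \<kappa> * (E k + E n)" using e_int by (simp add: E_def)
    finally show "(\<Sum>i<d. cmod (cinner ((diff_op (\<phi> k) - diff_op (\<phi> n)) (a i)) (b i))) \<le> \<kappa> * (E k + E n)" .
  qed
  have "formula_holds \<Phi> \<Phi>'"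
  proof (rule formula_holds_limit[OF g lim lim'])
    fix \<epsilon> :: real assume \<epsilon>: "\<epsilon> > 0"
    define \<delta> where "\<delta> = \<epsilon> / (\<kappa> + 1)"
    have "\<delta> / 2 > 0" using \<epsilon> kappa_nonneg by (simp add: \<delta>_def)
    then obtain N where N: "\<And>n. n \<ge> N \<Longrightarrow> norm (E n) < \<delta> / 2"
      using LIMSEQ_D[OF E, of "\<delta> / 2"] by auto
    have "trace_bound d (diff_op (\<phi> k) - diff_op (\<phi> n)) \<epsilon>" if "k \<ge> N" "n \<ge> N" for k n d
    proof (rule trace_bound_mono[OF tb])
      have "E k + E n \<le> \<delta>"
        using N[OF that(1)] N[OF that(2)] unfolding real_norm_def by linarith
      then have "\<kappa> * (E k + E n) \<le> \<kappa> * \<delta>" by (intro mult_left_mono kappa_nonneg)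
      also have "\<dots> \<le> \<epsilon>" using kappa_nonneg \<epsilon> by (simp add: \<delta>_def field_simps)
      finally show "\<kappa> * (E k + E n) \<le> \<epsilon>" .
    qed
    then show "\<exists>N. \<forall>k\<ge>N. \<forall>n\<ge>N. \<forall>d. trace_bound d (diff_op (\<phi> k) - diff_op (\<phi> n)) \<epsilon>" by blast
  qed
  then show "formula_holds (\<lambda>x. LINT y|\<nu>. psi y x) (\<lambda>x. LINT y|\<nu>. cis (x * y))" by (simp only: \<Phi>_def \<Phi>'_def)
  have tb1: "trace_bound d (diff_op (\<phi> n)) (\<kappa> * measure \<nu> (space \<nu>))" for n d
  proof (rule trace_boundI)
    fix a b :: "nat \<Rightarrow> 'a" assume ab: "bessel_family d a" "bessel_family d b"
    define h where "h = (\<lambda>i y. cinner (diff_op (psi (s n y)) (a i)) (b i))"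
    have ih: "integrable \<nu> (h i)" for i
      unfolding h_def by (rule fi[of "\<lambda>v. cinner (diff_op (psi v) (a i)) (b i)"])
    have "(\<Sum>i<d. cmod (cinner (diff_op (\<phi> n) (a i)) (b i))) = (\<Sum>i<d. cmod (LINT y|\<nu>. h i y))"
      by (simp only: h_def form)
    also have "\<dots> \<le> (\<Sum>i<d. LINT y|\<nu>. cmod (h i y))" by (intro sum_mono integral_norm_bound)
    also have "\<dots> = (LINT y|\<nu>. (\<Sum>i<d. cmod (h i y)))"
      by (rule Bochner_Integration.integral_sum[symmetric]) (auto intro: ih)
    also have "\<dots> \<le> (LINT y|\<nu>. \<kappa>)"
    proof (rule integral_mono)
      show "integrable \<nu> (\<lambda>y. \<Sum>i<d. cmod (h i y))" by (intro Bochner_Integration.integrable_sum integrable_norm ih)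
      show "(\<Sum>i<d. cmod (h i y)) \<le> \<kappa>" for y
        unfolding h_def by (rule trace_boundD[OF trace_bound_psi ab])
    qed simp
    also have "\<dots> = \<kappa> * measure \<nu> (space \<nu>)" by simp
    finally show "(\<Sum>i<d. cmod (cinner (diff_op (\<phi> n) (a i)) (b i))) \<le> \<kappa> * measure \<nu> (space \<nu>)" .
  qed
  have "trace_bound d (diff_op \<Phi>) (\<kappa> * measure \<nu> (space \<nu>))"
    by (rule trace_bound_LIMSEQ[OF diff_op_uniform_limit[OF formula_holds_continuous[OF g] lim] tendsto_const]) (simp add: tb1)
  then show "trace_bound d (diff_op (\<lambda>x. LINT y|\<nu>. psi y x)) (\<kappa> * measure \<nu> (space \<nu>))" by (simp only: \<Phi>_def)
qed

text \<open>By the mean value theorem \<open>\<psi>\<close> differs from the integral of \<open>psi\<close> against the measure by the constant \<open>\<psi> 0\<close>.\<close>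

theorem formula_holds_W1:
  assumes "\<psi> \<in> W1"
  shows "\<exists>\<psi>' C. formula_holds \<psi> \<psi>' \<and> (\<forall>d. trace_bound d (diff_op \<psi>) C)"
proof -
  obtain \<nu> :: "nat \<Rightarrow> real measure" where \<nu>: "\<And>k. k < 4 \<Longrightarrow> finite_measure (\<nu> k) \<and> sets (\<nu> k) = sets borel"
    and der: "\<And>x. (\<psi> has_vector_derivative (\<Sum>k<4. \<i> ^ k * (LINT y|\<nu> k. cis (x * y)))) (at x)"
    using W1_derivative[OF assms] by blast
  define \<psi>' where "\<psi>' = (\<lambda>x. \<Sum>k<4::nat. \<i> ^ k * (LINT y|\<nu> k. cis (x * y)))"
  define \<Phi> where "\<Phi> = (\<lambda>x. \<Sum>k<4::nat. \<i> ^ k * (LINT y|\<nu> k. psi y x))"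
  have g\<Phi>: "formula_holds \<Phi> \<psi>'"
    unfolding \<Phi>_def \<psi>'_def using \<nu> by (intro formula_holds_sum formula_holds_integral) auto
  have g: "formula_holds (\<lambda>x. \<psi> 0 + \<Phi> x) (\<lambda>x. 0 + \<psi>' x)" by (rule formula_holds_add[OF formula_holds_const g\<Phi>])
  have "((\<lambda>x. \<psi> x - \<Phi> x) has_vector_derivative 0) (at x within {0..c})" if "x \<in> {0..c}" for x
  proof -
    have "(\<psi> has_vector_derivative \<psi>' x) (at x within {0..c})"
      using der[of x] unfolding \<psi>'_def by (rule has_vector_derivative_at_within)
    from has_vector_derivative_diff[OF this formula_holds_derivD[OF g\<Phi> that]] show ?thesis by simp
  qed
  then obtain k where k: "\<And>x. x \<in> {0..c} \<Longrightarrow> \<psi> x - \<Phi> x = k"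
    using has_vector_derivative_zero_constant[of "{0..c}" "\<lambda>x. \<psi> x - \<Phi> x"] by auto
  have "psi y 0 = 0" for y by (simp add: psi_def)
  then have "\<Phi> 0 = 0" by (simp add: \<Phi>_def)
  then have "k = \<psi> 0" using k[of 0] c_nonneg by simp
  then have eq: "\<psi> 0 + \<Phi> x = \<psi> x" if "x \<in> {0..c}" for x using k[OF that] by (simp add: algebra_simps)
  have op: "diff_op \<psi> = diff_op (\<lambda>x. \<psi> 0 + \<Phi> x)"
    by (rule diff_op_cong[OF formula_holds_continuous[OF g] eq])
  have "formula_holds \<psi> \<psi>'"
    unfolding formula_holds_def op
  proof (intro conjI ballI allI impI)
    show "(\<psi> has_vector_derivative \<psi>' x) (at x within {0..c})" for x
      using der[of x] unfolding \<psi>'_def by (rule has_vector_derivative_at_within)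
    show "continuous_on {0..c} \<psi>'" by (rule formula_holds_deriv_continuous[OF g\<Phi>])
    fix E :: "'a set" assume "orthonormal_basis E"
    from formula_holds_traceD[OF g this] show "((\<lambda>e. cinner (diff_op (\<lambda>x. \<psi> 0 + \<Phi> x) e) e) has_sum area \<psi>') E" by simp
  qed
  moreover have "trace_bound d (diff_op \<psi>) (\<Sum>k<4::nat. cmod (\<i> ^ k) * (\<kappa> * measure (\<nu> k) (space (\<nu> k))))" for d
  proof -
    have gk: "formula_holds (\<lambda>x. LINT y|\<nu> k. psi y x) (\<lambda>x. LINT y|\<nu> k. cis (x * y))" if "k < 4" for k
      using \<nu>[OF that] by (intro formula_holds_integral) auto
    have "diff_op \<psi> = diff_op \<Phi>"
      unfolding op using diff_op_add[of "\<lambda>_. \<psi> 0" \<Phi>] formula_holds_continuous[OF g\<Phi>] by (simp add: diff_op_const)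
    also have "\<dots> = (\<Sum>k<4::nat. diff_op (\<lambda>x. \<i> ^ k * (LINT y|\<nu> k. psi y x)))"
      unfolding \<Phi>_def by (intro diff_op_sum continuous_intros formula_holds_continuous[OF gk]) auto
    also have "\<dots> = (\<Sum>k<4::nat. scalar_op (\<i> ^ k) \<odot> diff_op (\<lambda>x. LINT y|\<nu> k. psi y x))"
      by (intro sum.cong refl diff_op_cmult formula_holds_continuous[OF gk]) auto
    finally show ?thesis
      using \<nu> by (simp only:) (intro trace_bound_sum trace_bound_scalar_op formula_holds_integral(2), auto)
  qed
  ultimately show ?thesis by blast
qed

end


section \<open>The trace formula for analytic Toeplitz operators\<close>

text \<open>The energy only involves the coefficients with \<open>n \<ge> 0\<close>, and \<open>n \<le> 1 + n\<close>.\<close>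

lemma sobolev_half_finite_energy:
  assumes "f \<in> sobolev_half"
  shows "finite_energy (Abs_fps (fcoef f))"
proof -
  have "(\<lambda>n. (1 + real_of_int \<bar>n\<bar>) * (cmod (fourier f n))\<^sup>2) summable_on UNIV"
    using assms by (simp add: sobolev_half_def)
  then have "(\<lambda>n. (1 + real_of_int \<bar>n\<bar>) * (cmod (fourier f n))\<^sup>2) summable_on (range int)"
    by (rule summable_on_subset_banach) simp
  then have "(\<lambda>l. (1 + real l) * (cmod (fcoef f l))\<^sup>2) summable_on UNIV"
    by (subst (asm) summable_on_reindex) (auto simp: o_def fcoef_def)
  then have sm: "summable (\<lambda>l. (1 + real l) * (cmod (fcoef f l))\<^sup>2)"
    by (subst (asm) summable_on_UNIV_nonneg_real_iff) auto
  show ?thesis unfolding finite_energy_def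
    by (rule summable_comparison_test'[OF sm]) (auto intro!: mult_right_mono)
qed

theorem theorem2p11:
  fixes f :: l2 and \<phi> :: "real \<Rightarrow> complex"
  assumes "f \<in> sobolev_half \<inter> H_infinity"
    and "\<phi> \<in> W1_on 0 ((linf_norm f)\<^sup>2)"
  shows "let T = toeplitz f;
             F = holomorphic_extension f;
             D = cfc \<phi> (adjoint_op T o\<^sub>L T) - cfc \<phi> (T o\<^sub>L adjoint_op T);
             g = (\<lambda>z. vector_derivative \<phi> (at ((cmod (F z))\<^sup>2) within {0..(linf_norm f)\<^sup>2})
                    * complex_of_real ((cmod (deriv F z))\<^sup>2))
         in trace_class D \<and>
            set_integrable lborel (ball 0 1) g \<and>
            op_trace D = 1 / complex_of_real pi * (LINT z:ball 0 1|lborel. g z)"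
proof -
  have f: "f \<in> sobolev_half" "f \<in> H_infinity" using assms by auto
  define M where "M = linf_norm f"
  define c where "c = M\<^sup>2"
  define T where "T = toeplitz f"
  define F where "F = Abs_fps (fcoef f)"
  have M: "M \<ge> 0" unfolding M_def using f(2) by (intro linf_norm_nonneg) (simp add: H_infinity_def)
  have TF: "mult_op T F" unfolding T_def F_def by (rule mult_op_toeplitz[OF f(2)])
  have nT: "norm T \<le> M" unfolding T_def M_def by (rule toeplitz_analytic(2)[OF f(2)])
  have en: "finite_energy F" unfolding F_def by (rule sobolev_half_finite_energy[OF f(1)])
  have "complex_linear T" using TF by (simp add: mult_op_def)
  then obtain T' where T': "adjoint_pair T T'" using ex_adjoint_pair by blast
  note T'T = adjoint_pair_sym[OF T']
  have nT': "norm T' \<le> M" using adjoint_pair_norm_le[OF T'] nT by simp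
  define A where "A = T' \<odot> T"
  define B where "B = T \<odot> T'"
  have A: "selfadjoint_in c A" "norm A \<le> c"
    unfolding A_def c_def using power_mono[OF nT norm_ge_zero, of 2] norm_compose_le[OF nT' nT]
    by (auto intro: selfadjoint_in_compose[OF T'] simp: power2_eq_square)
  have B: "selfadjoint_in c B" "norm B \<le> c"
    unfolding B_def c_def using power_mono[OF nT' norm_ge_zero, of 2] norm_compose_le[OF nT nT']
    by (auto intro: selfadjoint_in_compose[OF T'T] simp: power2_eq_square)
  have K: "trace_bound d (A - B) (energy F)" for d
  proof -
    have "(\<Sum>k. norm (bshift F (Suc k)) * norm (bshift F (Suc k))) = energy F"
      using bshift_energy[OF en] by (simp add: sums_iff power2_eq_square)
    then show ?thesis
      using trace_bound_nuclear_sum[OF nuclear_sum_commutator[OF TF TF T' T' en en], of d] by (simp add: A_def B_def)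
  qed
  note R = mult_op_conv_radius[OF TF]
  have R': "fps_conv_radius (fps_deriv F) \<ge> 1" using R fps_conv_radius_deriv[of F] by (rule order_trans)
  have disc: "ball 0 1 \<subseteq> eball 0 (fps_conv_radius G)" if "fps_conv_radius G \<ge> 1" for G :: "complex fps"
    using that ball_eball_mono[of 1 "fps_conv_radius G"] by (simp add: one_ereal_def)
  define p where "p = (\<lambda>z. (cmod (eval_fps F z))\<^sup>2)"
  define q where "q = (\<lambda>z. (cmod (eval_fps (fps_deriv F) z))\<^sup>2)"
  interpret trace_formula A B c "energy F" p q
  proof
    show "continuous_on (ball 0 1) p" "continuous_on (ball 0 1) q"
      unfolding p_def q_def
      by (intro continuous_intros continuous_on_subset[OF continuous_on_eval_fps disc] R R')+
    show "p z \<in> {0..c}" if "z \<in> ball 0 1" for z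
      using mult_op_eval_le[OF TF nT, of z] that M by (simp add: p_def c_def power_mono)
    show "set_integrable lborel (ball 0 1) q"
      unfolding q_def by (rule energy_power(1)[OF TF nT en])
    fix E :: "h2 set" and m assume E: "orthonormal_basis E"
    show "((\<lambda>e. cinner ((opow A (Suc m) - opow B (Suc m)) e) e) has_sum
        complex_of_real (1 / pi * (LINT z:ball 0 1|lborel. real (Suc m) * p z ^ m * q z))) E"
      unfolding A_def B_def p_def q_def energy_power(3)[OF TF nT en, symmetric]
      by (rule trace_power_difference[OF TF T' energy_power(2)[OF TF nT en] E])
  qed (use A B K in \<open>auto simp: q_def\<close>)
  obtain \<psi> where \<psi>: "\<psi> \<in> W1" "\<And>x. x \<in> {0..c} \<Longrightarrow> \<psi> x = \<phi> x"
    using assms(2) by (auto simp: W1_on_def c_def M_def)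
  obtain \<psi>' C where g: "formula_holds \<psi> \<psi>'" and tb: "\<And>d. trace_bound d (diff_op \<psi>) C"
    using formula_holds_W1[OF \<psi>(1)] by blast
  define D where "D = cfc \<phi> (adjoint_op T o\<^sub>L T) - cfc \<phi> (T o\<^sub>L adjoint_op T)"
  have "D = diff_op \<phi>" unfolding diff_op_def by (simp only: D_def A_def B_def adjoint_op_eq[OF T'])
  also have "\<dots> = diff_op \<psi>" by (rule diff_op_cong[OF formula_holds_continuous[OF g] \<psi>(2)])
  finally have D: "D = diff_op \<psi>" .
  have "adjoint_pair D (cfc (\<lambda>x. cnj (\<psi> x)) A - cfc (\<lambda>x. cnj (\<psi> x)) B)"
    unfolding D diff_op_def
    by (intro adjoint_pair_diff adjoint_pair_cfc[OF A(1)] adjoint_pair_cfc[OF B(1)] formula_holds_continuous[OF g])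
  then have tc: "trace_class D"
    using trace_classI[OF _ tb[folded D] orthonormal_basis_zpow] by blast
  have tr: "op_trace D = area \<psi>'"
    unfolding op_trace_def D
  proof (rule the_equality)
    show "\<forall>E. orthonormal_basis E \<longrightarrow> ((\<lambda>e. cinner (diff_op \<psi> e) e) has_sum area \<psi>') E"
      using formula_holds_traceD[OF g] by blast
    fix t assume "\<forall>E. orthonormal_basis E \<longrightarrow> ((\<lambda>e. cinner (diff_op \<psi> e) e) has_sum t) E"
    then show "t = area \<psi>'"
      using formula_holds_traceD[OF g orthonormal_basis_zpow] orthonormal_basis_zpow has_sum_unique by blast
  qed
  define g where "g = (\<lambda>z. vector_derivative \<phi> (at ((cmod (holomorphic_extension f z))\<^sup>2) within {0..(linf_norm f)\<^sup>2})
                    * complex_of_real ((cmod (deriv (holomorphic_extension f) z))\<^sup>2))"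
  have hol: "holomorphic_extension f = eval_fps F"
    by (rule ext) (simp add: holomorphic_extension_def eval_fps_def F_def fcoef_def)
  have geq: "g z = \<psi>' (p z) * complex_of_real (q z)" if z: "z \<in> ball 0 1" for z
  proof -
    have "ereal (cmod z) < fps_conv_radius F" using subsetD[OF disc[OF R] z] by (simp add: in_eball_iff)
    then have d: "deriv (holomorphic_extension f) z = eval_fps (fps_deriv F) z"
      unfolding hol by (rule eval_fps_deriv[symmetric])
    have gz: "g z = vector_derivative \<phi> (at (p z) within {0..c}) * complex_of_real (q z)"
      unfolding g_def d by (simp add: hol p_def q_def c_def M_def)
    show ?thesis
    \<comment> \<open>On the one-point interval \<open>{0}\<close> the value of \<open>vector_derivative\<close> is arbitrary, but then \<open>f = 0\<close> and
      both integrands vanish.\<close>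
    proof (cases "c = 0")
      case True
      then have "norm T \<le> 0" using nT by (simp add: c_def)
      then have "fps_nth F n = 0" for n
        using mult_op_zpow_coef[OF TF, of 0 n] by (simp add: hcoef_def)
      then have "F = 0" by (simp add: fps_eq_iff)
      then show ?thesis unfolding gz by (simp add: q_def)
    next
      case False
      then have "0 < c" using c_nonneg by simp
      moreover have "(\<phi> has_vector_derivative \<psi>' (p z)) (at (p z) within {0..c})"
        by (rule has_vector_derivative_transform[OF p(2)[OF z] \<psi>(2)[symmetric] formula_holds_derivD[OF \<open>formula_holds \<psi> \<psi>'\<close> p(2)[OF z]]])
      ultimately have "vector_derivative \<phi> (at (p z) within {0..c}) = \<psi>' (p z)"
        using p(2)[OF z] vector_derivative_within_cbox[of 0 c "p z" \<phi>] by simp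
      then show ?thesis unfolding gz by simp
    qed
  qed
  have "set_integrable lborel (ball 0 1) g"
    using area_integrable[OF formula_holds_deriv_continuous[OF \<open>formula_holds \<psi> \<psi>'\<close>]]
    by (rule set_integrable_cong[THEN iffD1, rotated 3]) (auto simp: geq)
  moreover have "area \<psi>' = 1 / complex_of_real pi * (LINT z:ball 0 1|lborel. g z)"
    unfolding area_def by (intro arg_cong[where f = "\<lambda>x. 1 / complex_of_real pi * x"] set_lebesgue_integral_cong) (auto simp: geq)
  ultimately show ?thesis
    using tc tr unfolding Let_def D_def T_def g_def by simp
qed

end
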